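(* Let $K\subseteq\overline{\mathbb{Q}}$ be an algebraic extension of $\mathbb{Q}$. Assume there exist a rational prime $\ell$ and a number field $F\subseteq K$ such that no prime of $\mathcal{O}_F$ lying over $\ell$ is ramified in $K/F$ (in particular, this hypothesis holds if $K/\mathbb{Q}$ is Galois and some rational prime $\ell$ has finite ramification index in $K$). Then there exist nontrivial (i.e. $L\neq K$) extensions $L/K$ which are Bogomolov; moreover such $L$ can be taken of the form $L=K(\sqrt[\ell]{\alpha})$ for suitably chosen elements $\alpha\in K$.
   Context: All fields are subfields of a fixed algebraic closure $\overline{\mathbb{Q}}$ of $\mathbb{Q}$. $h$ denotes the absolute logarithmic Weil height. For fields $\mathbb{Q}\subseteq K\subseteq L\subseteq\overline{\mathbb{Q}}$, the extension $L/K$ is called Bogomolov if there exists $\varepsilon>0$ such that $\{\gamma\in L^\times : 0<h(\gamma)<\varepsilon\}\subseteq K$. *)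

theory Defs
  imports
    Complex_Main
    "HOL-Library.Extended_Nat"
    "HOL-Algebra.Algebraic_Closure_Type"
    "HOL-Algebra.Generated_Fields"
    "HOL-Algebra.Ideal_Product"
    "HOL-Algebra.QuotRing"
begin

section \<open>Subfields of a fixed algebraic closure of the rationals\<close>

text \<open>The algebraic closure is the set of algebraic complex numbers; all fields are subsets of it.\<close>

abbreviation CC :: "complex ring" where
  "CC \<equiv> ring_of_type_algebra"

definition Qbar :: "complex set" where
  "Qbar = {x. algebraic x}"

definition subfield_ring :: "complex set \<Rightarrow> complex ring" where
  "subfield_ring K = CC\<lparr>carrier := K\<rparr>"

definition integer_ring :: "complex set \<Rightarrow> complex ring" where
  "integer_ring K = CC\<lparr>carrier := {x \<in> K. algebraic_int x}\<rparr>"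

definition adjoin :: "complex set \<Rightarrow> complex \<Rightarrow> complex set" where
  "adjoin K x = generate_field CC (insert x K)"

definition number_field :: "complex set \<Rightarrow> bool" where
  "number_field E \<longleftrightarrow> subfield E CC \<and> ring.finite_dimension CC \<rat> E"

definition degree_over_Q :: "complex set \<Rightarrow> nat" where
  "degree_over_Q E = ring.dim CC \<rat> E"

definition algebraic_field_extension :: "complex set \<Rightarrow> complex set \<Rightarrow> bool" where
  "algebraic_field_extension K L \<longleftrightarrow>
     subfield K CC \<and> subfield L CC \<and> K \<subseteq> L \<and> L \<subseteq> Qbar"

definition field_automorphisms :: "complex set \<Rightarrow> complex set \<Rightarrow> (complex \<Rightarrow> complex) set" where
  "field_automorphisms F K =
     {\<sigma> \<in> ring_iso (subfield_ring K) (subfield_ring K). \<forall>x\<in>F. \<sigma> x = x}"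

definition galois_extension :: "complex set \<Rightarrow> complex set \<Rightarrow> bool" where
  "galois_extension F K \<longleftrightarrow>
     algebraic_field_extension F K \<and>
     {x \<in> K. \<forall>\<sigma>\<in>field_automorphisms F K. \<sigma> x = x} = F"

section \<open>Ramification\<close>

abbreviation ideal_power :: "complex set \<Rightarrow> complex set \<Rightarrow> nat \<Rightarrow> complex set" where
  "ideal_power E P n \<equiv> P [^]\<^bsub>ideals_set (integer_ring E)\<^esub> n"

text \<open>Primes of the integers of \<open>K\<close> above a rational prime; \<open>K\<close> may be of infinite degree.\<close>

definition primes_over :: "complex set \<Rightarrow> nat \<Rightarrow> complex set set" where
  "primes_over K l = {P. primeideal P (integer_ring K) \<and> of_nat l \<in> P}"

text \<open>For number fields \<open>F \<subseteq> E\<close> and a nonzero prime \<open>P\<close> of \<open>E\<close>: the exponent of \<open>P\<close> in the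
  extension to \<open>E\<close> of the ideal below \<open>P\<close> in \<open>F\<close>.\<close>

definition finite_ramification_index ::
    "complex set \<Rightarrow> complex set \<Rightarrow> complex set \<Rightarrow> enat" where
  "finite_ramification_index F E P =
     (SUP e\<in>{e. genideal (integer_ring E) (P \<inter> F) \<subseteq> ideal_power E P e}. enat e)"

text \<open>For a number field \<open>F\<close> and an algebraic extension \<open>K\<close> of \<open>F\<close>, possibly infinite, the
  ramification index of a prime \<open>P\<close> of \<open>K\<close> is the supremum over the intermediate number
  fields. If \<open>K\<close> is itself a number field, it is attained at \<open>K\<close>.\<close>

definition ramification_index ::
    "complex set \<Rightarrow> complex set \<Rightarrow> complex set \<Rightarrow> enat" where
  "ramification_index F K P =
     (SUP E\<in>{E. number_field E \<and> F \<subseteq> E \<and> E \<subseteq> K}. finite_ramification_index F E (P \<inter> E))"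

text \<open>Residue extensions are algebraic extensions of finite fields, hence separable, so
  ramification is detected by the index alone.\<close>

definition ramified_in :: "complex set \<Rightarrow> complex set \<Rightarrow> complex set \<Rightarrow> bool" where
  "ramified_in F K p \<longleftrightarrow>
     (\<exists>P. primeideal P (integer_ring K) \<and> P \<inter> F = p \<and> ramification_index F K P \<noteq> 1)"

definition unramified_above :: "nat \<Rightarrow> complex set \<Rightarrow> complex set \<Rightarrow> bool" where
  "unramified_above l F K \<longleftrightarrow> (\<forall>p\<in>primes_over F l. \<not> ramified_in F K p)"

definition has_finite_ramification :: "nat \<Rightarrow> complex set \<Rightarrow> bool" where
  "has_finite_ramification l K \<longleftrightarrow> (\<forall>P\<in>primes_over K l. ramification_index \<rat> K P < \<infinity>)"

section \<open>The absolute logarithmic Weil height\<close>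

definition finite_places :: "complex set \<Rightarrow> complex set set" where
  "finite_places E = {P. primeideal P (integer_ring E) \<and> P \<noteq> {0}}"

definition field_embeddings :: "complex set \<Rightarrow> (complex \<Rightarrow> complex) set" where
  "field_embeddings E = ring_hom (subfield_ring E) CC \<inter> extensional E"

definition integer_ord :: "complex set \<Rightarrow> complex set \<Rightarrow> complex \<Rightarrow> nat" where
  "integer_ord E P x = (GREATEST n. x \<in> ideal_power E P n)"

definition ord_at :: "complex set \<Rightarrow> complex set \<Rightarrow> complex \<Rightarrow> int" where
  "ord_at E P x =
     (THE k. \<exists>a\<in>carrier (integer_ring E) - {0}. \<exists>b\<in>carrier (integer_ring E) - {0}.
        x = a / b \<and> k = int (integer_ord E P a) - int (integer_ord E P b))"

text \<open>The normalised absolute value \<open>\<bar>x\<bar>\<^sub>P ^ [E\<^sub>P : Q\<^sub>p]\<close>, where \<open>\<bar>p\<bar>\<^sub>P = 1 / p\<close>.\<close>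

definition place_abs :: "complex set \<Rightarrow> complex set \<Rightarrow> complex \<Rightarrow> real" where
  "place_abs E P x =
     (if x = 0 then 0 else real (card (carrier (integer_ring E Quot P))) powi (- ord_at E P x))"

text \<open>The height relative to a number field \<open>E\<close> containing \<open>x\<close>. The sum over all embeddings is
  the sum over the archimedean places weighted by their local degrees. In the sum over the
  finite places only the finitely many nonzero terms are kept, as a sum over an infinite index
  set would be zero by convention.\<close>

definition height_in :: "complex set \<Rightarrow> complex \<Rightarrow> real" where
  "height_in E x =
     ((\<Sum>\<sigma>\<in>field_embeddings E. ln (max 1 (cmod (\<sigma> x)))) +
      (\<Sum>P\<in>{P \<in> finite_places E. place_abs E P x > 1}. ln (max 1 (place_abs E P x))))
     / real (degree_over_Q E)"

text \<open>The value does not depend on the number field containing \<open>x\<close>.\<close>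

definition weil_height :: "complex \<Rightarrow> real" where
  "weil_height x = height_in (adjoin \<rat> x) x"

definition bogomolov :: "complex set \<Rightarrow> complex set \<Rightarrow> bool" where
  "bogomolov K L \<longleftrightarrow>
     algebraic_field_extension K L \<and>
     (\<exists>\<epsilon>>0. {\<gamma> \<in> L - {0}. 0 < weil_height \<gamma> \<and> weil_height \<gamma> < \<epsilon>} \<subseteq> K)"

end

theory Submission imports Defs "Jordan_Normal_Form.Char_Poly" begin

text \<open>Let \<open>v\<close> be a place of \<open>Qbar\<close> above \<open>l\<close>, let \<open>\<pi>\<close> be a uniformizer of \<open>F\<close> at \<open>v\<close> and let
  \<open>\<beta>\<^sup>l = \<pi>\<close>. As \<open>v\<close> is unramified in \<open>K/F\<close>, its values on \<open>K\<close> are powers of the value of \<open>\<pi>\<close>, so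
  the summands of \<open>\<gamma> = \<Sum> b\<^sub>i \<beta>\<^sup>i\<close> in \<open>K(\<beta>)\<close> have distinct values. Let \<open>\<sigma>\<close> be an automorphism
  fixing \<open>F\<close> and all \<open>b\<^sub>i\<close>. Since \<open>\<sigma>\<close> multiplies \<open>\<beta>\<close> by an \<open>l\<close>-th root of unity, \<open>\<sigma>\<gamma>/\<gamma>\<close> is so close
  to \<open>1\<close> that \<open>(\<sigma>\<gamma>)\<^sup>N\<close> and \<open>\<gamma>\<^sup>N\<close>, where \<open>N = l\<^sup>k\<close>, agree up to a factor \<open>l\<^sup>k\<close>. If they differ for some
  \<open>\<sigma>\<close>, the product formula bounds the height of \<open>\<gamma>\<close> from below once \<open>k\<close> is large in terms of \<open>F\<close>. If they
  agree for all \<open>\<sigma>\<close>, comparing \<open>\<gamma>\<close> with its dominant summand shows that \<open>\<gamma>/\<beta>\<^sup>i\<close> is in \<open>K\<close> for some \<open>i\<close>;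
  then \<open>\<gamma>\<close> is in \<open>K\<close>, or its value at all places above \<open>v\<close> restricted to \<open>F\<close> is a nonintegral power of
  that of \<open>\<pi>\<close>, which bounds the height again.

  If \<open>K\<close> is Galois with finite ramification at \<open>l\<close>, a Galois number field \<open>F\<close> in \<open>K\<close> of maximal
  ramification index at one place above \<open>l\<close> works, because the places above \<open>l\<close> are conjugate.\<close>

section \<open>Algebraic integers\<close>

text \<open>The bound has to be uniform over \<gamma> of arbitrarily large degree, so the local
  estimates must hold at a fixed proportion of the conjugates of \<gamma>. The conjugates over
  \<open>F\<close> serve: twisting the absolute value by an automorphism fixing \<open>F\<close>
  leaves every hypothesis intact, and they make up at least one part in m of all, where m is the
  number of embeddings of \<open>F\<close>. Hence k depends on \<open>F\<close> only: it is chosen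
  with k log l \<ge> m (log 2 + 1). The number r = l^(-1/(l-1)), the distance of a nontrivial l-th
  root of unity from 1, is exactly where the map z -> z^l changes its behaviour. On the closed disc
  of radius r around 1 it shrinks the distance from 1 at least by a factor l, which gives the
  congruence. On the open disc the factor is exactly l, so no other root of unity of l-power order
  lies there, which gives the rigidity in the second case. Heights are defined through the primes of
  Q(\<gamma>), while the estimates concern conjugates. The link is an inequality with the
  logarithmic Mahler measure, whose finite part is obtained by counting classes modulo the integers,
  not by factoring ideals.\<close>

lemma algebraic_int_eigenvalue:
  fixes z :: complex and c :: "nat \<Rightarrow> nat \<Rightarrow> int" and e :: "nat \<Rightarrow> complex"
  assumes "\<And>i. i < n \<Longrightarrow> z * e i = (\<Sum>j<n. of_int (c i j) * e j)"
    and "i0 < n" "e i0 \<noteq> 0"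
  shows "algebraic_int z"
proof -
  \<comment> \<open>Determinant trick: multiplication by \<open>z\<close> acts on the vector
    \<open>e\<close> through an integer matrix, so \<open>z\<close> is a root of its monic integral
    characteristic polynomial.\<close>
  define M where "M = mat n n (\<lambda>(i,j). c i j)"
  define MC where "MC = mat n n (\<lambda>(i,j). of_int (c i j) :: complex)"
  define v where "v = vec n e"
  have M: "M \<in> carrier_mat n n" and MC: "MC \<in> carrier_mat n n"
    by (simp_all add: M_def MC_def)
  have MM: "MC = map_mat of_int M"
    by (rule eq_matI) (auto simp: M_def MC_def)
  have "MC *\<^sub>v v = z \<cdot>\<^sub>v v"
    by (rule eq_vecI) (auto simp: MC_def v_def scalar_prod_def row_def assms(1) atLeast0LessThan)
  moreover have "v \<noteq> 0\<^sub>v n"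
  proof
    assume "v = 0\<^sub>v n"
    hence "vec_index v i0 = vec_index (0\<^sub>v n) i0" by simp
    thus False using assms(2,3) by (simp add: v_def)
  qed
  ultimately have "eigenvalue MC z"
    unfolding eigenvalue_def eigenvector_def using MC by (intro exI[of _ v]) (auto simp: v_def)
  hence "poly (char_poly MC) z = 0"
    using eigenvalue_root_char_poly[OF MC] by simp
  moreover have "char_poly MC = map_poly of_int (char_poly M)"
    unfolding MM by (rule of_int_hom.char_poly_hom[OF M])
  moreover have "lead_coeff (char_poly M) = 1"
    using degree_monic_char_poly[OF M] by simp
  ultimately show ?thesis
    unfolding algebraic_int_altdef_ipoly by metis
qed

section \<open>Rings that are finitely generated as additive groups\<close>

definition int_span :: "nat \<Rightarrow> (nat \<Rightarrow> complex) \<Rightarrow> complex set" where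
  "int_span n e = {\<Sum>i<n. of_int (c i) * e i | c. True}"

text \<open>A subring of the complex numbers that is finitely generated as an additive group. The
  generators may be dependent, since only integral relations are read off from them.\<close>

definition finite_order :: "complex set \<Rightarrow> bool" where
  "finite_order S \<longleftrightarrow> (\<exists>n e. S = int_span n e) \<and> 1 \<in> S \<and> (\<forall>x\<in>S. \<forall>y\<in>S. x * y \<in> S)"

lemma int_spanI: "(\<Sum>i<n. of_int (c i) * e i) \<in> int_span n e"
  by (auto simp: int_span_def)

lemma int_span_base:
  assumes "i < n" shows "e i \<in> int_span n e"
proof -
  have "(\<Sum>j<n. of_int (if j = i then 1 else 0) * e j) = e i"
    using assms by (subst sum.remove[of _ i]) auto
  thus ?thesis using int_spanI by metis
qed

lemma int_span_add: "x \<in> int_span n e \<Longrightarrow> y \<in> int_span n e \<Longrightarrow> x + y \<in> int_span n e"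
proof -
  assume "x \<in> int_span n e" "y \<in> int_span n e"
  then obtain c d where "x = (\<Sum>i<n. of_int (c i) * e i)" "y = (\<Sum>i<n. of_int (d i) * e i)"
    by (auto simp: int_span_def)
  hence "x + y = (\<Sum>i<n. of_int (c i + d i) * e i)"
    by (simp add: sum.distrib distrib_right)
  thus ?thesis using int_spanI by metis
qed

lemma int_span_scale: "x \<in> int_span n e \<Longrightarrow> of_int k * x \<in> int_span n e"
proof -
  assume "x \<in> int_span n e"
  then obtain c where "x = (\<Sum>i<n. of_int (c i) * e i)" by (auto simp: int_span_def)
  hence "of_int k * x = (\<Sum>i<n. of_int (k * c i) * e i)"
    by (simp add: sum_distrib_left mult.assoc)
  thus ?thesis using int_spanI by metis
qed

lemma int_span_zero: "0 \<in> int_span n e"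
  using int_spanI[of "\<lambda>_. 0" e n] by simp

lemma int_span_sum: "(\<And>i. i \<in> A \<Longrightarrow> f i \<in> int_span n e) \<Longrightarrow> sum f A \<in> int_span n e"
  by (induction A rule: infinite_finite_induct) (auto intro: int_span_add int_span_zero)

text \<open>Multiplication by \<open>z\<close> maps each generator into the integer span of all of
  them; some generator is nonzero because 1 lies in the span.\<close>

lemma finite_order_algebraic_int:
  assumes "finite_order S" "z \<in> S"
  shows "algebraic_int z"
proof -
  obtain n e where S: "S = int_span n e" using assms(1) by (auto simp: finite_order_def)
  have "\<exists>c. z * e i = (\<Sum>j<n. of_int (c j) * e j)" if "i < n" for i
  proof -
    have "z * e i \<in> int_span n e"
      using assms that int_span_base[of i n e] unfolding finite_order_def S by blast
    thus ?thesis by (auto simp: int_span_def)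
  qed
  then obtain c where c: "\<And>i. i < n \<Longrightarrow> z * e i = (\<Sum>j<n. of_int (c i j) * e j)" by metis
  have "\<exists>i<n. e i \<noteq> 0"
  proof (rule ccontr)
    assume "\<not> ?thesis"
    hence "x = 0" if "x \<in> int_span n e" for x using that by (auto simp: int_span_def)
    hence "(1::complex) = 0" using assms(1) S unfolding finite_order_def by blast
    thus False by simp
  qed
  thus ?thesis using algebraic_int_eigenvalue[OF c] by blast
qed

lemma finite_order_Ints: "finite_order \<int>"
proof -
  have "(\<int>::complex set) = int_span 1 (\<lambda>_. 1)"
    by (force simp: int_span_def Ints_def)
  thus ?thesis by (auto simp: finite_order_def)
qed

text \<open>The new generators are the products of the old ones with the powers of \<open>z\<close>
  below \<open>n\<close>; the given relation reduces all higher powers.\<close>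

lemma finite_order_adjoin:
  assumes "finite_order S" and n: "n > 0"
    and z: "z ^ n = (\<Sum>i<n. s i * z ^ i)" "\<And>i. i < n \<Longrightarrow> s i \<in> S"
  obtains S' where "finite_order S'" "S \<subseteq> S'" "z \<in> S'"
proof -
  obtain m e where S: "S = int_span m e" using assms(1) by (auto simp: finite_order_def)
  have S1: "1 \<in> S" and Sm: "\<And>x y. x \<in> S \<Longrightarrow> y \<in> S \<Longrightarrow> x * y \<in> S"
    using assms(1) by (auto simp: finite_order_def)
  \<comment> \<open>\<open>t = i * n + j\<close> encodes the pair of the generator
    \<open>e i\<close> and the exponent \<open>j\<close>.\<close>
  define g where "g t = e (t div n) * z ^ (t mod n)" for t
  define T where "T = int_span (m * n) g"
  have Tadd: "x + y \<in> T" if "x \<in> T" "y \<in> T" for x y using that by (simp add: T_def int_span_add)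
  have Tsum: "sum f A \<in> T" if "\<And>i. i \<in> A \<Longrightarrow> f i \<in> T" for f and A :: "nat set"
    using that by (simp add: T_def int_span_sum)
  have Tsc: "of_int k * x \<in> T" if "x \<in> T" for k x using that by (simp add: T_def int_span_scale)
  have low: "x * z ^ j \<in> T" if "x \<in> S" "j < n" for x j
  proof -
    obtain c where c: "x = (\<Sum>i<m. of_int (c i) * e i)" using \<open>x \<in> S\<close> S by (auto simp: int_span_def)
    have "e i * z ^ j \<in> T" if "i < m" for i
    proof -
      have "i * n + j < Suc i * n" using \<open>j < n\<close> by simp
      also have "\<dots> \<le> m * n" using \<open>i < m\<close> by (intro mult_le_mono1) simp
      finally have "g (i * n + j) \<in> T" unfolding T_def by (rule int_span_base)
      thus ?thesis using \<open>j < n\<close> by (simp add: g_def)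
    qed
    thus ?thesis
      by (simp add: c sum_distrib_right mult.assoc) (intro Tsum Tsc, auto)
  qed
  have pow: "x * z ^ k \<in> T" if "x \<in> S" for x k
    using that
  proof (induction k arbitrary: x rule: less_induct)
    case (less k)
    show ?case
    proof (cases "k < n")
      case True thus ?thesis using low less.prems by simp
    next
      case False
      have "x * z ^ k = x * z ^ (k - n) * z ^ n" using False by (simp flip: power_add)
      also have "\<dots> = (\<Sum>i<n. (x * s i) * z ^ (k - n + i))"
        by (simp add: z(1) sum_distrib_left power_add mult_ac)
      also have "\<dots> \<in> T"
      proof (intro Tsum)
        fix i assume "i \<in> {..<n}"
        thus "x * s i * z ^ (k - n + i) \<in> T"
          using less.prems z(2) Sm False by (intro less.IH) auto
      qed
      finally show ?thesis .
    qed
  qed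
  have gform: "\<exists>x\<in>S. g t = x * z ^ (t mod n)" if "t < m * n" for t
    using that by (intro bexI[of _ "e (t div n)"])
       (auto simp: g_def S less_mult_imp_div_less intro!: int_span_base)
  have "x * y \<in> T" if xy: "x \<in> T" "y \<in> T" for x y
  proof -
    obtain c where c: "x = (\<Sum>i<m*n. of_int (c i) * g i)" using xy by (auto simp: int_span_def T_def)
    obtain d where d: "y = (\<Sum>i<m*n. of_int (d i) * g i)" using xy by (auto simp: int_span_def T_def)
    have "g i * g j \<in> T" if ij: "i < m * n" "j < m * n" for i j
    proof -
      obtain a b where "a \<in> S" "b \<in> S" "g i = a * z ^ (i mod n)" "g j = b * z ^ (j mod n)"
        using gform[OF ij(1)] gform[OF ij(2)] by blast
      thus ?thesis using pow[of "a * b" "i mod n + j mod n"] Sm by (simp add: power_add mult_ac)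
    qed
    hence "(\<Sum>i<m*n. of_int (c i) * (\<Sum>j<m*n. of_int (d j) * (g i * g j))) \<in> T"
      by (intro Tsum Tsc) auto
    also have "(\<Sum>i<m*n. of_int (c i) * (\<Sum>j<m*n. of_int (d j) * (g i * g j))) = x * y"
      unfolding c d sum_product by (simp add: sum_distrib_left mult_ac)
    finally show ?thesis .
  qed
  moreover have "S \<subseteq> T" using low[of _ 0] n by auto
  moreover have "z \<in> T" using pow[OF S1, of 1] by simp
  ultimately show ?thesis using S1 that[of T] unfolding finite_order_def T_def by blast
qed

lemma monic_relation:
  fixes p :: "complex poly"
  assumes "lead_coeff p = 1" "poly p x = 0"
  shows "degree p > 0" and "x ^ degree p = (\<Sum>i<degree p. - coeff p i * x ^ i)"
proof -
  show "degree p > 0"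
    using assms by (intro Nat.gr0I) (auto elim!: degree_eq_zeroE)
  have "0 = (\<Sum>i\<le>degree p. coeff p i * x ^ i)"
    using assms by (simp add: poly_altdef)
  also have "\<dots> = x ^ degree p + (\<Sum>i<degree p. coeff p i * x ^ i)"
    using assms(1) by (simp add: lessThan_Suc_atMost[symmetric])
  finally show "x ^ degree p = (\<Sum>i<degree p. - coeff p i * x ^ i)"
    by (simp add: add_eq_0_iff2 sum_negf)
qed

lemma finite_order_minus:
  assumes "finite_order S" "x \<in> S" shows "- x \<in> S"
  using assms int_span_scale[of x _ _ "-1"] by (auto simp: finite_order_def)

lemma finite_order_adjoin_algebraic_int:
  assumes "finite_order S" "algebraic_int z"
  obtains S' where "finite_order S'" "S \<subseteq> S'" "z \<in> S'"
proof -
  obtain p where p: "lead_coeff p = 1" "\<forall>i. coeff p i \<in> \<int>" "poly p z = 0"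
    using assms(2) by (auto elim: algebraic_int.cases)
  have "\<int> \<subseteq> S"
  proof
    fix x :: complex assume "x \<in> \<int>"
    then obtain k where "x = of_int k * 1" by (auto simp: Ints_def)
    thus "x \<in> S" using assms(1) int_span_scale[of 1] by (auto simp: finite_order_def)
  qed
  hence "- coeff p i \<in> S" for i using p(2) by auto
  thus ?thesis
    using finite_order_adjoin[OF assms(1) monic_relation[OF p(1,3)]] that by metis
qed

text \<open>The source of all closure properties of algebraic integers: finitely many of them lie in
  one finitely generated ring, and every element of such a ring is integral.\<close>

lemma finite_order_cover:
  assumes "finite A" "\<And>x. x \<in> A \<Longrightarrow> algebraic_int x"
  obtains S where "finite_order S" "A \<subseteq> S"
proof -
  have "\<exists>S. finite_order S \<and> A \<subseteq> S"
    using assms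
  proof (induction A rule: finite_induct)
    case empty thus ?case using finite_order_Ints by blast
  next
    case (insert x A)
    then obtain S where "finite_order S" "A \<subseteq> S" by auto
    moreover obtain S' where "finite_order S'" "S \<subseteq> S'" "x \<in> S'"
      using finite_order_adjoin_algebraic_int \<open>finite_order S\<close> insert.prems by (metis insertI1)
    ultimately show ?case by blast
  qed
  thus ?thesis using that by blast
qed

section \<open>The ring of algebraic integers\<close>

lemma algebraic_int_add:
  fixes x y :: complex
  assumes "algebraic_int x" "algebraic_int y"
  shows "algebraic_int (x + y)"
proof -
  obtain S where S: "finite_order S" "{x, y} \<subseteq> S" using finite_order_cover[of "{x,y}"] assms by auto
  hence "x + y \<in> S" using int_span_add by (auto simp: finite_order_def)
  thus ?thesis using S finite_order_algebraic_int by blast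
qed

lemma algebraic_int_mult:
  fixes x y :: complex
  assumes "algebraic_int x" "algebraic_int y"
  shows "algebraic_int (x * y)"
proof -
  obtain S where S: "finite_order S" "{x, y} \<subseteq> S" using finite_order_cover[of "{x,y}"] assms by auto
  hence "x * y \<in> S" by (auto simp: finite_order_def)
  thus ?thesis using S finite_order_algebraic_int by blast
qed

text \<open>Integrality is transitive: the coefficients lie in one finitely generated ring, which
  stays finitely generated when the root is adjoined.\<close>

lemma algebraic_int_monic_root:
  fixes p :: "complex poly"
  assumes "\<And>i. algebraic_int (coeff p i)" "lead_coeff p = 1" "poly p z = 0"
  shows "algebraic_int z"
proof -
  obtain S where S: "finite_order S" "coeff p ` {..degree p} \<subseteq> S"
    using finite_order_cover[of "coeff p ` {..degree p}"] assms(1) by auto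
  have "- coeff p i \<in> S" if "i < degree p" for i
    using S finite_order_minus that by (simp add: image_subset_iff)
  then obtain S' where "finite_order S'" "z \<in> S'"
    using finite_order_adjoin[OF S(1) monic_relation[OF assms(2,3)]] by metis
  thus ?thesis using finite_order_algebraic_int by blast
qed

lemma algebraic_int_diff:
  fixes x y :: complex
  assumes "algebraic_int x" "algebraic_int y"
  shows "algebraic_int (x - y)"
  using algebraic_int_add[OF assms(1) algebraic_int_minus[OF assms(2)]] by simp

lemma algebraic_int_power:
  fixes x :: complex
  assumes "algebraic_int x"
  shows "algebraic_int (x ^ n)"
  by (induction n) (auto intro: algebraic_int_mult assms)

lemma algebraic_int_sum:
  fixes f :: "'a \<Rightarrow> complex"
  assumes "\<And>i. i \<in> A \<Longrightarrow> algebraic_int (f i)"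
  shows "algebraic_int (sum f A)"
  using assms by (induction A rule: infinite_finite_induct) (auto intro: algebraic_int_add)

lemma algebraic_int_prod:
  fixes f :: "'a \<Rightarrow> complex"
  assumes "\<And>i. i \<in> A \<Longrightarrow> algebraic_int (f i)"
  shows "algebraic_int (prod f A)"
  using assms by (induction A rule: infinite_finite_induct) (auto intro: algebraic_int_mult)

section \<open>Leading coefficients times roots\<close>

text \<open>With a the leading coefficient and n the degree, multiplying the equation by a^(n-1)
  makes it monic in \<open>a * z\<close>; \<open>q\<close> is that monic polynomial.\<close>

lemma algebraic_int_lead_coeff_mult_root:
  fixes p :: "complex poly"
  assumes p: "\<And>i. algebraic_int (coeff p i)" and "poly p z = 0"
  shows "algebraic_int (lead_coeff p * z)"
proof (cases "degree p = 0")
  case True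
  then obtain c where "p = [:c:]" by (auto elim!: degree_eq_zeroE)
  thus ?thesis using assms by auto
next
  case False
  define n where "n = degree p"
  define a where "a = lead_coeff p"
  have n: "n > 0" using False by (simp add: n_def)
  define q where "q = Poly (map (\<lambda>i. if i = n then 1 else coeff p i * a ^ (n - 1 - i)) [0..<Suc n])"
  have cq: "coeff q i = (if i = n then 1 else if i < n then coeff p i * a ^ (n - 1 - i) else 0)" for i
    by (auto simp: q_def coeff_Poly_eq nth_default_def simp del: upt_Suc)
  have "degree q = n"
    by (intro antisym degree_le le_degree) (auto simp: cq)
  hence "lead_coeff q = 1" by (simp add: cq)
  moreover have "algebraic_int (coeff q i)" for i
    using p by (auto simp: cq a_def intro!: algebraic_int_mult algebraic_int_power)
  moreover have "poly q (a * z) = 0"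
  proof -
    have "poly q (a * z) = (\<Sum>i\<le>n. coeff q i * (a * z) ^ i)"
      by (simp add: poly_altdef \<open>degree q = n\<close>)
    also have "\<dots> = (\<Sum>i\<le>n. a ^ (n - 1) * (coeff p i * z ^ i))"
    proof (intro sum.cong refl)
      fix i assume "i \<in> {..n}"
      show "coeff q i * (a * z) ^ i = a ^ (n - 1) * (coeff p i * z ^ i)"
      proof (cases "i = n")
        case True
        obtain m where "n = Suc m" using n gr0_implies_Suc by blast
        thus ?thesis using True by (simp add: cq power_mult_distrib a_def n_def[symmetric])
      next
        case False
        hence "i < n" using \<open>i \<in> {..n}\<close> by simp
        hence "a ^ (n - 1 - i) * a ^ i = a ^ (n - 1)" by (simp flip: power_add)
        thus ?thesis using \<open>i < n\<close> by (simp add: cq power_mult_distrib mult_ac)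
      qed
    qed
    also have "\<dots> = a ^ (n - 1) * poly p z"
      by (simp add: poly_altdef n_def sum_distrib_left)
    finally show ?thesis using assms(2) by simp
  qed
  ultimately show ?thesis
    using algebraic_int_monic_root[of q "a * z"] by (simp add: a_def)
qed

text \<open>Splitting off a linear factor keeps the coefficients integral although the cofactor is
  not monic.\<close>

lemma algebraic_int_coeff_cofactor:
  fixes h :: "complex poly"
  assumes "\<And>i. algebraic_int (coeff ([:-r, 1:] * h) i)"
  shows "algebraic_int (coeff h i)"
  using assms
proof (induction "degree h" arbitrary: h i rule: less_induct)
  case (less h)
  define a where "a = lead_coeff h"
  define n where "n = degree h"
  define f where "f = [:-r, 1:] * h"
  have lead: "lead_coeff f = a" by (simp only: f_def lead_coeff_mult a_def) simp
  have fi: "algebraic_int (coeff f i)" for i using less.prems by (simp add: f_def)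
  have ar: "algebraic_int (a * r)"
    using algebraic_int_lead_coeff_mult_root[of f r, OF fi] lead by (simp add: f_def)
  have a: "algebraic_int a" using fi lead by metis
  define h' where "h' = h - monom a n"
  have hh: "h = h' + monom a n" by (simp add: h'_def)
  have "algebraic_int (coeff ([:-r, 1:] * h') i)" for i
  proof -
    have "[:-r, 1:] * h' = f - [:-r, 1:] * monom a n" unfolding f_def h'_def by (rule right_diff_distrib)
    moreover have "[:-r, 1:] * monom a n = monom a (Suc n) - monom (a * r) n"
      by (rule poly_eqI) (auto simp: coeff_pCons coeff_monom split: nat.splits)
    ultimately have "coeff ([:-r, 1:] * h') i
        = coeff f i - ((if Suc n = i then a else 0) - (if n = i then a * r else 0))"
      by (simp only: coeff_diff coeff_monom)
    thus ?thesis using fi ar a by (auto intro!: algebraic_int_diff algebraic_int_add)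
  qed
  hence "algebraic_int (coeff h' i)" if "degree h' < degree h" using less.hyps that by blast
  moreover have "h' = 0 \<or> degree h' < degree h"
  proof (cases "n = 0")
    case True
    then obtain c where "h = [:c:]" by (auto simp: n_def elim!: degree_eq_zeroE)
    thus ?thesis by (simp add: h'_def a_def n_def monom_0)
  next
    case False
    have "degree h' < n"
    proof (rule degree_lessI)
      show "h' \<noteq> 0 \<or> 0 < n" using False by simp
      show "\<forall>k\<ge>n. coeff h' k = 0"
        by (auto simp: h'_def a_def n_def coeff_monom coeff_eq_0)
    qed
    thus ?thesis by (simp add: n_def)
  qed
  ultimately have "algebraic_int (coeff h' i)" by auto
  hence "algebraic_int (coeff h' i + (if n = i then a else 0))"
    using a by (auto intro!: algebraic_int_add)
  thus ?case by (simp add: h'_def coeff_monom)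
qed

text \<open>The linear factors not belonging to \<open>S\<close> are split off one by one without
  leaving the algebraic integers, until the cofactor is a constant; then the product in question is,
  up to sign, the constant coefficient.\<close>

lemma algebraic_int_lead_coeff_mult_roots:
  fixes p :: "complex poly"
  assumes p: "\<And>i. algebraic_int (coeff p i)" and "p \<noteq> 0"
    and "finite S" "\<And>s. s \<in> S \<Longrightarrow> poly p s = 0"
  shows "algebraic_int (lead_coeff p * prod (\<lambda>s. s) S)"
proof -
  have roots: "\<exists>q. p = prod (\<lambda>s. [:-s, 1:]) S * q" if "finite S" "\<And>s. s \<in> S \<Longrightarrow> poly p s = 0" for S
    using that
  proof (induction S rule: finite_induct)
    case empty
    thus ?case by simp
  next
    case (insert x S)
    then obtain q where q: "p = prod (\<lambda>s. [:-s, 1:]) S * q" by auto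
    have "poly (prod (\<lambda>s. [:-s, 1:]) S) x \<noteq> 0"
      using insert.hyps by (auto simp: poly_prod)
    moreover have "poly p x = 0" using insert.prems by simp
    ultimately have "poly q x = 0" by (metis mult_eq_0_iff poly_mult q)
    then obtain q' where "q = [:-x, 1:] * q'" by (auto simp: poly_eq_0_iff_dvd)
    hence "p = ([:-x, 1:] * prod (\<lambda>s. [:-s, 1:]) S) * q'"
      unfolding q by (simp only: mult.left_commute mult.assoc)
    also have "[:-x, 1:] * prod (\<lambda>s. [:-s, 1:]) S = prod (\<lambda>s. [:-s, 1:]) (insert x S)"
      by (rule prod.insert[OF insert.hyps, symmetric])
    finally show ?case by blast
  qed
  have "algebraic_int (lead_coeff q * prod (\<lambda>s. s) S)"
    if "\<And>i. algebraic_int (coeff (prod (\<lambda>s. [:-s, 1:]) S * q) i)" "q \<noteq> 0" for q :: "complex poly"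
    using that
  proof (induction "degree q" arbitrary: q rule: less_induct)
    case (less q)
    show ?case
    proof (cases "degree q = 0")
      case True
      then obtain c where q: "q = [:c:]" by (auto elim!: degree_eq_zeroE)
      have "coeff (prod (\<lambda>s. [:-s, 1:]) S * q) 0 = (-1) ^ card S * (c * prod (\<lambda>s. s) S)"
        by (simp add: q poly_0_coeff_0[symmetric] poly_prod prod_uminus)
      hence "algebraic_int ((-1) ^ card S * (c * prod (\<lambda>s. s) S))"
        using less.prems(1)[of 0] by simp
      thus ?thesis using q by (cases "even (card S)") auto
    next
      case False
      hence "\<not> constant (poly q)" by (simp add: constant_degree)
      then obtain r where "poly q r = 0" using fundamental_theorem_of_algebra by blast
      then obtain q' where q': "q = [:-r, 1:] * q'" by (auto simp: poly_eq_0_iff_dvd)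
      have nz: "q' \<noteq> 0" using q' less.prems(2) by auto
      have "algebraic_int (coeff ([:-r, 1:] * (prod (\<lambda>s. [:-s, 1:]) S * q')) i)" for i
      proof -
        have "[:-r, 1:] * (prod (\<lambda>s. [:-s, 1:]) S * q') = prod (\<lambda>s. [:-s, 1:]) S * q"
          unfolding q' by (simp only: mult.left_commute)
        thus ?thesis using less.prems(1) by metis
      qed
      hence "algebraic_int (coeff (prod (\<lambda>s. [:-s, 1:]) S * q') i)" for i
        by (rule algebraic_int_coeff_cofactor)
      moreover have "degree q' < degree q"
        unfolding q' using nz by (subst degree_mult_eq) auto
      ultimately have "algebraic_int (lead_coeff q' * prod (\<lambda>s. s) S)"
        using less.hyps nz by blast
      moreover have "lead_coeff q = lead_coeff q'" by (simp only: q' lead_coeff_mult) simp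
      ultimately show ?thesis by simp
    qed
  qed
  moreover obtain q where q: "p = prod (\<lambda>s. [:-s, 1:]) S * q" using roots assms(3,4) by blast
  moreover have "lead_coeff p = lead_coeff q"
    unfolding q by (simp add: lead_coeff_mult lead_coeff_prod)
  ultimately show ?thesis using p \<open>p \<noteq> 0\<close> by auto
qed

section \<open>The field of algebraic numbers\<close>

text \<open>Integral multiples reduce sums and products of algebraic numbers to those of algebraic
  integers.\<close>

lemma algebraic_iff_int_multiple:
  fixes x :: complex
  shows "algebraic x \<longleftrightarrow> (\<exists>n::int. n > 0 \<and> algebraic_int (of_int n * x))"
proof
  assume "algebraic x"
  then obtain p where p: "\<And>i. coeff p i \<in> \<int>" "p \<noteq> 0" "poly p x = 0" by (auto simp: algebraic_def)
  then obtain k where k: "lead_coeff p = of_int k" using Ints_cases by metis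
  have "algebraic_int (of_int k * x)"
    using algebraic_int_lead_coeff_mult_root[of p x] p int_imp_algebraic_int k by metis
  hence "algebraic_int (of_int \<bar>k\<bar> * x)"
    using algebraic_int_minus[of "of_int k * x"] by (auto simp: abs_if)
  moreover have "k \<noteq> 0" using k p(2) by auto
  ultimately show "\<exists>n::int. n > 0 \<and> algebraic_int (of_int n * x)"
    by (intro exI[of _ "\<bar>k\<bar>"]) auto
next
  assume "\<exists>n::int. n > 0 \<and> algebraic_int (of_int n * x)"
  then obtain n :: int where n: "n > 0" "algebraic_int (of_int n * x)" by blast
  then obtain p where p: "lead_coeff p = 1" "\<forall>i. coeff p i \<in> \<int>" "poly p (of_int n * x) = 0"
    by (auto elim: algebraic_int.cases)
  define q where "q = pcompose p [:0, of_int n:]"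
  have "coeff q i \<in> \<int>" for i
    unfolding q_def using p(2)
    by (intro coeff_pcompose_semiring_closed) (auto simp: coeff_pCons split: nat.splits)
  moreover have "q \<noteq> 0"
  proof
    assume "q = 0"
    hence "p = 0" using pcompose_eq_0[of p "[:0, of_int n:]"] n unfolding q_def by simp
    thus False using p(1) by simp
  qed
  moreover have "poly q x = 0" using p(3) by (simp add: q_def poly_pcompose mult.commute)
  ultimately show "algebraic x" by (rule algebraicI)
qed

lemma algebraic_add:
  fixes x y :: complex
  assumes "algebraic x" "algebraic y"
  shows "algebraic (x + y)"
proof -
  obtain m n :: int where "m > 0" "n > 0" "algebraic_int (of_int m * x)" "algebraic_int (of_int n * y)"
    using assms algebraic_iff_int_multiple by blast
  hence "algebraic_int (of_int n * (of_int m * x) + of_int m * (of_int n * y))"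
    by (blast intro: algebraic_int_add algebraic_int_mult algebraic_int_of_int)
  hence "algebraic_int (of_int (m * n) * (x + y))" by (simp add: algebra_simps)
  thus ?thesis using algebraic_iff_int_multiple \<open>m > 0\<close> \<open>n > 0\<close> zero_less_mult_iff by blast
qed

lemma algebraic_mult:
  fixes x y :: complex
  assumes "algebraic x" "algebraic y"
  shows "algebraic (x * y)"
proof -
  obtain m n :: int where "m > 0" "n > 0" "algebraic_int (of_int m * x)" "algebraic_int (of_int n * y)"
    using assms algebraic_iff_int_multiple by blast
  hence "algebraic_int ((of_int m * x) * (of_int n * y))"
    by (blast intro: algebraic_int_mult)
  hence "algebraic_int (of_int (m * n) * (x * y))" by (simp add: algebra_simps)
  thus ?thesis using algebraic_iff_int_multiple \<open>m > 0\<close> \<open>n > 0\<close> zero_less_mult_iff by blast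
qed

section \<open>Subfields and rings of integers\<close>

text \<open>Carrier-free form of the subfield property; the clause on inverses may include 0 because
  \<open>inverse 0 = 0\<close>.\<close>

definition is_subfield :: "complex set \<Rightarrow> bool" where
  "is_subfield A \<longleftrightarrow> 1 \<in> A \<and> (\<forall>x\<in>A. \<forall>y\<in>A. x - y \<in> A \<and> x * y \<in> A) \<and> (\<forall>x\<in>A. inverse x \<in> A)"

lemma CC_simps [simp]:
  "carrier CC = UNIV" "x \<otimes>\<^bsub>CC\<^esub> y = x * y" "\<one>\<^bsub>CC\<^esub> = 1" "\<zero>\<^bsub>CC\<^esub> = 0" "x \<oplus>\<^bsub>CC\<^esub> y = x + y"
  by (simp_all add: ring_of_type_algebra_def)

lemmas field_CC = field_from_type_algebra[where ?'a = complex]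

interpretation CC: cring CC
  by (rule cring_from_type_algebra)

lemma CC_a_inv [simp]: "\<ominus>\<^bsub>CC\<^esub> x = - x"
  by (rule CC.minus_equality) simp_all

lemma CC_m_inv [simp]: "x \<noteq> 0 \<Longrightarrow> inv\<^bsub>CC\<^esub> x = inverse x"
  by (rule CC.comm_inv_char) simp_all

context
  fixes A assumes A: "is_subfield A"
begin

lemma subfield_one: "1 \<in> A" using A by (auto simp: is_subfield_def)
lemma subfield_diff: "x \<in> A \<Longrightarrow> y \<in> A \<Longrightarrow> x - y \<in> A" using A by (auto simp: is_subfield_def)
lemma subfield_mult: "x \<in> A \<Longrightarrow> y \<in> A \<Longrightarrow> x * y \<in> A" using A by (auto simp: is_subfield_def)
lemma subfield_inverse: "x \<in> A \<Longrightarrow> inverse x \<in> A" using A by (auto simp: is_subfield_def)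
lemma subfield_zero: "0 \<in> A" using subfield_diff[OF subfield_one subfield_one] by simp
lemma subfield_uminus: "x \<in> A \<Longrightarrow> - x \<in> A" using subfield_diff[OF subfield_zero] by force
lemma subfield_add: "x \<in> A \<Longrightarrow> y \<in> A \<Longrightarrow> x + y \<in> A"
  using subfield_diff[OF _ subfield_uminus, of x y] by simp
lemma subfield_divide: "x \<in> A \<Longrightarrow> y \<in> A \<Longrightarrow> x / y \<in> A"
  using subfield_mult[OF _ subfield_inverse] by (simp add: divide_inverse)
lemma subfield_power: "x \<in> A \<Longrightarrow> x ^ n \<in> A"
  by (induction n) (auto intro: subfield_one subfield_mult)
lemma subfield_sum: "(\<And>i. i \<in> I \<Longrightarrow> f i \<in> A) \<Longrightarrow> sum f I \<in> A"
  by (induction I rule: infinite_finite_induct) (auto intro: subfield_add subfield_zero)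
lemma subfield_prod: "(\<And>i. i \<in> I \<Longrightarrow> f i \<in> A) \<Longrightarrow> prod f I \<in> A"
  by (induction I rule: infinite_finite_induct) (auto intro: subfield_mult subfield_one)
lemma subfield_of_nat: "of_nat n \<in> A"
  by (induction n) (auto intro: subfield_zero subfield_one subfield_add)
lemma subfield_of_int: "of_int n \<in> A"
  by (cases n rule: int_cases2) (auto intro: subfield_of_nat subfield_uminus)
lemma subfield_Rats: "\<rat> \<subseteq> A"
  by (auto elim!: Rats_cases' intro!: subfield_divide subfield_of_int)
lemma subfield_poly: "(\<And>i. coeff p i \<in> A) \<Longrightarrow> x \<in> A \<Longrightarrow> poly p x \<in> A"
  unfolding poly_altdef by (intro subfield_sum subfield_mult subfield_power) auto
lemma subfield_powi: "x \<in> A \<Longrightarrow> x powi n \<in> A"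
  by (auto simp: power_int_def intro: subfield_power subfield_inverse)

end

lemmas subfield_closed = subfield_one subfield_diff subfield_mult subfield_inverse subfield_zero
  subfield_uminus subfield_add subfield_divide subfield_power subfield_of_nat subfield_of_int
  subfield_powi

lemma subfield_CC_iff: "subfield A CC \<longleftrightarrow> is_subfield A"
proof
  assume s: "subfield A CC"
  note sr = subringE[OF subfieldE(1)[OF s]]
  show "is_subfield A"
    unfolding is_subfield_def
  proof (intro conjI ballI)
    show "1 \<in> A" using sr(3) by simp
    fix x y assume xy: "x \<in> A" "y \<in> A"
    show "x - y \<in> A" using sr(7)[OF xy(1) sr(5)[OF xy(2)]] by simp
    show "x * y \<in> A" using sr(6)[OF xy] by simp
  next
    fix x assume x: "x \<in> A"
    show "inverse x \<in> A"
    proof (cases "x = 0")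
      case True thus ?thesis using sr(2) by simp
    next
      case False
      thus ?thesis using CC.subfield_m_inv(1)[OF s, of x] x by simp
    qed
  qed
next
  assume A: "is_subfield A"
  show "subfield A CC"
  proof (rule field.subfieldI'[OF field_CC])
    show "subring A CC"
      by (rule CC.subringI) (auto intro: subfield_closed[OF A])
    fix k assume "k \<in> A - {\<zero>\<^bsub>CC\<^esub>}"
    thus "inv\<^bsub>CC\<^esub> k \<in> A" using subfield_inverse[OF A] by simp
  qed
qed

lemma is_subfield_Qbar: "is_subfield Qbar"
  unfolding is_subfield_def Qbar_def
  using algebraic_add[OF _ algebraic_minus]
  by (force intro: algebraic_mult algebraic_inverse int_imp_algebraic_int algebraic_int_imp_algebraic)

lemma is_subfield_Rats: "is_subfield \<rat>"
  by (auto simp: is_subfield_def)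

lemma adjoin_is_subfield: "is_subfield (adjoin K x)"
  unfolding adjoin_def subfield_CC_iff[symmetric] by (rule field.generate_field_is_subfield[OF field_CC]) simp

lemma adjoin_mem: "x \<in> adjoin K x" and adjoin_superset: "K \<subseteq> adjoin K x"
  unfolding adjoin_def by (auto intro: generate_field.incl)

lemma adjoin_least: "is_subfield A \<Longrightarrow> K \<subseteq> A \<Longrightarrow> x \<in> A \<Longrightarrow> adjoin K x \<subseteq> A"
  unfolding adjoin_def by (rule field.generate_field_min_subfield1[OF field_CC]) (auto simp: subfield_CC_iff)

section \<open>Rings of integers and their ideals as plain sets\<close>

definition integers_of :: "complex set \<Rightarrow> complex set" where
  "integers_of E = {x \<in> E. algebraic_int x}"

definition is_ideal :: "complex set \<Rightarrow> complex set \<Rightarrow> bool" where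
  "is_ideal E I \<longleftrightarrow> I \<subseteq> integers_of E \<and> 0 \<in> I \<and> (\<forall>x\<in>I. \<forall>y\<in>I. x + y \<in> I) \<and>
     (\<forall>x\<in>integers_of E. \<forall>y\<in>I. x * y \<in> I)"

definition is_prime :: "complex set \<Rightarrow> complex set \<Rightarrow> bool" where
  "is_prime E P \<longleftrightarrow> is_ideal E P \<and> 1 \<notin> P \<and>
     (\<forall>x\<in>integers_of E. \<forall>y\<in>integers_of E. x * y \<in> P \<longrightarrow> x \<in> P \<or> y \<in> P)"

lemma integer_ring_simps [simp]:
  "carrier (integer_ring E) = integers_of E" "x \<otimes>\<^bsub>integer_ring E\<^esub> y = x * y"
  "\<one>\<^bsub>integer_ring E\<^esub> = 1" "\<zero>\<^bsub>integer_ring E\<^esub> = 0" "x \<oplus>\<^bsub>integer_ring E\<^esub> y = x + y"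
  by (simp_all add: integer_ring_def integers_of_def)

context
  fixes E assumes E: "is_subfield E"
begin

lemma integers_one: "1 \<in> integers_of E" and integers_zero: "0 \<in> integers_of E"
  and integers_of_int: "of_int n \<in> integers_of E" and integers_of_nat: "of_nat m \<in> integers_of E"
  using subfield_closed[OF E] by (auto simp: integers_of_def)
lemma integers_add: "x \<in> integers_of E \<Longrightarrow> y \<in> integers_of E \<Longrightarrow> x + y \<in> integers_of E"
  and integers_diff: "x \<in> integers_of E \<Longrightarrow> y \<in> integers_of E \<Longrightarrow> x - y \<in> integers_of E"
  and integers_mult: "x \<in> integers_of E \<Longrightarrow> y \<in> integers_of E \<Longrightarrow> x * y \<in> integers_of E"
  and integers_uminus: "x \<in> integers_of E \<Longrightarrow> - x \<in> integers_of E"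
  and integers_power: "x \<in> integers_of E \<Longrightarrow> x ^ n \<in> integers_of E"
  using subfield_closed[OF E]
  by (auto simp: integers_of_def intro: algebraic_int_add algebraic_int_mult algebraic_int_diff
      algebraic_int_power)
lemma integers_sum: "(\<And>i. i \<in> I \<Longrightarrow> f i \<in> integers_of E) \<Longrightarrow> sum f I \<in> integers_of E"
  by (induction I rule: infinite_finite_induct) (auto intro: integers_add integers_zero)
lemma cring_integer_ring: "cring (integer_ring E)"
  by (intro cringI abelian_groupI comm_monoidI)
     (auto simp: integers_zero integers_one algebra_simps intro: integers_add integers_mult
        bexI[OF _ integers_uminus])

lemma ideal_iff: "ideal I (integer_ring E) \<longleftrightarrow> is_ideal E I"
proof
  assume I: "ideal I (integer_ring E)"
  interpret ideal I "integer_ring E" by fact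
  show "is_ideal E I"
    unfolding is_ideal_def
    using a_subset additive_subgroup.zero_closed[OF additive_subgroup_axioms]
      additive_subgroup.a_closed[OF additive_subgroup_axioms] I_l_closed
    by auto
next
  assume I: "is_ideal E I"
  interpret R: cring "integer_ring E" by (rule cring_integer_ring)
  have minv: "\<ominus>\<^bsub>integer_ring E\<^esub> x = - x" if "x \<in> integers_of E" for x
    by (rule R.minus_equality) (use that integers_uminus in auto)
  show "ideal I (integer_ring E)"
  proof (rule idealI[OF R.ring_axioms])
    show "subgroup I (add_monoid (integer_ring E))"
    proof (rule group.subgroupI)
      show "Group.group (add_monoid (integer_ring E))" by (rule R.a_group)
      show "I \<subseteq> carrier (add_monoid (integer_ring E))" using I by (simp add: is_ideal_def)
      show "I \<noteq> {}" using I by (auto simp: is_ideal_def)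
      show "x \<otimes>\<^bsub>add_monoid (integer_ring E)\<^esub> y \<in> I" if "x \<in> I" "y \<in> I" for x y
        using I that by (simp add: is_ideal_def)
      show "inv\<^bsub>add_monoid (integer_ring E)\<^esub> x \<in> I" if "x \<in> I" for x
      proof -
        have "x \<in> integers_of E" using I that by (auto simp: is_ideal_def)
        moreover have "- 1 * x \<in> I"
          using I that integers_uminus[OF integers_one] unfolding is_ideal_def by blast
        ultimately show ?thesis using minv by (simp add: a_inv_def)
      qed
    qed
    show "x \<otimes>\<^bsub>integer_ring E\<^esub> a \<in> I" "a \<otimes>\<^bsub>integer_ring E\<^esub> x \<in> I"
      if "a \<in> I" "x \<in> carrier (integer_ring E)" for a x
    proof -
      have "x * a \<in> I" using I that by (simp add: is_ideal_def)
      thus "x \<otimes>\<^bsub>integer_ring E\<^esub> a \<in> I" "a \<otimes>\<^bsub>integer_ring E\<^esub> x \<in> I"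
        by (simp_all add: mult.commute[of a])
    qed
  qed
qed

lemma primeideal_iff: "primeideal P (integer_ring E) \<longleftrightarrow> is_prime E P"
proof
  assume P: "primeideal P (integer_ring E)"
  interpret primeideal P "integer_ring E" by fact
  have i: "is_ideal E P" using is_ideal ideal_iff by blast
  moreover have "1 \<notin> P"
  proof
    assume "1 \<in> P"
    hence "integers_of E \<subseteq> P" using i unfolding is_ideal_def by force
    thus False using I_notcarr a_subset by auto
  qed
  ultimately show "is_prime E P" using I_prime by (auto simp: is_prime_def)
next
  assume P: "is_prime E P"
  show "primeideal P (integer_ring E)"
  proof (rule primeidealI)
    show "ideal P (integer_ring E)" using P ideal_iff by (simp add: is_prime_def)
    show "cring (integer_ring E)" by (rule cring_integer_ring)
    show "carrier (integer_ring E) \<noteq> P" using P integers_one by (auto simp: is_prime_def)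
  qed (use P in \<open>auto simp: is_prime_def\<close>)
qed

end

section \<open>Number fields\<close>

lemma CC_combine_eq_sum:
  "length Ks = length Us \<Longrightarrow> CC.combine Ks Us = (\<Sum>i<length Us. Ks ! i * Us ! i)"
proof (induction Ks Us rule: list_induct2)
  case (Cons k Ks u Us)
  thus ?case by (simp add: sum.lessThan_Suc_shift del: sum.lessThan_Suc)
qed simp

lemma subfield_Rats_CC: "subfield \<rat> CC"
  using is_subfield_Rats subfield_CC_iff by blast

lemma number_field_is_subfield: "number_field E \<Longrightarrow> is_subfield E"
  by (simp add: number_field_def subfield_CC_iff)

lemma number_field_basis:
  assumes "number_field E"
  obtains bs where "set bs \<subseteq> E"
    "\<And>x. x \<in> E \<Longrightarrow> \<exists>c. (\<forall>i. c i \<in> \<rat>) \<and> x = (\<Sum>i<length bs. c i * bs ! i)"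
proof -
  obtain n where "CC.dimension n \<rat> E"
    using assms by (auto simp: number_field_def CC.finite_dimension_def)
  then obtain bs where bs: "CC.Span \<rat> bs = E"
    using CC.exists_base[OF subfield_Rats_CC] by metis
  have "\<exists>c. (\<forall>i. c i \<in> \<rat>) \<and> x = (\<Sum>i<length bs. c i * bs ! i)" if "x \<in> E" for x
  proof -
    obtain Ks where Ks: "set Ks \<subseteq> \<rat>" "length Ks = length bs" "x = CC.combine Ks bs"
      using CC.Span_mem_iff_length_version[OF subfield_Rats_CC, of bs x] \<open>x \<in> E\<close> bs
      by (auto simp del: CC.Span.simps)
    show ?thesis
      by (rule exI[of _ "\<lambda>i. if i < length Ks then Ks ! i else 0"])
         (use Ks in \<open>auto simp: CC_combine_eq_sum intro: nth_mem\<close>)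
  qed
  moreover have "set bs \<subseteq> E"
    using CC.Span_base_incl[OF subfield_Rats_CC, of bs] bs by auto
  ultimately show ?thesis using that by blast
qed

text \<open>\<open>d\<close> is the degree: the \<open>d + 1\<close> elements \<open>f 0\<close> to
  \<open>f d\<close> outnumber the dimension.\<close>

lemma number_field_dependent:
  assumes "number_field E"
  shows "\<exists>d. \<forall>f. (\<forall>i\<le>d. f i \<in> E) \<longrightarrow>
    (\<exists>c. (\<forall>i. c i \<in> \<rat>) \<and> (\<exists>i\<le>d::nat. c i \<noteq> 0) \<and> (\<Sum>i\<le>d. c i * f i) = 0)"
proof -
  obtain d where d: "CC.dimension d \<rat> E"
    using assms by (auto simp: number_field_def CC.finite_dimension_def)
  have "\<exists>c. (\<forall>i. c i \<in> \<rat>) \<and> (\<exists>i\<le>d. c i \<noteq> 0) \<and> (\<Sum>i\<le>d. c i * f i) = 0"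
    if f: "\<And>i. i \<le> d \<Longrightarrow> f i \<in> E" for f
  proof -
    define Us where "Us = map f [0..<Suc d]"
    have len: "length Us = Suc d" by (simp add: Us_def)
    have "set Us \<subseteq> E" using f by (auto simp: Us_def)
    hence dep: "CC.dependent \<rat> Us"
      using CC.independent_length_le_dimension[OF subfield_Rats_CC d, of Us] len by auto
    obtain Ks where Ks: "length Ks = length Us" "CC.combine Ks Us = 0" "set Ks \<subseteq> \<rat>" "set Ks \<noteq> {0}"
      using CC.dependent_imp_non_trivial_combine[OF subfield_Rats_CC _ dep] by auto
    have "\<exists>i\<le>d. Ks ! i \<noteq> 0"
    proof (rule ccontr)
      assume "\<not> ?thesis"
      hence "Ks ! i = 0" if "i < length Ks" for i using that Ks(1) len by auto
      hence "set Ks \<subseteq> {0}" by (auto simp: in_set_conv_nth)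
      thus False using Ks(1,4) len by (cases Ks) auto
    qed
    moreover have "(\<Sum>i\<le>d. Ks ! i * f i) = 0"
    proof -
      have "(\<Sum>i<Suc d. Ks ! i * Us ! i) = 0"
        using Ks(1,2) CC_combine_eq_sum[OF Ks(1)] len by simp
      moreover have "Us ! i = f i" if "i < Suc d" for i
        using that by (simp add: Us_def del: upt_Suc)
      ultimately show ?thesis by (simp add: lessThan_Suc_atMost)
    qed
    ultimately show ?thesis
      by (intro exI[of _ "\<lambda>i. if i \<le> d then Ks ! i else 0"])
         (use Ks(1) len in \<open>auto intro: subsetD[OF Ks(3)]\<close>)
  qed
  thus ?thesis by blast
qed

lemma number_field_subset_Qbar:
  assumes "number_field E" shows "E \<subseteq> Qbar"
proof
  fix x assume x: "x \<in> E"
  obtain d where d: "\<forall>f. (\<forall>i\<le>d. f i \<in> E) \<longrightarrow>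
       (\<exists>c. (\<forall>i. c i \<in> \<rat>) \<and> (\<exists>i\<le>d::nat. c i \<noteq> 0) \<and> (\<Sum>i\<le>d. c i * f i) = 0)"
    using number_field_dependent[OF assms] ..
  have "\<forall>i\<le>d. x ^ i \<in> E"
    using subfield_power[OF number_field_is_subfield[OF assms] x] by blast
  from d[THEN spec, THEN mp, OF this]
  obtain c where c: "\<forall>i. c i \<in> \<rat>" "\<exists>i\<le>d. c i \<noteq> 0" "(\<Sum>i\<le>d. c i * x ^ i) = 0"
    by blast
  define p where "p = (\<Sum>i\<le>d. monom (c i) i)"
  have cp: "coeff p i = (if i \<le> d then c i else 0)" for i
    by (simp add: p_def coeff_sum coeff_monom)
  have "p \<noteq> 0" using c(2) cp by (metis coeff_0)
  moreover have "poly p x = 0" using c(3) by (simp add: p_def poly_sum poly_monom)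
  moreover have "\<forall>i. coeff p i \<in> \<rat>" using c(1) by (simp add: cp)
  ultimately show "x \<in> Qbar" unfolding Qbar_def using algebraic_altdef by blast
qed

text \<open>The list polynomials evaluated by \<open>CC.eval\<close> carry the leading coefficient
  first; reversing the list is the bridge to \<open>poly\<close>.\<close>

lemma CC_eval_rev: "CC.eval (rev cs) x = foldr (\<lambda>a s. a + x * s) cs 0"
proof (induction cs)
  case (Cons a cs)
  thus ?case using CC.eval_append_aux[of "rev cs" a x] by (simp add: mult.commute)
qed simp

lemma CC_algebraic_over:
  assumes "algebraic x" "is_subfield E"
  shows "CC.algebraic E x"
proof -
  obtain p where p: "\<And>i. coeff p i \<in> \<int>" "p \<noteq> 0" "poly p x = 0"
    using assms(1) by (auto simp: algebraic_def)
  have "rev (coeffs p) \<in> carrier (univ_poly CC E)"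
    unfolding univ_poly_def polynomial_def
  proof (simp add: p(2) hd_rev last_coeffs_eq_coeff_degree, intro subsetI)
    fix y assume "y \<in> set (coeffs p)"
    then obtain i where "y = coeff p i" using p(2) by (auto simp: coeffs_def)
    thus "y \<in> E" using p(1)[of i] subfield_of_int[OF assms(2)] by (auto elim: Ints_cases)
  qed
  moreover have "CC.eval (rev (coeffs p)) x = 0"
    using p(3) by (simp add: CC_eval_rev poly_def fold_coeffs_def horner_sum_foldr)
  ultimately have "(CC.algebraic over E) x" using p(2) by (intro CC.algebraicI) auto
  thus ?thesis by (simp add: over_def)
qed

lemma adjoin_eq_simple_extension:
  assumes "algebraic x" "is_subfield E"
  shows "adjoin E x = CC.simple_extension E x"
proof -
  have dom: "domain CC" using field_CC by (simp add: Ring.field_def)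
  have sE: "subfield E CC" using assms(2) subfield_CC_iff by blast
  note sr = subfieldE(1)[OF sE]
  show ?thesis
    unfolding adjoin_def
  proof (rule sym, rule field.generate_fieldI[OF field_CC])
    show "subfield (CC.simple_extension E x) CC"
      using domain.simple_extension_is_subfield[OF dom sE, of x] CC_algebraic_over[OF assms] by (simp add: over_def)
    show "insert x E \<subseteq> CC.simple_extension E x"
      using CC.simple_extension_incl[of E x] CC.simple_extension_mem[OF sr, of x] by simp
    fix K assume "subfield K CC" "insert x E \<subseteq> K"
    thus "CC.simple_extension E x \<subseteq> K"
      using CC.simple_extension_subring_incl[of K E x] subfieldE(1) by blast
  qed simp
qed

lemma number_field_adjoin:
  assumes "number_field E" "x \<in> Qbar"
  shows "number_field (adjoin E x)"
proof -
  have dom: "domain CC" using field_CC by (simp add: Ring.field_def)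
  have sE: "subfield E CC" and fd: "CC.finite_dimension \<rat> E"
    using assms by (auto simp: number_field_def)
  have alg: "algebraic x" using assms(2) by (simp add: Qbar_def)
  have "CC.finite_dimension E (CC.simple_extension E x)"
    using domain.finite_dimension_simple_extension[OF dom sE, of x]
      CC_algebraic_over[OF alg] sE subfield_CC_iff by (auto simp: over_def)
  hence "CC.finite_dimension \<rat> (CC.simple_extension E x)"
    using CC.telescopic_base_dim(1)[OF subfield_Rats_CC sE fd] by blast
  thus ?thesis
    using adjoin_eq_simple_extension[OF alg, of E] sE adjoin_is_subfield[of E x]
    by (simp add: number_field_def subfield_CC_iff)
qed

lemma number_field_Rats: "number_field \<rat>"
  unfolding number_field_def
  using subfield_Rats_CC CC.finite_dimensionI[OF CC.dimension_one[OF subfield_Rats_CC]] by simp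

text \<open>Adjoining the elements one at a time. The minimality clause is what later keeps a field
  generated by elements of \<open>K\<close> inside \<open>K\<close> and makes fields generated by
  conjugates stable under automorphisms.\<close>

lemma number_field_adjoin_finite:
  assumes "number_field F" "finite B" "B \<subseteq> Qbar"
  shows "\<exists>E. number_field E \<and> F \<subseteq> E \<and> B \<subseteq> E \<and>
    (\<forall>A. is_subfield A \<longrightarrow> F \<subseteq> A \<longrightarrow> B \<subseteq> A \<longrightarrow> E \<subseteq> A)"
  using assms(2,3)
proof (induction B rule: finite_induct)
    case empty
    thus ?case using assms(1) by blast
  next
    case (insert x B)
    then obtain E where E: "number_field E" "F \<subseteq> E" "B \<subseteq> E"
      "\<forall>A. is_subfield A \<longrightarrow> F \<subseteq> A \<longrightarrow> B \<subseteq> A \<longrightarrow> E \<subseteq> A" by auto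
    show ?case
      using number_field_adjoin[OF E(1), of x] E insert.prems adjoin_superset[of E x]
        adjoin_mem[of x E] adjoin_least[of _ E x]
      by (intro exI[of _ "adjoin E x"]) auto
qed

lemma number_field_covers:
  assumes "finite B" "B \<subseteq> Qbar"
  obtains E where "number_field E" "B \<subseteq> E"
  using number_field_adjoin_finite[OF number_field_Rats assms] by blast

lemma integer_multiple_in_field:
  assumes "is_subfield E" "E \<subseteq> Qbar" "x \<in> E"
  obtains n :: int where "n > 0" "of_int n * x \<in> integers_of E"
  using algebraic_iff_int_multiple[of x] assms subfield_mult[OF assms(1)] subfield_of_int[OF assms(1)]
  by (auto simp: Qbar_def integers_of_def)

text \<open>Powers of the variable can be cancelled because \<open>x\<close> is nonzero. The nonzero
  constant term then expresses \<open>inverse x\<close> as a polynomial in \<open>x\<close>, and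
  displays a rational integer divisible by \<open>x\<close> if \<open>x\<close> is integral.\<close>

lemma algebraic_nonzero_const:
  fixes x :: complex
  assumes "algebraic x" "x \<noteq> 0"
  shows "\<exists>p. (\<forall>i. coeff p i \<in> \<int>) \<and> coeff p 0 \<noteq> 0 \<and> poly p x = 0"
proof -
  have "\<exists>p. (\<forall>i. coeff p i \<in> \<int>) \<and> coeff p 0 \<noteq> 0 \<and> poly p x = 0"
    if "\<And>i. coeff p i \<in> \<int>" "p \<noteq> 0" "poly p x = 0" for p
    using that
  proof (induction p rule: pCons_induct)
    case (pCons a p)
    show ?case
    proof (cases "a = 0")
      case True
      have "coeff p i \<in> \<int>" for i using pCons.prems(1)[of "Suc i"] by simp
      thus ?thesis using pCons.IH pCons.prems True assms(2) by auto
    next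
      case False
      thus ?thesis using pCons.prems by (intro exI[of _ "pCons a p"]) auto
    qed
  qed simp
  thus ?thesis using assms(1) unfolding algebraic_def by metis
qed

text \<open>The constant term of an integral polynomial vanishing at \<open>x\<close> is a multiple
  of \<open>x\<close>; its sign is adjusted.\<close>

lemma integer_divides_int:
  assumes E: "is_subfield E" and x: "x \<in> integers_of E" "x \<noteq> 0"
  obtains n :: int and y where "n > 0" "y \<in> integers_of E" "of_int n = x * y"
proof -
  have "algebraic_int x" using x by (simp add: integers_of_def)
  have "\<exists>p. (\<forall>i. coeff p i \<in> \<int>) \<and> coeff p 0 \<noteq> 0 \<and> poly p x = 0"
    using algebraic_nonzero_const[of x] \<open>algebraic_int x\<close> x by blast
  then obtain p where p: "\<And>i. coeff p i \<in> \<int>" "coeff p 0 \<noteq> 0" "poly p x = 0" by blast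
  obtain c q where pq: "p = pCons c q" by (cases p) auto
  obtain k where k: "c = of_int k" "k \<noteq> 0" using p(1)[of 0] p(2) pq by (auto elim: Ints_cases)
  have qi: "coeff q i \<in> \<int>" for i using p(1)[of "Suc i"] pq by simp
  have "coeff q i \<in> integers_of E" for i
    using qi[of i] integers_of_int[OF E] by (auto elim: Ints_cases)
  hence "poly q x \<in> integers_of E"
    unfolding poly_altdef
    using integers_power[OF E x(1)] by (intro integers_sum[OF E] integers_mult[OF E]) auto
  moreover have "of_int k = x * (- poly q x)" using p(3) by (simp add: pq k(1) eq_neg_iff_add_eq_0)
  moreover from this have "of_int (- k) = x * poly q x" by simp
  ultimately show ?thesis
    using that[of k "- poly q x"] that[of "-k" "poly q x"] k(2) integers_uminus[OF E] by force
qed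

section \<open>Primes above a given prime\<close>

lemma is_ideal_sum:
  "is_ideal E I \<Longrightarrow> (\<And>i. i \<in> A \<Longrightarrow> f i \<in> I) \<Longrightarrow> sum f A \<in> I"
  by (induction A rule: infinite_finite_induct) (auto simp: is_ideal_def)

lemma is_ideal_uminus:
  assumes "is_subfield E" "is_ideal E I" "x \<in> I" shows "- x \<in> I"
  using assms integers_uminus[OF assms(1) integers_one[OF assms(1)]]
  unfolding is_ideal_def by (metis mult_minus1)

lemma is_ideal_diff:
  assumes "is_subfield E" "is_ideal E I" "x \<in> I" "y \<in> I" shows "x - y \<in> I"
  using is_ideal_uminus[OF assms(1,2,4)] assms(2,3) unfolding is_ideal_def by (metis diff_conv_add_uminus)

lemma is_ideal_mult:
  assumes "is_ideal E I" "x \<in> I" "y \<in> integers_of E"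
  shows "x * y \<in> I" "y * x \<in> I"
  using assms by (auto simp: is_ideal_def mult.commute)

lemma is_prime_power:
  assumes "is_subfield E" "is_prime E P" "x \<in> integers_of E" "x ^ n \<in> P"
  shows "x \<in> P"
  using assms(4)
proof (induction n)
  case (Suc n)
  thus ?case using assms(2,3) integers_power[OF assms(1,3)] by (auto simp: is_prime_def)
qed (use assms in \<open>auto simp: is_prime_def\<close>)

lemma is_prime_restrict:
  assumes "is_prime E' P" "is_subfield E" "E \<subseteq> E'"
  shows "is_prime E (P \<inter> E)"
  using assms subfield_closed[OF assms(2)]
  unfolding is_prime_def is_ideal_def integers_of_def by (auto simp: subset_iff)

text \<open>Lying over, for a subfield of possibly infinite degree. An ideal \<open>Q\<close>
  maximal among those whose trace on \<open>E\<close> lies in \<open>P\<close> is prime. If some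
  \<open>p\<close> in \<open>P\<close> were outside \<open>Q\<close>, an \<open>s\<close> outside
  \<open>P\<close> would equal \<open>q + p * z\<close>; the monic equation of \<open>z\<close>,
  scaled by powers of \<open>p\<close>, would then put a power of \<open>s\<close> into
  \<open>P\<close>.\<close>

lemma is_prime_lift:
  assumes E: "is_subfield E" "E \<subseteq> Qbar" and P: "is_prime E P"
  obtains Q where "is_prime Qbar Q" "Q \<inter> E = P"
proof -
  define F where "F = {J. is_ideal Qbar J \<and> J \<inter> E \<subseteq> P}"
  note ring = integers_add[OF is_subfield_Qbar] integers_mult[OF is_subfield_Qbar]
    integers_one[OF is_subfield_Qbar] integers_zero[OF is_subfield_Qbar]
    integers_power[OF is_subfield_Qbar] integers_uminus[OF is_subfield_Qbar]
  have OE: "integers_of E \<subseteq> integers_of Qbar" using E by (auto simp: integers_of_def)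
  have PE: "P \<subseteq> integers_of E" "0 \<in> P" using P by (auto simp: is_prime_def is_ideal_def)
  have "{0} \<in> F" using ring PE by (auto simp: F_def is_ideal_def)
  hence "\<exists>Q\<in>F. \<forall>J\<in>F. Q \<subseteq> J \<longrightarrow> J = Q"
  proof (intro subset_Zorn_nonempty)
    fix C assume C: "C \<noteq> {}" "subset.chain F C"
    have ch: "\<And>I J. I \<in> C \<Longrightarrow> J \<in> C \<Longrightarrow> I \<subseteq> J \<or> J \<subseteq> I" and CF: "C \<subseteq> F"
      using C by (auto simp: subset.chain_def subset_chain_def)
    show "\<Union>C \<in> F"
      unfolding F_def is_ideal_def
    proof (intro CollectI conjI ballI)
      fix x y assume "x \<in> \<Union>C" "y \<in> \<Union>C"
      then obtain I where "I \<in> C" "x \<in> I" "y \<in> I" using ch by blast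
      moreover have "x + y \<in> I" using calculation CF by (auto simp: F_def is_ideal_def)
      ultimately show "x + y \<in> \<Union>C" by blast
    next
      fix x y assume "x \<in> integers_of Qbar" "y \<in> \<Union>C"
      then obtain I where I: "I \<in> C" "y \<in> I" "x \<in> integers_of Qbar" by blast
      hence "x * y \<in> I" using CF by (auto simp: F_def is_ideal_def)
      thus "x * y \<in> \<Union>C" using I by blast
    next
      show "0 \<in> \<Union>C" using C(1) CF unfolding F_def is_ideal_def by blast
    next
      show "\<Union>C \<subseteq> integers_of Qbar" using CF unfolding F_def is_ideal_def by blast
    next
      show "\<Union>C \<inter> E \<subseteq> P" using CF unfolding F_def by blast
    qed
  qed auto
  then obtain Q where QF: "Q \<in> F" "\<forall>J\<in>F. Q \<subseteq> J \<longrightarrow> J = Q" ..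
  hence Q: "is_ideal Qbar Q" "Q \<inter> E \<subseteq> P"
    and max: "\<And>J. is_ideal Qbar J \<Longrightarrow> J \<inter> E \<subseteq> P \<Longrightarrow> Q \<subseteq> J \<Longrightarrow> J = Q"
    by (simp_all add: F_def)
  define gen where "gen z = {q + z * w | q w. q \<in> Q \<and> w \<in> integers_of Qbar}" for z
  have gen: "is_ideal Qbar (gen z)" "Q \<subseteq> gen z" "z \<in> gen z" if z: "z \<in> integers_of Qbar" for z
  proof -
    show "is_ideal Qbar (gen z)"
      unfolding is_ideal_def
    proof (intro conjI ballI)
      show "gen z \<subseteq> integers_of Qbar"
        using Q(1) z ring by (auto simp: gen_def is_ideal_def intro!: ring)
      show "0 \<in> gen z" unfolding gen_def using Q(1) ring
        by (intro CollectI exI[of _ 0] exI[of _ 0]) (auto simp: is_ideal_def)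
      fix x y assume "x \<in> gen z" "y \<in> gen z"
      then obtain q w q' w' where "q \<in> Q" "q' \<in> Q" "w \<in> integers_of Qbar" "w' \<in> integers_of Qbar"
        "x = q + z * w" "y = q' + z * w'" by (auto simp: gen_def)
      thus "x + y \<in> gen z" unfolding gen_def using Q(1) ring
        by (intro CollectI exI[of _ "q + q'"] exI[of _ "w + w'"]) (auto simp: is_ideal_def algebra_simps)
    next
      fix x y assume "x \<in> integers_of Qbar" "y \<in> gen z"
      then obtain q w where "q \<in> Q" "w \<in> integers_of Qbar" "y = q + z * w" by (auto simp: gen_def)
      thus "x * y \<in> gen z" unfolding gen_def using Q(1) ring \<open>x \<in> integers_of Qbar\<close>
        by (intro CollectI exI[of _ "x * q"] exI[of _ "x * w"]) (auto simp: is_ideal_def algebra_simps)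
    qed
    show "Q \<subseteq> gen z"
    proof
      fix q assume "q \<in> Q"
      thus "q \<in> gen z" unfolding gen_def using ring by (intro CollectI exI[of _ q] exI[of _ 0]) auto
    qed
    show "z \<in> gen z" unfolding gen_def using ring Q(1)
      by (intro CollectI exI[of _ 0] exI[of _ 1]) (auto simp: is_ideal_def)
  qed
  \<comment> \<open>By maximality, adding any \<open>z\<close> outside \<open>Q\<close> makes the
    ideal meet \<open>integers_of E\<close> outside \<open>P\<close>.\<close>
  have meets: "\<exists>s q w. s \<in> integers_of E - P \<and> q \<in> Q \<and> w \<in> integers_of Qbar \<and> s = q + z * w"
    if z: "z \<in> integers_of Qbar" "z \<notin> Q" for z
  proof -
    have "\<not> gen z \<inter> E \<subseteq> P"
      using max[OF gen(1)[OF z(1)] _ gen(2)[OF z(1)]] gen(3)[OF z(1)] z(2) by metis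
    then obtain s where s: "s \<in> gen z" "s \<in> E" "s \<notin> P" by blast
    moreover have "s \<in> integers_of Qbar" using s gen(1)[OF z(1)] by (auto simp: is_ideal_def)
    ultimately show ?thesis by (auto simp: gen_def integers_of_def)
  qed
  have prime: "is_prime Qbar Q"
    unfolding is_prime_def
  proof (intro conjI ballI impI)
    show "1 \<notin> Q" using Q(2) P subfield_one[OF E(1)] by (auto simp: is_prime_def)
    fix x y assume xy: "x \<in> integers_of Qbar" "y \<in> integers_of Qbar" "x * y \<in> Q"
    show "x \<in> Q \<or> y \<in> Q"
    proof (rule ccontr)
      assume "\<not> ?thesis"
      hence "x \<notin> Q" "y \<notin> Q" by auto
      then obtain s q w t r v where st: "s \<in> integers_of E - P" "t \<in> integers_of E - P"
        "q \<in> Q" "r \<in> Q" "w \<in> integers_of Qbar" "v \<in> integers_of Qbar" "s = q + x * w" "t = r + y * v"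
        using meets[OF xy(1)] meets[OF xy(2)] by blast
      have "s * t = q * t + (x * w) * r + (x * y) * (w * v)"
        by (simp add: st(7,8) algebra_simps)
      also have "\<dots> \<in> Q"
      proof -
        have "t \<in> integers_of Qbar" using st(2) OE by blast
        hence "q * t \<in> Q" by (rule is_ideal_mult(1)[OF Q(1) st(3)])
        moreover have "(x * w) * r \<in> Q"
          by (rule is_ideal_mult(2)[OF Q(1) st(4) ring(2)[OF xy(1) st(5)]])
        moreover have "(x * y) * (w * v) \<in> Q"
          by (rule is_ideal_mult(1)[OF Q(1) xy(3) ring(2)[OF st(5,6)]])
        ultimately show ?thesis using Q(1) by (simp add: is_ideal_def)
      qed
      finally have "s * t \<in> P" using Q(2) st integers_mult[OF E(1)]
        by (auto simp: integers_of_def)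
      thus False using P st unfolding is_prime_def by blast
    qed
  qed (rule Q)
  have "P \<subseteq> Q"
  proof
    fix p assume p: "p \<in> P"
    show "p \<in> Q"
    proof (rule ccontr)
      assume "p \<notin> Q"
      moreover have pO: "p \<in> integers_of Qbar" using p PE OE by blast
      ultimately obtain s q z where s: "s \<in> integers_of E - P" "q \<in> Q" "z \<in> integers_of Qbar" "s = q + p * z"
        using meets[OF pO] by blast
      obtain f where f: "lead_coeff f = 1" "\<forall>i. coeff f i \<in> \<int>" "poly f z = 0"
        using s(3) by (auto simp: integers_of_def elim: algebraic_int.cases)
      define n where "n = degree f"
      define t where "t = p * z"
      \<comment> \<open>\<open>T u\<close> gathers all terms but the leading one of the monic
        equation of \<open>p * z\<close>; each of its coefficients is a multiple of
        \<open>p\<close>.\<close>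
      define T where "T u = (\<Sum>i<n. coeff f i * p ^ (n - i) * u ^ i)" for u
      have cO: "coeff f i \<in> integers_of E" for i
        using f(2) integers_of_int[OF E(1)] by (metis Ints_cases)
      have tO: "t \<in> integers_of Qbar" unfolding t_def by (rule ring(2)[OF pO s(3)])
      have sO: "s \<in> integers_of Qbar" using s OE by blast
      have "0 = p ^ n * poly f z" using f by simp
      also have "\<dots> = (\<Sum>i\<le>n. p ^ n * (coeff f i * z ^ i))"
        by (simp add: poly_altdef n_def sum_distrib_left)
      also have "\<dots> = (\<Sum>i\<le>n. coeff f i * p ^ (n - i) * t ^ i)"
      proof (intro sum.cong refl)
        fix i assume "i \<in> {..n}"
        hence "p ^ n = p ^ (n - i) * p ^ i" by (simp flip: power_add)
        thus "p ^ n * (coeff f i * z ^ i) = coeff f i * p ^ (n - i) * t ^ i"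
          by (simp add: t_def power_mult_distrib mult_ac)
      qed
      also have "\<dots> = t ^ n + T t"
        using f(1) by (simp add: lessThan_Suc_atMost[symmetric] n_def T_def)
      finally have t0: "t ^ n + T t = 0" by simp
      have powdiff: "s ^ i - t ^ i \<in> Q" for i
      proof (induction i)
        case 0 thus ?case using Q(1) by (simp add: is_ideal_def)
      next
        case (Suc i)
        have "s ^ Suc i - t ^ Suc i = s * (s ^ i - t ^ i) + t ^ i * q"
          by (simp add: s(4) t_def[symmetric] algebra_simps)
        moreover have "s * (s ^ i - t ^ i) \<in> Q" "t ^ i * q \<in> Q"
          using is_ideal_mult(2)[OF Q(1)] Suc sO tO s(2) ring by auto
        ultimately show ?case using Q(1) by (auto simp: is_ideal_def)
      qed
      have "s ^ n + T s = (s ^ n - t ^ n) + (\<Sum>i<n. coeff f i * p ^ (n - i) * (s ^ i - t ^ i))"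
        using t0 by (simp add: T_def algebra_simps sum_subtractf)
      also have "\<dots> \<in> Q"
      proof -
        have "(\<Sum>i<n. coeff f i * p ^ (n - i) * (s ^ i - t ^ i)) \<in> Q"
          using powdiff subsetD[OF OE cO] ring(2,5) pO
          by (intro is_ideal_sum[OF Q(1)] is_ideal_mult(2)[OF Q(1)]) simp_all
        thus ?thesis using powdiff[of n] Q(1) by (simp add: is_ideal_def)
      qed
      finally have "s ^ n + T s \<in> Q" .
      moreover have Ts: "T s \<in> P"
        unfolding T_def
      proof (intro is_ideal_sum[of E])
        show "is_ideal E P" using P by (simp add: is_prime_def)
        fix i assume "i \<in> {..<n}"
        hence "p ^ (n - i) = p * p ^ (n - i - 1)" by (simp add: Suc_diff_Suc flip: power_Suc)
        hence "coeff f i * p ^ (n - i) * s ^ i = p * (coeff f i * p ^ (n - i - 1) * s ^ i)"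
          by (simp add: mult_ac)
        also have "\<dots> \<in> P"
          using \<open>is_ideal E P\<close> p cO PE s integers_mult[OF E(1)] integers_power[OF E(1)]
          by (intro is_ideal_mult(1)[of E P]) auto
        finally show "coeff f i * p ^ (n - i) * s ^ i \<in> P" .
      qed
      moreover have "s ^ n + T s \<in> E"
      proof -
        have "T s \<in> E" using Ts PE by (auto simp: integers_of_def)
        moreover have "s ^ n \<in> E" using s subfield_power[OF E(1)] by (auto simp: integers_of_def)
        ultimately show ?thesis using subfield_add[OF E(1)] by blast
      qed
      ultimately have "s ^ n + T s \<in> P" using Q(2) by blast
      hence "s ^ n + T s - T s \<in> P"
        using P Ts by (intro is_ideal_diff[OF E(1)]) (simp_all add: is_prime_def)
      hence "s ^ n \<in> P" by simp
      hence "s \<in> P" using is_prime_power[OF E(1) P] s(1) by blast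
      thus False using s by blast
    qed
  qed
  hence "Q \<inter> E = P" using Q(2) PE by (auto simp: integers_of_def)
  thus ?thesis using prime that by blast
qed

lemma is_prime_of_prime_number:
  assumes "Factorial_Ring.prime (l::nat)"
  obtains Q where "is_prime Qbar Q" "of_nat l \<in> Q"
proof -
  define P where "P = {complex_of_int k | k. int l dvd k}"
  have O: "integers_of \<rat> = \<int>"
    by (auto simp: integers_of_def intro: rational_algebraic_int_is_int int_imp_algebraic_int
        elim: Ints_cases)
  have "is_prime \<rat> P"
    unfolding is_prime_def is_ideal_def O
  proof (intro conjI ballI impI)
    show "1 \<notin> P"
    proof
      assume "1 \<in> P"
      then obtain k where "complex_of_int k = 1" "int l dvd k" by (auto simp: P_def)
      hence "int l dvd 1" by (metis of_int_eq_1_iff)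
      thus False using assms prime_gt_1_nat[of l] by auto
    qed
    fix x y :: complex assume "x \<in> \<int>" "y \<in> \<int>" "x * y \<in> P"
    then obtain a b k where ab: "x = of_int a" "y = of_int b" "x * y = of_int k" "int l dvd k"
      by (auto simp: P_def Ints_def)
    hence "complex_of_int (a * b) = of_int k" by simp
    hence "a * b = k" by (metis of_int_eq_iff)
    hence "int l dvd a \<or> int l dvd b" using ab(4) assms
      by (metis prime_dvd_multD prime_nat_int_transfer)
    thus "x \<in> P \<or> y \<in> P" using ab by (auto simp: P_def)
  next
    show "0 \<in> P" by (auto simp: P_def intro: exI[of _ 0])
  next
    fix x y assume "x \<in> P" "y \<in> P"
    then obtain a b where "x = of_int a" "y = of_int b" "int l dvd a" "int l dvd b" by (auto simp: P_def)
    thus "x + y \<in> P" unfolding P_def by (intro CollectI exI[of _ "a + b"]) auto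
  next
    fix x y :: complex assume "x \<in> \<int>" "y \<in> P"
    then obtain a b where "x = of_int a" "y = of_int b" "int l dvd b" by (auto simp: P_def Ints_def)
    thus "x * y \<in> P" unfolding P_def by (intro CollectI exI[of _ "a * b"]) auto
  qed (auto simp: P_def)
  moreover have "\<rat> \<subseteq> Qbar" using subfield_Rats[OF is_subfield_Qbar] .
  ultimately obtain Q where "is_prime Qbar Q" "Q \<inter> \<rat> = P"
    using is_prime_lift[OF is_subfield_Rats] by blast
  moreover have "of_nat l \<in> P" unfolding P_def by (intro CollectI exI[of _ "int l"]) simp
  ultimately show ?thesis using that by blast
qed

section \<open>Automorphisms of the field of algebraic numbers\<close>

text \<open>Only the values on \<open>Qbar\<close> matter; outside, the function is arbitrary. That
  0, 1 and inverses are respected is a consequence.\<close>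

definition is_aut :: "(complex \<Rightarrow> complex) \<Rightarrow> bool" where
  "is_aut \<tau> \<longleftrightarrow> (\<forall>x\<in>Qbar. \<forall>y\<in>Qbar. \<tau> (x + y) = \<tau> x + \<tau> y \<and> \<tau> (x * y) = \<tau> x * \<tau> y) \<and>
     bij_betw \<tau> Qbar Qbar"

text \<open>Graphs of partial embeddings; the last condition makes the relation and its converse
  single-valued.\<close>

definition hom_graph :: "(complex \<times> complex) set \<Rightarrow> bool" where
  "hom_graph r \<longleftrightarrow> r \<subseteq> Qbar \<times> Qbar \<and> (\<forall>q\<in>\<rat>. (q, q) \<in> r) \<and>
     (\<forall>(x, x')\<in>r. \<forall>(y, y')\<in>r. (x + y, x' + y') \<in> r \<and> (x * y, x' * y') \<in> r) \<and>
     (\<forall>(x, x')\<in>r. x = 0 \<longleftrightarrow> x' = 0)"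

text \<open>\<open>h\<close> arises from \<open>g\<close> by applying the partial embedding
  \<open>r\<close> to the coefficients. As a relation it can be read in both directions.\<close>

definition poly_rel :: "(complex \<times> complex) set \<Rightarrow> complex poly \<Rightarrow> complex poly \<Rightarrow> bool" where
  "poly_rel r g h \<longleftrightarrow> (\<forall>i. (coeff g i, coeff h i) \<in> r)"

context
  fixes r assumes r: "hom_graph r"
begin

lemma hom_graph_Rats: "q \<in> \<rat> \<Longrightarrow> (q, q) \<in> r"
  using r by (simp add: hom_graph_def)

lemma hom_graph_add: "(x, x') \<in> r \<Longrightarrow> (y, y') \<in> r \<Longrightarrow> (x + y, x' + y') \<in> r"
  and hom_graph_mult: "(x, x') \<in> r \<Longrightarrow> (y, y') \<in> r \<Longrightarrow> (x * y, x' * y') \<in> r"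
  and hom_graph_zero_iff: "(x, x') \<in> r \<Longrightarrow> x = 0 \<longleftrightarrow> x' = 0"
  and hom_graph_Qbar: "(x, x') \<in> r \<Longrightarrow> x \<in> Qbar" "(x, x') \<in> r \<Longrightarrow> x' \<in> Qbar"
  using r unfolding hom_graph_def by fast+

lemma hom_graph_zero: "(0, 0) \<in> r"
  by (rule hom_graph_Rats) simp

lemma hom_graph_uminus: "(x, x') \<in> r \<Longrightarrow> (- x, - x') \<in> r"
  using hom_graph_mult[OF hom_graph_Rats[of "-1"], of x x'] by simp

lemma hom_graph_diff: "(x, x') \<in> r \<Longrightarrow> (y, y') \<in> r \<Longrightarrow> (x - y, x' - y') \<in> r"
  using hom_graph_add[OF _ hom_graph_uminus, of x x' y y'] by simp

lemma hom_graph_unique: "(x, y) \<in> r \<Longrightarrow> (x', y') \<in> r \<Longrightarrow> x = x' \<longleftrightarrow> y = y'"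
  using hom_graph_zero_iff[OF hom_graph_diff, of x y x' y'] by simp

lemma hom_graph_sum:
  "(\<And>i. i \<in> I \<Longrightarrow> (f i, g i) \<in> r) \<Longrightarrow> (sum f I, sum g I) \<in> r"
  by (induction I rule: infinite_finite_induct) (auto intro: hom_graph_add hom_graph_zero)

lemma hom_graph_power: "(x, y) \<in> r \<Longrightarrow> (x ^ n, y ^ n) \<in> r"
  by (induction n) (auto intro: hom_graph_mult hom_graph_Rats)

text \<open>\<open>x\<close> and \<open>y\<close> are roots of the same integral polynomial with
  nonzero constant term, so both inverses are the same rational polynomial expression, in
  \<open>x\<close> and in \<open>y\<close>. Hence the domain of \<open>r\<close> is a field although
  inverses are absent from the definition.\<close>

lemma hom_graph_inverse:
  assumes xy: "(x, y) \<in> r" shows "(inverse x, inverse y) \<in> r"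
proof (cases "x = 0")
  case True
  thus ?thesis using hom_graph_zero_iff[OF xy] hom_graph_zero by simp
next
  case False
  have "algebraic x" using hom_graph_Qbar(1)[OF xy] by (simp add: Qbar_def)
  then obtain p where p: "\<forall>i. coeff p i \<in> \<int>" "coeff p 0 \<noteq> 0" "poly p x = 0"
    using algebraic_nonzero_const False by blast
  have int: "coeff p i \<in> \<rat>" for i using p(1) Ints_subset_Rats by blast
  have ev: "(poly q u, poly q v) \<in> r" if "(u, v) \<in> r" "\<And>i. coeff q i \<in> \<rat>" for q u v
    unfolding poly_altdef using that
    by (intro hom_graph_sum hom_graph_mult hom_graph_power hom_graph_Rats) auto
  obtain c q where pq: "p = pCons c q" by (cases p) auto
  have c: "c \<noteq> 0" "c \<in> \<rat>" using p(2) int[of 0] pq by auto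
  have q: "coeff q i \<in> \<rat>" for i using int[of "Suc i"] pq by simp
  have "poly p y = 0" using hom_graph_zero_iff[OF ev[of x y p]] xy int p(3) by simp
  hence "c = - (y * poly q y)" "c = - (x * poly q x)"
    using p(3) by (simp_all add: pq eq_neg_iff_add_eq_0)
  hence "- (y * poly q y) / c = 1" "- (x * poly q x) / c = 1" using c(1) by simp_all
  hence "y * (- poly q y / c) = 1" "x * (- poly q x / c) = 1" by simp_all
  hence "inverse x = poly q x * (- inverse c)" "inverse y = poly q y * (- inverse c)"
    by (simp_all add: inverse_unique divide_inverse)
  moreover have "(- inverse c, - inverse c) \<in> r" using c(2) by (intro hom_graph_Rats) simp
  ultimately show ?thesis
    using hom_graph_mult[OF ev[OF xy q], of "- inverse c" "- inverse c"] by metis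
qed

lemma poly_rel_add: "poly_rel r g h \<Longrightarrow> poly_rel r g' h' \<Longrightarrow> poly_rel r (g + g') (h + h')"
  and poly_rel_diff: "poly_rel r g h \<Longrightarrow> poly_rel r g' h' \<Longrightarrow> poly_rel r (g - g') (h - h')"
  by (simp_all add: poly_rel_def hom_graph_add hom_graph_diff)

lemma poly_rel_mult: "poly_rel r g h \<Longrightarrow> poly_rel r g' h' \<Longrightarrow> poly_rel r (g * g') (h * h')"
  unfolding poly_rel_def coeff_mult by (intro allI hom_graph_sum hom_graph_mult) auto

lemma poly_rel_monom: "(x, y) \<in> r \<Longrightarrow> poly_rel r (monom x n) (monom y n)"
  by (simp add: poly_rel_def coeff_monom hom_graph_zero)

lemma poly_rel_Rats: "(\<And>i. coeff g i \<in> \<rat>) \<Longrightarrow> poly_rel r g g"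
  by (simp add: poly_rel_def hom_graph_Rats)

lemma poly_rel_degree:
  assumes "poly_rel r g h" shows "degree g = degree h"
proof -
  have "coeff g i = 0 \<longleftrightarrow> coeff h i = 0" for i
    using assms hom_graph_zero_iff unfolding poly_rel_def by blast
  thus ?thesis by (simp add: degree_def)
qed

lemma poly_rel_zero_iff: "poly_rel r g h \<Longrightarrow> g = 0 \<longleftrightarrow> h = 0"
  using hom_graph_zero_iff unfolding poly_rel_def poly_eq_iff coeff_0 by blast

text \<open>The division algorithm runs on both sides in parallel: leading coefficients correspond
  under \<open>r\<close>, hence so do their quotients, and degrees agree.\<close>

lemma poly_rel_division:
  assumes "poly_rel r m n" "m \<noteq> 0" "poly_rel r g h"
  shows "\<exists>q q' s s'. poly_rel r q q' \<and> poly_rel r s s' \<and> g = m * q + s \<and> h = n * q' + s' \<and>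
    (s = 0 \<or> degree s < degree m)"
  using assms(3)
proof (induction "degree g" arbitrary: g h rule: less_induct)
  case less
  show ?case
  proof (cases "g = 0 \<or> degree g < degree m")
    case True
    thus ?thesis using less.prems poly_rel_Rats[of 0]
      by (intro exI[of _ 0] exI[of _ g] exI[of _ h]) auto
  next
    case False
    define k where "k = degree g - degree m"
    define c where "c = lead_coeff g * inverse (lead_coeff m)"
    define c' where "c' = lead_coeff h * inverse (lead_coeff n)"
    have mn: "degree n = degree m" "n \<noteq> 0" "degree h = degree g"
      using poly_rel_degree[OF assms(1)] poly_rel_zero_iff[OF assms(1)] assms(2)
        poly_rel_degree[OF less.prems] by auto
    have cc: "(c, c') \<in> r"
      unfolding c_def c'_def mn using assms(1) less.prems
      by (intro hom_graph_mult hom_graph_inverse) (auto simp: poly_rel_def)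
    define g1 where "g1 = g - m * monom c k"
    define h1 where "h1 = h - n * monom c' k"
    have rel: "poly_rel r g1 h1" unfolding g1_def h1_def
      by (intro poly_rel_diff poly_rel_mult poly_rel_monom less.prems assms(1) cc)
    have "c \<noteq> 0" using False assms(2) by (simp add: c_def)
    have deg: "degree (m * monom c k) = degree g"
      using False assms(2) \<open>c \<noteq> 0\<close> unfolding k_def
      by (subst degree_mult_eq) (simp_all add: degree_monom_eq)
    moreover have "lead_coeff (m * monom c k) = lead_coeff g"
      using assms(2) by (simp only: lead_coeff_mult lead_coeff_monom) (simp add: c_def)
    ultimately have "g1 = 0 \<or> degree g1 < degree g"
    proof -
      have "coeff g1 (degree g) = 0"
        using \<open>lead_coeff (m * monom c k) = lead_coeff g\<close> deg by (simp add: g1_def)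
      moreover have "degree g1 \<le> degree g" unfolding g1_def by (rule degree_diff_le) (simp_all add: deg)
      ultimately show ?thesis by (metis leading_coeff_0_iff le_neq_implies_less)
    qed
    moreover have "\<exists>q q' s s'. poly_rel r q q' \<and> poly_rel r s s' \<and> g1 = m * q + s \<and> h1 = n * q' + s' \<and>
      (s = 0 \<or> degree s < degree m)"
    proof (cases "g1 = 0")
      case True
      hence "h1 = 0" using poly_rel_zero_iff[OF rel] by simp
      thus ?thesis using True poly_rel_Rats[of 0]
        by (intro exI[of _ 0]) auto
    next
      case False
      thus ?thesis using less.hyps[OF _ rel] calculation by blast
    qed
    then obtain q q' s s' where q: "poly_rel r q q'" "poly_rel r s s'" "g1 = m * q + s"
      "h1 = n * q' + s'" "s = 0 \<or> degree s < degree m" by blast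
    have "poly_rel r (q + monom c k) (q' + monom c' k)"
      by (intro poly_rel_add poly_rel_monom q cc)
    moreover have "g = m * (q + monom c k) + s" using q(3) by (simp add: g1_def algebra_simps)
    moreover have "h = n * (q' + monom c' k) + s'" using q(4) by (simp add: h1_def algebra_simps)
    ultimately show ?thesis using q(2,5) by blast
  qed
qed

text \<open>\<open>m\<close> is a minimal polynomial of \<open>x\<close> over the domain of
  \<open>r\<close> and \<open>n\<close> its image. Sending \<open>poly g x\<close> to
  \<open>poly h y\<close> is well defined because division by \<open>m\<close> leaves remainder 0
  whenever \<open>g\<close> vanishes at \<open>x\<close>.\<close>

lemma hom_graph_extend:
  assumes mn: "poly_rel r m n" "m \<noteq> 0" and x: "poly m x = 0" "x \<in> Qbar" and y: "poly n y = 0"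
    and min: "\<And>g g'. poly_rel r g g' \<Longrightarrow> g \<noteq> 0 \<Longrightarrow> poly g x = 0 \<Longrightarrow> degree m \<le> degree g"
  shows "\<exists>r'. hom_graph r' \<and> r \<subseteq> r' \<and> (x, y) \<in> r'"
proof -
  define r' where "r' = {(poly g x, poly h y) | g h. poly_rel r g h}"
  have to: "poly h y = 0" if "poly_rel r g h" "poly g x = 0" for g h
  proof -
    obtain q q' s s' where q: "poly_rel r q q'" "poly_rel r s s'" "g = m * q + s"
      "h = n * q' + s'" "s = 0 \<or> degree s < degree m"
      using poly_rel_division[OF mn \<open>poly_rel r g h\<close>] by blast
    have "poly s x = 0" using q(3) \<open>poly g x = 0\<close> x(1) by simp
    hence "s = 0" using min[OF q(2)] q(5) by linarith
    hence "s' = 0" using poly_rel_zero_iff[OF q(2)] by simp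
    thus ?thesis using q(4) y by simp
  qed
  have rat: "poly_rel r p p" if "\<forall>i. coeff p i \<in> \<int>" for p
    using that Ints_subset_Rats by (intro poly_rel_Rats) blast
  have "\<exists>p. (\<forall>i. coeff p i \<in> \<int>) \<and> p \<noteq> 0 \<and> poly p x = 0" using x(2) by (simp add: Qbar_def algebraic_def)
  then obtain p where p: "\<forall>i. coeff p i \<in> \<int>" "p \<noteq> 0" "poly p x = 0" by blast
  have "y \<in> Qbar"
    using to[OF rat[OF p(1)] p(3)] p by (auto simp: Qbar_def algebraic_def)
  have coQ: "coeff g i \<in> Qbar \<and> coeff h i \<in> Qbar" if "poly_rel r g h" for g h i
    using that hom_graph_Qbar unfolding poly_rel_def by blast
  have r'Q: "r' \<subseteq> Qbar \<times> Qbar"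
    using coQ x(2) \<open>y \<in> Qbar\<close> by (auto simp: r'_def intro!: subfield_poly[OF is_subfield_Qbar])
  have rr': "r \<subseteq> r'"
  proof
    fix z assume "z \<in> r"
    moreover obtain a b where "z = (a, b)" by (cases z)
    ultimately show "z \<in> r'"
      using poly_rel_monom[of a b 0] unfolding r'_def
      by (intro CollectI exI[of _ "monom a 0"] exI[of _ "monom b 0"]) (auto simp: poly_monom)
  qed
  have r'_mult: "(a * b, a' * b') \<in> r'" and r'_add: "(a + b, a' + b') \<in> r'"
    if ab: "(a, a') \<in> r'" "(b, b') \<in> r'" for a a' b b'
  proof -
    obtain g h g' h' where "poly_rel r g h" "poly_rel r g' h'" "a = poly g x" "a' = poly h y"
      "b = poly g' x" "b' = poly h' y" using ab unfolding r'_def by blast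
    thus "(a * b, a' * b') \<in> r'" "(a + b, a' + b') \<in> r'"
      using poly_rel_mult[of g h g' h'] poly_rel_add[of g h g' h'] unfolding r'_def
      by (metis (mono_tags, lifting) CollectI poly_mult, metis (mono_tags, lifting) CollectI poly_add)
  qed
  have from': "poly g x = 0" if gh: "poly_rel r g h" "poly h y = 0" for g h
  proof (rule ccontr)
    text \<open>A nonzero value is invertible over the smaller field, and the inverse is carried along.\<close>
    assume nz: "poly g x \<noteq> 0"
    have "poly g x \<in> Qbar" using coQ gh x by (intro subfield_poly[OF is_subfield_Qbar]) auto
    hence "\<exists>p. (\<forall>i. coeff p i \<in> \<int>) \<and> coeff p 0 \<noteq> 0 \<and> poly p (poly g x) = 0"
      using nz algebraic_nonzero_const by (simp add: Qbar_def)
    then obtain p where p: "\<forall>i. coeff p i \<in> \<int>" "coeff p 0 \<noteq> 0" "poly p (poly g x) = 0" by blast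
    have comp: "poly_rel r (pcompose p g) (pcompose p h)" if "poly_rel r p p" for p
      using that
    proof (induction p rule: pCons_induct)
      case (pCons a p)
      have "(a, a) \<in> r" using pCons.prems unfolding poly_rel_def by (metis coeff_pCons_0)
      hence "poly_rel r [:a:] [:a:]" using poly_rel_monom[of a a 0] by (simp add: monom_0)
      moreover have "poly_rel r p p" using pCons.prems unfolding poly_rel_def by (metis coeff_pCons_Suc)
      ultimately show ?case
        using pCons.IH gh(1) by (auto simp: pcompose_pCons intro!: poly_rel_add poly_rel_mult)
    qed simp
    have "poly (pcompose p h) y = 0"
      using to[OF comp[OF rat[OF p(1)]]] p(3) by (simp add: poly_pcompose)
    hence "poly p 0 = 0" using gh(2) by (simp add: poly_pcompose)
    thus False using p(2) by (simp add: poly_0_coeff_0)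
  qed
  have "hom_graph r'"
    unfolding hom_graph_def
  proof (intro conjI)
    show "\<forall>q\<in>\<rat>. (q, q) \<in> r'" using rr' hom_graph_Rats by blast
    show "\<forall>(a, a')\<in>r'. a = 0 \<longleftrightarrow> a' = 0"
    proof clarify
      fix a a' assume "(a, a') \<in> r'"
      then obtain g h where "poly_rel r g h" "a = poly g x" "a' = poly h y" unfolding r'_def by blast
      thus "a = 0 \<longleftrightarrow> a' = 0" using to[of g h] from'[of g h] by auto
    qed
    show "\<forall>(a, a')\<in>r'. \<forall>(b, b')\<in>r'. (a + b, a' + b') \<in> r' \<and> (a * b, a' * b') \<in> r'"
      using r'_mult r'_add by blast
  qed (rule r'Q)
  moreover have "(x, y) \<in> r'"
  proof -
    have "poly_rel r [:0, 1:] [:0, 1:]" by (rule poly_rel_Rats) (simp add: coeff_pCons split: nat.splits)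
    thus ?thesis unfolding r'_def by (intro CollectI exI[of _ "[:0, 1:]"]) auto
  qed
  ultimately show ?thesis using rr' by blast
qed

lemma poly_rel_minimal:
  assumes x: "x \<in> Qbar"
  shows "\<exists>m n. poly_rel r m n \<and> m \<noteq> 0 \<and> poly m x = 0 \<and> degree n > 0 \<and>
    (\<forall>g g'. poly_rel r g g' \<longrightarrow> g \<noteq> 0 \<longrightarrow> poly g x = 0 \<longrightarrow> degree m \<le> degree g)"
proof -
  define S where "S k \<longleftrightarrow> (\<exists>m n. poly_rel r m n \<and> m \<noteq> 0 \<and> poly m x = 0 \<and> degree m = k)" for k
  have "\<exists>p. (\<forall>i. coeff p i \<in> \<int>) \<and> p \<noteq> 0 \<and> poly p x = 0" using x by (simp add: Qbar_def algebraic_def)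
  then obtain p where p: "\<forall>i. coeff p i \<in> \<int>" "p \<noteq> 0" "poly p x = 0" by blast
  have "S (degree p)" unfolding S_def
    using p Ints_subset_Rats by (intro exI[of _ p]) (auto intro!: poly_rel_Rats)
  hence L: "S (LEAST k. S k)" by (rule LeastI)
  then obtain m n where mn: "poly_rel r m n" "m \<noteq> 0" "poly m x = 0" "degree m = (LEAST k. S k)"
    unfolding S_def by blast
  have "degree m \<le> degree g" if "poly_rel r g g'" "g \<noteq> 0" "poly g x = 0" for g g'
    unfolding mn(4) using that by (intro Least_le) (auto simp: S_def)
  moreover have "degree n > 0"
    using mn poly_rel_degree[OF mn(1)] by (auto elim!: degree_eq_zeroE intro!: Nat.gr0I)
  ultimately show ?thesis using mn by blast
qed

end

lemma hom_graph_converse: "hom_graph r \<Longrightarrow> hom_graph (r\<inverse>)"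
  unfolding hom_graph_def by fast

lemma hom_graph_Union:
  assumes "C \<noteq> {}" "\<And>r. r \<in> C \<Longrightarrow> hom_graph r" "\<And>r s. r \<in> C \<Longrightarrow> s \<in> C \<Longrightarrow> r \<subseteq> s \<or> s \<subseteq> r"
  shows "hom_graph (\<Union>C)"
  unfolding hom_graph_def
proof (intro conjI)
  obtain r where "r \<in> C" using assms(1) by blast
  thus "\<forall>q\<in>\<rat>. (q, q) \<in> \<Union>C" using hom_graph_Rats[OF assms(2)] by blast
  show "\<Union>C \<subseteq> Qbar \<times> Qbar" using assms(2) unfolding hom_graph_def by blast
  show "\<forall>(x, x')\<in>\<Union>C. x = 0 \<longleftrightarrow> x' = 0" using hom_graph_zero_iff[OF assms(2)] by blast
  have "(x + y, x' + y') \<in> \<Union>C \<and> (x * y, x' * y') \<in> \<Union>C"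
    if xy: "(x, x') \<in> \<Union>C" "(y, y') \<in> \<Union>C" for x x' y y'
  proof -
    obtain s t where "s \<in> C" "t \<in> C" "(x, x') \<in> s" "(y, y') \<in> t" using xy by blast
    then obtain u where "u \<in> C" "(x, x') \<in> u" "(y, y') \<in> u" using assms(3)[of s t] by blast
    thus ?thesis using hom_graph_add[OF assms(2)] hom_graph_mult[OF assms(2)] by blast
  qed
  thus "\<forall>(x, x')\<in>\<Union>C. \<forall>(y, y')\<in>\<Union>C. (x + y, x' + y') \<in> \<Union>C \<and> (x * y, x' * y') \<in> \<Union>C" by blast
qed

text \<open>A missing \<open>x\<close> could be sent to any complex root of the image of its minimal
  polynomial.\<close>

lemma hom_graph_maximal_total:
  assumes r: "hom_graph r" and max: "\<And>s. hom_graph s \<Longrightarrow> r \<subseteq> s \<Longrightarrow> s = r" and x: "x \<in> Qbar"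
  shows "\<exists>y. (x, y) \<in> r"
proof -
  obtain m n where mn: "poly_rel r m n" "m \<noteq> 0" "poly m x = 0" "degree n > 0"
    and min: "\<forall>g g'. poly_rel r g g' \<longrightarrow> g \<noteq> 0 \<longrightarrow> poly g x = 0 \<longrightarrow> degree m \<le> degree g"
    using poly_rel_minimal[OF r x] by blast
  have "\<not> constant (poly n)" using mn(4) by (simp add: constant_degree)
  then obtain y where "poly n y = 0" using fundamental_theorem_of_algebra by blast
  then obtain r' where "hom_graph r'" "r \<subseteq> r'" "(x, y) \<in> r'"
    using hom_graph_extend[OF r mn(1,2,3) x] min by blast
  thus ?thesis using max by blast
qed

text \<open>A maximal extension exists by Zorn's lemma and is total. Its converse is maximal as
  well, and totality of the converse is surjectivity.\<close>

lemma hom_graph_aut: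
  assumes r: "hom_graph r"
  shows "\<exists>\<tau>. is_aut \<tau> \<and> (\<forall>(x, y)\<in>r. \<tau> x = y)"
proof -
  define F where "F = {s. hom_graph s \<and> r \<subseteq> s}"
  have "\<exists>s\<in>F. \<forall>t\<in>F. s \<subseteq> t \<longrightarrow> t = s"
  proof (intro subset_Zorn_nonempty)
    show "F \<noteq> {}" using r by (auto simp: F_def)
    fix C assume C: "C \<noteq> {}" "subset.chain F C"
    hence "\<And>s t. s \<in> C \<Longrightarrow> t \<in> C \<Longrightarrow> s \<subseteq> t \<or> t \<subseteq> s" "C \<subseteq> F"
      by (auto simp: subset.chain_def subset_chain_def)
    moreover from this have "hom_graph (\<Union>C)" using C(1) by (intro hom_graph_Union) (auto simp: F_def)
    ultimately show "\<Union>C \<in> F" using C(1) unfolding F_def by blast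
  qed
  then obtain s where "s \<in> F" and sm: "\<forall>t\<in>F. s \<subseteq> t \<longrightarrow> t = s" ..
  hence s: "hom_graph s" "r \<subseteq> s" by (simp_all add: F_def)
  have max: "t = s" if "hom_graph t" "s \<subseteq> t" for t using sm that s by (auto simp: F_def)
  have max': "t = s\<inverse>" if "hom_graph t" "s\<inverse> \<subseteq> t" for t
  proof -
    have "s \<subseteq> t\<inverse>" using that(2) by auto
    hence "t\<inverse> = s" by (rule max[OF hom_graph_converse[OF that(1)]])
    thus ?thesis by auto
  qed
  define \<tau> where "\<tau> x = (SOME y. (x, y) \<in> s)" for x
  have tau: "(x, \<tau> x) \<in> s" if "x \<in> Qbar" for x
    unfolding \<tau>_def using hom_graph_maximal_total[OF s(1) max that] by (rule someI_ex)
  have tau_eq: "\<tau> x = y" if "(x, y) \<in> s" for x y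
    using hom_graph_unique[OF s(1) that tau] hom_graph_Qbar(1)[OF s(1) that] by auto
  have "is_aut \<tau>"
    unfolding is_aut_def bij_betw_def
  proof (intro conjI ballI)
    fix x y assume "x \<in> Qbar" "y \<in> Qbar"
    thus "\<tau> (x + y) = \<tau> x + \<tau> y" "\<tau> (x * y) = \<tau> x * \<tau> y"
      using tau_eq[OF hom_graph_add[OF s(1) tau tau]] tau_eq[OF hom_graph_mult[OF s(1) tau tau]] by auto
  next
    show "inj_on \<tau> Qbar"
      using hom_graph_unique[OF s(1) tau tau] by (intro inj_onI) blast
    show "\<tau> ` Qbar = Qbar"
    proof
      show "\<tau> ` Qbar \<subseteq> Qbar" using hom_graph_Qbar(2)[OF s(1) tau] by blast
      show "Qbar \<subseteq> \<tau> ` Qbar"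
      proof
        fix y assume "y \<in> Qbar"
        then obtain x where "(x, y) \<in> s"
          using hom_graph_maximal_total[OF hom_graph_converse[OF s(1)] max'] by blast
        thus "y \<in> \<tau> ` Qbar" using tau_eq hom_graph_Qbar(1)[OF s(1)] by blast
      qed
    qed
  qed
  thus ?thesis using tau_eq s(2) by blast
qed

text \<open>Separability in characteristic 0: the minimal polynomial of \<open>x\<close> over
  \<open>A\<close> has a root \<open>y\<close> other than \<open>x\<close>, as otherwise its
  derivative, of smaller degree, would vanish at \<open>x\<close>. The map sending \<open>x\<close>
  to \<open>y\<close> extends to an automorphism.\<close>

lemma aut_moves:
  assumes A: "is_subfield A" "A \<subseteq> Qbar" and x: "x \<in> Qbar" "x \<notin> A"
  shows "\<exists>\<tau>. is_aut \<tau> \<and> (\<forall>a\<in>A. \<tau> a = a) \<and> \<tau> x \<noteq> x"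
proof -
  define r where "r = (\<lambda>a. (a, a)) ` A"
  have r: "hom_graph r"
    unfolding hom_graph_def r_def using A subfield_Rats[OF A(1)] subfield_closed[OF A(1)] by auto
  have rel: "poly_rel r g h \<longleftrightarrow> g = h \<and> (\<forall>i. coeff g i \<in> A)" for g h
  proof -
    have "(coeff g i, coeff h i) \<in> r \<longleftrightarrow> coeff g i = coeff h i \<and> coeff g i \<in> A" for i
      unfolding r_def by auto
    thus ?thesis by (auto simp: poly_rel_def poly_eq_iff)
  qed
  obtain m where m: "\<forall>i. coeff m i \<in> A" "m \<noteq> 0" "poly m x = 0"
    and min0: "\<forall>g g'. poly_rel r g g' \<longrightarrow> g \<noteq> 0 \<longrightarrow> poly g x = 0 \<longrightarrow> degree m \<le> degree g"
    using poly_rel_minimal[OF r x(1)] unfolding rel by blast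
  have min: "degree m \<le> degree g" if "\<forall>i. coeff g i \<in> A" "g \<noteq> 0" "poly g x = 0" for g
    using min0 that rel by blast
  obtain k where k: "m = [:-x, 1:] * k" using m(3) by (auto simp: poly_eq_0_iff_dvd)
  have "k \<noteq> 0" using k m(2) by auto
  have "degree k \<noteq> 0"
  proof
    assume "degree k = 0"
    then obtain c where "k = [:c:]" by (auto elim!: degree_eq_zeroE)
    hence "coeff m 1 = c" "coeff m 0 = - (x * c)" "c \<noteq> 0" using k m(2) by auto
    hence "x = - coeff m 0 / coeff m 1" by simp
    thus False using x(2) m(1) subfield_divide[OF A(1)] subfield_uminus[OF A(1)] by metis
  qed
  hence "\<not> constant (poly k)" by (simp add: constant_degree)
  then obtain y where y: "poly k y = 0" using fundamental_theorem_of_algebra by blast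
  have "y \<noteq> x"
  proof
    assume "y = x"
    have "pderiv m = [:-x, 1:] * pderiv k + k"
      unfolding k pderiv_mult by (simp add: pderiv_pCons)
    hence "poly (pderiv m) x = 0" using y \<open>y = x\<close> by simp
    moreover have "\<forall>i. coeff (pderiv m) i \<in> A"
      using m(1) subfield_mult[OF A(1) subfield_of_nat[OF A(1)]] unfolding coeff_pderiv by blast
    moreover have "degree m \<noteq> 0"
      using m by (auto elim!: degree_eq_zeroE)
    hence "pderiv m \<noteq> 0" "degree (pderiv m) < degree m" by (auto simp: pderiv_eq_0_iff degree_pderiv)
    ultimately show False using min by fastforce
  qed
  have "poly m y = 0" using y k by simp
  then obtain r' where r': "hom_graph r'" "r \<subseteq> r'" "(x, y) \<in> r'"
    using hom_graph_extend[OF r, of m m x y] rel m x(1) min by blast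
  then obtain \<tau> where tau: "is_aut \<tau>" "\<forall>(x, y)\<in>r'. \<tau> x = y" using hom_graph_aut by blast
  moreover have "\<tau> a = a" if "a \<in> A" for a using that r'(2) tau(2) by (auto simp: r_def)
  moreover have "\<tau> x = y" using r'(3) tau(2) by auto
  ultimately show ?thesis using \<open>y \<noteq> x\<close> by (intro exI[of _ \<tau>]) simp
qed

section \<open>Finiteness of residue rings\<close>

lemma number_field_int_dependent:
  assumes "number_field E"
  shows "\<exists>d. \<forall>f. (\<forall>i\<le>d. f i \<in> E) \<longrightarrow>
    (\<exists>c::nat \<Rightarrow> int. (\<exists>i\<le>d. c i \<noteq> 0) \<and> (\<Sum>i\<le>d. of_int (c i) * f i) = 0)"
proof -
  obtain d where d: "\<forall>f. (\<forall>i\<le>d. f i \<in> E) \<longrightarrow>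
       (\<exists>c. (\<forall>i. c i \<in> \<rat>) \<and> (\<exists>i\<le>d::nat. c i \<noteq> 0) \<and> (\<Sum>i\<le>d. c i * f i) = 0)"
    using number_field_dependent[OF assms] ..
  have "\<exists>c::nat \<Rightarrow> int. (\<exists>i\<le>d. c i \<noteq> 0) \<and> (\<Sum>i\<le>d. of_int (c i) * f i) = 0"
    if f: "\<forall>i\<le>d. f i \<in> E" for f
  proof -
    obtain c where c: "\<forall>i. c i \<in> \<rat>" "\<exists>i\<le>d. c i \<noteq> 0" "(\<Sum>i\<le>d. c i * f i) = 0"
      using d[THEN spec, THEN mp, OF f] by blast
    have "\<exists>a b::int. b \<noteq> 0 \<and> c i = of_int a / of_int b" for i
      using c(1) by (metis Rats_cases' less_irrefl)
    then obtain a b :: "nat \<Rightarrow> int" where ab: "\<And>i. b i \<noteq> 0" "\<And>i. c i = of_int (a i) / of_int (b i)"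
      by metis
    define e where "e i = a i * (\<Prod>j\<in>{..d}-{i}. b j)" for i
    have e: "of_int (e i) = c i * of_int (\<Prod>j\<le>d. b j)" if "i \<le> d" for i
    proof -
      have "(\<Prod>j\<le>d. b j) = b i * (\<Prod>j\<in>{..d}-{i}. b j)" using that by (intro prod.remove) auto
      thus ?thesis using ab(1)[of i] by (simp add: e_def ab(2)[of i])
    qed
    have nz: "(\<Prod>j\<le>d. b j) \<noteq> 0" using ab(1) by simp
    have "(\<Sum>i\<le>d. of_int (e i) * f i) = (\<Sum>i\<le>d. of_int (\<Prod>j\<le>d. b j) * (c i * f i))"
      by (intro sum.cong) (auto simp: e mult_ac)
    also have "\<dots> = 0" using c(3) by (simp flip: sum_distrib_left)
    finally have "(\<Sum>i\<le>d. of_int (e i) * f i) = 0" .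
    moreover have "\<exists>i\<le>d. e i \<noteq> 0"
    proof -
      obtain i where "i \<le> d" "c i \<noteq> 0" using c(2) by blast
      hence "of_int (e i) \<noteq> (0::complex)" using e[of i] nz by simp
      thus ?thesis using \<open>i \<le> d\<close> by auto
    qed
    ultimately show ?thesis by blast
  qed
  thus ?thesis by blast
qed

context
  fixes E assumes nf: "number_field E"
begin

lemma nf_subfield: "is_subfield E" using nf by (rule number_field_is_subfield)

lemmas nf_integers = integers_one[OF nf_subfield] integers_zero[OF nf_subfield]
  integers_add[OF nf_subfield] integers_diff[OF nf_subfield] integers_mult[OF nf_subfield]
  integers_power[OF nf_subfield] integers_uminus[OF nf_subfield] integers_of_int[OF nf_subfield]
  integers_of_nat[OF nf_subfield]

text \<open>The dimension over the field with \<open>q\<close> elements of the integers modulo \<open>q\<close> is at most the degree: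
  a rational relation can be scaled to an integral one that is nontrivial modulo \<open>q\<close>.\<close>

lemma residue_reps_prime:
  assumes q: "Factorial_Ring.prime (q::int)"
  shows "\<exists>R. finite R \<and> R \<subseteq> integers_of E \<and>
    (\<forall>x\<in>integers_of E. \<exists>r\<in>R. \<exists>w\<in>integers_of E. x = r + of_int q * w)"
proof -
  let ?O = "integers_of E"
  define indep where "indep k f \<longleftrightarrow> (\<forall>i<k. f i \<in> ?O) \<and>
    (\<forall>c::nat \<Rightarrow> int. (\<exists>w\<in>?O. (\<Sum>i<k. of_int (c i) * f i) = of_int q * w) \<longrightarrow> (\<forall>i<k. q dvd c i))"
    for k and f :: "nat \<Rightarrow> complex"
  obtain d where d: "\<forall>f. (\<forall>i\<le>d. f i \<in> E) \<longrightarrow>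
    (\<exists>c::nat \<Rightarrow> int. (\<exists>i\<le>d. c i \<noteq> 0) \<and> (\<Sum>i\<le>d. of_int (c i) * f i) = 0)"
    using number_field_int_dependent[OF nf] ..
  have q0: "q > 0" "q > 1" using q prime_gt_0_int prime_gt_1_int by auto
  have bound: "k \<le> d" if ind: "indep k f" for k f
  proof (rule ccontr)
    assume "\<not> k \<le> d"
    hence k: "d < k" by simp
    have "\<forall>i\<le>d. f i \<in> E" using ind k by (auto simp: indep_def integers_of_def)
    then obtain c :: "nat \<Rightarrow> int" where c: "\<exists>i\<le>d. c i \<noteq> 0" "(\<Sum>i\<le>d. of_int (c i) * f i) = 0"
      using d by blast
    \<comment> \<open>Descent: independence modulo \<open>q\<close> makes all coefficients of a
      relation divisible by \<open>q\<close>, and dividing by \<open>q\<close> gives a smaller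
      relation.\<close>
    have "\<not> (\<exists>i\<le>d. c i \<noteq> 0)" if "(\<Sum>i\<le>d. of_int (c i) * f i) = 0" for c :: "nat \<Rightarrow> int"
      using that
    proof (induction "\<Sum>i\<le>d. nat \<bar>c i\<bar>" arbitrary: c rule: less_induct)
      case less
      show ?case
      proof
        assume "\<exists>i\<le>d. c i \<noteq> 0"
        then obtain i0 where i0: "i0 \<le> d" "c i0 \<noteq> 0" by blast
        define c' where "c' i = (if i \<le> d then c i else 0)" for i
        have "(\<Sum>i<k. of_int (c' i) * f i) = (\<Sum>i\<le>d. of_int (c i) * f i)"
          using k by (intro sum.mono_neutral_cong_right) (auto simp: c'_def)
        also have "\<dots> = of_int q * 0" using less.prems by simp
        finally have "\<forall>i<k. q dvd c' i" using ind nf_integers(2) unfolding indep_def by blast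
        hence dvd: "q dvd c i" if "i \<le> d" for i
        proof -
          have "q dvd c' i" using that k \<open>\<forall>i<k. q dvd c' i\<close> by simp
          thus ?thesis using that by (simp add: c'_def)
        qed
        define e where "e i = c i div q" for i
        have ce: "c i = q * e i" if "i \<le> d" for i using dvd[OF that] by (simp add: e_def)
        have "of_int q * (\<Sum>i\<le>d. of_int (e i) * f i) = (\<Sum>i\<le>d. of_int (c i) * f i)"
          unfolding sum_distrib_left by (intro sum.cong) (auto simp: ce)
        hence "(\<Sum>i\<le>d. of_int (e i) * f i) = 0" using less.prems q0 by simp
        moreover have "(\<Sum>i\<le>d. nat \<bar>e i\<bar>) < (\<Sum>i\<le>d. nat \<bar>c i\<bar>)"
        proof (rule sum_strict_mono_ex1)
          show "\<forall>i\<in>{..d}. nat \<bar>e i\<bar> \<le> nat \<bar>c i\<bar>"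
          proof
            fix i assume "i \<in> {..d}"
            moreover have "1 * \<bar>e i\<bar> \<le> q * \<bar>e i\<bar>" using q0 by (intro mult_right_mono) auto
            ultimately show "nat \<bar>e i\<bar> \<le> nat \<bar>c i\<bar>" using ce[of i] q0 by (simp add: abs_mult)
          qed
          have "e i0 \<noteq> 0" using ce[OF i0(1)] i0(2) by auto
          hence "1 * \<bar>e i0\<bar> < q * \<bar>e i0\<bar>" using q0 by (intro mult_strict_right_mono) auto
          hence "nat \<bar>e i0\<bar> < nat \<bar>c i0\<bar>" using ce[OF i0(1)] q0 by (simp add: abs_mult)
          thus "\<exists>i\<in>{..d}. nat \<bar>e i\<bar> < nat \<bar>c i\<bar>" using i0 by blast
        qed simp
        ultimately have "\<not> (\<exists>i\<le>d. e i \<noteq> 0)" using less.hyps by blast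
        thus False using ce[OF i0(1)] i0 by auto
      qed
    qed
    thus False using c by blast
  qed
  have "\<exists>f. indep 0 f" by (auto simp: indep_def)
  \<comment> \<open>An independent system of maximal length exists because the lengths are bounded
    by \<open>d\<close>; it spans modulo \<open>q\<close>.\<close>
  have "\<exists>k. (\<exists>f. indep k f) \<and> \<not> (\<exists>f. indep (Suc k) f)"
  proof (rule ccontr)
    assume "\<not> ?thesis"
    hence "\<exists>f. indep k f" for k using \<open>\<exists>f. indep 0 f\<close> by (induction k) auto
    then obtain f where "indep (Suc d) f" by blast
    thus False using bound by fastforce
  qed
  then obtain k where k: "\<exists>f. indep k f" "\<not> (\<exists>f. indep (Suc k) f)" by blast
  then obtain f where f: "indep k f" by blast
  define R where "R = (\<lambda>c. \<Sum>i<k. of_int (c i) * f i) ` ({..<k} \<rightarrow>\<^sub>E {0..<q})"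
  have fO: "f i \<in> ?O" if "i < k" for i using f that by (simp add: indep_def)
  have RO: "(\<Sum>i<k. of_int (c i) * f i) \<in> ?O" for c :: "nat \<Rightarrow> int"
    by (intro integers_sum[OF nf_subfield] nf_integers fO) simp
  have "finite R" unfolding R_def by (intro finite_imageI finite_PiE) auto
  moreover have "R \<subseteq> ?O" using RO unfolding R_def by blast
  moreover have "\<exists>r\<in>R. \<exists>w\<in>?O. x = r + of_int q * w" if x: "x \<in> ?O" for x
  proof -
    define g where "g i = (if i < k then f i else x)" for i
    have "\<not> indep (Suc k) g" using k(2) by blast
    moreover have "\<forall>i<Suc k. g i \<in> ?O" using fO x by (simp add: g_def)
    ultimately obtain c w i where c: "w \<in> ?O" "(\<Sum>i<Suc k. of_int (c i) * g i) = of_int q * w"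
      "i < Suc k" "\<not> q dvd c i" unfolding indep_def by blast
    have gs: "(\<Sum>i<k. of_int (c i) * g i) = (\<Sum>i<k. of_int (c i) * f i)" for c :: "nat \<Rightarrow> int"
      by (intro sum.cong) (auto simp: g_def)
    have eq: "(\<Sum>i<k. of_int (c i) * f i) + of_int (c k) * x = of_int q * w"
      using c(2) by (simp add: gs) (simp add: g_def)
    have "\<not> q dvd c k"
    proof
      assume "q dvd c k"
      then obtain e where "c k = q * e" by blast
      hence "(\<Sum>i<k. of_int (c i) * f i) = of_int q * (w - of_int e * x)"
        using eq by (simp add: algebra_simps)
      moreover have "w - of_int e * x \<in> ?O" by (intro nf_integers c(1) x)
      ultimately have "\<forall>i<k. q dvd c i" using f unfolding indep_def by blast
      thus False using c(3,4) \<open>q dvd c k\<close> less_Suc_eq by auto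
    qed
    \<comment> \<open>The coefficient of \<open>x\<close> is invertible modulo \<open>q\<close>, so
      modulo \<open>q\<close> the element \<open>x\<close> is a combination of the
      \<open>f i\<close> with digits \<open>e i\<close> in \<open>{0..<q}\<close>.\<close>
    hence "Rings.coprime (c k) q" using q prime_imp_coprime[of q "c k"] by (simp add: coprime_commute)
    then obtain u v where uv: "u * c k + v * q = 1" by (metis coprime_iff_gcd_eq_1 bezout_int)
    define e where "e i = (- u * c i) mod q" for i
    define h where "h i = (- u * c i) div q" for i
    have "- u * c i = q * h i + e i" for i unfolding e_def h_def by simp
    hence eh: "of_int (- u * c i) = of_int q * of_int (h i) + (of_int (e i) :: complex)" for i
      by (metis of_int_add of_int_mult)
    have "x = of_int (u * c k + v * q) * x" by (simp add: uv)
    also have "\<dots> = of_int u * (of_int (c k) * x) + of_int q * (of_int v * x)"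
      by (simp add: algebra_simps)
    also have "of_int (c k) * x = of_int q * w - (\<Sum>i<k. of_int (c i) * f i)"
      using eq by (simp add: eq_diff_eq add.commute)
    also have "of_int u * \<dots> = of_int q * (of_int u * w) + (\<Sum>i<k. of_int (- u * c i) * f i)"
      by (simp add: algebra_simps sum_distrib_left sum_negf)
    also have "(\<Sum>i<k. of_int (- u * c i) * f i) =
      of_int q * (\<Sum>i<k. of_int (h i) * f i) + (\<Sum>i<k. of_int (e i) * f i)"
      unfolding eh by (simp add: algebra_simps sum.distrib sum_distrib_left)
    finally have "x = (\<Sum>i<k. of_int (e i) * f i) +
      of_int q * (of_int u * w + (\<Sum>i<k. of_int (h i) * f i) + of_int v * x)"
      by (simp add: algebra_simps)
    moreover have "(\<Sum>i<k. of_int (e i) * f i) \<in> R"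
    proof -
      have "(\<Sum>i<k. of_int (e i) * f i) = (\<Sum>i<k. of_int (restrict e {..<k} i) * f i)"
        by (intro sum.cong) auto
      moreover have "restrict e {..<k} \<in> {..<k} \<rightarrow>\<^sub>E {0..<q}" using q0 by (auto simp: e_def)
      ultimately show ?thesis unfolding R_def by blast
    qed
    moreover have "of_int u * w + (\<Sum>i<k. of_int (h i) * f i) + of_int v * x \<in> ?O"
      by (intro nf_integers RO c(1) x)
    ultimately show ?thesis by blast
  qed
  ultimately show ?thesis by blast
qed

text \<open>Induction over the prime factors: representatives modulo \<open>q * m\<close> are
  \<open>s + q * r\<close> with \<open>s\<close> from a system modulo \<open>q\<close> and
  \<open>r\<close> from one modulo \<open>m\<close>.\<close>

lemma residue_reps_int:
  assumes "n > 0"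
  shows "\<exists>R. finite R \<and> R \<subseteq> integers_of E \<and>
    (\<forall>x\<in>integers_of E. \<exists>r\<in>R. \<exists>w\<in>integers_of E. x = r + of_nat n * w)"
  using assms
proof (induction n rule: less_induct)
  case (less n)
  show ?case
  proof (cases "n = 1")
    case True
    thus ?thesis using nf_integers by (intro exI[of _ "{0}"]) auto
  next
    case False
    then obtain q m where q: "Factorial_Ring.prime q" "n = q * m"
      using prime_factor_nat[of n] by (metis dvdE)
    have "m > 0" "m < n" using less.prems q prime_gt_1_nat[of q] by auto
    then obtain R where R: "finite R" "R \<subseteq> integers_of E"
      "\<forall>x\<in>integers_of E. \<exists>r\<in>R. \<exists>w\<in>integers_of E. x = r + of_nat m * w"
      using less.IH[OF \<open>m < n\<close> \<open>m > 0\<close>] by blast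
    have "Factorial_Ring.prime (int q)" using q(1) by simp
    then obtain S where S: "finite S" "S \<subseteq> integers_of E"
      "\<forall>x\<in>integers_of E. \<exists>r\<in>S. \<exists>w\<in>integers_of E. x = r + of_int (int q) * w"
      using residue_reps_prime[OF \<open>Factorial_Ring.prime (int q)\<close>] by metis
    define T where "T = (\<lambda>(s, r). s + of_nat q * r) ` (S \<times> R)"
    have "finite T" using R(1) S(1) by (simp add: T_def)
    moreover have "T \<subseteq> integers_of E" using R(2) S(2) by (auto simp: T_def intro!: nf_integers)
    moreover have "\<exists>r\<in>T. \<exists>w\<in>integers_of E. x = r + of_nat n * w" if x: "x \<in> integers_of E" for x
    proof -
      obtain s w where s: "s \<in> S" "w \<in> integers_of E" "x = s + of_int (int q) * w" using S(3) x by blast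
      obtain r v where r: "r \<in> R" "v \<in> integers_of E" "w = r + of_nat m * v" using R(3) s(2) by blast
      have "x = (s + of_nat q * r) + of_nat n * v" using s r q(2) by (simp add: algebra_simps)
      moreover have "s + of_nat q * r \<in> T" using s r by (auto simp: T_def)
      ultimately show ?thesis using r(2) by blast
    qed
    ultimately show ?thesis by blast
  qed
qed

text \<open>\<open>b\<close> divides a positive rational integer, and representatives modulo that
  integer suffice.\<close>

lemma residue_reps:
  assumes b: "b \<in> integers_of E" "b \<noteq> 0"
  shows "\<exists>R. finite R \<and> R \<subseteq> integers_of E \<and>
    (\<forall>x\<in>integers_of E. \<exists>r\<in>R. \<exists>w\<in>integers_of E. x = r + b * w)"
proof -
  obtain n :: int and y where n: "n > 0" "y \<in> integers_of E" "of_int n = b * y"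
    using integer_divides_int[OF nf_subfield b] by metis
  obtain R where R: "finite R" "R \<subseteq> integers_of E"
    "\<forall>x\<in>integers_of E. \<exists>r\<in>R. \<exists>w\<in>integers_of E. x = r + of_nat (nat n) * w"
    using residue_reps_int[of "nat n"] n(1) by auto
  have "\<exists>r\<in>R. \<exists>w\<in>integers_of E. x = r + b * w" if x: "x \<in> integers_of E" for x
  proof -
    obtain r w where "r \<in> R" "w \<in> integers_of E" "x = r + of_nat (nat n) * w" using R(3) x by blast
    moreover have "of_nat (nat n) * w = b * (y * w)" using n by (simp flip: n(3) add: mult.assoc[symmetric])
    ultimately show ?thesis using nf_integers(5) n(2) by metis
  qed
  thus ?thesis using R(1,2) by blast
qed

lemma residue_pigeonhole:
  assumes b: "b \<in> integers_of E" "b \<noteq> 0" and f: "\<And>n::nat. f n \<in> integers_of E"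
  shows "\<exists>i j. i < j \<and> (\<exists>w\<in>integers_of E. f i - f j = b * w)"
proof -
  obtain R where R: "finite R" "\<forall>x\<in>integers_of E. \<exists>r\<in>R. \<exists>w\<in>integers_of E. x = r + b * w"
    using residue_reps[OF b] by blast
  have "\<forall>n. \<exists>r w. r \<in> R \<and> w \<in> integers_of E \<and> f n = r + b * w" using R(2) f by blast
  then obtain r w where rw: "\<And>n. r n \<in> R" "\<And>n. w n \<in> integers_of E" "\<And>n. f n = r n + b * w n"
    by metis
  have "\<not> inj r"
  proof
    assume "inj r"
    moreover have "finite (range r)" using rw(1) by (intro finite_subset[OF _ R(1)]) auto
    ultimately show False using finite_imageD[of r UNIV] by simp
  qed
  then obtain i j where "r i = r j" "i < j" unfolding inj_def by (metis linorder_neqE_nat)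
  moreover from this have "f i - f j = b * (w i - w j)" using rw(3) by (simp add: algebra_simps)
  ultimately show ?thesis using rw(2) nf_integers(4) by blast
qed

text \<open>The powers of \<open>c\<close> repeat modulo \<open>b\<close> by the pigeonhole
  principle. This relation takes the place of chain conditions: at a prime containing
  \<open>b\<close> one of the two factors is usually known to be a unit, which makes the other one
  divisible.\<close>

lemma residue_power_relation:
  assumes b: "b \<in> integers_of E" "b \<noteq> 0" and c: "c \<in> integers_of E"
  shows "\<exists>i k. k > 0 \<and> (\<exists>w\<in>integers_of E. c ^ i * (1 - c ^ k) = b * w)"
proof -
  obtain i j w where "i < j" "w \<in> integers_of E" "c ^ i - c ^ j = b * w"
    using residue_pigeonhole[OF b, of "\<lambda>n. c ^ n"] nf_integers(6)[OF c] by blast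
  moreover from this have "c ^ i * (1 - c ^ (j - i)) = b * w"
    by (simp add: right_diff_distrib flip: power_add)
  ultimately show ?thesis by (metis zero_less_diff)
qed

end

section \<open>The valuation of a prime ideal\<close>

context
  fixes E P assumes nf: "number_field E" and P: "is_prime E P" and P0: "P \<noteq> {0}"
begin

lemmas nfi = nf_integers[OF nf]
lemmas nfs = nf_subfield[OF nf]

lemma prime_ideal: "is_ideal E P" using P by (simp add: is_prime_def)

lemma prime_subset: "P \<subseteq> integers_of E" using prime_ideal by (simp add: is_ideal_def)

lemma prime_props:
  "1 \<notin> P" "0 \<in> P" "x \<in> P \<Longrightarrow> y \<in> P \<Longrightarrow> x + y \<in> P" "x \<in> P \<Longrightarrow> y \<in> P \<Longrightarrow> x - y \<in> P"
  "x \<in> integers_of E \<Longrightarrow> y \<in> P \<Longrightarrow> x * y \<in> P" "x \<in> P \<Longrightarrow> y \<in> integers_of E \<Longrightarrow> x * y \<in> P"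
  "x \<in> integers_of E \<Longrightarrow> y \<in> integers_of E \<Longrightarrow> x * y \<in> P \<Longrightarrow> x \<in> P \<or> y \<in> P"
  using P is_ideal_diff[OF nfs prime_ideal] is_ideal_mult[OF prime_ideal]
  by (auto simp: is_prime_def is_ideal_def)

lemma prime_pow_mem: "x \<in> P \<Longrightarrow> n > 0 \<Longrightarrow> x ^ n \<in> P"
  using prime_props(6)[of x "x ^ (n - 1)"] nfi(6)[of x "n - 1"] prime_subset
  by (cases n) auto

lemma one_minus_power_notin: "x \<in> P \<Longrightarrow> n > 0 \<Longrightarrow> 1 - x ^ n \<notin> P"
  using prime_props(1) prime_props(3)[of "1 - x ^ n" "x ^ n"] prime_pow_mem by force

text \<open>Modulo a nonzero element of \<open>P\<close> the powers of \<open>v\<close> repeat;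
  since \<open>v\<close> is outside \<open>P\<close>, cancelling shows that some positive power of
  \<open>v\<close> is 1 modulo \<open>P\<close>, so a power of \<open>v\<close> inverts
  \<open>v\<close>.\<close>

lemma prime_maximal:
  assumes "v \<in> integers_of E" "v \<notin> P"
  shows "\<exists>c\<in>integers_of E. 1 - v * c \<in> P"
proof -
  obtain b where b: "b \<in> P" "b \<noteq> 0" using P0 prime_props(2) by blast
  then obtain i k w where ik: "k > 0" "w \<in> integers_of E" "v ^ i * (1 - v ^ k) = b * w"
    using residue_power_relation[OF nf, of b v] assms prime_subset by blast
  have "v ^ i * (1 - v ^ k) \<in> P" using prime_props(6) b ik by simp
  moreover have "v ^ i \<notin> P" using is_prime_power[OF nfs P assms(1)] assms(2) by blast
  moreover have "v ^ i \<in> integers_of E" "1 - v ^ k \<in> integers_of E" by (intro nfi assms(1))+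
  ultimately have "1 - v ^ k \<in> P" using prime_props(7) by metis
  moreover have "v ^ k = v * v ^ (k - 1)" using ik(1) by (simp flip: power_Suc)
  ultimately show ?thesis using nfi(6)[OF assms(1)] by metis
qed

text \<open>A nonzero element of \<open>P\<close> whose residue ring has an element with annihilator exactly \<open>P\<close>
  gives a fraction \<open>y\<close> inverting \<open>P\<close>.\<close>

lemma prime_annihilator:
  assumes b: "b \<in> P" "b \<noteq> 0"
  shows "\<exists>s\<in>integers_of E. {r \<in> integers_of E. \<exists>w\<in>integers_of E. r * s = b * w} = P"
proof -
  let ?O = "integers_of E"
  have bO: "b \<in> ?O" using b prime_subset by blast
  define J where "J s = {r \<in> ?O. \<exists>w\<in>?O. r * s = b * w}" for s
  have JI: "r \<in> J s" if "r \<in> ?O" "w \<in> ?O" "r * s = b * w" for r s w using that by (auto simp: J_def)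
  have JE: "\<exists>w\<in>?O. r * s = b * w" "r \<in> ?O" if "r \<in> J s" for r s using that by (auto simp: J_def)
  obtain R where R: "finite R" "R \<subseteq> ?O" "\<forall>x\<in>?O. \<exists>r\<in>R. \<exists>w\<in>?O. x = r + b * w"
    using residue_reps[OF nf bO b(2)] by blast
  have Jmod: "r + b * w \<in> J s \<longleftrightarrow> r \<in> J s" if "s \<in> ?O" "r \<in> ?O" "w \<in> ?O" for r s w
  proof
    assume "r + b * w \<in> J s"
    then obtain v where "v \<in> ?O" "(r + b * w) * s = b * v" using JE by blast
    hence "r * s = b * (v - w * s)" by (simp add: algebra_simps)
    thus "r \<in> J s" using that \<open>v \<in> ?O\<close> by (intro JI[of _ "v - w * s"] nfi)
  next
    assume "r \<in> J s"
    then obtain v where "v \<in> ?O" "r * s = b * v" using JE by blast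
    hence "(r + b * w) * s = b * (v + w * s)" by (simp add: algebra_simps)
    thus "r + b * w \<in> J s" using that bO \<open>v \<in> ?O\<close> by (intro JI[of _ "v + w * s"] nfi)
  qed
  \<comment> \<open>The ideals \<open>J s\<close> are unions of classes modulo \<open>b\<close> and
    hence determined by their trace on the finite set \<open>R\<close>; a maximal one inside
    \<open>P\<close> is found by counting.\<close>
  define m where "m s = card (R \<inter> J s)" for s
  have mle: "m s \<le> card R" for s unfolding m_def using R(1) by (intro card_mono) auto
  have "J 1 \<subseteq> P" using JE(1)[of _ 1] b prime_props(6) by fastforce
  hence "\<exists>s. (s \<in> ?O \<and> J s \<subseteq> P) \<and> (\<forall>t. t \<in> ?O \<and> J t \<subseteq> P \<longrightarrow> m t \<le> m s)"
    using ex_has_greatest_nat[of "\<lambda>s. s \<in> ?O \<and> J s \<subseteq> P" 1 m "Suc (card R)"] mle nfi(1)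
    by (simp add: less_Suc_eq_le)
  then obtain s where s: "s \<in> ?O" "J s \<subseteq> P" "\<forall>t. t \<in> ?O \<and> J t \<subseteq> P \<longrightarrow> m t \<le> m s" by blast
  have maxJ: "J t = J s" if t: "t \<in> ?O" "J t \<subseteq> P" "J s \<subseteq> J t" for t
  proof
    have "R \<inter> J s = R \<inter> J t"
      using t s(3) R(1) unfolding m_def by (intro card_seteq) auto
    show "J t \<subseteq> J s"
    proof
      fix x assume x: "x \<in> J t"
      then obtain r w where rw: "r \<in> R" "w \<in> ?O" "x = r + b * w" using R(3) JE(2) by blast
      hence "r \<in> J t" using x Jmod[OF t(1)] R(2) by blast
      hence "r \<in> J s" using \<open>R \<inter> J s = R \<inter> J t\<close> rw by blast
      thus "x \<in> J s" using Jmod[OF s(1)] rw R(2) by blast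
    qed
  qed (rule t)
  have mult_sub: "J s \<subseteq> J (s * t)" if "t \<in> ?O" for t
  proof
    fix r assume "r \<in> J s"
    then obtain w where "w \<in> ?O" "r * s = b * w" "r \<in> ?O" using JE by blast
    thus "r \<in> J (s * t)" using that nfi by (intro JI[of _ "w * t"]) (auto simp: mult_ac)
  qed
  \<comment> \<open>For \<open>t\<close> outside \<open>P\<close>, multiplying \<open>s\<close> by
    \<open>t\<close> can only enlarge the annihilator, and it stays inside \<open>P\<close>; so
    maximality leaves it unchanged.\<close>
  have coprime_mult: "J (s * t) = J s" if t: "t \<in> ?O" "t \<notin> P" for t
  proof (rule maxJ)
    show "J (s * t) \<subseteq> P"
    proof
      fix r assume "r \<in> J (s * t)"
      then obtain w where "w \<in> ?O" "r * (s * t) = b * w" "r \<in> ?O" using JE by blast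
      hence "r * t \<in> J s" using t nfi by (intro JI[of _ w]) (auto simp: mult_ac)
      thus "r \<in> P" using s(2) prime_props(7) \<open>r \<in> ?O\<close> t by blast
    qed
  qed (use t s nfi mult_sub in auto)
  have "P \<subseteq> J s"
  proof
    fix c assume c: "c \<in> P"
    hence cO: "c \<in> ?O" using prime_subset by blast
    obtain i k w where ik: "k > 0" "w \<in> ?O" "c ^ i * (1 - c ^ k) = b * w"
      using residue_power_relation[OF nf bO b(2) cO] by blast
    have "c ^ i * (s * (1 - c ^ k)) = b * (s * w)"
      using arg_cong[OF ik(3), of "\<lambda>x. s * x"] by (simp add: mult_ac)
    hence "c ^ i \<in> J (s * (1 - c ^ k))" using ik(2) s(1) cO nfi by (intro JI[of _ "s * w"])
    moreover have "1 - c ^ k \<in> ?O" by (intro nfi cO)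
    ultimately have "c ^ i \<in> J s" using coprime_mult one_minus_power_notin[OF c ik(1)] by simp
    \<comment> \<open>With \<open>j\<close> least, \<open>c ^ (j - 1)\<close> is outside
      \<open>J s\<close>. This keeps the annihilator of \<open>s * c ^ (j - 1)\<close> inside
      \<open>P\<close>, so by maximality it is \<open>J s\<close>, and it contains
      \<open>c\<close>.\<close>
    define j where "j = (LEAST j. c ^ j \<in> J s)"
    have j: "c ^ j \<in> J s" unfolding j_def by (rule LeastI) fact
    have "j \<noteq> 0" using j s(2) prime_props(1) by (metis power_0 subsetD)
    hence j1: "c ^ (j - 1) \<notin> J s"
      using not_less_Least[of "j - 1" "\<lambda>j. c ^ j \<in> J s"] unfolding j_def by auto
    have "J (s * c ^ (j - 1)) = J s"
    proof (rule maxJ)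
      show "J (s * c ^ (j - 1)) \<subseteq> P"
      proof (rule ccontr)
        assume "\<not> ?thesis"
        then obtain r where r: "r \<in> J (s * c ^ (j - 1))" "r \<notin> P" by blast
        then obtain w where w: "w \<in> ?O" "r * (s * c ^ (j - 1)) = b * w" "r \<in> ?O" using JE by blast
        hence "c ^ (j - 1) \<in> J (s * r)" using cO nfi by (intro JI[of _ w]) (auto simp: mult_ac)
        thus False using coprime_mult[OF w(3) r(2)] j1 by blast
      qed
    qed (use s nfi cO mult_sub in auto)
    moreover obtain w where w: "w \<in> ?O" "c ^ j * s = b * w" using JE(1)[OF j] by blast
    have "c * c ^ (j - 1) = c ^ j" using \<open>j \<noteq> 0\<close> by (cases j) auto
    hence "c * (s * c ^ (j - 1)) = b * w" using w(2) by (metis mult.assoc mult.commute)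
    hence "c \<in> J (s * c ^ (j - 1))" using cO w(1) by (intro JI[of _ w])
    ultimately show "c \<in> J s" by blast
  qed
  hence "J s = P" using s(2) by blast
  thus ?thesis using s(1) unfolding J_def by blast
qed

text \<open>The fraction \<open>y\<close> is not integral but maps \<open>P\<close> into the
  integers. If it mapped \<open>P\<close> into itself, all \<open>b * y ^ n\<close> would be
  integers, and the pigeonhole principle would make \<open>y\<close> integral. So
  \<open>y * p\<close> is a unit at \<open>P\<close> for some \<open>p\<close>, which is the
  uniformizer.\<close>

lemma prime_uniformizer:
  "\<exists>p y. p \<in> P \<and> p \<noteq> 0 \<and> (\<forall>r\<in>P. y * r \<in> integers_of E) \<and> y * p \<notin> P"
proof -
  let ?O = "integers_of E"
  obtain b where b: "b \<in> P" "b \<noteq> 0" using P0 prime_props(2) by blast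
  obtain s where s: "s \<in> ?O" "{r \<in> ?O. \<exists>w\<in>?O. r * s = b * w} = P"
    using prime_annihilator[OF b] by blast
  define y where "y = s / b"
  have bO: "b \<in> ?O" using b prime_subset by blast
  have yE: "y \<in> E" using s(1) bO subfield_divide[OF nfs] by (auto simp: y_def integers_of_def)
  have yP: "y * r \<in> ?O" if "r \<in> P" for r
  proof -
    obtain w where "w \<in> ?O" "r * s = b * w" using s(2) \<open>r \<in> P\<close> by blast
    hence "y * r = w" using b(2) by (simp add: y_def field_simps)
    thus ?thesis using \<open>w \<in> ?O\<close> by simp
  qed
  have yO: "y \<notin> ?O"
  proof
    assume "y \<in> ?O"
    moreover have "1 * s = b * y" using b(2) by (simp add: y_def)
    ultimately have "1 \<in> P" using s(2) nfi(1) by blast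
    thus False using prime_props(1) by blast
  qed
  have "\<exists>p\<in>P. y * p \<notin> P"
  proof (rule ccontr)
    assume "\<not> ?thesis"
    hence stab: "y * p \<in> P" if "p \<in> P" for p using that by blast
    have "b * y ^ n \<in> P" for n
    proof (induction n)
      case (Suc n)
      thus ?case using stab[of "b * y ^ n"] by (simp add: mult_ac)
    qed (use b in simp)
    hence "\<And>n. b * y ^ n \<in> ?O" using prime_subset by blast
    then obtain i j w where ij: "i < j" "w \<in> ?O" "b * y ^ i - b * y ^ j = b * w"
      using residue_pigeonhole[OF nf bO b(2), of "\<lambda>n. b * y ^ n"] by blast
    have "b * (y ^ i - y ^ j) = b * w" using ij(3) by (simp add: right_diff_distrib)
    hence w: "y ^ i - y ^ j = w" using b(2) by simp
    \<comment> \<open>Cancelling \<open>b\<close> left \<open>y ^ i - y ^ j = w\<close> with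
      \<open>w\<close> integral, which is a monic equation for \<open>y\<close> over the algebraic
      integers.\<close>
    define g :: "complex poly" where "g = monom 1 j - monom 1 i"
    have "coeff g n = (if j = n then 1 else 0) - (if i = n then 1 else 0)" for n
      by (simp add: g_def coeff_monom)
    hence cg: "\<forall>n. coeff g n \<in> \<int>" "coeff g j = 1" "\<And>n. n > j \<Longrightarrow> coeff g n = 0" using ij(1) by auto
    have "degree g = j" using cg(2,3) by (intro antisym degree_le le_degree) auto
    moreover have "poly g y = - w" using w by (simp add: g_def poly_monom flip: w)
    moreover have "algebraic_int (- w)" using ij(2) by (simp add: integers_of_def)
    ultimately have "algebraic_int y"
      using algebraic_int_root[of "- w" g y] cg ij(1) by auto
    thus False using yE yO by (simp add: integers_of_def)
  qed
  then obtain p where "p \<in> P" "y * p \<notin> P" by blast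
  moreover from this have "p \<noteq> 0" using prime_props(2) by auto
  ultimately show ?thesis using yP by blast
qed

section \<open>The valuation as an exponent relation\<close>

text \<open>\<open>a / v\<close> is a unit of the localization at \<open>P\<close>, so
  \<open>k\<close> is the valuation of \<open>x\<close> when \<open>p\<close> is a
  uniformizer.\<close>

definition val_rep :: "complex \<Rightarrow> complex \<Rightarrow> int \<Rightarrow> bool" where
  "val_rep p x k \<longleftrightarrow> (\<exists>a\<in>integers_of E - P. \<exists>v\<in>integers_of E - P. x = p powi k * a / v)"

lemma prime_units_mult: "a \<in> integers_of E - P \<Longrightarrow> b \<in> integers_of E - P \<Longrightarrow> a * b \<in> integers_of E - P"
  using prime_props(7) nfi(5) by blast

lemma prime_unit_nonzero: "a \<in> integers_of E - P \<Longrightarrow> a \<noteq> 0"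
  using prime_props(2) by auto

lemma val_rep_unique:
  assumes p: "p \<in> P" "p \<noteq> 0" and "val_rep p x k" "val_rep p x k'"
  shows "k = k'"
proof -
  have "\<not> k < k'" if "val_rep p x k" "val_rep p x k'" for k k'
  proof
    assume "k < k'"
    obtain a v a' v' where av: "a \<in> integers_of E - P" "v \<in> integers_of E - P"
      "a' \<in> integers_of E - P" "v' \<in> integers_of E - P"
      "x = p powi k * a / v" "x = p powi k' * a' / v'"
      using \<open>val_rep p x k\<close> \<open>val_rep p x k'\<close> unfolding val_rep_def by blast
    define n where "n = nat (k' - k)"
    have n: "k' = k + int n" "n > 0" using \<open>k < k'\<close> by (auto simp: n_def)
    have "p powi k' = p powi k * p ^ n" using p(2) unfolding n(1) by (simp add: power_int_add)
    hence "p powi k * (a / v) = p powi k * (p ^ n * a' / v')"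
      using av(5,6) by (simp add: mult.assoc)
    moreover have "p powi k \<noteq> 0" using p(2) by simp
    ultimately have "a / v = p ^ n * a' / v'" using mult_left_cancel by blast
    hence "a * v' = p ^ n * (a' * v)"
      using prime_unit_nonzero[OF av(2)] prime_unit_nonzero[OF av(4)]
      by (simp add: frac_eq_eq mult.assoc)
    moreover have "p ^ n * (a' * v) \<in> P"
      using prime_pow_mem[OF p(1) n(2)] prime_units_mult[OF av(3,2)] prime_props(6) by blast
    ultimately show False using prime_units_mult[OF av(1,4)] by simp
  qed
  thus ?thesis using assms(3,4) by (meson linorder_neqE)
qed

lemma val_rep_mult:
  assumes "p \<noteq> 0" "val_rep p x k" "val_rep p x' k'"
  shows "val_rep p (x * x') (k + k')"
proof -
  obtain a v a' v' where av: "a \<in> integers_of E - P" "v \<in> integers_of E - P"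
      "a' \<in> integers_of E - P" "v' \<in> integers_of E - P"
      "x = p powi k * a / v" "x' = p powi k' * a' / v'"
    using assms(2,3) unfolding val_rep_def by blast
  have "x * x' = p powi (k + k') * (a * a') / (v * v')"
    using assms(1) by (simp add: av(5,6) power_int_add)
  thus ?thesis using prime_units_mult av unfolding val_rep_def by blast
qed

lemma val_rep_inverse:
  assumes "val_rep p x k" shows "val_rep p (inverse x) (- k)"
proof -
  obtain a v where av: "a \<in> integers_of E - P" "v \<in> integers_of E - P" "x = p powi k * a / v"
    using assms unfolding val_rep_def by blast
  have "inverse x = p powi (- k) * v / a"
    by (simp add: av(3) power_int_minus divide_inverse mult_ac)
  thus ?thesis using av unfolding val_rep_def by blast
qed

text \<open>The relation for the powers of \<open>p\<close> modulo \<open>x\<close> bounds the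
  exponents \<open>n\<close> for which \<open>p ^ n\<close> divides \<open>x\<close> locally. At the
  largest one the cofactor is prime to \<open>P\<close>: if \<open>a\<close> were in
  \<open>P\<close>, then \<open>y * a\<close> would be integral and the unit
  \<open>u = y * p\<close> would turn \<open>p ^ n * a\<close> into
  \<open>p ^ Suc n * (y * a)\<close>.\<close>

lemma val_rep_integer:
  assumes py: "p \<in> P" "p \<noteq> 0" "\<forall>r\<in>P. y * r \<in> integers_of E" "y * p \<notin> P"
    and x: "x \<in> integers_of E" "x \<noteq> 0"
  shows "\<exists>n::nat. val_rep p x (int n)"
proof -
  let ?O = "integers_of E"
  define u where "u = y * p"
  have u: "u \<in> ?O - P" using py by (auto simp: u_def)
  have pO: "p \<in> ?O" using py prime_subset by blast
  define D where "D n \<longleftrightarrow> (\<exists>a\<in>?O. \<exists>v\<in>?O - P. x * v = p ^ n * a)" for n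
  have D0: "D 0" unfolding D_def using x nfi(1) prime_props(1) by (intro bexI[of _ x] bexI[of _ 1]) auto
  obtain i k w where ik: "k > 0" "w \<in> ?O" "p ^ i * (1 - p ^ k) = x * w"
    using residue_power_relation[OF nf x pO] by blast
  have "1 - p ^ k \<in> ?O" by (intro nfi pO)
  hence u': "1 - p ^ k \<in> ?O - P" using one_minus_power_notin[OF py(1) ik(1)] by simp
  have bound: "n \<le> i" if "D n" for n
  proof (rule ccontr)
    assume "\<not> n \<le> i"
    obtain a v where av: "a \<in> ?O" "v \<in> ?O - P" "x * v = p ^ n * a" using \<open>D n\<close> unfolding D_def by blast
    have "p ^ i * ((1 - p ^ k) * v) = (x * v) * w" using ik(3) by (simp add: mult_ac)
    also have "\<dots> = (p ^ i * p ^ (n - i)) * (a * w)"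
      using \<open>\<not> n \<le> i\<close> unfolding av(3) by (simp flip: power_add)
    also have "\<dots> = p ^ i * (p ^ (n - i) * (a * w))" by (rule mult.assoc)
    finally have "(1 - p ^ k) * v = p ^ (n - i) * (a * w)" using py(2) by simp
    moreover have "p ^ (n - i) * (a * w) \<in> P"
      using prime_pow_mem[OF py(1), of "n - i"] \<open>\<not> n \<le> i\<close> nfi(5)[OF av(1) ik(2)] prime_props(6) by simp
    ultimately show False using prime_units_mult[OF u' av(2)] by simp
  qed
  define n where "n = (GREATEST n. D n)"
  have Dn: "D n" unfolding n_def by (rule GreatestI_nat[of D 0 i]) (use D0 bound in auto)
  have nDn: "\<not> D (Suc n)"
    using Greatest_le_nat[of D "Suc n" i] bound unfolding n_def by fastforce
  obtain a v where av: "a \<in> ?O" "v \<in> ?O - P" "x * v = p ^ n * a" using Dn unfolding D_def by blast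
  have "a \<notin> P"
  proof
    assume "a \<in> P"
    have "x * (v * u) = p ^ Suc n * (y * a)" using av(3) by (simp add: u_def mult_ac)
    hence "D (Suc n)" unfolding D_def using py(3) \<open>a \<in> P\<close> prime_units_mult[OF av(2) u] by blast
    thus False using nDn by blast
  qed
  moreover have "x = p powi (int n) * a / v" using av(3) prime_unit_nonzero[OF av(2)] by (simp add: field_simps)
  ultimately show ?thesis using av unfolding val_rep_def by blast
qed

lemma prime_valuation:
  "\<exists>w p. p \<in> P \<and> p \<noteq> 0 \<and> (\<forall>x\<in>E - {0}. val_rep p x (w x)) \<and>
    (\<forall>x k. val_rep p x k \<longrightarrow> w x = k) \<and> (\<forall>x\<in>integers_of E - {0}. w x \<ge> 0)"
proof -
  obtain p y where py: "p \<in> P" "p \<noteq> 0" "\<forall>r\<in>P. y * r \<in> integers_of E" "y * p \<notin> P"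
    using prime_uniformizer by blast
  define w where "w x = (THE k. val_rep p x k)" for x
  have w: "w x = k" if "val_rep p x k" for x k
    unfolding w_def using that val_rep_unique[OF py(1,2)] by (intro the_equality) auto
  have "\<exists>k. val_rep p x k" if x: "x \<in> E" "x \<noteq> 0" for x
  proof -
    obtain n where n: "n > 0" "of_int n * x \<in> integers_of E"
      using integer_multiple_in_field[OF nfs number_field_subset_Qbar[OF nf] x(1)] by blast
    obtain i where i: "val_rep p (of_int n * x) (int i)"
      using val_rep_integer[OF py n(2)] n(1) x(2) by auto
    obtain j where j: "val_rep p (of_int n) (int j)"
      using val_rep_integer[OF py, of "of_int n"] n(1) nfi(8) by auto
    have "inverse (of_int n) * (of_int n * x) = x" using n(1) by simp
    thus ?thesis using val_rep_mult[OF py(2) val_rep_inverse[OF j] i] by metis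
  qed
  hence "\<forall>x\<in>E - {0}. val_rep p x (w x)" using w by blast
  moreover have "\<forall>x\<in>integers_of E - {0}. w x \<ge> 0" using val_rep_integer[OF py] w by fastforce
  ultimately show ?thesis using py(1,2) w by blast
qed

section \<open>Powers of the prime ideal and the order function\<close>

lemma ideal_power_is_ideal: "is_ideal E (ideal_power E P n)"
proof (induction n)
  case 0
  show ?case using nfi by (simp add: nat_pow_def ideals_set_def is_ideal_def)
next
  case (Suc n)
  interpret R: cring "integer_ring E" by (rule cring_integer_ring[OF nfs])
  have "ideal (ideal_prod (integer_ring E) (ideal_power E P n) P) (integer_ring E)"
    using Suc prime_ideal ideal_iff[OF nfs] by (intro R.ideal_prod_is_ideal) auto
  thus ?case using ideal_iff[OF nfs] by (simp add: nat_pow_def ideals_set_def)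
qed

lemma ideal_power_Suc: "ideal_power E P (Suc n) = ideal_prod (integer_ring E) (ideal_power E P n) P"
  by (simp add: nat_pow_def ideals_set_def)

lemma ideal_power_0: "ideal_power E P 0 = integers_of E"
  by (simp add: nat_pow_def ideals_set_def)

lemma power_mem_ideal_power: "x \<in> P \<Longrightarrow> x ^ n \<in> ideal_power E P n"
proof (induction n)
  case 0 thus ?case unfolding ideal_power_0 using nfi(1) by simp
next
  case (Suc n)
  show ?case unfolding ideal_power_Suc
    using ideal_prod.prod[of "x ^ n" "ideal_power E P n" x P "integer_ring E"] Suc by (simp add: mult.commute)
qed

text \<open>An element of order at least \<open>n\<close> is a multiple of \<open>p ^ n\<close> up
  to a denominator \<open>v\<close> prime to \<open>P\<close>. This \<open>v\<close> is invertible
  modulo the \<open>n\<close>-th power of \<open>P\<close>: if \<open>1 - v * c\<close> is in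
  \<open>P\<close>, its \<open>n\<close>-th power has the form \<open>1 - v * d\<close>. Conversely,
  sums of products are handled by a common denominator.\<close>

lemma ideal_power_eq:
  assumes p: "p \<in> P" "p \<noteq> 0" and w: "\<forall>x\<in>E - {0}. val_rep p x (w x)"
    "\<forall>x k. val_rep p x k \<longrightarrow> w x = k" "\<forall>x\<in>integers_of E - {0}. w x \<ge> 0"
  shows "ideal_power E P n = {x \<in> integers_of E. x = 0 \<or> w x \<ge> int n}"
proof
  let ?O = "integers_of E"
  have OE: "?O \<subseteq> E" by (auto simp: integers_of_def)
  have wm: "w (x * y) = w x + w y" if "x \<in> E" "y \<in> E" "x \<noteq> 0" "y \<noteq> 0" for x y
    using that w val_rep_mult[OF p(2)] by blast
  have div: "\<exists>a\<in>?O. \<exists>v\<in>?O - P. x * v = p ^ n * a" if x: "x \<in> ?O" "x = 0 \<or> w x \<ge> int n" for x n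
  proof (cases "x = 0")
    case True
    thus ?thesis using nfi(1,2) prime_props(1) by (intro bexI[of _ 0] bexI[of _ 1]) auto
  next
    case False
    obtain a v where av: "a \<in> ?O - P" "v \<in> ?O - P" "x = p powi (w x) * a / v"
      using w(1) False x OE unfolding val_rep_def by blast
    define m where "m = nat (w x - int n)"
    have "w x = int n + int m" using x False by (simp add: m_def)
    hence "p powi (w x) = p ^ n * p ^ m" using p(2) by (simp add: power_int_add)
    hence "x * v = p ^ n * (p ^ m * a)"
      using prime_unit_nonzero[OF av(2)] by (subst av(3)) simp
    moreover have "p ^ m * a \<in> ?O" using p(1) prime_subset av(1) by (intro nfi) auto
    ultimately show ?thesis using av(2) by blast
  qed
  have wI: "x = 0 \<or> w x \<ge> int n" if "x \<in> ?O" "a \<in> ?O" "v \<in> ?O - P" "x * v = p ^ n * a" for x a v n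
  proof (cases "x = 0")
    case False
    have "v \<noteq> 0" using prime_unit_nonzero that(3) by blast
    hence "a \<noteq> 0" using that(4) False by auto
    have "val_rep p v 0" unfolding val_rep_def using that(3) nfi(1) prime_props(1)
      by (intro bexI[of _ v] bexI[of _ 1]) auto
    hence "w v = 0" using w(2) by blast
    have "val_rep p (p ^ n) (int n)" unfolding val_rep_def using nfi(1) prime_props(1)
      by (intro bexI[of _ 1]) auto
    hence "w (p ^ n) = int n" using w(2) by blast
    have "v \<in> E" "x \<in> E" using that(1,3) OE by auto
    hence "w (x * v) = w x" using wm[of x v] False \<open>v \<noteq> 0\<close> \<open>w v = 0\<close> by simp
    moreover have "p ^ n \<in> E" using p prime_subset OE subfield_power[OF nfs] by blast
    hence "w (p ^ n * a) = int n + w a"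
      using wm[of "p ^ n" a] that p(2) \<open>a \<noteq> 0\<close> \<open>w (p ^ n) = int n\<close> OE by auto
    ultimately show ?thesis using that(4) w(3) \<open>a \<noteq> 0\<close> that(2) by force
  qed simp
  show "{x \<in> ?O. x = 0 \<or> w x \<ge> int n} \<subseteq> ideal_power E P n"
  proof
    fix x assume "x \<in> {x \<in> ?O. x = 0 \<or> w x \<ge> int n}"
    hence "x \<in> ?O" "x = 0 \<or> w x \<ge> int n" by auto
    have x: "x \<in> ideal_power E P n" if xO: "x \<in> ?O" and wx: "x = 0 \<or> w x \<ge> int n" for x
    proof -
      obtain a v where av: "a \<in> ?O" "v \<in> ?O - P" "x * v = p ^ n * a" using div[OF xO wx] by blast
      obtain c where c: "c \<in> ?O" "1 - v * c \<in> P" using prime_maximal av(2) by blast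
      have "\<exists>d\<in>?O. (1 - v * c) ^ m = 1 - v * d" for m
      proof (induction m)
        case 0 show ?case using nfi(2) by (intro bexI[of _ 0]) auto
      next
        case (Suc m)
        then obtain d where d: "d \<in> ?O" "(1 - v * c) ^ m = 1 - v * d" by blast
        have "(1 - v * c) ^ Suc m = (1 - v * c) * (1 - v * d)" by (simp add: d(2))
        also have "\<dots> = 1 - v * (c + d - v * c * d)" by (simp add: algebra_simps)
        finally have "(1 - v * c) ^ Suc m = 1 - v * (c + d - v * c * d)" .
        moreover have "c + d - v * c * d \<in> ?O" using d c av(2) by (intro nfi) auto
        ultimately show ?case by blast
      qed
      then obtain d where d: "d \<in> ?O" "(1 - v * c) ^ n = 1 - v * d" by blast
      have "x = (x * v) * d + x * (1 - v * c) ^ n"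
        unfolding d(2) by (simp add: algebra_simps)
      also have "(x * v) * d = (a * d) * p ^ n" unfolding av(3) by simp
      finally have "x = (a * d) * p ^ n + x * (1 - v * c) ^ n" .
      moreover have "a * d \<in> ?O" using av(1) d(1) by (intro nfi)
      hence "(a * d) * p ^ n \<in> ideal_power E P n"
        by (intro is_ideal_mult(2)[OF ideal_power_is_ideal power_mem_ideal_power[OF p(1)]])
      moreover have "x * (1 - v * c) ^ n \<in> ideal_power E P n"
        by (intro is_ideal_mult(2)[OF ideal_power_is_ideal power_mem_ideal_power[OF c(2)]] xO)
      ultimately show ?thesis using ideal_power_is_ideal[of n] unfolding is_ideal_def by metis
    qed
    show "x \<in> ideal_power E P n" using x \<open>x \<in> ?O\<close> \<open>x = 0 \<or> w x \<ge> int n\<close> by blast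
  qed
  show "ideal_power E P n \<subseteq> {x \<in> ?O. x = 0 \<or> w x \<ge> int n}"
  proof (induction n)
    case 0 show ?case unfolding ideal_power_0 using w(3) by auto
  next
    case (Suc n)
    have "x \<in> ?O \<and> (x = 0 \<or> w x \<ge> int (Suc n))"
      if "x \<in> ideal_prod (integer_ring E) (ideal_power E P n) P" for x
      using that
    proof (induction rule: ideal_prod.induct)
      case (prod i j)
      hence i: "i \<in> ?O" "i = 0 \<or> w i \<ge> int n" using Suc.IH by auto
      have j: "j \<in> ?O" using prod prime_subset by blast
      have "j = 0 \<or> w j \<ge> 1"
      proof (rule ccontr)
        assume "\<not> ?thesis"
        hence "j \<noteq> 0" "w j = 0" using w(3) j by force+
        then obtain a v where av: "a \<in> ?O - P" "v \<in> ?O - P" "j = p powi 0 * a / v"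
          using w(1) j OE unfolding val_rep_def by (metis DiffI empty_iff insert_iff subsetD)
        hence "j * v = a" using prime_unit_nonzero[OF av(2)] by simp
        thus False using prime_props(6)[OF prod(2)] av by blast
      qed
      hence "i * j = 0 \<or> w (i * j) \<ge> int (Suc n)" 
      proof (cases "i = 0 \<or> j = 0")
        case False
        have "i \<in> E" "j \<in> E" using i(1) j OE by auto
        thus ?thesis using False wm[of i j] i(2) \<open>j = 0 \<or> w j \<ge> 1\<close> by auto
      qed auto
      thus ?case using nfi(5)[OF i(1) j] by simp
    next
      case (sum s t)
      have "s + t = 0 \<or> w (s + t) \<ge> int (Suc n)"
      proof -
        obtain a v where a: "a \<in> ?O" "v \<in> ?O - P" "s * v = p ^ Suc n * a" using div sum.IH(1) by blast
        obtain b u where b: "b \<in> ?O" "u \<in> ?O - P" "t * u = p ^ Suc n * b" using div sum.IH(2) by blast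
        have "(s + t) * (v * u) = (s * v) * u + (t * u) * v" by (simp add: algebra_simps)
        also have "\<dots> = p ^ Suc n * (a * u + b * v)" unfolding a(3) b(3) by (simp add: algebra_simps)
        finally have "(s + t) * (v * u) = p ^ Suc n * (a * u + b * v)" .
        moreover have "a * u + b * v \<in> ?O" "s + t \<in> ?O" using a b sum.IH by (auto intro!: nfi)
        ultimately show ?thesis using wI prime_units_mult[OF a(2) b(2)] by blast
      qed
      thus ?case using nfi(3) sum.IH by simp
    qed
    thus ?case unfolding ideal_power_Suc by blast
  qed
qed

text \<open>The greatest exponent exists because the powers of \<open>P\<close> are cut out by the
  valuation, and all fractions representing \<open>x\<close> give the same difference of
  exponents.\<close>

lemma ord_at_eq:
  assumes p: "p \<in> P" "p \<noteq> 0" and w: "\<forall>x\<in>E - {0}. val_rep p x (w x)"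
    "\<forall>x k. val_rep p x k \<longrightarrow> w x = k" "\<forall>x\<in>integers_of E - {0}. w x \<ge> 0"
    and x: "x \<in> E" "x \<noteq> 0"
  shows "ord_at E P x = w x"
proof -
  let ?O = "integers_of E"
  have OE: "?O \<subseteq> E" by (auto simp: integers_of_def)
  have io: "int (integer_ord E P x) = w x" if "x \<in> ?O" "x \<noteq> 0" for x
  proof -
    have "integer_ord E P x = nat (w x)"
      unfolding integer_ord_def
      using w(3) that by (intro Greatest_equality) (auto simp: ideal_power_eq[OF p w])
    thus ?thesis using w(3) that by auto
  qed
  have quot: "w x = w a - w b" if "a \<in> ?O" "a \<noteq> 0" "b \<in> ?O" "b \<noteq> 0" "x = a / b" for a b x
  proof -
    have "val_rep p (a * inverse b) (w a + - w b)"
      using w(1) that OE by (intro val_rep_mult[OF p(2)] val_rep_inverse) auto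
    thus ?thesis using w(2) that(5) by (simp add: divide_inverse)
  qed
  obtain n where n: "n > 0" "of_int n * x \<in> ?O"
    using integer_multiple_in_field[OF nfs number_field_subset_Qbar[OF nf] x(1)] by blast
  have xe: "x = (of_int n * x) / of_int n" using n(1) by simp
  show ?thesis
    unfolding ord_at_def
  proof (rule the_equality)
    show "\<exists>a\<in>carrier (integer_ring E) - {0}. \<exists>b\<in>carrier (integer_ring E) - {0}.
      x = a / b \<and> w x = int (integer_ord E P a) - int (integer_ord E P b)"
      using n x xe nfi(8)[of n] quot[of "of_int n * x" "of_int n" x] io
      by (intro bexI[of _ "of_int n * x"] bexI[of _ "of_int n"]) auto
    fix k assume "\<exists>a\<in>carrier (integer_ring E) - {0}. \<exists>b\<in>carrier (integer_ring E) - {0}.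
      x = a / b \<and> k = int (integer_ord E P a) - int (integer_ord E P b)"
    then obtain a b where "a \<in> ?O" "a \<noteq> 0" "b \<in> ?O" "b \<noteq> 0" "x = a / b"
      "k = int (integer_ord E P a) - int (integer_ord E P b)" by auto
    thus "k = w x" using io quot by metis
  qed
qed

lemma ord_at_uniformizer:
  "\<exists>p. p \<in> P \<and> p \<noteq> 0 \<and> ord_at E P p = 1 \<and> (\<forall>x\<in>E - {0}. val_rep p x (ord_at E P x)) \<and>
    (\<forall>x\<in>E - {0}. \<forall>k. val_rep p x k \<longrightarrow> ord_at E P x = k) \<and>
    (\<forall>x\<in>integers_of E - {0}. ord_at E P x \<ge> 0) \<and>
    (\<forall>n. ideal_power E P n = {x \<in> integers_of E. x = 0 \<or> ord_at E P x \<ge> int n})"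
proof -
  obtain w p where p: "p \<in> P" "p \<noteq> 0" and w: "\<forall>x\<in>E - {0}. val_rep p x (w x)"
    "\<forall>x k. val_rep p x k \<longrightarrow> w x = k" "\<forall>x\<in>integers_of E - {0}. w x \<ge> 0"
    using prime_valuation by blast
  have o: "ord_at E P x = w x" if "x \<in> E" "x \<noteq> 0" for x using ord_at_eq[OF p w] that by blast
  have OE: "integers_of E \<subseteq> E" by (auto simp: integers_of_def)
  have "val_rep p p 1" unfolding val_rep_def using nfi(1) prime_props(1)
    by (intro bexI[of _ 1]) auto
  hence "w p = 1" using w(2) by blast
  moreover have "p \<in> E" using p(1) prime_subset OE by blast
  ultimately have "ord_at E P p = 1" using o p(2) by simp
  moreover have "ideal_power E P n = {x \<in> integers_of E. x = 0 \<or> ord_at E P x \<ge> int n}" for n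
  proof -
    have "x = 0 \<or> int n \<le> ord_at E P x \<longleftrightarrow> x = 0 \<or> int n \<le> w x" if "x \<in> integers_of E" for x
      using o[of x] that OE by (cases "x = 0") auto
    thus ?thesis using ideal_power_eq[OF p w, of n] by blast
  qed
  moreover have "ord_at E P x \<ge> 0" if "x \<in> integers_of E - {0}" for x
    using that w(3) o[of x] OE by auto
  ultimately show ?thesis using p w o by (intro exI[of _ p]) auto
qed

lemma ord_at_mult:
  assumes "x \<in> E" "y \<in> E" "x \<noteq> 0" "y \<noteq> 0"
  shows "ord_at E P (x * y) = ord_at E P x + ord_at E P y"
proof -
  obtain p where p: "p \<noteq> 0" "\<forall>x\<in>E - {0}. val_rep p x (ord_at E P x)"
    "\<forall>x\<in>E - {0}. \<forall>k. val_rep p x k \<longrightarrow> ord_at E P x = k" using ord_at_uniformizer by blast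
  have "x * y \<in> E - {0}" using assms subfield_mult[OF nfs] by simp
  moreover have "val_rep p (x * y) (ord_at E P x + ord_at E P y)"
    using p(2) assms by (intro val_rep_mult[OF p(1)]) auto
  ultimately show ?thesis using p(3) by blast
qed

lemma ord_at_nonneg: "x \<in> integers_of E \<Longrightarrow> x \<noteq> 0 \<Longrightarrow> ord_at E P x \<ge> 0"
  using ord_at_uniformizer by blast

lemma ideal_power_ord: "ideal_power E P n = {x \<in> integers_of E. x = 0 \<or> ord_at E P x \<ge> int n}"
  using ord_at_uniformizer by blast

lemma ideal_power_1: "ideal_power E P 1 = P"
proof -
  interpret R: cring "integer_ring E" by (rule cring_integer_ring[OF nfs])
  have "ideal P (integer_ring E)" using prime_ideal ideal_iff[OF nfs] by blast
  hence "ideal_prod (integer_ring E) P (carrier (integer_ring E)) = P" by (rule R.ideal_prod_one)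
  moreover have "ideal_prod (integer_ring E) P (carrier (integer_ring E))
      = ideal_prod (integer_ring E) (carrier (integer_ring E)) P"
    by (rule R.ideal_prod_commute) (use \<open>ideal P (integer_ring E)\<close> R.oneideal in auto)
  ultimately show ?thesis by (simp add: nat_pow_def ideals_set_def)
qed

lemma ord_at_pos_iff: "x \<in> integers_of E \<Longrightarrow> x \<noteq> 0 \<Longrightarrow> ord_at E P x > 0 \<longleftrightarrow> x \<in> P"
proof -
  assume x: "x \<in> integers_of E" "x \<noteq> 0"
  have "P = {x \<in> integers_of E. x = 0 \<or> ord_at E P x \<ge> int 1}"
    using ideal_power_ord[of 1] unfolding ideal_power_1 .
  hence "x \<in> P \<longleftrightarrow> ord_at E P x \<ge> int 1" using x by blast
  thus "ord_at E P x > 0 \<longleftrightarrow> x \<in> P" by auto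
qed

lemma ord_at_one: "ord_at E P 1 = 0"
  using ord_at_mult[of 1 1] nfi(1) by (simp add: integers_of_def)

lemma ord_at_inverse: "x \<in> E \<Longrightarrow> x \<noteq> 0 \<Longrightarrow> ord_at E P (inverse x) = - ord_at E P x"
  using ord_at_mult[of x "inverse x"] subfield_inverse[OF nfs] ord_at_one by simp

lemma ord_at_divide:
  "x \<in> E \<Longrightarrow> y \<in> E \<Longrightarrow> x \<noteq> 0 \<Longrightarrow> y \<noteq> 0 \<Longrightarrow> ord_at E P (x / y) = ord_at E P x - ord_at E P y"
  using ord_at_mult[of x "inverse y"] subfield_inverse[OF nfs] ord_at_inverse
  by (simp add: divide_inverse)

lemma ord_at_fraction:
  assumes "x \<in> E" "x \<noteq> 0" "ord_at E P x \<ge> 0"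
  shows "\<exists>a\<in>integers_of E. \<exists>v\<in>integers_of E - P. x = a / v"
proof -
  obtain p where p: "p \<in> P" "\<forall>x\<in>E - {0}. val_rep p x (ord_at E P x)" using ord_at_uniformizer by blast
  then obtain a v where av: "a \<in> integers_of E - P" "v \<in> integers_of E - P"
    "x = p powi (ord_at E P x) * a / v" using assms unfolding val_rep_def by blast
  have "p powi (ord_at E P x) = p ^ nat (ord_at E P x)" using assms(3) by (simp add: power_int_def)
  moreover have "p ^ nat (ord_at E P x) * a \<in> integers_of E"
    using p(1) av(1) prime_subset by (intro nfi) auto
  ultimately show ?thesis using av by metis
qed

lemma ord_at_fraction_nonneg:
  assumes "a \<in> integers_of E" "v \<in> integers_of E - P" "a \<noteq> 0"
  shows "ord_at E P (a / v) \<ge> 0"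
proof -
  have v: "v \<noteq> 0" using prime_unit_nonzero[OF assms(2)] .
  have "ord_at E P v = 0" using ord_at_pos_iff[of v] ord_at_nonneg[of v] assms(2) v by force
  thus ?thesis using ord_at_divide[of a v] ord_at_nonneg[of a] assms v by (auto simp: integers_of_def)
qed

text \<open>Factor out the summand of smaller order: the rest is 1 plus an element of nonnegative
  order, hence a fraction \<open>(v + a) / v\<close> with denominator prime to
  \<open>P\<close>.\<close>

lemma ord_at_add:
  assumes x: "x \<in> E" "y \<in> E" "x \<noteq> 0" "y \<noteq> 0" "x + y \<noteq> 0" and k: "ord_at E P x \<ge> k" "ord_at E P y \<ge> k"
  shows "ord_at E P (x + y) \<ge> k"
proof -
  have *: "ord_at E P (x + y) \<ge> ord_at E P x"
    if "x \<in> E" "y \<in> E" "x \<noteq> 0" "y \<noteq> 0" "x + y \<noteq> 0" "ord_at E P x \<le> ord_at E P y" for x y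
  proof -
    have yx: "y / x \<in> E" "y / x \<noteq> 0" "ord_at E P (y / x) \<ge> 0"
      using that ord_at_divide subfield_divide[OF nfs] by auto
    then obtain a v where av: "a \<in> integers_of E" "v \<in> integers_of E - P" "y / x = a / v"
      using ord_at_fraction by blast
    have v0: "v \<noteq> 0" using prime_unit_nonzero[OF av(2)] .
    have "(v + a) / v = 1 + y / x" using av(3) v0 by (simp add: add_divide_distrib)
    hence e: "x + y = x * ((v + a) / v)" using that(3) by (simp add: distrib_left)
    have "v + a \<in> integers_of E" using av by (intro nfi) auto
    moreover have "v + a \<noteq> 0" using e that(5) by auto
    ultimately have "ord_at E P ((v + a) / v) \<ge> 0" using ord_at_fraction_nonneg av(2) by blast
    moreover have "(v + a) / v \<in> E" "(v + a) / v \<noteq> 0"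
      using \<open>v + a \<in> integers_of E\<close> \<open>v + a \<noteq> 0\<close> av v0 subfield_divide[OF nfs] by (auto simp: integers_of_def)
    ultimately show ?thesis using ord_at_mult[of x "(v + a) / v"] that e by simp
  qed
  show ?thesis
  proof (cases "ord_at E P x \<le> ord_at E P y")
    case True
    thus ?thesis using *[of x y] x k by simp
  next
    case False
    thus ?thesis using *[of y x] x k by (simp add: add.commute)
  qed
qed

end

section \<open>Nonarchimedean absolute values\<close>

definition nonarch_abs :: "complex set \<Rightarrow> (complex \<Rightarrow> real) \<Rightarrow> bool" where
  "nonarch_abs E A \<longleftrightarrow> (\<forall>x\<in>E. A x \<ge> 0 \<and> (A x = 0 \<longleftrightarrow> x = 0)) \<and>
     (\<forall>x\<in>E. \<forall>y\<in>E. A (x * y) = A x * A y \<and> A (x + y) \<le> max (A x) (A y)) \<and>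
     (\<forall>x\<in>integers_of E. A x \<le> 1)"

definition center :: "complex set \<Rightarrow> (complex \<Rightarrow> real) \<Rightarrow> complex set" where
  "center E A = {x \<in> integers_of E. A x < 1}"

lemma nonarch_abs_mono: "nonarch_abs E A \<Longrightarrow> F \<subseteq> E \<Longrightarrow> nonarch_abs F A"
  unfolding nonarch_abs_def integers_of_def by blast

lemma center_Int: "F \<subseteq> E \<Longrightarrow> center E A \<inter> F = center F A"
  by (auto simp: center_def integers_of_def)

context
  fixes E A assumes E: "is_subfield E" and A: "nonarch_abs E A"
begin

lemma nonarch_nonneg: "x \<in> E \<Longrightarrow> A x \<ge> 0"
  and nonarch_eq_0: "x \<in> E \<Longrightarrow> A x = 0 \<longleftrightarrow> x = 0"
  and nonarch_mult: "x \<in> E \<Longrightarrow> y \<in> E \<Longrightarrow> A (x * y) = A x * A y"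
  and nonarch_add: "x \<in> E \<Longrightarrow> y \<in> E \<Longrightarrow> A (x + y) \<le> max (A x) (A y)"
  and nonarch_integer: "x \<in> integers_of E \<Longrightarrow> A x \<le> 1"
  using A by (simp_all add: nonarch_abs_def)

lemma nonarch_pos: "x \<in> E \<Longrightarrow> x \<noteq> 0 \<Longrightarrow> A x > 0"
  using nonarch_nonneg nonarch_eq_0 by (metis less_eq_real_def)

lemma nonarch_zero: "A 0 = 0"
  using nonarch_eq_0[OF subfield_zero[OF E]] by simp

lemma nonarch_one: "A 1 = 1"
  using nonarch_mult[OF subfield_one[OF E] subfield_one[OF E]] nonarch_eq_0[OF subfield_one[OF E]] by simp

lemma nonarch_minus_one: "A (-1) = 1"
proof -
  have "A (-1) * A (-1) = 1"
    using nonarch_mult[of "-1" "-1"] subfield_closed[OF E] nonarch_one by simp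
  moreover have "A (-1) \<ge> 0" using subfield_closed[OF E] nonarch_nonneg by simp
  ultimately show ?thesis by (simp add: square_eq_1_iff)
qed

lemma nonarch_uminus: "x \<in> E \<Longrightarrow> A (- x) = A x"
  using nonarch_mult[of "-1" x] nonarch_minus_one subfield_closed[OF E] by simp

lemma nonarch_diff: "x \<in> E \<Longrightarrow> y \<in> E \<Longrightarrow> A (x - y) \<le> max (A x) (A y)"
  using nonarch_add[of x "- y"] nonarch_uminus subfield_closed[OF E] by simp

lemma nonarch_power: "x \<in> E \<Longrightarrow> A (x ^ n) = A x ^ n"
  by (induction n) (auto simp: nonarch_one nonarch_mult subfield_power[OF E])

lemma nonarch_inverse: "x \<in> E \<Longrightarrow> A (inverse x) = inverse (A x)"
proof (cases "x = 0")
  case False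
  assume "x \<in> E"
  hence "A x * A (inverse x) = 1"
    using nonarch_mult[of x "inverse x"] subfield_inverse[OF E] nonarch_one False by simp
  thus ?thesis using inverse_unique by metis
qed (simp add: nonarch_zero)

lemma nonarch_divide: "x \<in> E \<Longrightarrow> y \<in> E \<Longrightarrow> A (x / y) = A x / A y"
  using nonarch_mult[of x "inverse y"] nonarch_inverse subfield_inverse[OF E] by (simp add: divide_inverse)

lemma nonarch_powi: "x \<in> E \<Longrightarrow> A (x powi n) = A x powi n"
  by (auto simp: power_int_def nonarch_power nonarch_inverse subfield_power[OF E] power_inverse subfield_inverse[OF E])

lemma nonarch_prod: "(\<And>i. i \<in> I \<Longrightarrow> f i \<in> E) \<Longrightarrow> A (prod f I) = (\<Prod>i\<in>I. A (f i))"
proof (induction I rule: infinite_finite_induct)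
  case (insert i I)
  have "prod f I \<in> E" using insert.prems by (intro subfield_prod[OF E]) auto
  thus ?case using insert by (simp add: nonarch_mult)
qed (auto simp: nonarch_one)

lemma nonarch_sum_le:
  assumes "\<And>i. i \<in> I \<Longrightarrow> f i \<in> E" "\<And>i. i \<in> I \<Longrightarrow> A (f i) \<le> c" "c \<ge> 0"
  shows "A (sum f I) \<le> c"
  using assms(1,2)
proof (induction I rule: infinite_finite_induct)
  case (insert i I)
  have "sum f I \<in> E" using insert.prems by (intro subfield_sum[OF E]) auto
  moreover have "A (sum f I) \<le> c" using insert by auto
  ultimately show ?case using insert nonarch_add[of "f i" "sum f I"] by fastforce
qed (use assms(3) nonarch_zero in auto)

lemma nonarch_add_dominant:
  assumes "x \<in> E" "y \<in> E" "A y < A x" shows "A (x + y) = A x"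
proof (rule antisym)
  show "A (x + y) \<le> A x" using nonarch_add[of x y] assms by simp
  have "A ((x + y) - y) \<le> max (A (x + y)) (A y)"
    using assms subfield_add[OF E] by (intro nonarch_diff) auto
  thus "A x \<le> A (x + y)" using assms(3) by (simp add: max_def split: if_splits)
qed

lemma nonarch_sum_dominant:
  assumes "finite I" "\<And>i. i \<in> I \<Longrightarrow> f i \<in> E" "j \<in> I" "\<And>i. i \<in> I \<Longrightarrow> i \<noteq> j \<Longrightarrow> A (f i) < A (f j)"
  shows "A (sum f I) = A (f j)"
proof (cases "I = {j}")
  case False
  define J where "J = I - {j}"
  have J: "finite J" "J \<noteq> {}" using assms(1,3) False by (auto simp: J_def)
  have s: "sum f I = f j + sum f J" using assms(1,3) by (simp add: J_def sum.remove)
  have "A (sum f J) \<le> Max ((\<lambda>i. A (f i)) ` J)"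
  proof (rule nonarch_sum_le)
    obtain i where "i \<in> J" using J by blast
    hence "A (f i) \<le> Max ((\<lambda>i. A (f i)) ` J)" "A (f i) \<ge> 0"
      using J nonarch_nonneg assms(2) by (auto simp: J_def)
    thus "0 \<le> Max ((\<lambda>i. A (f i)) ` J)" by linarith
  qed (use J assms(2) in \<open>auto simp: J_def\<close>)
  also have "\<dots> < A (f j)" using J assms(4) by (subst Max_less_iff) (auto simp: J_def)
  finally show ?thesis
    unfolding s using assms(2,3) by (intro nonarch_add_dominant subfield_sum[OF E]) (auto simp: J_def)
qed simp

lemma center_prime: "is_prime E (center E A)"
  unfolding is_prime_def is_ideal_def
proof (intro conjI ballI impI)
  have OE: "x \<in> E" if "x \<in> integers_of E" for x using that by (simp add: integers_of_def)
  show "0 \<in> center E A" using nonarch_zero integers_zero[OF E] by (simp add: center_def)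
  show "1 \<notin> center E A" using nonarch_one by (simp add: center_def)
  show "x + y \<in> center E A" if "x \<in> center E A" "y \<in> center E A" for x y
    using that nonarch_add[of x y] OE integers_add[OF E] by (auto simp: center_def)
  show "x * y \<in> center E A" if "x \<in> integers_of E" "y \<in> center E A" for x y
  proof -
    have "A x * A y \<le> 1 * A y" using that OE nonarch_integer nonarch_nonneg
      by (intro mult_right_mono) (auto simp: center_def)
    also have "\<dots> < 1" using that by (simp add: center_def)
    finally show ?thesis using that OE integers_mult[OF E] nonarch_mult by (auto simp: center_def)
  qed
  show "x \<in> center E A \<or> y \<in> center E A"
    if "x \<in> integers_of E" "y \<in> integers_of E" "x * y \<in> center E A" for x y
  proof (rule ccontr)
    assume "\<not> ?thesis"
    hence "A x = 1" "A y = 1" using that nonarch_integer[of x] nonarch_integer[of y] by (auto simp: center_def)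
    thus False using that(3) nonarch_mult[of x y] OE that by (simp add: center_def)
  qed
qed (auto simp: center_def)

end

text \<open>Integers outside the centre have value 1, so the absolute value is determined by its
  centre and by its value at one element of order 1.\<close>

lemma nonarch_eq_powi_ord:
  assumes nf: "number_field E" and A: "nonarch_abs E A" and c0: "center E A \<noteq> {0}"
    and p: "p \<in> E" "p \<noteq> 0" "ord_at E (center E A) p = 1" and x: "x \<in> E" "x \<noteq> 0"
  shows "A x = A p powi ord_at E (center E A) x"
proof -
  note E = number_field_is_subfield[OF nf]
  define P where "P = center E A"
  have P: "is_prime E P" "P \<noteq> {0}" using center_prime[OF E A] c0 by (simp_all add: P_def)
  obtain q where q: "q \<in> P" "q \<noteq> 0" "\<forall>x\<in>E - {0}. val_rep E P q x (ord_at E P x)"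
    using ord_at_uniformizer[OF nf P] by blast
  have u: "A a = 1" "a \<in> E" if "a \<in> integers_of E - P" for a
    using that nonarch_integer[OF E A, of a] by (auto simp: P_def center_def integers_of_def)
  have qE: "q \<in> E" using q(1) by (simp add: P_def center_def integers_of_def)
  have rep: "A x = A q powi ord_at E P x" if x: "x \<in> E" "x \<noteq> 0" for x
  proof -
    obtain a v where av: "a \<in> integers_of E - P" "v \<in> integers_of E - P"
      "x = q powi (ord_at E P x) * a / v" using q(3) x unfolding val_rep_def[OF nf P] by blast
    have "A x = A (q powi (ord_at E P x) * a) / A v"
      using av u subfield_closed[OF E] qE by (subst av(3)) (intro nonarch_divide[OF E A], auto)
    thus ?thesis using u av(1,2) qE subfield_closed[OF E]
      by (simp add: nonarch_mult[OF E A] nonarch_powi[OF E A])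
  qed
  have "A p = A q" using rep[of p] p by (simp add: P_def)
  thus ?thesis using rep[OF x] by (simp add: P_def)
qed

lemma ord_abs:
  assumes nf: "number_field E" and P: "is_prime E P" "P \<noteq> {0}" and r: "0 < r" "r < (1::real)"
  defines "A \<equiv> (\<lambda>x. if x = 0 then 0 else r powr real_of_int (ord_at E P x))"
  shows "nonarch_abs E A" "center E A = P"
proof -
  note E = number_field_is_subfield[OF nf]
  have pw: "r powr a \<le> r powr b \<longleftrightarrow> b \<le> a" for a b
    using r powr_mono'[of b a r] powr_less_mono'[of r a b] by (meson less_le not_le)
  show "nonarch_abs E A"
    unfolding nonarch_abs_def
  proof (intro conjI ballI)
    fix x y assume xy: "x \<in> E" "y \<in> E"
    show "A (x * y) = A x * A y"
      using xy ord_at_mult[OF nf P, of x y] by (auto simp: A_def powr_add)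
    show "A (x + y) \<le> max (A x) (A y)"
    proof (cases "x = 0 \<or> y = 0 \<or> x + y = 0")
      case False
      define k where "k = min (ord_at E P x) (ord_at E P y)"
      have "ord_at E P (x + y) \<ge> k" using ord_at_add[OF nf P, of x y k] xy False by (simp add: k_def)
      hence "r powr real_of_int (ord_at E P (x + y)) \<le> r powr real_of_int k" using pw by simp
      also have "\<dots> \<le> max (A x) (A y)" using False by (simp add: A_def k_def min_def)
      finally show ?thesis using False by (simp add: A_def)
    qed (use r in \<open>auto simp: A_def le_max_iff_disj\<close>)
  qed (use r ord_at_nonneg[OF nf P] pw[of _ 0] in \<open>auto simp: A_def\<close>)
  have "A x < 1 \<longleftrightarrow> x \<in> P" if x: "x \<in> integers_of E" for x
  proof (cases "x = 0")
    case True
    thus ?thesis using prime_props(2)[OF nf P] by (simp add: A_def)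
  next
    case False
    have "r powr real_of_int (ord_at E P x) < 1 \<longleftrightarrow> 0 < ord_at E P x"
      using pw[of 0 "real_of_int (ord_at E P x)"] r by (simp add: not_le[symmetric])
    thus ?thesis using ord_at_pos_iff[OF nf P x False] False by (simp add: A_def)
  qed
  thus "center E A = P" using prime_subset[OF nf P] by (auto simp: center_def)
qed

text \<open>Normalized by \<open>l\<close>, the valuations of the primes of the number fields below a prime \<open>Q\<close>
  of all algebraic integers fit together.\<close>

lemma nonarch_abs_exists:
  assumes l: "Factorial_Ring.prime l" and Q: "is_prime Qbar Q" "of_nat l \<in> Q"
  shows "\<exists>A. nonarch_abs Qbar A \<and> A (of_nat l) = 1 / real l \<and> center Qbar A = Q"
proof -
  define L :: complex where "L = of_nat l"
  have l1: "l > 1" using l prime_gt_1_nat by blast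
  have L0: "L \<noteq> 0" using l1 by (simp add: L_def)
  have LE: "L \<in> integers_of E" if "is_subfield E" for E using that integers_of_nat by (simp add: L_def)
  define e where "e E = ord_at E (Q \<inter> E) L" for E
  define B where "B E x = (if x = 0 then 0 else (1 / real l) powr (real_of_int (ord_at E (Q \<inter> E) x) / real_of_int (e E)))"
    for E x
  have pr: "is_prime E (Q \<inter> E)" "Q \<inter> E \<noteq> {0}" "e E > 0" if "number_field E" for E
  proof -
    note E = number_field_is_subfield[OF that]
    show 1: "is_prime E (Q \<inter> E)" using is_prime_restrict[OF Q(1) E number_field_subset_Qbar[OF that]] .
    have "L \<in> Q \<inter> E" using Q(2) LE[OF E] by (simp add: L_def integers_of_def)
    thus 2: "Q \<inter> E \<noteq> {0}" using L0 by blast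
    show "e E > 0" unfolding e_def
      using ord_at_pos_iff[OF that 1 2 LE[OF E] L0] \<open>L \<in> Q \<inter> E\<close> by simp
  qed
  have Babs: "nonarch_abs E (B E)" "center E (B E) = Q \<inter> E" "B E L = 1 / real l" if nf: "number_field E" for E
  proof -
    define r where "r = (1 / real l) powr (1 / real_of_int (e E))"
    have "(1 / real l) powr (1 / real_of_int (e E)) < (1 / real l) powr 0"
      using l1 pr(3)[OF nf] by (intro powr_less_mono') auto
    hence r: "0 < r" "r < 1" using l1 by (auto simp: r_def)
    have "B E = (\<lambda>x. if x = 0 then 0 else r powr real_of_int (ord_at E (Q \<inter> E) x))"
      by (auto simp: B_def r_def powr_powr)
    thus "nonarch_abs E (B E)" "center E (B E) = Q \<inter> E"
      using ord_abs[OF nf pr(1,2)[OF nf] r] by simp_all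
    show "B E L = 1 / real l" using pr(3)[OF nf] L0 l1 by (simp add: B_def e_def[symmetric])
  qed
  \<comment> \<open>Restricted to \<open>F\<close>, the absolute value of \<open>E\<close> is
    centred at the prime of \<open>F\<close>, hence a power of the one of \<open>F\<close>; the
    common value at \<open>l\<close> makes the exponent 1.\<close>
  have compat: "B E x = B F x" if nf: "number_field E" "number_field F" "F \<subseteq> E" "x \<in> F" for E F x
  proof (cases "x = 0")
    case False
    have BF: "nonarch_abs F (B E)" using nonarch_abs_mono[OF Babs(1)[OF nf(1)] nf(3)] .
    have cF: "center F (B E) = Q \<inter> F" using center_Int[OF nf(3), of "B E"] Babs(2)[OF nf(1)] nf(3) by blast
    obtain p where p: "p \<in> Q \<inter> F" "p \<noteq> 0" "ord_at F (Q \<inter> F) p = 1"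
      using ord_at_uniformizer[OF nf(2) pr(1,2)[OF nf(2)]] by blast
    have c0: "center F (B E) \<noteq> {0}" using cF pr(2)[OF nf(2)] by simp
    have pw: "B E y = B E p powi ord_at F (Q \<inter> F) y" if "y \<in> F" "y \<noteq> 0" for y
      using nonarch_eq_powi_ord[OF nf(2) BF c0, of p y] p that by (simp add: cF)
    define t where "t = B E p"
    have t: "t > 0" using nonarch_pos[OF number_field_is_subfield[OF nf(2)] BF] p by (auto simp: t_def)
    have "1 / real l = t powi e F"
      using pw[of L] LE[OF number_field_is_subfield[OF nf(2)]] L0 Babs(3)[OF nf(1)]
      by (simp add: t_def e_def integers_of_def)
    hence "t powr real_of_int (e F) = 1 / real l" using t by (simp add: powr_real_of_int')
    hence "t = (1 / real l) powr (1 / real_of_int (e F))"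
    proof -
      have "t = (t powr real_of_int (e F)) powr (1 / real_of_int (e F))"
        using t pr(3)[OF nf(2)] by (simp add: powr_powr)
      thus ?thesis using \<open>t powr real_of_int (e F) = 1 / real l\<close> by simp
    qed
    moreover have "B E x = t powr real_of_int (ord_at F (Q \<inter> F) x)"
      using pw[OF nf(4) False] t by (simp add: t_def powr_real_of_int')
    ultimately show ?thesis using False by (simp add: B_def powr_powr)
  qed (simp add: B_def)
  \<comment> \<open>Each \<open>x\<close> is evaluated in the field it generates; by compatibility
    any larger number field gives the same value.\<close>
  define A where "A x = B (adjoin \<rat> x) x" for x
  have A: "A x = B E x" if "number_field E" "x \<in> E" for x E
  proof -
    have "x \<in> Qbar" using that number_field_subset_Qbar by blast
    hence "number_field (adjoin \<rat> x)" by (intro number_field_adjoin number_field_Rats)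
    moreover have "adjoin \<rat> x \<subseteq> E"
      using that number_field_is_subfield subfield_Rats by (intro adjoin_least) auto
    ultimately show ?thesis using compat[of E "adjoin \<rat> x" x] that adjoin_mem by (simp add: A_def)
  qed
  have two: "\<exists>E. number_field E \<and> x \<in> E \<and> y \<in> E" if "x \<in> Qbar" "y \<in> Qbar" for x y
  proof -
    have "finite {x, y}" "{x, y} \<subseteq> Qbar" using that by auto
    then obtain E where "number_field E" "{x, y} \<subseteq> E" by (rule number_field_covers)
    thus ?thesis by auto
  qed
  have "nonarch_abs Qbar A"
    unfolding nonarch_abs_def
  proof (intro conjI ballI)
    fix x assume "x \<in> Qbar"
    then obtain E where E: "number_field E" "x \<in> E" using two by blast
    note EE = number_field_is_subfield[OF E(1)]
    show "A x \<ge> 0" "A x = 0 \<longleftrightarrow> x = 0"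
      using nonarch_nonneg[OF EE Babs(1)[OF E(1)] E(2)] nonarch_eq_0[OF EE Babs(1)[OF E(1)] E(2)] A[OF E] by auto
  next
    fix x y assume "x \<in> Qbar" "y \<in> Qbar"
    then obtain E where E: "number_field E" "x \<in> E" "y \<in> E" using two by blast
    note EE = number_field_is_subfield[OF E(1)]
    have "x * y \<in> E" "x + y \<in> E" using E subfield_closed[OF EE] by auto
    thus "A (x * y) = A x * A y" "A (x + y) \<le> max (A x) (A y)"
      using nonarch_mult[OF EE Babs(1)[OF E(1)] E(2,3)] nonarch_add[OF EE Babs(1)[OF E(1)] E(2,3)] A[OF E(1)] E
      by auto
  next
    fix x assume x: "x \<in> integers_of Qbar"
    hence "x \<in> Qbar" by (simp add: integers_of_def)
    then obtain E where E: "number_field E" "x \<in> E" using two by blast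
    thus "A x \<le> 1" using nonarch_integer[OF number_field_is_subfield[OF E(1)] Babs(1)[OF E(1)], of x] A[OF E] x
      by (simp add: integers_of_def)
  qed
  moreover have "A L = 1 / real l"
    using A[OF number_field_Rats, of L] Babs(3)[OF number_field_Rats] by (simp add: L_def)
  moreover have "center Qbar A = Q"
  proof -
    have "A x < 1 \<longleftrightarrow> x \<in> Q" if x: "x \<in> integers_of Qbar" for x
    proof -
      have "x \<in> Qbar" using x by (simp add: integers_of_def)
      then obtain E where E: "number_field E" "x \<in> E" using two by blast
      have "x \<in> center E (B E) \<longleftrightarrow> x \<in> Q" using Babs(2)[OF E(1)] E(2) by blast
      thus ?thesis using x E A[OF E] by (simp add: center_def integers_of_def)
    qed
    moreover have "Q \<subseteq> integers_of Qbar" using Q(1) by (simp add: is_prime_def is_ideal_def)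
    ultimately show ?thesis by (auto simp: center_def)
  qed
  ultimately show ?thesis unfolding L_def by blast
qed

lemma nonarch_abs_prime:
  assumes "Factorial_Ring.prime l"
  shows "\<exists>A. nonarch_abs Qbar A \<and> A (of_nat l) = 1 / real l"
  using is_prime_of_prime_number[OF assms] nonarch_abs_exists[OF assms] by metis

section \<open>Orbits\<close>

context
  fixes t assumes t: "is_aut t"
begin

lemma aut_add: "x \<in> Qbar \<Longrightarrow> y \<in> Qbar \<Longrightarrow> t (x + y) = t x + t y"
  and aut_mult: "x \<in> Qbar \<Longrightarrow> y \<in> Qbar \<Longrightarrow> t (x * y) = t x * t y"
  and aut_Qbar: "x \<in> Qbar \<Longrightarrow> t x \<in> Qbar"
  and aut_inj: "inj_on t Qbar"
  using t by (auto simp: is_aut_def bij_betw_def)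

lemma aut_zero: "t 0 = 0"
  using aut_add[of 0 0] subfield_zero[OF is_subfield_Qbar] by simp

lemma aut_eq_iff: "x \<in> Qbar \<Longrightarrow> y \<in> Qbar \<Longrightarrow> t x = t y \<longleftrightarrow> x = y"
  using aut_inj by (auto dest: inj_onD)

lemma aut_one: "t 1 = 1"
proof -
  have Q: "0 \<in> Qbar" "1 \<in> Qbar" using subfield_closed[OF is_subfield_Qbar] by auto
  have "t 1 \<noteq> 0" using aut_eq_iff[OF Q(2,1)] aut_zero by simp
  thus ?thesis using aut_mult[OF Q(2,2)] by simp
qed

lemma aut_uminus: "x \<in> Qbar \<Longrightarrow> t (- x) = - t x"
  using aut_add[of x "- x"] subfield_uminus[OF is_subfield_Qbar, of x] aut_zero
  by (simp add: add_eq_0_iff)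

lemma aut_diff: "x \<in> Qbar \<Longrightarrow> y \<in> Qbar \<Longrightarrow> t (x - y) = t x - t y"
  using aut_add[of x "- y"] aut_uminus[of y] subfield_uminus[OF is_subfield_Qbar, of y] by simp

lemma aut_power: "x \<in> Qbar \<Longrightarrow> t (x ^ n) = t x ^ n"
  by (induction n) (auto simp: aut_one aut_mult subfield_power[OF is_subfield_Qbar])

lemma aut_sum: "(\<And>i. i \<in> I \<Longrightarrow> f i \<in> Qbar) \<Longrightarrow> t (sum f I) = (\<Sum>i\<in>I. t (f i))"
proof (induction I rule: infinite_finite_induct)
  case (insert i I)
  have "sum f I \<in> Qbar" using insert.prems by (intro subfield_sum[OF is_subfield_Qbar]) auto
  thus ?case using insert by (simp add: aut_add)
qed (auto simp: aut_zero)

lemma aut_prod: "(\<And>i. i \<in> I \<Longrightarrow> f i \<in> Qbar) \<Longrightarrow> t (prod f I) = (\<Prod>i\<in>I. t (f i))"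
proof (induction I rule: infinite_finite_induct)
  case (insert i I)
  have "prod f I \<in> Qbar" using insert.prems by (intro subfield_prod[OF is_subfield_Qbar]) auto
  thus ?case using insert by (simp add: aut_mult)
qed (auto simp: aut_one)

lemma aut_of_nat: "t (of_nat n) = of_nat n"
  by (induction n) (auto simp: aut_zero aut_one aut_add subfield_closed[OF is_subfield_Qbar])

lemma aut_of_int: "t (of_int n) = of_int n"
  by (cases n rule: int_cases2)
     (auto simp: aut_of_nat aut_uminus subfield_closed[OF is_subfield_Qbar])

lemma aut_inverse: "x \<in> Qbar \<Longrightarrow> t (inverse x) = inverse (t x)"
proof (cases "x = 0")
  case False
  assume x: "x \<in> Qbar"
  have "t x * t (inverse x) = 1"
    using aut_mult[OF x subfield_inverse[OF is_subfield_Qbar x]] aut_one False by simp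
  thus ?thesis using inverse_unique by metis
qed (simp add: aut_zero)

lemma aut_divide: "x \<in> Qbar \<Longrightarrow> y \<in> Qbar \<Longrightarrow> t (x / y) = t x / t y"
  using aut_mult[of x "inverse y"] aut_inverse subfield_inverse[OF is_subfield_Qbar]
  by (simp add: divide_inverse)

lemma aut_Rats: "x \<in> \<rat> \<Longrightarrow> t x = x"
  by (auto elim!: Rats_cases' simp: aut_divide aut_of_int subfield_closed[OF is_subfield_Qbar])

lemma aut_poly:
  assumes "\<And>i. coeff p i \<in> Qbar" "x \<in> Qbar" "\<And>i. t (coeff p i) = coeff p i"
  shows "t (poly p x) = poly p (t x)"
  unfolding poly_altdef
  using assms subfield_closed[OF is_subfield_Qbar] by (simp add: aut_sum aut_mult aut_power)

lemma aut_poly_Rats: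
  assumes "\<And>i. coeff p i \<in> \<rat>" "x \<in> Qbar" shows "t (poly p x) = poly p (t x)"
  using assms subfield_Rats[OF is_subfield_Qbar] aut_Rats by (intro aut_poly) auto

lemma aut_algebraic_int: "algebraic_int x \<Longrightarrow> algebraic_int (t x)"
proof -
  assume x: "algebraic_int x"
  then obtain p where p: "lead_coeff p = 1" "\<forall>i. coeff p i \<in> \<int>" "poly p x = 0"
    by (auto elim: algebraic_int.cases)
  have "t (poly p x) = poly p (t x)"
    using p(2) Ints_subset_Rats x by (intro aut_poly_Rats) (auto simp: Qbar_def)
  thus ?thesis using p aut_zero by (auto intro: algebraic_int.intros)
qed

lemma aut_nonarch_abs:
  assumes "nonarch_abs Qbar A" shows "nonarch_abs Qbar (A \<circ> t)"
  using assms aut_Qbar aut_eq_iff[OF _ subfield_zero[OF is_subfield_Qbar]] aut_zero aut_algebraic_int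
  unfolding nonarch_abs_def integers_of_def by (simp add: aut_mult aut_add)

lemma aut_inv: "is_aut (inv_into Qbar t)"
proof -
  have b: "bij_betw t Qbar Qbar" using t by (simp add: is_aut_def)
  let ?s = "inv_into Qbar t"
  have s: "bij_betw ?s Qbar Qbar" using b by (rule bij_betw_inv_into)
  have ts: "t (?s y) = y" "?s y \<in> Qbar" if "y \<in> Qbar" for y
    using that b s by (auto simp: bij_betw_inv_into_right bij_betwE)
  have st: "?s (t x) = x" if "x \<in> Qbar" for x using that b by (simp add: bij_betw_inv_into_left)
  have "?s (x + y) = ?s x + ?s y" "?s (x * y) = ?s x * ?s y" if "x \<in> Qbar" "y \<in> Qbar" for x y
  proof -
    have "?s (t (?s x + ?s y)) = ?s x + ?s y" "?s (t (?s x * ?s y)) = ?s x * ?s y"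
      using ts that subfield_closed[OF is_subfield_Qbar] by (auto intro!: st)
    thus "?s (x + y) = ?s x + ?s y" "?s (x * y) = ?s x * ?s y"
      using ts that by (simp_all add: aut_add aut_mult)
  qed
  thus ?thesis using s by (auto simp: is_aut_def)
qed

end

lemma aut_comp: "is_aut s \<Longrightarrow> is_aut t \<Longrightarrow> is_aut (s \<circ> t)"
  using bij_betw_trans[of t Qbar Qbar s Qbar] aut_Qbar[of t] unfolding is_aut_def by simp

lemma aut_id: "is_aut id"
  by (simp add: is_aut_def)

lemma aut_inv_left: "is_aut t \<Longrightarrow> x \<in> Qbar \<Longrightarrow> inv_into Qbar t (t x) = x"
  using bij_betw_inv_into_left[of t Qbar Qbar x] by (simp add: is_aut_def)

lemma aut_fixed_rational:
  assumes "x \<in> Qbar" "\<And>t. is_aut t \<Longrightarrow> t x = x" shows "x \<in> \<rat>"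
  using aut_moves[OF is_subfield_Rats subfield_Rats[OF is_subfield_Qbar] assms(1)] assms(2) by blast

section \<open>Orbits of tuples and their fibres\<close>

text \<open>Tuples are needed because several elements have to be conjugated by the same
  automorphism. The orbit plays the role of the set of embeddings of the field generated by the
  tuple.\<close>

definition orbit :: "complex list \<Rightarrow> complex list set" where
  "orbit xs = {map t xs | t. is_aut t}"

definition conjugates :: "complex \<Rightarrow> complex set" where
  "conjugates x = {t x | t. is_aut t}"

definition select :: "nat list \<Rightarrow> complex list \<Rightarrow> complex list" where
  "select js xs = map (\<lambda>j. xs ! j) js"

lemma conjugates_finite:
  assumes "x \<in> Qbar" shows "finite (conjugates x)"
proof -
  obtain p where p: "\<forall>i. coeff p i \<in> \<int>" "p \<noteq> 0" "poly p x = 0"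
    using assms unfolding Qbar_def algebraic_def by blast
  have "poly p (t x) = 0" if "is_aut t" for t
    using aut_poly_Rats[OF that, of p x] p Ints_subset_Rats assms aut_zero[OF that] by auto
  hence "conjugates x \<subseteq> {y. poly p y = 0}" by (auto simp: conjugates_def)
  thus ?thesis using poly_roots_finite[OF p(2)] finite_subset by blast
qed

lemma conjugates_self: "x \<in> conjugates x"
  unfolding conjugates_def using aut_id by (intro CollectI exI[of _ id]) auto

lemma conjugates_Qbar: "x \<in> Qbar \<Longrightarrow> conjugates x \<subseteq> Qbar"
  by (auto simp: conjugates_def aut_Qbar)

lemma orbit_finite:
  assumes "set xs \<subseteq> Qbar" shows "finite (orbit xs)"
proof -
  have "orbit xs \<subseteq> {ys. set ys \<subseteq> (\<Union>x\<in>set xs. conjugates x) \<and> length ys = length xs}"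
    unfolding orbit_def conjugates_def by fastforce
  moreover have "finite (\<Union>x\<in>set xs. conjugates x)" using assms conjugates_finite by blast
  ultimately show ?thesis using finite_lists_length_eq finite_subset by blast
qed

lemma orbit_self: "xs \<in> orbit xs"
  unfolding orbit_def using aut_id by (intro CollectI exI[of _ id]) auto

lemma orbit_length: "ys \<in> orbit xs \<Longrightarrow> length ys = length xs"
  by (auto simp: orbit_def)

lemma orbit_map: "set xs \<subseteq> Qbar \<Longrightarrow> is_aut t \<Longrightarrow> bij_betw (map t) (orbit xs) (orbit xs)"
proof -
  assume xs: "set xs \<subseteq> Qbar" and t: "is_aut t"
  have in1: "map s ys \<in> orbit xs" if s: "is_aut s" "ys \<in> orbit xs" for s ys
  proof -
    obtain u where u: "is_aut u" "ys = map u xs" using s(2) by (auto simp: orbit_def)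
    have "map s ys = map (s \<circ> u) xs" by (simp add: u)
    thus ?thesis unfolding orbit_def using aut_comp[OF s(1) u(1)] by blast
  qed
  have q: "set ys \<subseteq> Qbar" if "ys \<in> orbit xs" for ys
  proof -
    obtain u where "is_aut u" "ys = map u xs" using \<open>ys \<in> orbit xs\<close> by (auto simp: orbit_def)
    thus ?thesis using xs aut_Qbar[of u] by auto
  qed
  show ?thesis
  proof (rule bij_betw_byWitness[of _ "map (inv_into Qbar t)"])
    show "\<forall>a\<in>orbit xs. map (inv_into Qbar t) (map t a) = a"
      using q aut_inv_left[OF t] by (simp add: map_idI subset_iff)
    show "\<forall>a\<in>orbit xs. map t (map (inv_into Qbar t) a) = a"
    proof
      fix ys assume "ys \<in> orbit xs"
      moreover have "t (inv_into Qbar t y) = y" if "y \<in> Qbar" for y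
        using that t bij_betw_inv_into_right[of t Qbar Qbar y] by (simp add: is_aut_def)
      ultimately show "map t (map (inv_into Qbar t) ys) = ys" using q by (simp add: map_idI subset_iff)
    qed
    show "map t ` orbit xs \<subseteq> orbit xs" "map (inv_into Qbar t) ` orbit xs \<subseteq> orbit xs"
      using in1[OF t] in1[OF aut_inv[OF t]] by auto
  qed
qed

lemma select_orbit:
  assumes "set js \<subseteq> {..<length xs}"
  shows "select js ` orbit xs = orbit (select js xs)"
proof -
  have "select js (map t xs) = map t (select js xs)" for t
    using assms by (auto simp: select_def)
  hence "select js ` orbit xs = {map t (select js xs) | t. is_aut t}"
    unfolding orbit_def by (auto simp: image_def)
  thus ?thesis by (simp add: orbit_def)
qed

text \<open>The automorphisms act transitively on the orbit of the subtuple and permute the fibres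
  of the projection, so all fibres have the same size.\<close>

lemma orbit_fibre_card:
  assumes xs: "set xs \<subseteq> Qbar" and js: "set js \<subseteq> {..<length xs}" and u: "u \<in> orbit (select js xs)"
  shows "card {ys\<in>orbit xs. select js ys = u} * card (orbit (select js xs)) = card (orbit xs)"
proof -
  let ?T = "orbit (select js xs)"
  define F where "F u = {ys\<in>orbit xs. select js ys = u}" for u
  have sel: "select js (map t ys) = map t (select js ys)" if "ys \<in> orbit xs" for t ys
    using js orbit_length[OF that] by (auto simp: select_def)
  have sQ: "set (select js xs) \<subseteq> Qbar"
    using js by (auto simp: select_def intro!: subsetD[OF xs] nth_mem)
  have fF: "finite (F u)" for u using orbit_finite[OF xs] by (simp add: F_def)
  have le: "card (F u) \<le> card (F v)" if uv: "u \<in> ?T" "v \<in> ?T" for u v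
  proof -
    obtain s t where st: "is_aut s" "is_aut t" "u = map s (select js xs)" "v = map t (select js xs)"
      using uv unfolding orbit_def by blast
    define r where "r = t \<circ> inv_into Qbar s"
    have r: "is_aut r" using st aut_comp aut_inv by (simp add: r_def)
    have "map r u = v"
      using sQ aut_inv_left[OF st(1)] by (auto simp: st(3,4) r_def)
    have "map r ` F u \<subseteq> F v"
    proof
      fix y assume "y \<in> map r ` F u"
      then obtain o1 where o1: "o1 \<in> orbit xs" "select js o1 = u" "y = map r o1" by (auto simp: F_def)
      thus "y \<in> F v"
        using bij_betwE[OF orbit_map[OF xs r]] sel[of o1 r] \<open>map r u = v\<close> by (simp add: F_def)
    qed
    moreover have "inj_on (map r) (F u)"
      using bij_betw_imp_inj_on[OF orbit_map[OF xs r]] by (rule inj_on_subset) (auto simp: F_def)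
    ultimately show ?thesis using card_inj_on_le fF by blast
  qed
  have "orbit xs = (\<Union>v\<in>?T. F v)" using select_orbit[OF js] by (auto simp: F_def)
  hence "card (orbit xs) = (\<Sum>v\<in>?T. card (F v))"
    using card_UN_disjoint[OF orbit_finite[OF sQ], of F] fF by (simp add: F_def disjoint_iff)
  also have "\<dots> = (\<Sum>v\<in>?T. card (F u))" using le u by (intro sum.cong) (auto intro: antisym)
  finally show ?thesis by (simp add: F_def mult.commute)
qed

text \<open>Multiplicativity of degrees: when the prefix generates \<open>F\<close>, the fibre
  consists of the conjugates of the tuple over \<open>F\<close>.\<close>

lemma orbit_prefix_card:
  assumes xs: "set xs \<subseteq> Qbar" and n: "n \<le> length xs"
  shows "card {ys\<in>orbit xs. take n ys = take n xs} * card (orbit (take n xs)) = card (orbit xs)"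
proof -
  have sel: "select [0..<n] ys = take n ys" if "length ys = length xs" for ys
    using that n by (intro nth_equalityI) (auto simp: select_def)
  have "{ys\<in>orbit xs. select [0..<n] ys = select [0..<n] xs} = {ys\<in>orbit xs. take n ys = take n xs}"
    using sel orbit_length by (metis (lifting))
  thus ?thesis
    using orbit_fibre_card[OF xs, of "[0..<n]" "select [0..<n] xs"] n orbit_self sel[of xs]
    by (simp add: atLeast0LessThan)
qed

lemma orbit_singleton: "orbit [x] = (\<lambda>y. [y]) ` conjugates x"
  by (auto simp: orbit_def conjugates_def)

section \<open>Conjugates and minimal polynomials\<close>

text \<open>For algebraic \<open>x\<close> this is the minimal polynomial over the rationals, the
  conjugates being distinct.\<close>

definition conj_poly :: "complex \<Rightarrow> complex poly" where
  "conj_poly x = (\<Prod>r\<in>conjugates x. [:-r, 1:])"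

lemma coeff_linear_mult:
  fixes u :: "complex poly"
  shows "coeff ([:-s, 1:] * u) i = (if i = 0 then 0 else coeff u (i - 1)) - s * coeff u i"
  by (auto simp: coeff_pCons split: nat.splits)

lemma linear_prod_coeff_aut:
  assumes "is_aut t" "finite S" "S \<subseteq> Qbar"
  shows "coeff (\<Prod>r\<in>S. [:-r, 1:]) i \<in> Qbar \<and>
    t (coeff (\<Prod>r\<in>S. [:-r, 1:]) i) = coeff (\<Prod>r\<in>S. [:-t r, 1:]) i"
  using assms(2,3)
proof (induction S arbitrary: i rule: finite_induct)
  case empty
  thus ?case using subfield_closed[OF is_subfield_Qbar] aut_one[OF assms(1)] aut_zero[OF assms(1)]
    by (auto simp: coeff_1)
next
  case (insert r S)
  define p where "p = (\<Prod>r\<in>S. [:-r, 1:])"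
  define q where "q = (\<Prod>r\<in>S. [:-t r, 1:])"
  have IH: "coeff p i \<in> Qbar" "t (coeff p i) = coeff q i" for i
    using insert by (auto simp: p_def q_def)
  have r: "r \<in> Qbar" using insert.prems by simp
  have "(\<Prod>r\<in>insert r S. [:-r, 1:]) = [:-r, 1:] * p" "(\<Prod>r\<in>insert r S. [:-t r, 1:]) = [:-t r, 1:] * q"
    using insert.hyps unfolding p_def q_def by (rule prod.insert)+
  moreover have "coeff ([:-r, 1:] * p) i \<in> Qbar"
    unfolding coeff_linear_mult using IH(1) r subfield_closed[OF is_subfield_Qbar] by auto
  moreover have "t (coeff ([:-r, 1:] * p) i) = coeff ([:-t r, 1:] * q) i"
    unfolding coeff_linear_mult using IH r subfield_closed[OF is_subfield_Qbar]
    by (simp add: aut_diff[OF assms(1)] aut_mult[OF assms(1)] aut_uminus[OF assms(1)] aut_zero[OF assms(1)])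
  ultimately show ?case by simp
qed

lemma conjugates_bij:
  assumes "x \<in> Qbar" "is_aut t" shows "bij_betw t (conjugates x) (conjugates x)"
proof -
  have b: "bij_betw (map t) (orbit [x]) (orbit [x])" using orbit_map[of "[x]" t] assms by simp
  have "inj_on t (conjugates x)"
    using aut_inj[OF assms(2)] conjugates_Qbar[OF assms(1)] inj_on_subset by blast
  moreover have "t ` conjugates x = conjugates x"
  proof -
    have "map t ` orbit [x] = orbit [x]" using b by (simp add: bij_betw_def)
    hence "(\<lambda>y. [t y]) ` conjugates x = (\<lambda>y. [y]) ` conjugates x"
      by (simp add: orbit_singleton image_image)
    hence "hd ` (\<lambda>y. [t y]) ` conjugates x = hd ` (\<lambda>y. [y]) ` conjugates x" by simp
    thus ?thesis by (simp add: image_image)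
  qed
  ultimately show ?thesis by (simp add: bij_betw_def)
qed

lemma conj_poly_Rats:
  assumes "x \<in> Qbar" shows "coeff (conj_poly x) i \<in> \<rat>"
proof (rule aut_fixed_rational)
  note fin = conjugates_finite[OF assms] conjugates_Qbar[OF assms]
  show "coeff (conj_poly x) i \<in> Qbar"
    using linear_prod_coeff_aut[OF aut_id fin] by (simp add: conj_poly_def)
  fix t assume t: "is_aut t"
  have "(\<Prod>r\<in>conjugates x. [:-t r, 1:]) = (\<Prod>r\<in>conjugates x. [:-r, 1:])"
    by (rule prod.reindex_bij_betw[OF conjugates_bij[OF assms t]])
  thus "t (coeff (conj_poly x) i) = coeff (conj_poly x) i"
    using linear_prod_coeff_aut[OF t fin, of i] by (simp add: conj_poly_def)
qed

lemma conj_poly_degree: "x \<in> Qbar \<Longrightarrow> degree (conj_poly x) = card (conjugates x)"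
  and conj_poly_monic: "lead_coeff (conj_poly x) = 1"
  and conj_poly_root: "x \<in> Qbar \<Longrightarrow> poly (conj_poly x) y = 0 \<longleftrightarrow> y \<in> conjugates x"
proof -
  show "lead_coeff (conj_poly x) = 1" by (simp add: conj_poly_def lead_coeff_prod)
  assume x: "x \<in> Qbar"
  show "degree (conj_poly x) = card (conjugates x)"
    unfolding conj_poly_def by (subst degree_prod_eq_sum_degree) auto
  show "poly (conj_poly x) y = 0 \<longleftrightarrow> y \<in> conjugates x"
    using conjugates_finite[OF x] by (auto simp: conj_poly_def poly_prod)
qed

lemma conj_poly_int:
  assumes "algebraic_int x" shows "coeff (conj_poly x) i \<in> \<int>"
proof (rule rational_algebraic_int_is_int)
  have x: "x \<in> Qbar" using assms by (auto simp: Qbar_def)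
  show "coeff (conj_poly x) i \<in> \<rat>" by (rule conj_poly_Rats[OF x])
  have "algebraic_int (coeff (\<Prod>r\<in>S. [:-r, 1:]) i)" if "finite S" "\<And>r. r \<in> S \<Longrightarrow> algebraic_int r"
    for S :: "complex set" and i
    using that
  proof (induction S arbitrary: i rule: finite_induct)
    case (insert r S)
    have "(\<Prod>r\<in>insert r S. [:-r, 1:]) = [:-r, 1:] * (\<Prod>r\<in>S. [:-r, 1:])"
      using insert.hyps by (rule prod.insert)
    moreover have "algebraic_int (coeff ([:-r, 1:] * (\<Prod>r\<in>S. [:-r, 1:])) j)" for j
      unfolding coeff_linear_mult using insert.IH insert.prems
      by (intro algebraic_int_diff algebraic_int_mult) (auto split: if_splits)
    ultimately show ?case by (simp only:)
  qed (auto simp: coeff_1)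
  thus "algebraic_int (coeff (conj_poly x) i)"
    using conjugates_finite[OF x] aut_algebraic_int assms unfolding conj_poly_def conjugates_def by blast
qed

lemma rational_poly_conjugate_root:
  assumes "x \<in> Qbar" "\<And>i. coeff p i \<in> \<rat>" "poly p x = 0" "y \<in> conjugates x"
  shows "poly p y = 0"
  using assms aut_poly_Rats[of _ p x] aut_zero by (auto simp: conjugates_def)

lemma rational_poly_degree_ge:
  assumes "x \<in> Qbar" "\<And>i. coeff p i \<in> \<rat>" "poly p x = 0" "p \<noteq> 0"
  shows "card (conjugates x) \<le> degree p"
proof -
  have "conjugates x \<subseteq> {y. poly p y = 0}" using rational_poly_conjugate_root[OF assms(1-3)] by blast
  hence "card (conjugates x) \<le> card {y. poly p y = 0}" using poly_roots_finite[OF assms(4)] card_mono by blast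
  also have "\<dots> \<le> degree p" using poly_roots_degree[OF assms(4)] .
  finally show ?thesis .
qed

lemma card_conjugates_pos: "x \<in> Qbar \<Longrightarrow> card (conjugates x) > 0"
  using conjugates_finite conjugates_self card_gt_0_iff by blast

section \<open>Simple extensions, their degrees and embeddings\<close>

text \<open>The values at \<open>x\<close> of polynomials over \<open>K\<close> already form a
  field, since the inverse of an algebraic \<open>u\<close> is a polynomial in \<open>u\<close>.
  Division by \<open>m\<close>, which may be any nonzero polynomial vanishing at \<open>x\<close>,
  then lowers the degree.\<close>

lemma adjoin_repr:
  assumes K: "is_subfield K" "K \<subseteq> Qbar" and x: "x \<in> Qbar" and y: "y \<in> adjoin K x"
    and m: "\<forall>i. coeff m i \<in> K" "m \<noteq> 0" "poly m x = 0"
  shows "\<exists>c. (\<forall>i. c i \<in> K) \<and> y = (\<Sum>i<degree m. c i * x ^ i)"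
proof -
  \<comment> \<open>The graph of the identity on \<open>K\<close> turns
    \<open>poly_rel_division\<close> into division with remainder over \<open>K\<close>.\<close>
  define r where "r = (\<lambda>a::complex. (a, a)) ` K"
  have r: "hom_graph r"
    unfolding hom_graph_def r_def using K(2) subfield_Rats[OF K(1)] subfield_closed[OF K(1)] by auto
  have rel: "poly_rel r g h \<longleftrightarrow> g = h \<and> (\<forall>i. coeff g i \<in> K)" for g h
  proof -
    have "(coeff g i, coeff h i) \<in> r \<longleftrightarrow> coeff g i = coeff h i \<and> coeff g i \<in> K" for i
      unfolding r_def by auto
    thus ?thesis by (auto simp: poly_rel_def poly_eq_iff)
  qed
  define S where "S = {poly p x | p. \<forall>i. coeff p i \<in> K}"
  have SI: "poly p x \<in> S" if "\<forall>i. coeff p i \<in> K" for p using that by (auto simp: S_def)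
  have S_rat: "a \<in> S" if "a \<in> K" for a
    using SI[of "[:a:]"] that subfield_zero[OF K(1)] by (auto simp: coeff_pCons split: nat.splits)
  have S_diff: "u - v \<in> S" and S_mult: "u * v \<in> S" if "u \<in> S" "v \<in> S" for u v
  proof -
    obtain p q where pq: "\<forall>i. coeff p i \<in> K" "\<forall>i. coeff q i \<in> K" "u = poly p x" "v = poly q x"
      using \<open>u \<in> S\<close> \<open>v \<in> S\<close> unfolding S_def by blast
    show "u - v \<in> S" using SI[of "p - q"] pq subfield_diff[OF K(1)] by simp
    have "\<forall>i. coeff (p * q) i \<in> K"
      unfolding coeff_mult using pq by (intro allI subfield_sum[OF K(1)] subfield_mult[OF K(1)]) auto
    thus "u * v \<in> S" using SI[of "p * q"] pq by simp
  qed
  have S_poly: "poly p u \<in> S" if "\<forall>i. coeff p i \<in> K" "u \<in> S" for p u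
    using that(1)
  proof (induction p rule: pCons_induct)
    case 0 thus ?case using S_rat[OF subfield_zero[OF K(1)]] by simp
  next
    case (pCons a p)
    have a: "a \<in> K" using pCons.prems by (metis coeff_pCons_0)
    have "\<forall>i. coeff p i \<in> K" using pCons.prems by (metis coeff_pCons_Suc)
    hence "u * poly p u \<in> S" using pCons.IH S_mult that(2) by blast
    hence "(-1) * (u * poly p u) \<in> S" by (rule S_mult[OF S_rat[OF subfield_uminus[OF K(1) subfield_one[OF K(1)]]]])
    hence "a - (-1) * (u * poly p u) \<in> S" by (rule S_diff[OF S_rat[OF a]])
    thus ?case by simp
  qed
  have S_Qbar: "S \<subseteq> Qbar"
    using x K(2) by (auto simp: S_def intro!: subfield_poly[OF is_subfield_Qbar])
  have "is_subfield S"
    unfolding is_subfield_def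
  proof (intro conjI ballI)
    show "1 \<in> S" by (rule S_rat[OF subfield_one[OF K(1)]])
    fix u assume u: "u \<in> S"
    show "inverse u \<in> S"
    proof (cases "u = 0")
      case False
      have "algebraic u" using u S_Qbar by (auto simp: Qbar_def)
      then obtain p where p: "\<forall>i. coeff p i \<in> \<int>" "coeff p 0 \<noteq> 0" "poly p u = 0"
        using algebraic_nonzero_const False by blast
      obtain c q where pq: "p = pCons c q" by (cases p) auto
      have IK: "\<int> \<subseteq> K" using subfield_of_int[OF K(1)] by (auto elim: Ints_cases)
      have c: "c \<noteq> 0" "c \<in> K" using p pq IK by (auto dest: spec[of _ 0])
      have q: "\<forall>i. coeff q i \<in> K" using p(1) pq IK by (metis coeff_pCons_Suc subsetD)
      have "u * poly q u = - c" using p(3) pq by (simp add: add_eq_0_iff)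
      hence "u * (poly q u * (- inverse c)) = 1" using c(1) by (simp add: mult.assoc[symmetric])
      hence "inverse u = poly q u * (- inverse c)" by (rule inverse_unique)
      thus ?thesis using S_mult[OF S_poly[OF q u] S_rat[of "- inverse c"]] c(2)
          subfield_uminus[OF K(1) subfield_inverse[OF K(1)]] by simp
    qed (use S_rat[OF subfield_zero[OF K(1)]] in simp)
  qed (use S_diff S_mult in auto)
  moreover have "K \<subseteq> S" using S_rat by blast
  moreover have "x \<in> S" using SI[of "[:0, 1:]"] subfield_closed[OF K(1)] by (auto simp: coeff_pCons split: nat.splits)
  ultimately have "y \<in> S" using adjoin_least y by blast
  then obtain p where p: "\<forall>i. coeff p i \<in> K" "y = poly p x" by (auto simp: S_def)
  have "poly_rel r m m" "poly_rel r p p" using m(1) p(1) by (auto simp: rel)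
  from poly_rel_division[OF r this(1) m(2) this(2)] obtain q s where qs: "p = m * q + s"
    "\<forall>i. coeff s i \<in> K" "s = 0 \<or> degree s < degree m" unfolding rel by metis
  have ys: "y = poly s x" using p(2) qs(1) m(3) by simp
  have "poly s x = (\<Sum>i<degree m. coeff s i * x ^ i)"
    unfolding poly_altdef using qs(3)
    by (cases "s = 0"; intro sum.mono_neutral_cong) (auto simp: coeff_eq_0 not_le not_less)
  thus ?thesis using ys qs(2) by blast
qed

lemma adjoin_Rats_repr:
  assumes x: "x \<in> Qbar" and y: "y \<in> adjoin \<rat> x"
  shows "\<exists>c. (\<forall>i. c i \<in> \<rat>) \<and> y = (\<Sum>i<card (conjugates x). c i * x ^ i)"
proof -
  have "conj_poly x \<noteq> 0" using conj_poly_monic[of x] by auto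
  moreover have "poly (conj_poly x) x = 0" using conj_poly_root[OF x] conjugates_self by simp
  ultimately show ?thesis
    using adjoin_repr[OF is_subfield_Rats subfield_Rats[OF is_subfield_Qbar] x y, of "conj_poly x"]
      conj_poly_Rats[OF x] conj_poly_degree[OF x] by auto
qed

lemma CC_combine_eq_sum_min:
  "CC.combine Ks Us = (\<Sum>i<min (length Ks) (length Us). Ks ! i * Us ! i)"
proof (induction Ks arbitrary: Us)
  case (Cons k Ks)
  thus ?case by (cases Us) (simp_all add: sum.lessThan_Suc_shift del: sum.lessThan_Suc)
qed simp

lemma degree_adjoin_Rats:
  assumes x: "x \<in> Qbar"
  shows "degree_over_Q (adjoin \<rat> x) = card (conjugates x)"
proof -
  define d where "d = card (conjugates x)"
  define Us where "Us = map (\<lambda>i. x ^ i) [0..<d]"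
  have len: "length Us = d" and nth: "\<And>i. i < d \<Longrightarrow> Us ! i = x ^ i" by (auto simp: Us_def)
  have "CC.independent \<rat> Us"
  proof (rule CC.trivial_combine_imp_independent[OF subfield_Rats_CC])
    fix Ks assume Ks: "set Ks \<subseteq> \<rat>" "CC.combine Ks Us = \<zero>\<^bsub>CC\<^esub>"
    define k where "k = min (length Ks) d"
    define p where "p = (\<Sum>i<k. monom (Ks ! i) i)"
    have cp: "coeff p i = (if i < k then Ks ! i else 0)" for i
      by (simp add: p_def coeff_sum coeff_monom)
    have "poly p x = (\<Sum>i<k. Ks ! i * x ^ i)" by (simp add: p_def poly_sum poly_monom)
    also have "\<dots> = (\<Sum>i<k. Ks ! i * Us ! i)" by (intro sum.cong) (auto simp: nth k_def)
    also have "\<dots> = 0" using Ks(2) by (simp add: CC_combine_eq_sum_min len k_def)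
    finally have "poly p x = 0" .
    moreover have "coeff p i \<in> \<rat>" for i using Ks(1) by (auto simp: cp k_def)
    moreover have "degree p < d" if "p \<noteq> 0"
    proof -
      have "coeff p (degree p) \<noteq> 0" using that by simp
      thus ?thesis by (metis cp k_def min_less_iff_conj)
    qed
    ultimately have "p = 0" using rational_poly_degree_ge[OF x, of p] by (force simp: d_def)
    hence "Ks ! i = 0" if "i < k" for i using cp[of i] that by simp
    thus "set (take (length Us) Ks) \<subseteq> {\<zero>\<^bsub>CC\<^esub>}"
      by (auto simp: len in_set_conv_nth k_def)
  qed simp
  moreover have "CC.Span \<rat> Us = adjoin \<rat> x"
  proof
    show "CC.Span \<rat> Us \<subseteq> adjoin \<rat> x"
    proof
      fix y assume "y \<in> CC.Span \<rat> Us"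
      then obtain Ks where Ks: "set Ks \<subseteq> \<rat>" "length Ks = length Us" "y = CC.combine Ks Us"
        using CC.Span_mem_iff_length_version[OF subfield_Rats_CC, of Us y] by auto
      have "\<rat> \<subseteq> adjoin \<rat> x" by (rule adjoin_superset)
      hence "Ks ! i * Us ! i \<in> adjoin \<rat> x" if "i < d" for i
        using that Ks len nth adjoin_mem[of x \<rat>] subfield_closed[OF adjoin_is_subfield[of \<rat> x]]
        by (metis nth_mem subsetD)
      thus "y \<in> adjoin \<rat> x"
        unfolding Ks(3) CC_combine_eq_sum_min using Ks(2) len
        by (intro subfield_sum[OF adjoin_is_subfield]) auto
    qed
    show "adjoin \<rat> x \<subseteq> CC.Span \<rat> Us"
    proof
      fix y assume "y \<in> adjoin \<rat> x"
      then obtain c where c: "\<forall>i. c i \<in> \<rat>" "y = (\<Sum>i<d. c i * x ^ i)"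
        using adjoin_Rats_repr[OF x] d_def by blast
      have "y = CC.combine (map c [0..<d]) Us"
        unfolding CC_combine_eq_sum_min using c(2) by (auto simp: len nth intro!: sum.cong)
      moreover have "set (map c [0..<d]) \<subseteq> \<rat>" "length (map c [0..<d]) = length Us"
        using c(1) by (auto simp: len)
      ultimately show "y \<in> CC.Span \<rat> Us"
        using CC.Span_mem_iff_length_version[OF subfield_Rats_CC, of Us y] by (metis CC_simps(1) subset_UNIV)
    qed
  qed
  ultimately have "CC.dimension d \<rat> (adjoin \<rat> x)"
    using CC.dimensionI[OF subfield_Rats_CC, of Us] len by blast
  thus ?thesis
    unfolding degree_over_Q_def d_def
    using CC.dimI[OF subfield_Rats_CC] by (simp add: over_def)
qed

lemma subfield_ring_simps [simp]:
  "carrier (subfield_ring E) = E" "x \<otimes>\<^bsub>subfield_ring E\<^esub> y = x * y"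
  "\<one>\<^bsub>subfield_ring E\<^esub> = 1" "\<zero>\<^bsub>subfield_ring E\<^esub> = 0" "x \<oplus>\<^bsub>subfield_ring E\<^esub> y = x + y"
  by (simp_all add: subfield_ring_def)

text \<open>Evaluation at \<open>x\<close> is a bijection from embeddings to conjugates: the image
  of \<open>x\<close> determines an embedding, being extensional, and is a root of the minimal
  polynomial; conversely a conjugate comes from an automorphism, which is restricted.\<close>

lemma sum_field_embeddings:
  assumes x: "x \<in> Qbar"
  shows "(\<Sum>\<sigma>\<in>field_embeddings (adjoin \<rat> x). g (\<sigma> x)) = (\<Sum>y\<in>conjugates x. g y)"
proof -
  let ?E = "adjoin \<rat> x"
  note E = adjoin_is_subfield[of \<rat> x]
  have EQ: "?E \<subseteq> Qbar" using x subfield_Rats[OF is_subfield_Qbar] adjoin_least[OF is_subfield_Qbar] by blast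
  have emb: "s \<in> field_embeddings ?E \<longleftrightarrow> s \<in> extensional ?E \<and> s 1 = 1 \<and>
    (\<forall>u\<in>?E. \<forall>v\<in>?E. s (u + v) = s u + s v \<and> s (u * v) = s u * s v)" for s
    by (auto simp: field_embeddings_def Ring.ring_hom_def)
  have expand: "s (\<Sum>i\<in>I. c i * x ^ i) = (\<Sum>i\<in>I. c i * s x ^ i)"
    if s: "s \<in> field_embeddings ?E" and c: "\<forall>i. c i \<in> \<rat>" and I: "finite I" for s c and I :: "nat set"
  proof -
    have sa: "s (u + v) = s u + s v" and sm: "s (u * v) = s u * s v" if "u \<in> ?E" "v \<in> ?E" for u v
      using that s emb by auto
    have s1: "s 1 = 1" using s emb by blast
    have xE: "x \<in> ?E" by (rule adjoin_mem)
    have RE: "\<rat> \<subseteq> ?E" by (rule adjoin_superset)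
    have s0: "s 0 = 0" using sa[of 0 0] subfield_closed[OF E] by simp
    have spow: "s (x ^ i) = s x ^ i" for i
      by (induction i) (auto simp: s1 sm xE subfield_closed[OF E])
    have snat: "s (of_nat n) = of_nat n" for n
      by (induction n) (auto simp: s0 s1 sa subfield_closed[OF E])
    have sneg: "s (- u) = - s u" if "u \<in> ?E" for u
      using sa[of u "- u"] that s0 subfield_closed[OF E] by (simp add: add_eq_0_iff)
    have sint: "s (of_int n) = of_int n" for n
      by (cases n rule: int_cases2) (auto simp: snat sneg subfield_closed[OF E])
    have srat: "s q = q" if "q \<in> \<rat>" for q
    proof -
      obtain a b where ab: "b > 0" "q = of_int a / of_int b" using \<open>q \<in> \<rat>\<close> by (auto elim: Rats_cases')
      have "s (q * of_int b) = s q * of_int b"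
        using that RE sint[of b] subfield_closed[OF E] by (subst sm) auto
      moreover have "s (q * of_int b) = of_int a" using ab sint[of a] by simp
      ultimately have "s q * of_int b = q * of_int b" using ab by simp
      thus ?thesis using ab(1) by (simp only: mult_cancel_right) simp
    qed
    have cE: "c i * x ^ i \<in> ?E" "s (c i * x ^ i) = c i * s x ^ i" for i
      using c RE xE subfield_closed[OF E] srat spow sm by (auto simp: subset_iff)
    show ?thesis
      using I by (induction I rule: finite_induct) (auto simp: s0 sa cE subfield_sum[OF E])
  qed
  have "bij_betw (\<lambda>s. s x) (field_embeddings ?E) (conjugates x)"
    unfolding bij_betw_def
  proof
    show "inj_on (\<lambda>s. s x) (field_embeddings ?E)"
    proof (rule inj_onI)
      fix s t assume st: "s \<in> field_embeddings ?E" "t \<in> field_embeddings ?E" "s x = t x"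
      show "s = t"
      proof (rule extensionalityI[of _ ?E])
        show "s \<in> extensional ?E" "t \<in> extensional ?E" using st emb by auto
        fix y assume "y \<in> ?E"
        then obtain c where c: "\<forall>i. c i \<in> \<rat>" "y = (\<Sum>i<card (conjugates x). c i * x ^ i)"
          using adjoin_Rats_repr[OF x] by blast
        show "s y = t y" using expand[OF st(1) c(1)] expand[OF st(2) c(1)] st(3) c(2) by simp
      qed
    qed
    show "(\<lambda>s. s x) ` field_embeddings ?E = conjugates x"
    proof
      show "(\<lambda>s. s x) ` field_embeddings ?E \<subseteq> conjugates x"
      proof
        fix y assume "y \<in> (\<lambda>s. s x) ` field_embeddings ?E"
        then obtain s where s: "s \<in> field_embeddings ?E" "y = s x" by blast
        have "s (poly (conj_poly x) x) = poly (conj_poly x) y"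
          unfolding poly_altdef s(2) using conj_poly_Rats[OF x] by (intro expand[OF s(1)]) auto
        moreover have "poly (conj_poly x) x = 0" using conj_poly_root[OF x] conjugates_self by simp
        moreover have "s 0 = 0"
          using s(1) emb subfield_zero[OF E] by (metis add_cancel_right_right add_0)
        ultimately show "y \<in> conjugates x" using conj_poly_root[OF x] by simp
      qed
      show "conjugates x \<subseteq> (\<lambda>s. s x) ` field_embeddings ?E"
      proof
        fix y assume "y \<in> conjugates x"
        then obtain t where t: "is_aut t" "y = t x" by (auto simp: conjugates_def)
        have "restrict t ?E \<in> field_embeddings ?E"
          unfolding emb using EQ subfield_closed[OF E] aut_add[OF t(1)] aut_mult[OF t(1)] aut_one[OF t(1)]
          by (auto simp: subset_iff)
        thus "y \<in> (\<lambda>s. s x) ` field_embeddings ?E" using t adjoin_mem[of x \<rat>]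
          by (intro image_eqI[of _ _ "restrict t ?E"]) auto
      qed
    qed
  qed
  thus ?thesis by (rule sum.reindex_bij_betw)
qed

section \<open>The nonarchimedean part of the height\<close>

lemma finite_places_eq: "is_subfield E \<Longrightarrow> finite_places E = {P. is_prime E P \<and> P \<noteq> {0}}"
  by (auto simp: finite_places_def primeideal_iff)

context
  fixes E assumes nf: "number_field E"
begin

lemmas nfE = number_field_is_subfield[OF nf]
lemmas nfO = nf_integers[OF nf]

lemma integers_subset: "integers_of E \<subseteq> E" by (auto simp: integers_of_def)

text \<open>Ideals containing \<open>b\<close> are determined by their trace on a finite system of
  representatives modulo \<open>b\<close>, so a maximal proper ideal above \<open>I\<close> is found
  by counting; it is prime.\<close>

lemma proper_ideal_in_prime:
  assumes I: "is_ideal E I" "1 \<notin> I" and b: "b \<in> I" "b \<noteq> 0"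
  shows "\<exists>P. is_prime E P \<and> I \<subseteq> P"
proof -
  let ?O = "integers_of E"
  have bO: "b \<in> ?O" using I b by (auto simp: is_ideal_def)
  obtain R where R: "finite R" "R \<subseteq> ?O" "\<forall>x\<in>?O. \<exists>r\<in>R. \<exists>w\<in>?O. x = r + b * w"
    using residue_reps[OF nf bO b(2)] by blast
  define good where "good J \<longleftrightarrow> is_ideal E J \<and> 1 \<notin> J \<and> I \<subseteq> J" for J
  define m where "m J = card (R \<inter> J)" for J
  have "m J < Suc (card R)" for J unfolding m_def using R(1) by (simp add: card_mono less_Suc_eq_le)
  moreover have "good I" using I by (simp add: good_def)
  ultimately have "\<exists>J. good J \<and> (\<forall>K. good K \<longrightarrow> m K \<le> m J)"
    by (intro ex_has_greatest_nat) auto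
  then obtain J where J: "good J" "\<forall>K. good K \<longrightarrow> m K \<le> m J" by blast
  have JI: "is_ideal E J" and J1: "1 \<notin> J" and IJ: "I \<subseteq> J" using J(1) by (auto simp: good_def)
  have max: "K = J" if K: "good K" "J \<subseteq> K" for K
  proof
    have eq: "R \<inter> J = R \<inter> K"
      using K J(2) R(1) unfolding m_def by (intro card_seteq) auto
    show "K \<subseteq> J"
    proof
      fix x assume x: "x \<in> K"
      have KI: "is_ideal E K" "b \<in> K" using K b by (auto simp: good_def)
      have "x \<in> ?O" using x KI(1) by (auto simp: is_ideal_def)
      then obtain r w where rw: "r \<in> R" "w \<in> ?O" "x = r + b * w" using R(3) by blast
      have "b * w \<in> K" "b * w \<in> J"
        using is_ideal_mult(1)[OF KI(1,2) rw(2)] is_ideal_mult(1)[OF JI _ rw(2), of b] b IJ by auto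
      hence "r \<in> K" using is_ideal_diff[OF nfE KI(1) x, of "b * w"] rw(3) by simp
      hence "r \<in> J" using eq rw(1) by blast
      thus "x \<in> J" using JI \<open>b * w \<in> J\<close> rw(3) unfolding is_ideal_def by blast
    qed
  qed (rule K)
  have "is_prime E J"
    unfolding is_prime_def
  proof (intro conjI ballI impI)
    fix x y assume xy: "x \<in> ?O" "y \<in> ?O" "x * y \<in> J"
    show "x \<in> J \<or> y \<in> J"
    proof (rule ccontr)
      assume n: "\<not> ?thesis"
      define K where "K = {j + x * r | j r. j \<in> J \<and> r \<in> ?O}"
      have JO: "J \<subseteq> ?O" and J0: "0 \<in> J" using JI by (auto simp: is_ideal_def)
      have KI: "is_ideal E K"
        unfolding is_ideal_def
      proof (intro conjI ballI)
        show "K \<subseteq> ?O" using JO xy(1) by (auto simp: K_def intro!: nfO)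
        show "0 \<in> K" unfolding K_def using J0 nfO(2) by (intro CollectI exI[of _ 0]) auto
        fix u v assume "u \<in> K" "v \<in> K"
        then obtain j r k s where "j \<in> J" "r \<in> ?O" "k \<in> J" "s \<in> ?O" "u = j + x * r" "v = k + x * s"
          by (auto simp: K_def)
        moreover from this have "j + k \<in> J" using JI by (simp add: is_ideal_def)
        moreover from calculation have "u + v = (j + k) + x * (r + s)" by (simp add: algebra_simps)
        ultimately show "u + v \<in> K" unfolding K_def using nfO(3) by blast
      next
        fix u v assume u: "u \<in> ?O" and "v \<in> K"
        then obtain k s where "k \<in> J" "s \<in> ?O" "v = k + x * s" by (auto simp: K_def)
        moreover from this have "u * k \<in> J" using JI u by (simp add: is_ideal_def)
        moreover from calculation have "u * v = u * k + x * (u * s)" by (simp add: algebra_simps)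
        ultimately show "u * v \<in> K" unfolding K_def using nfO(5) u by blast
      qed
      have JK: "J \<subseteq> K"
      proof
        fix j assume "j \<in> J"
        thus "j \<in> K" unfolding K_def using nfO(2) by (intro CollectI exI[of _ j] exI[of _ 0]) auto
      qed
      have "x \<in> K" unfolding K_def using J0 nfO(1) by (intro CollectI exI[of _ 0] exI[of _ 1]) auto
      hence "K \<noteq> J" using n by blast
      hence "1 \<in> K" using max[of K] KI JK IJ unfolding good_def by blast
      then obtain j r where jr: "j \<in> J" "r \<in> ?O" "1 = j + x * r" by (auto simp: K_def)
      have "y = y * j + (x * y) * r" using arg_cong[OF jr(3), of "\<lambda>z. y * z"] by (simp add: algebra_simps)
      moreover have "y * j \<in> J" "(x * y) * r \<in> J"
        using is_ideal_mult(2)[OF JI jr(1) xy(2)] is_ideal_mult(1)[OF JI xy(3) jr(2)] by auto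
      ultimately have "y \<in> J" using JI unfolding is_ideal_def by metis
      thus False using n by blast
    qed
  qed (use JI J1 in auto)
  thus ?thesis using IJ by blast
qed

text \<open>The denominators of \<open>x\<close> form an ideal. Were it proper, it would lie in a
  prime \<open>P\<close>; but nonnegative order at \<open>P\<close> provides a denominator outside
  \<open>P\<close>.\<close>

lemma integer_of_ord_nonneg:
  assumes x: "x \<in> E" "x \<noteq> 0" and ord: "\<And>P. is_prime E P \<Longrightarrow> P \<noteq> {0} \<Longrightarrow> ord_at E P x \<ge> 0"
  shows "x \<in> integers_of E"
proof -
  let ?O = "integers_of E"
  obtain n :: int where n: "n > 0" "of_int n * x \<in> ?O"
    using integer_multiple_in_field[OF nfE number_field_subset_Qbar[OF nf] x(1)] by blast
  define b :: complex where "b = of_int n"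
  have b: "b \<noteq> 0" "b \<in> ?O" using n(1) nfO(8) by (auto simp: b_def)
  define I where "I = {r \<in> ?O. r * x \<in> ?O}"
  have I: "is_ideal E I"
    unfolding is_ideal_def I_def
  proof (intro conjI ballI)
    fix u v assume uv: "u \<in> {r \<in> ?O. r * x \<in> ?O}" "v \<in> {r \<in> ?O. r * x \<in> ?O}"
    have "(u + v) * x = u * x + v * x" by (simp add: algebra_simps)
    thus "u + v \<in> {r \<in> ?O. r * x \<in> ?O}" using uv nfO(3) by auto
  next
    fix u v assume uv: "u \<in> ?O" "v \<in> {r \<in> ?O. r * x \<in> ?O}"
    hence "u * (v * x) \<in> ?O" using nfO(5) by blast
    hence "(u * v) * x \<in> ?O" by (simp only: mult.assoc)
    thus "u * v \<in> {r \<in> ?O. r * x \<in> ?O}" using uv nfO(5) by blast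
  qed (use nfO(2) in auto)
  have bI: "b \<in> I" using n b by (simp add: I_def b_def)
  have "1 \<in> I"
  proof (rule ccontr)
    assume "1 \<notin> I"
    then obtain P where P: "is_prime E P" "I \<subseteq> P" using proper_ideal_in_prime[OF I _ bI b(1)] by blast
    have P0: "P \<noteq> {0}" using bI b P(2) by blast
    obtain a v where av: "a \<in> ?O" "v \<in> ?O - P" "x = a / v"
      using ord_at_fraction[OF nf P(1) P0 x ord[OF P(1) P0]] by blast
    have "v \<noteq> 0" using prime_unit_nonzero[OF nf P(1) P0 av(2)] .
    hence "v * x = a" using av(3) by simp
    hence "v \<in> I" using av by (simp add: I_def)
    thus False using P(2) av(2) by blast
  qed
  thus ?thesis by (simp add: I_def)
qed

section \<open>Residue fields and elements with bounded poles\<close>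

definition residue :: "complex set \<Rightarrow> complex \<Rightarrow> complex set" where
  "residue P x = {h + x | h. h \<in> P}"

context
  fixes P assumes P: "is_prime E P" and P0: "P \<noteq> {0}"
begin

lemma quotient_carrier: "carrier (integer_ring E Quot P) = residue P ` integers_of E"
  by (auto simp: FactRing_def A_RCOSETS_def' a_r_coset_def' residue_def)

lemma residue_eq_iff:
  assumes "x \<in> integers_of E" "y \<in> integers_of E"
  shows "residue P x = residue P y \<longleftrightarrow> x - y \<in> P"
proof
  assume "residue P x = residue P y"
  moreover have "x \<in> residue P x"
    using prime_props(2)[OF nf P P0] unfolding residue_def by (intro CollectI exI[of _ 0]) auto
  ultimately have "x \<in> residue P y" by simp
  then obtain h where "h \<in> P" "x = h + y" by (auto simp: residue_def)
  thus "x - y \<in> P" by simp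
next
  have *: "residue P x \<subseteq> residue P y" if "x - y \<in> P" for x y
  proof
    fix z assume "z \<in> residue P x"
    then obtain h where "h \<in> P" "z = h + x" by (auto simp: residue_def)
    hence "z = (h + (x - y)) + y" "h + (x - y) \<in> P" using that prime_props(3)[OF nf P P0] by auto
    thus "z \<in> residue P y" unfolding residue_def by blast
  qed
  assume xy: "x - y \<in> P"
  hence "- (x - y) \<in> P" using is_ideal_uminus[OF nfE prime_ideal[OF nf P P0]] by blast
  thus "residue P x = residue P y" using *[OF xy] *[of y x] by simp
qed

lemma residue_finite: "finite (residue P ` integers_of E)"
proof -
  obtain b where b: "b \<in> P" "b \<noteq> 0" using P0 prime_props(2)[OF nf P P0] by blast
  have bO: "b \<in> integers_of E" using b prime_subset[OF nf P P0] by blast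
  obtain R where R: "finite R" "R \<subseteq> integers_of E"
    "\<forall>x\<in>integers_of E. \<exists>r\<in>R. \<exists>w\<in>integers_of E. x = r + b * w"
    using residue_reps[OF nf bO b(2)] by blast
  have "residue P ` integers_of E \<subseteq> residue P ` R"
  proof
    fix z assume "z \<in> residue P ` integers_of E"
    then obtain x where x: "x \<in> integers_of E" "z = residue P x" by blast
    then obtain r w where rw: "r \<in> R" "w \<in> integers_of E" "x = r + b * w" using R(3) by blast
    have "x - r \<in> P" using rw(3) prime_props(6)[OF nf P P0 b(1) rw(2)] by simp
    hence "residue P x = residue P r" using residue_eq_iff[of x r] x rw R(2) by blast
    thus "z \<in> residue P ` R" using x rw by blast
  qed
  thus ?thesis using R(1) finite_subset by blast
qed

lemma residue_card_ge_2: "card (carrier (integer_ring E Quot P)) \<ge> 2"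
proof -
  have "residue P 1 \<noteq> residue P 0"
    using residue_eq_iff[of 1 0] nfO prime_props(1)[OF nf P P0] by simp
  hence "card {residue P 0, residue P 1} = 2" by simp
  moreover have "{residue P 0, residue P 1} \<subseteq> residue P ` integers_of E" using nfO(1,2) by blast
  ultimately show ?thesis unfolding quotient_carrier using card_mono[OF residue_finite] by metis
qed

lemma residue_approx:
  assumes x: "x \<in> E" and ord: "x = 0 \<or> ord_at E P x \<ge> 0"
  shows "\<exists>c\<in>integers_of E. x = c \<or> ord_at E P (x - c) \<ge> 1"
proof (cases "x = 0")
  case True
  thus ?thesis using nfO(2) by blast
next
  case False
  then obtain a v where av: "a \<in> integers_of E" "v \<in> integers_of E - P" "x = a / v"
    using ord_at_fraction[OF nf P P0 x] ord by blast
  have v0: "v \<noteq> 0" using prime_unit_nonzero[OF nf P P0 av(2)] .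
  obtain w where w: "w \<in> integers_of E" "1 - v * w \<in> P" using prime_maximal[OF nf P P0, of v] av by blast
  have e: "x - a * w = a * (1 - v * w) / v" using v0 by (simp add: av(3) field_simps)
  have num: "a * (1 - v * w) \<in> P" using prime_props(5)[OF nf P P0 av(1) w(2)] .
  have "x = a * w \<or> ord_at E P (x - a * w) \<ge> 1"
  proof (cases "a * (1 - v * w) = 0")
    case False
    have numO: "a * (1 - v * w) \<in> integers_of E" using num prime_subset[OF nf P P0] by blast
    have "ord_at E P v = 0"
      using ord_at_pos_iff[OF nf P P0, of v] ord_at_nonneg[OF nf P P0, of v] av(2) v0 by force
    hence "ord_at E P (x - a * w) = ord_at E P (a * (1 - v * w))"
      unfolding e using ord_at_divide[OF nf P P0, of "a * (1 - v * w)" v] numO av v0 False integers_subset by auto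
    thus ?thesis using ord_at_pos_iff[OF nf P P0 numO False] num by simp
  next
    case True
    hence "x - a * w = 0" unfolding e by simp
    thus ?thesis by simp
  qed
  thus ?thesis using nfO(5)[OF av(1) w(1)] by blast
qed

end

definition residue_card :: "complex set \<Rightarrow> nat" where
  "residue_card P = card (carrier (integer_ring E Quot P))"

text \<open>The fractional ideal given by the product of the inverse powers of \<open>P\<close> with
  exponent \<open>m P\<close>, over \<open>P\<close> in \<open>T\<close>.\<close>

definition polar :: "complex set set \<Rightarrow> (complex set \<Rightarrow> nat) \<Rightarrow> complex set" where
  "polar T m = {y \<in> E. \<forall>P. is_prime E P \<longrightarrow> P \<noteq> {0} \<longrightarrow>
     y = 0 \<or> ord_at E P y \<ge> (if P \<in> T then - int (m P) else 0)}"

lemma ord_ge_diff: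
  assumes P: "is_prime E P" "P \<noteq> {0}" and xy: "x \<in> E" "y \<in> E" "x = 0 \<or> ord_at E P x \<ge> k" "y = 0 \<or> ord_at E P y \<ge> k"
  shows "x - y = 0 \<or> ord_at E P (x - y) \<ge> k"
proof -
  have m1: "- y \<in> E" using xy(2) subfield_closed[OF nfE] by auto
  have "ord_at E P (- y) = ord_at E P y" if "y \<noteq> 0"
  proof -
    have o: "-1 \<in> E" using subfield_closed[OF nfE] by auto
    have "ord_at E P (-1) + ord_at E P (-1) = 0"
      using ord_at_mult[OF nf P o o] ord_at_one[OF nf P] by simp
    thus ?thesis using ord_at_mult[OF nf P o xy(2)] that by simp
  qed
  thus ?thesis using ord_at_add[OF nf P xy(1) m1, of k] xy by (cases "x = 0"; cases "y = 0") auto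
qed

lemma polar_diff: "x \<in> polar T m \<Longrightarrow> y \<in> polar T m \<Longrightarrow> x - y \<in> polar T m"
  using ord_ge_diff subfield_diff[OF nfE] unfolding polar_def by (simp; metis)

text \<open>Reducing modulo \<open>P\<close> after multiplication by a power of a uniformizer lowers the pole order
  at \<open>P\<close> by one at the cost of a factor \<open>N(P)\<close>.\<close>

lemma polar_classes_card:
  assumes T: "finite T" "T \<subseteq> finite_places E"
    and S: "finite S" "S \<subseteq> polar T m" "\<And>x y. x \<in> S \<Longrightarrow> y \<in> S \<Longrightarrow> x - y \<in> integers_of E \<Longrightarrow> x = y"
  shows "card S \<le> (\<Prod>P\<in>T. residue_card P ^ m P)"
  using S
proof (induction "\<Sum>P\<in>T. m P" arbitrary: m S rule: less_induct)
  case less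
  show ?case
  proof (cases "\<forall>P\<in>T. m P = 0")
    case True
    have "x \<in> integers_of E" if "x \<in> polar T m" for x
    proof (cases "x = 0")
      case False
      have "ord_at E P x \<ge> 0" if "is_prime E P" "P \<noteq> {0}" for P
        using \<open>x \<in> polar T m\<close> True False that by (cases "P \<in> T") (auto simp: polar_def)
      thus ?thesis using integer_of_ord_nonneg[of x] False \<open>x \<in> polar T m\<close> by (auto simp: polar_def)
    qed (use nfO(2) in simp)
    hence "x = y" if "x \<in> S" "y \<in> S" for x y
      using that less.prems(2,3) polar_diff by blast
    hence "card S \<le> 1" by (metis card_eq_0_iff card_le_Suc0_iff_eq less.prems(1) One_nat_def)
    thus ?thesis using True by simp
  next
    case False
    then obtain P where PT: "P \<in> T" "m P \<noteq> 0" by blast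
    define k where "k = m P"
    define m' where "m' = m(P := k - 1)"
    have k0: "k > 0" using PT by (simp add: k_def)
    have P: "is_prime E P" "P \<noteq> {0}" using PT T(2) finite_places_eq[OF nfE] by auto
    obtain p where p: "p \<in> P" "p \<noteq> 0" "ord_at E P p = 1" using ord_at_uniformizer[OF nf P] by blast
    have pE: "p \<in> E" using p prime_subset[OF nf P] integers_subset by blast
    have pkE: "p ^ k \<in> E" "p ^ k \<noteq> 0" using pE p(2) subfield_power[OF nfE] by auto
    have ordk: "ord_at E P (p ^ n) = int n" for n
    proof (induction n)
      case 0 show ?case using ord_at_one[OF nf P] by simp
    next
      case (Suc n)
      thus ?case using ord_at_mult[OF nf P pE subfield_power[OF nfE pE, of n]] p by simp
    qed
    have sE: "y \<in> E" and sP: "y = 0 \<or> ord_at E P y \<ge> - int k" if "y \<in> S" for y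
    proof -
      have "y \<in> polar T m" using that less.prems(2) by blast
      thus "y \<in> E" "y = 0 \<or> ord_at E P y \<ge> - int k"
        using P PT(1) by (auto simp only: polar_def k_def if_True mem_Collect_eq)
    qed
    have app: "\<exists>c\<in>integers_of E. p ^ k * y = c \<or> ord_at E P (p ^ k * y - c) \<ge> 1" if y: "y \<in> S" for y
    proof (rule residue_approx[OF P])
      show "p ^ k * y \<in> E" using pkE sE[OF y] subfield_mult[OF nfE] by blast
      show "p ^ k * y = 0 \<or> 0 \<le> ord_at E P (p ^ k * y)"
        using ord_at_mult[OF nf P pkE(1) sE[OF y] pkE(2)] ordk sP[OF y] by auto
    qed
    then obtain c where c: "\<And>y. y \<in> S \<Longrightarrow> c y \<in> integers_of E"
      "\<And>y. y \<in> S \<Longrightarrow> p ^ k * y = c y \<or> ord_at E P (p ^ k * y - c y) \<ge> 1" by metis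
    define f where "f y = residue P (c y)" for y
    have fO: "f ` S \<subseteq> residue P ` integers_of E" using c(1) by (auto simp: f_def)
    have fcard: "card (f ` S) \<le> residue_card P"
      unfolding residue_card_def quotient_carrier[OF P] using card_mono[OF residue_finite[OF P] fO] .
    \<comment> \<open>If the classes agree, then \<open>p ^ k * (x - y)\<close> has positive order
      at \<open>P\<close>, so the pole of \<open>x - y\<close> at \<open>P\<close> has order at most
      \<open>k - 1\<close>.\<close>
    have low: "x - y \<in> polar T m'" if xy: "x \<in> S" "y \<in> S" "f x = f y" for x y
    proof -
      define z where "z = x - y"
      have zm: "z \<in> polar T m"
        unfolding z_def using xy(1,2) less.prems(2) by (intro polar_diff) auto
      hence zE: "z \<in> E" by (simp add: polar_def)
      have cP: "c x - c y \<in> P" using xy residue_eq_iff[OF P c(1) c(1)] by (simp add: f_def)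
      have cO: "c x - c y \<in> integers_of E" using c(1) xy nfO(4) by blast
      define u where "u = p ^ k * x - c x"
      define v where "v = p ^ k * y - c y"
      have pz: "p ^ k * z - c z \<in> E" if "z \<in> S" for z
        using subfield_diff[OF nfE subfield_mult[OF nfE pkE(1) sE[OF that]]] c(1)[OF that]
          integers_subset by blast
      have uv: "u \<in> E" "v \<in> E" "u = 0 \<or> ord_at E P u \<ge> 1" "v = 0 \<or> ord_at E P v \<ge> 1"
        using c(2)[OF xy(1)] c(2)[OF xy(2)] pz[OF xy(1)] pz[OF xy(2)] by (auto simp: u_def v_def)
      have cc: "-(c x - c y) \<in> E" "-(c x - c y) = 0 \<or> ord_at E P (-(c x - c y)) \<ge> 1"
      proof -
        have "- (c x - c y) \<in> P" by (rule is_ideal_uminus[OF nfE prime_ideal[OF nf P] cP])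
        thus "-(c x - c y) = 0 \<or> ord_at E P (-(c x - c y)) \<ge> 1"
          using ord_at_pos_iff[OF nf P nfO(7)[OF cO]] by linarith
        show "-(c x - c y) \<in> E" using nfO(7)[OF cO] integers_subset by blast
      qed
      have uvd: "u - v \<in> E" "u - v = 0 \<or> ord_at E P (u - v) \<ge> 1"
        using ord_ge_diff[OF P uv] uv subfield_diff[OF nfE] by auto
      have "p ^ k * z = (u - v) - (-(c x - c y))" by (simp add: u_def v_def z_def algebra_simps)
      hence "p ^ k * z = 0 \<or> ord_at E P (p ^ k * z) \<ge> 1" using ord_ge_diff[OF P uvd(1) cc(1) uvd(2) cc(2)] by simp
      hence "z = 0 \<or> ord_at E P z \<ge> 1 - int k"
        using ord_at_mult[OF nf P pkE(1) zE pkE(2)] ordk[of k] pkE(2) by (cases "z = 0") auto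
      hence "z = 0 \<or> ord_at E P z \<ge> - int (m' P)" using k0 by (auto simp: m'_def)
      thus ?thesis using zm unfolding polar_def z_def[symmetric] m'_def by auto
    qed
    have less: "(\<Sum>P\<in>T. m' P) < (\<Sum>P\<in>T. m P)"
      using T(1) PT k0 by (intro sum_strict_mono_ex1) (auto simp: m'_def k_def)
    \<comment> \<open>A fibre of \<open>f\<close>, translated by one of its members, falls under the
      induction hypothesis for \<open>m'\<close>.\<close>
    have fib: "card {y\<in>S. f y = j} \<le> (\<Prod>P\<in>T. residue_card P ^ m' P)" if "j \<in> f ` S" for j
    proof -
      obtain y0 where y0: "y0 \<in> S" "f y0 = j" using \<open>j \<in> f ` S\<close> by blast
      define D where "D = (\<lambda>y. y - y0) ` {y\<in>S. f y = j}"
      have "card D \<le> (\<Prod>P\<in>T. residue_card P ^ m' P)"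
      proof (rule less.hyps[OF less])
        show "finite D" using less.prems(1) by (simp add: D_def)
        show "D \<subseteq> polar T m'" using low y0 by (auto simp: D_def)
        show "x = y" if "x \<in> D" "y \<in> D" "x - y \<in> integers_of E" for x y
          using that less.prems(3) by (auto simp: D_def)
      qed
      moreover have "card D = card {y\<in>S. f y = j}" unfolding D_def by (intro card_image) (simp add: inj_on_def)
      ultimately show ?thesis by simp
    qed
    have "card S = (\<Sum>j\<in>f ` S. card {y\<in>S. f y = j})"
    proof -
      have "card S = (\<Sum>x\<in>S. 1)" by simp
      also have "\<dots> = (\<Sum>j\<in>f ` S. \<Sum>y\<in>{y\<in>S. f y = j}. 1)"
        by (rule sum.group[symmetric]) (use less.prems(1) in auto)
      finally show ?thesis by simp
    qed
    also have "\<dots> \<le> card (f ` S) * (\<Prod>P\<in>T. residue_card P ^ m' P)"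
      using sum_bounded_above[of "f ` S" "\<lambda>j. card {y\<in>S. f y = j}"] fib by simp
    also have "\<dots> \<le> residue_card P * (\<Prod>P\<in>T. residue_card P ^ m' P)" using fcard by simp
    also have "\<dots> = (\<Prod>P\<in>T. residue_card P ^ m P)"
    proof -
      have "(\<Prod>Q\<in>T-{P}. residue_card Q ^ m' Q) = (\<Prod>Q\<in>T-{P}. residue_card Q ^ m Q)"
        by (intro prod.cong) (auto simp: m'_def)
      moreover have "residue_card P * residue_card P ^ (k - 1) = residue_card P ^ k"
        using k0 by (simp flip: power_Suc)
      ultimately show ?thesis
        using T(1) PT(1) by (simp add: prod.remove[of T P] m'_def k_def)
    qed
    finally show ?thesis .
  qed
qed

text \<open>All these primes contain a denominator \<open>b\<close> of \<open>x\<close>, and primes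
  containing \<open>b\<close> are determined by their trace on a finite system of representatives
  modulo \<open>b\<close>.\<close>

lemma finite_negative_places:
  assumes x: "x \<in> E" "x \<noteq> 0"
  shows "finite {P \<in> finite_places E. ord_at E P x < 0}"
proof -
  obtain n :: int where n: "n > 0" "of_int n * x \<in> integers_of E"
    using integer_multiple_in_field[OF nfE number_field_subset_Qbar[OF nf] x(1)] by blast
  define b :: complex where "b = of_int n"
  have b: "b \<noteq> 0" "b \<in> integers_of E" "b \<in> E" using n(1) nfO(8) integers_subset by (auto simp: b_def)
  have bP: "b \<in> P" if P: "is_prime E P" "P \<noteq> {0}" "ord_at E P x < 0" for P
  proof (rule ccontr)
    assume "b \<notin> P"
    hence "ord_at E P b \<le> 0" using ord_at_pos_iff[OF nf P(1,2) b(2,1)] by simp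
    moreover have "ord_at E P (b * x) \<ge> 0"
      using ord_at_nonneg[OF nf P(1,2)] n b x by (simp add: b_def)
    ultimately show False using ord_at_mult[OF nf P(1,2) b(3) x(1) b(1) x(2)] P(3) by simp
  qed
  obtain R where R: "finite R" "R \<subseteq> integers_of E"
    "\<forall>x\<in>integers_of E. \<exists>r\<in>R. \<exists>w\<in>integers_of E. x = r + b * w"
    using residue_reps[OF nf b(2,1)] by blast
  let ?T = "{P \<in> finite_places E. ord_at E P x < 0}"
  have sub: "P \<subseteq> Q" if PQ: "P \<in> ?T" "Q \<in> ?T" "R \<inter> P = R \<inter> Q" for P Q
  proof
    have P: "is_prime E P" "P \<noteq> {0}" "b \<in> P" and Q: "is_prime E Q" "Q \<noteq> {0}" "b \<in> Q"
      using PQ bP finite_places_eq[OF nfE] by auto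
    fix z assume z: "z \<in> P"
    hence "z \<in> integers_of E" using prime_subset[OF nf P(1,2)] by blast
    then obtain r w where rw: "r \<in> R" "w \<in> integers_of E" "z = r + b * w" using R(3) by blast
    have "z - b * w \<in> P" using prime_props(4,6)[OF nf P(1,2)] z P(3) rw(2) by blast
    hence "r \<in> Q" using rw PQ(3) by auto
    thus "z \<in> Q" using prime_props(3,6)[OF nf Q(1,2)] rw Q(3) by blast
  qed
  have "inj_on (\<lambda>P. R \<inter> P) ?T" using sub by (intro inj_onI) blast
  moreover have "finite ((\<lambda>P. R \<inter> P) ` ?T)" using R(1) by (rule finite_subset[rotated, OF finite_Pow_iff[THEN iffD2]]) auto
  ultimately show ?thesis using finite_imageD by blast
qed

end

section \<open>Finite height contributions and the leading coefficient\<close>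

lemma linear_prod_coeff_bound:
  assumes "finite S" "\<And>r. r \<in> S \<Longrightarrow> cmod r \<le> C" "C \<ge> 0"
  shows "cmod (coeff (\<Prod>r\<in>S. [:-r, 1:]) i) \<le> (1 + C) ^ card S"
  using assms(1,2)
proof (induction S arbitrary: i rule: finite_induct)
  case (insert r S)
  define p where "p = (\<Prod>r\<in>S. [:-r, 1:])"
  have IH: "cmod (coeff p i) \<le> (1 + C) ^ card S" for i using insert by (simp add: p_def)
  have "cmod (coeff ([:-r, 1:] * p) i) \<le> cmod (if i = 0 then 0 else coeff p (i - 1)) + cmod (r * coeff p i)"
    unfolding coeff_linear_mult by (rule norm_triangle_ineq4)
  also have "\<dots> \<le> (1 + C) ^ card S + C * (1 + C) ^ card S"
    using IH insert.prems assms(3) by (intro add_mono) (auto simp: norm_mult intro!: mult_mono)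
  also have "\<dots> = (1 + C) ^ card (insert r S)" using insert.hyps by (simp add: algebra_simps)
  finally show ?case using insert.hyps by (simp add: p_def)
qed auto

text \<open>Northcott's argument: the minimal polynomials have bounded degree and rational integral
  coefficients bounded in terms of \<open>C\<close> and \<open>d\<close>, so there are finitely many
  of them.\<close>

lemma finite_bounded_integers:
  "finite {z. algebraic_int z \<and> card (conjugates z) \<le> d \<and> (\<forall>y\<in>conjugates z. cmod y \<le> C)}"
    (is "finite ?Z")
proof (cases "C \<ge> 0")
  case False
  have "\<exists>y\<in>conjugates z. \<not> cmod y \<le> C" for z
    using False order.trans[OF norm_ge_zero[of z], of C] by (intro bexI[OF _ conjugates_self]) auto
  hence "?Z = {}" by blast
  thus ?thesis by (simp only: finite.emptyI)
next
  case True
  define B where "B = nat \<lceil>(1 + C) ^ d\<rceil>"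
  define L where "L = {cs :: int list. set cs \<subseteq> {- int B..int B} \<and> length cs = Suc d}"
  define R where "R = (\<Union>cs\<in>{cs\<in>L. Poly (map complex_of_int cs) \<noteq> 0}. {z. poly (Poly (map complex_of_int cs)) z = 0})"
  have "finite L" unfolding L_def by (rule finite_lists_length_eq) simp
  hence "finite R" unfolding R_def by (intro finite_UN_I) (auto intro: poly_roots_finite)
  moreover have "?Z \<subseteq> R"
  proof
    fix z assume "z \<in> ?Z"
    hence z: "algebraic_int z" "card (conjugates z) \<le> d" "\<forall>y\<in>conjugates z. cmod y \<le> C" by auto
    have zQ: "z \<in> Qbar" using z(1) by (auto simp: Qbar_def)
    have "\<forall>i. \<exists>k. coeff (conj_poly z) i = of_int k" using conj_poly_int[OF z(1)] by (meson Ints_cases)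
    then obtain k where k: "\<And>i. coeff (conj_poly z) i = of_int (k i)" by metis
    have kb: "k i \<in> {- int B..int B}" for i
    proof -
      have "real_of_int \<bar>k i\<bar> = cmod (coeff (conj_poly z) i)" by (simp add: k)
      also have "\<dots> \<le> (1 + C) ^ card (conjugates z)"
        unfolding conj_poly_def using z(3) True conjugates_finite[OF zQ] by (intro linear_prod_coeff_bound) auto
      also have "\<dots> \<le> (1 + C) ^ d" using True z(2) by (intro power_increasing) auto
      also have "\<dots> \<le> real B" unfolding B_def by linarith
      finally show ?thesis by auto
    qed
    define cs where "cs = map k [0..<Suc d]"
    have "cs \<in> L" using kb by (auto simp: L_def cs_def)
    moreover have "Poly (map complex_of_int cs) = conj_poly z"
    proof (rule poly_eqI)
      fix i
      show "coeff (Poly (map complex_of_int cs)) i = coeff (conj_poly z) i"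
      proof (cases "i < Suc d")
        case True
        thus ?thesis by (simp add: coeff_Poly_eq nth_default_def cs_def k del: upt_Suc)
      next
        case False
        hence "coeff (conj_poly z) i = 0" using conj_poly_degree[OF zQ] z(2) by (intro coeff_eq_0) simp
        thus ?thesis using False by (simp add: coeff_Poly_eq nth_default_def cs_def del: upt_Suc)
      qed
    qed
    moreover have "conj_poly z \<noteq> 0" using conj_poly_monic[of z] by auto
    moreover have "poly (conj_poly z) z = 0" using conj_poly_root[OF zQ] conjugates_self by simp
    ultimately show "z \<in> R" unfolding R_def by (intro UN_I[of cs]) auto
  qed
  ultimately show ?thesis using finite_subset by blast
qed

text \<open>The least leading coefficient of an integral polynomial vanishing at \<open>x\<close>; by Gauss' lemma
  it is the leading coefficient of the primitive minimal polynomial.\<close>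

definition lead_denom :: "complex \<Rightarrow> nat" where
  "lead_denom x = (LEAST a. a > 0 \<and> (\<exists>p. p \<noteq> 0 \<and> (\<forall>i. coeff p i \<in> \<int>) \<and> poly p x = 0 \<and>
     lead_coeff p = of_nat a))"

lemma lead_denom:
  assumes "x \<in> Qbar"
  shows "lead_denom x > 0" "\<exists>p. p \<noteq> 0 \<and> (\<forall>i. coeff p i \<in> \<int>) \<and> poly p x = 0 \<and>
    lead_coeff p = of_nat (lead_denom x)"
  and lead_denom_le: "\<And>p c. p \<noteq> 0 \<Longrightarrow> \<forall>i. coeff p i \<in> \<int> \<Longrightarrow> poly p x = 0 \<Longrightarrow> lead_coeff p = of_int c \<Longrightarrow>
    int (lead_denom x) \<le> \<bar>c\<bar>"
proof -
  define Q where "Q a \<longleftrightarrow> a > 0 \<and> (\<exists>p. p \<noteq> 0 \<and> (\<forall>i. coeff p i \<in> \<int>) \<and> poly p x = 0 \<and>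
     lead_coeff p = of_nat a)" for a
  have QI: "Q (nat \<bar>c\<bar>)" if p: "p \<noteq> 0" "\<forall>i. coeff p i \<in> \<int>" "poly p x = 0" "lead_coeff p = of_int c" for p c
  proof (cases "c \<ge> 0")
    case True
    moreover have "c \<noteq> 0" using p by auto
    ultimately show ?thesis using p unfolding Q_def by (intro conjI exI[of _ p]) auto
  next
    case False
    thus ?thesis using p unfolding Q_def by (intro conjI exI[of _ "- p"]) auto
  qed
  obtain p where p: "\<forall>i. coeff p i \<in> \<int>" "p \<noteq> 0" "poly p x = 0"
    using assms unfolding Qbar_def algebraic_def by blast
  obtain c where "lead_coeff p = of_int c" using p(1) Ints_cases by metis
  hence "Q (nat \<bar>c\<bar>)" using QI p by blast
  hence "Q (LEAST a. Q a)" by (rule LeastI)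
  hence "Q (lead_denom x)" by (simp add: lead_denom_def Q_def)
  thus "lead_denom x > 0" "\<exists>p. p \<noteq> 0 \<and> (\<forall>i. coeff p i \<in> \<int>) \<and> poly p x = 0 \<and>
    lead_coeff p = of_nat (lead_denom x)" by (auto simp: Q_def)
  fix p c assume "p \<noteq> 0" "\<forall>i. coeff p i \<in> \<int>" "poly p x = 0" "lead_coeff p = of_int c"
  hence "Q (nat \<bar>c\<bar>)" by (rule QI)
  hence "(LEAST a. Q a) \<le> nat \<bar>c\<bar>" by (rule Least_le)
  thus "int (lead_denom x) \<le> \<bar>c\<bar>" by (simp add: lead_denom_def Q_def)
qed

text \<open>Let \<open>g = n * x\<close> be integral. Rounding down the rational coordinates of
  \<open>z\<close> with respect to the powers of \<open>g\<close> subtracts an integral combination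
  of powers of \<open>g\<close>, hence of \<open>x\<close>. What remains is an algebraic integer
  with bounded conjugates and at most \<open>d\<close> of them, so one of finitely many.\<close>

lemma integers_mod_powers_finite:
  assumes x: "x \<in> Qbar"
  shows "\<exists>R. finite R \<and> (\<forall>z\<in>integers_of (adjoin \<rat> x). \<exists>r\<in>R. \<exists>c::nat \<Rightarrow> int.
    z - r = (\<Sum>i<card (conjugates x). of_int (c i) * x ^ i))"
proof -
  define d where "d = card (conjugates x)"
  obtain n :: int where n: "n > 0" "algebraic_int (of_int n * x)"
    using x algebraic_iff_int_multiple by (auto simp: Qbar_def)
  define g where "g = of_int n * x"
  have gQ: "g \<in> Qbar" using n(2) by (auto simp: g_def Qbar_def)
  define C0 where "C0 = (\<Sum>y\<in>conjugates g. cmod y)"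
  have C0: "cmod y \<le> C0" if "y \<in> conjugates g" for y
    unfolding C0_def using that conjugates_finite[OF gQ] by (intro member_le_sum) auto
  define C where "C = (\<Sum>i<d. C0 ^ i)"
  define R where "R = {z. algebraic_int z \<and> card (conjugates z) \<le> d \<and> (\<forall>y\<in>conjugates z. cmod y \<le> C)}"
  have "\<exists>r\<in>R. \<exists>c::nat \<Rightarrow> int. z - r = (\<Sum>i<d. of_int (c i) * x ^ i)" if z: "z \<in> integers_of (adjoin \<rat> x)" for z
  proof -
    have "z \<in> adjoin \<rat> x" using z by (simp add: integers_of_def)
    then obtain q where q: "\<forall>i. q i \<in> \<rat>" "z = (\<Sum>i<d. q i * x ^ i)"
      using adjoin_Rats_repr[OF x] d_def by blast
    have "\<forall>i. \<exists>s::rat. q i / of_int n ^ i = of_rat s" using q(1) by (metis Rats_cases Rats_divide Rats_of_int Rats_power)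
    then obtain s :: "nat \<Rightarrow> rat" where s: "\<And>i. q i / of_int n ^ i = of_rat (s i)" by metis
    have n0: "of_int n \<noteq> (0::complex)" using n(1) by simp
    have qs: "q i * x ^ i = of_rat (s i) * g ^ i" for i
    proof -
      have "q i = of_rat (s i) * of_int n ^ i" using s[of i] n0 by (simp add: field_simps)
      thus ?thesis by (simp add: g_def power_mult_distrib)
    qed
    define fr where "fr i = (of_rat (s i) :: complex) - of_int \<lfloor>s i\<rfloor>" for i
    have fr_eq: "fr i = of_rat (frac (s i))" for i by (simp add: fr_def frac_def of_rat_diff)
    have fr1: "cmod (fr i) \<le> 1" for i
    proof -
      have "\<bar>frac (s i)\<bar> \<le> 1" using frac_ge_0[of "s i"] frac_lt_1[of "s i"] by linarith
      have "cmod (of_rat (frac (s i))) = \<bar>of_rat (frac (s i)) :: real\<bar>"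
        by (cases "frac (s i)") (simp add: of_rat_rat norm_divide)
      also have "\<dots> = of_rat \<bar>frac (s i)\<bar>" by (simp add: abs_if of_rat_minus)
      also have "\<dots> \<le> of_rat 1" using \<open>\<bar>frac (s i)\<bar> \<le> 1\<close> of_rat_less_eq by blast
      finally show ?thesis by (simp add: fr_eq)
    qed
    define c where "c i = \<lfloor>s i\<rfloor> * n ^ i" for i
    define r where "r = (\<Sum>i<d. fr i * g ^ i)"
    have cx: "of_int (c i) * x ^ i = of_int \<lfloor>s i\<rfloor> * g ^ i" for i
      by (simp add: c_def g_def power_mult_distrib)
    have zr: "z - r = (\<Sum>i<d. of_int (c i) * x ^ i)"
      by (simp add: q(2) r_def qs cx fr_def left_diff_distrib flip: sum_subtractf)
    have "r \<in> R"
      unfolding R_def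
    proof (intro CollectI conjI ballI)
      have "algebraic_int (\<Sum>i<d. of_int (c i) * x ^ i)"
        unfolding cx using n(2) by (intro algebraic_int_sum algebraic_int_mult algebraic_int_power) (auto simp: g_def)
      hence "algebraic_int (z - (z - r))"
        unfolding zr using z by (intro algebraic_int_diff) (auto simp: integers_of_def)
      thus "algebraic_int r" by simp
      have tr: "t r = (\<Sum>i<d. fr i * t g ^ i)" if t: "is_aut t" for t
      proof -
        have frQ: "fr i \<in> \<rat>" for i by (simp add: fr_eq)
        hence "fr i \<in> Qbar" for i using subfield_Rats[OF is_subfield_Qbar] by blast
        thus ?thesis unfolding r_def using gQ subfield_closed[OF is_subfield_Qbar] frQ
          by (simp add: aut_sum[OF t] aut_mult[OF t] aut_power[OF t] aut_Rats[OF t])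
      qed
      have tg: "t g = of_int n * t x" if "is_aut t" for t
        using x subfield_closed[OF is_subfield_Qbar] by (simp add: g_def aut_mult[OF that] aut_of_int[OF that])
      have "conjugates r \<subseteq> (\<lambda>y. \<Sum>i<d. fr i * (of_int n * y) ^ i) ` conjugates x"
        using tr tg by (fastforce simp: conjugates_def)
      thus "card (conjugates r) \<le> d"
        unfolding d_def using conjugates_finite[OF x] by (meson card_image_le card_mono finite_imageI order.trans)
      fix y assume "y \<in> conjugates r"
      then obtain t where t: "is_aut t" "y = t r" by (auto simp: conjugates_def)
      have "cmod (t g) \<le> C0" using t(1) by (intro C0) (auto simp: conjugates_def)
      hence "cmod (fr i * t g ^ i) \<le> 1 * C0 ^ i" for i
        unfolding norm_mult norm_power using fr1 by (intro mult_mono power_mono) auto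
      hence "cmod (\<Sum>i<d. fr i * t g ^ i) \<le> C" unfolding C_def by (intro sum_norm_le) simp
      thus "cmod y \<le> C" using tr[OF t(1)] t(2) by simp
    qed
    thus ?thesis using zr by blast
  qed
  moreover have "finite R" unfolding R_def by (rule finite_bounded_integers)
  ultimately show ?thesis unfolding d_def by blast
qed

text \<open>The denominator ideal of \<open>x\<close> has norm at least the leading coefficient \<open>a\<close>: the \<open>a^n\<close> combinations
  of \<open>x^d, \<dots>, x^(d+n-1)\<close> with digits below \<open>a\<close> stay, up to a bounded factor, distinct
  modulo the integers, while only the \<open>(d+n)\<close>-th power of that norm many classes are available.\<close>

lemma lead_denom_le_norm:
  assumes x: "x \<in> Qbar" "x \<noteq> 0"
  defines "E \<equiv> adjoin \<rat> x"
  shows "real (lead_denom x) \<le>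
    (\<Prod>P\<in>{P \<in> finite_places E. ord_at E P x < 0}. real (residue_card E P) ^ nat (- ord_at E P x))"
proof -
  have nf: "number_field E" unfolding E_def by (rule number_field_adjoin[OF number_field_Rats x(1)])
  note sE = number_field_is_subfield[OF nf]
  have xE: "x \<in> E" by (simp add: E_def adjoin_mem)
  define T where "T = {P \<in> finite_places E. ord_at E P x < 0}"
  have T: "finite T" "T \<subseteq> finite_places E"
    using finite_negative_places[OF nf xE x(2)] by (auto simp: T_def)
  define k where "k P = nat (- ord_at E P x)" for P
  define N where "N = (\<Prod>P\<in>T. residue_card E P ^ k P)"
  define d where "d = card (conjugates x)"
  define a where "a = lead_denom x"
  define J where "J = {\<Sum>i<d. of_int (c i) * x ^ i | c :: nat \<Rightarrow> int. True}"
  obtain R where R: "finite R" "\<And>z. z \<in> integers_of E \<Longrightarrow> \<exists>r\<in>R. z - r \<in> J"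
    using integers_mod_powers_finite[OF x(1)] unfolding J_def E_def d_def by blast
  have Jdiff: "u - v \<in> J" if uv: "u \<in> J" "v \<in> J" for u v
  proof -
    obtain c e where "u = (\<Sum>i<d. of_int (c i) * x ^ i)" "v = (\<Sum>i<d. of_int (e i) * x ^ i)"
      using uv unfolding J_def by blast
    hence "u - v = (\<Sum>i<d. of_int (c i - e i) * x ^ i)" by (simp add: left_diff_distrib sum_subtractf)
    thus ?thesis unfolding J_def by (intro CollectI exI[of _ "\<lambda>i. c i - e i"]) simp
  qed
  have resN: "residue_card E P \<ge> 2" if "P \<in> T" for P
    using residue_card_ge_2[OF nf, of P] that T(2) finite_places_eq[OF sE] by (auto simp: residue_card_def[OF nf])
  have N1: "N \<ge> 1" unfolding N_def using resN by (intro prod_ge_1 one_le_power) force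
  have main: "a ^ n \<le> card R * N ^ (d + n)" for n
  proof -
    define Cs where "Cs = {..<n} \<rightarrow>\<^sub>E {0..<int a}"
    define y where "y c = (\<Sum>j<n. of_int (c j) * x ^ (d + j))" for c :: "nat \<Rightarrow> int"
    have Cs: "finite Cs" "card Cs = a ^ n" by (auto simp: Cs_def card_PiE intro: finite_PiE)
    \<comment> \<open>A coincidence would give an integral polynomial vanishing at \<open>x\<close>
      whose leading coefficient, a nonzero difference of digits, is smaller than \<open>a\<close> in
      absolute value, against the minimality of \<open>a\<close>.\<close>
    have yinj: "c = e" if ce: "c \<in> Cs" "e \<in> Cs" "y c - y e \<in> J" for c e
    proof (rule ccontr)
      assume "c \<noteq> e"
      have "\<exists>j<n. c j \<noteq> e j"
        using ce(1,2) \<open>c \<noteq> e\<close> unfolding Cs_def by (metis PiE_ext lessThan_iff)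
      hence ne: "{j. j < n \<and> c j \<noteq> e j} \<noteq> {}" by blast
      define m where "m = Max {j. j < n \<and> c j \<noteq> e j}"
      have m: "m < n" "c m \<noteq> e m" using Max_in[OF _ ne] by (auto simp: m_def)
      have above: "c j = e j" if "m < j" "j < n" for j
      proof (rule ccontr)
        assume "c j \<noteq> e j"
        hence "j \<le> m" unfolding m_def using that by (intro Max_ge) auto
        thus False using that by simp
      qed
      obtain f :: "nat \<Rightarrow> int" where f: "y c - y e = (\<Sum>i<d. of_int (f i) * x ^ i)" using ce(3) unfolding J_def by blast
      define p :: "complex poly" where
        "p = (\<Sum>j<n. monom (of_int (c j - e j)) (d + j)) - (\<Sum>i<d. monom (of_int (f i)) i)"
      have "poly p x = (y c - y e) - (\<Sum>i<d. of_int (f i) * x ^ i)"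
        by (simp add: p_def poly_sum poly_monom y_def left_diff_distrib sum_subtractf)
      hence p0: "poly p x = 0" using f by simp
      have cp: "coeff p i = (if i < d then - of_int (f i) else if i < d + n then of_int (c (i - d) - e (i - d)) else 0)" for i
      proof -
        have "(\<Sum>j<n. if d + j = i then of_int (c j - e j) else (0::complex)) =
          (\<Sum>j<n. if j = i - d then (if d \<le> i then of_int (c j - e j) else 0) else 0)"
          by (intro sum.cong) auto
        also have "\<dots> = (if d \<le> i \<and> i < d + n then of_int (c (i - d) - e (i - d)) else 0)"
          by (subst sum.delta) auto
        finally have 1: "(\<Sum>j<n. if d + j = i then of_int (c j - e j) else (0::complex)) =
          (if d \<le> i \<and> i < d + n then of_int (c (i - d) - e (i - d)) else 0)" .
        have 2: "(\<Sum>j<d. if j = i then of_int (f j) else (0::complex)) = (if i < d then of_int (f i) else 0)"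
          by (subst sum.delta) auto
        show ?thesis
          unfolding p_def coeff_diff coeff_sum coeff_monom 1 2 by simp
      qed
      have cm: "coeff p (d + m) = of_int (c m - e m)" using m(1) by (simp add: cp)
      have "coeff p i = 0" if "i > d + m" for i
        using that above[of "i - d"] unfolding cp by (cases "i < d + n") simp_all
      hence deg: "degree p = d + m" using cm m(2) by (intro antisym degree_le le_degree) auto
      have "\<forall>i. coeff p i \<in> \<int>" unfolding cp by simp
      moreover have "p \<noteq> 0" using cm m(2) by auto
      moreover have "lead_coeff p = of_int (c m - e m)" using deg cm by simp
      ultimately have "int a \<le> \<bar>c m - e m\<bar>" unfolding a_def using lead_denom_le[OF x(1)] p0 by blast
      moreover have "c m \<in> {0..<int a}" "e m \<in> {0..<int a}"
        using ce(1,2) m(1) unfolding Cs_def by (blast dest: PiE_mem)+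
      ultimately show False by auto
    qed
    define mm where "mm P = (d + n) * k P" for P
    have ypol: "y c \<in> polar E T mm" for c
      unfolding polar_def[OF nf]
    proof (intro CollectI conjI allI impI)
      show yE: "y c \<in> E" unfolding y_def
        using xE subfield_closed[OF sE] by (intro subfield_sum[OF sE]) auto
      fix P assume P: "is_prime E P" "P \<noteq> {0}"
      define b where "b = (if P \<in> T then - int (mm P) else 0)"
      have ordx: "ord_at E P (x ^ j) = int j * ord_at E P x" for j
      proof (induction j)
        case 0 show ?case using ord_at_one[OF nf P] by simp
      next
        case (Suc j)
        thus ?case using ord_at_mult[OF nf P xE subfield_power[OF sE xE, of j]] x(2) by (simp add: algebra_simps)
      qed
      have trm: "of_int (c j) * x ^ (d + j) = 0 \<or> ord_at E P (of_int (c j) * x ^ (d + j)) \<ge> b" if "j < n" for j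
      proof (cases "c j = 0")
        case False
        have "ord_at E P (of_int (c j)) \<ge> 0" using ord_at_nonneg[OF nf P nf_integers(8)[OF nf]] False by simp
        moreover have "ord_at E P (x ^ (d + j)) \<ge> b"
        proof (cases "P \<in> T")
          case True
          hence neg: "ord_at E P x < 0" by (simp add: T_def)
          have "int (d + j) * (- ord_at E P x) \<le> int (d + n) * (- ord_at E P x)"
            using that neg by (intro mult_right_mono) auto
          thus ?thesis using True neg unfolding ordx b_def mm_def k_def by simp
        next
          case False
          hence "ord_at E P x \<ge> 0" using P finite_places_eq[OF sE] by (auto simp: T_def)
          thus ?thesis using False unfolding ordx b_def by simp
        qed
        ultimately show ?thesis
          using ord_at_mult[OF nf P, of "of_int (c j)" "x ^ (d + j)"] False x(2) xE subfield_closed[OF sE] by simp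
      qed simp
      have sums: "sum f I = 0 \<or> ord_at E P (sum f I) \<ge> b"
        if "finite I" "\<And>i. i \<in> I \<Longrightarrow> f i \<in> E" "\<And>i. i \<in> I \<Longrightarrow> f i = 0 \<or> ord_at E P (f i) \<ge> b" for f and I :: "nat set"
        using that
      proof (induction I rule: finite_induct)
        case (insert i I)
        have "sum f I \<in> E" using insert.prems by (intro subfield_sum[OF sE]) auto
        moreover have "f i \<in> E" "f i = 0 \<or> ord_at E P (f i) \<ge> b" using insert.prems by auto
        moreover have "sum f I = 0 \<or> ord_at E P (sum f I) \<ge> b" using insert by auto
        ultimately show ?case
          using ord_at_add[OF nf P, of "f i" "sum f I" b] insert.hyps
          by (cases "f i = 0"; cases "sum f I = 0"; cases "f i + sum f I = 0") auto
      qed simp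
      have "y c = 0 \<or> b \<le> ord_at E P (y c)"
        unfolding y_def
      proof (rule sums)
        show "of_int (c i) * x ^ (d + i) \<in> E" for i
          by (rule subfield_mult[OF sE subfield_of_int[OF sE] subfield_power[OF sE xE]])
      qed (use trm in auto)
      thus "y c = 0 \<or> (if P \<in> T then - int (mm P) else 0) \<le> ord_at E P (y c)"
        unfolding b_def .
    qed
    let ?O = "integers_of E"
    have Od: "u - v \<in> ?O" if "u \<in> ?O" "v \<in> ?O" for u v using that nf_integers(4)[OF nf] by blast
    have O0: "0 \<in> ?O" using nf_integers(2)[OF nf] .
    \<comment> \<open>One digit vector is chosen in each class modulo the integers; the choice
      depends on the class only, so distinct values in \<open>S\<close> are incongruent.\<close>
    define rep where "rep c = (SOME e. e \<in> Cs \<and> y c - y e \<in> ?O)" for c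
    have rep: "rep c \<in> Cs \<and> y c - y (rep c) \<in> ?O" if "c \<in> Cs" for c
      unfolding rep_def by (rule someI[of "\<lambda>e. e \<in> Cs \<and> y c - y e \<in> ?O" c]) (use that O0 in simp)
    have rep_eq: "rep c = rep e" if ce: "y c - y e \<in> ?O" for c e
    proof -
      have ec: "y e - y c \<in> ?O" using Od[OF O0 ce] by simp
      have "y c - y z \<in> ?O \<longleftrightarrow> y e - y z \<in> ?O" for z
      proof
        assume "y c - y z \<in> ?O"
        from Od[OF this ce] show "y e - y z \<in> ?O" by simp
      next
        assume "y e - y z \<in> ?O"
        from Od[OF this ec] show "y c - y z \<in> ?O" by simp
      qed
      thus ?thesis by (simp add: rep_def)
    qed
    define S where "S = (\<lambda>c. y (rep c)) ` Cs"
    have "card S \<le> (\<Prod>P\<in>T. residue_card E P ^ mm P)"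
    proof (rule polar_classes_card[OF nf T])
      show "finite S" "S \<subseteq> polar E T mm" using Cs(1) ypol by (auto simp: S_def)
      fix u v assume uv: "u \<in> S" "v \<in> S" "u - v \<in> ?O"
      then obtain c e where ce: "c \<in> Cs" "e \<in> Cs" "u = y (rep c)" "v = y (rep e)" by (auto simp: S_def)
      have "y c - y e = ((y c - y (rep c)) - (y e - y (rep e))) - (0 - (u - v))"
        by (simp add: ce(3,4))
      also have "\<dots> \<in> ?O"
        by (rule Od[OF Od[OF conjunct2[OF rep[OF ce(1)]] conjunct2[OF rep[OF ce(2)]]] Od[OF O0 uv(3)]])
      finally show "u = v" using rep_eq ce(3,4) by simp
    qed
    also have "\<dots> = N ^ (d + n)" by (simp add: N_def mm_def prod_power_distrib power_mult mult.commute)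
    finally have S: "card S \<le> N ^ (d + n)" .
    \<comment> \<open>Within one class the values differ by integers, which modulo \<open>J\<close>
      fall among the members of \<open>R\<close>; two vectors with the same member of
      \<open>R\<close> agree by \<open>yinj\<close>.\<close>
    have fib: "card {c\<in>Cs. y (rep c) = u} \<le> card R" for u
    proof -
      have "\<exists>r\<in>R. y c - u - r \<in> J" if "c \<in> Cs" "y (rep c) = u" for c
        using R(2) rep that by blast
      then obtain h where h: "\<And>c. c \<in> Cs \<Longrightarrow> y (rep c) = u \<Longrightarrow> h c \<in> R \<and> y c - u - h c \<in> J" by metis
      have "inj_on h {c\<in>Cs. y (rep c) = u}"
      proof (rule inj_onI)
        fix c e assume ce: "c \<in> {c\<in>Cs. y (rep c) = u}" "e \<in> {c\<in>Cs. y (rep c) = u}" "h c = h e"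
        have "y c - u - h c \<in> J" "y e - u - h e \<in> J" using h ce(1,2) by blast+
        hence "(y c - u - h c) - (y e - u - h e) \<in> J" by (rule Jdiff)
        hence "y c - y e \<in> J" using ce(3) by simp
        thus "c = e" using yinj ce by blast
      qed
      moreover have "h ` {c\<in>Cs. y (rep c) = u} \<subseteq> R" using h by blast
      ultimately show ?thesis using card_inj_on_le R(1) by blast
    qed
    have "card Cs = (\<Sum>c\<in>Cs. 1)" by simp
    also have "\<dots> = (\<Sum>u\<in>S. \<Sum>c\<in>{c\<in>Cs. y (rep c) = u}. 1)"
      by (rule sum.group[symmetric]) (use Cs(1) in \<open>auto simp: S_def\<close>)
    also have "\<dots> \<le> card S * card R"
      using sum_bounded_above[of S "\<lambda>u. card {c\<in>Cs. y (rep c) = u}" "card R"] fib by simp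
    also have "\<dots> \<le> N ^ (d + n) * card R" using S by (rule mult_right_mono) simp
    finally show ?thesis using Cs(2) by (simp add: mult.commute)
  qed
  \<comment> \<open>As \<open>a ^ n\<close> is at most a constant times \<open>N ^ n\<close> for all
    \<open>n\<close>, the bounded factor disappears for large \<open>n\<close>.\<close>
  have "real a \<le> real N"
  proof (rule ccontr)
    assume "\<not> ?thesis"
    hence "real a / real N > 1" using N1 by simp
    then obtain n where "real (card R) * real N ^ d < (real a / real N) ^ n" using real_arch_pow by blast
    hence "real (card R) * real N ^ d * real N ^ n < real a ^ n"
      using N1 by (simp add: power_divide less_divide_eq)
    moreover have "real (a ^ n) \<le> real (card R * N ^ (d + n))" using main of_nat_le_iff by blast
    ultimately show False by (simp add: power_add mult.assoc)
  qed
  thus ?thesis by (simp add: a_def N_def T_def k_def)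
qed

text \<open>Half of the identity between height and Mahler measure, the half that serves for lower
  bounds. The archimedean parts agree term by term; the finite part is
  \<open>lead_denom_le_norm\<close> after taking logarithms.\<close>

lemma weil_height_ge:
  assumes x: "x \<in> Qbar" "x \<noteq> 0"
  shows "ln (real (lead_denom x)) + (\<Sum>y\<in>conjugates x. ln (max 1 (cmod y)))
    \<le> real (card (conjugates x)) * weil_height x"
proof -
  define E where "E = adjoin \<rat> x"
  have nf: "number_field E" unfolding E_def by (rule number_field_adjoin[OF number_field_Rats x(1)])
  note sE = number_field_is_subfield[OF nf]
  define T where "T = {P \<in> finite_places E. ord_at E P x < 0}"
  have pl: "place_abs E P x = real (residue_card E P) powi (- ord_at E P x)" "residue_card E P \<ge> 2"
    if "P \<in> finite_places E" for P
    using that x(2) residue_card_ge_2[OF nf, of P] finite_places_eq[OF sE]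
    by (auto simp: place_abs_def residue_card_def[OF nf])
  have gt: "place_abs E P x > 1 \<longleftrightarrow> ord_at E P x < 0" if P: "P \<in> finite_places E" for P
  proof (cases "ord_at E P x < 0")
    case True
    have "real (residue_card E P) ^ nat (- ord_at E P x) > 1"
      using pl(2)[OF P] True by (intro one_less_power) auto
    thus ?thesis using True by (simp add: pl(1)[OF P] power_int_def)
  next
    case False
    have "real (residue_card E P) ^ nat (ord_at E P x) \<ge> 1" using pl(2)[OF P] by (intro one_le_power) auto
    hence "real (residue_card E P) powi (- ord_at E P x) \<le> 1"
      using False pl(2)[OF P] by (auto simp: power_int_def inverse_le_1_iff power_inverse)
    thus ?thesis using False by (simp add: pl(1)[OF P])
  qed
  have "(\<Sum>P\<in>{P \<in> finite_places E. place_abs E P x > 1}. ln (max 1 (place_abs E P x)))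
      = (\<Sum>P\<in>T. ln (real (residue_card E P) ^ nat (- ord_at E P x)))"
  proof (intro sum.cong)
    show "{P \<in> finite_places E. place_abs E P x > 1} = T" using gt by (auto simp: T_def)
    fix P assume "P \<in> T"
    hence P: "P \<in> finite_places E" "ord_at E P x < 0" by (auto simp: T_def)
    hence "max 1 (place_abs E P x) = place_abs E P x" using gt by simp
    thus "ln (max 1 (place_abs E P x)) = ln (real (residue_card E P) ^ nat (- ord_at E P x))"
      using P(2) pl(1)[OF P(1)] by (simp add: power_int_def)
  qed
  also have "\<dots> = ln (\<Prod>P\<in>T. real (residue_card E P) ^ nat (- ord_at E P x))"
    using pl(2) finite_negative_places[OF nf, of x] x(2)
    by (intro ln_prod[symmetric]) (force simp: T_def E_def adjoin_mem)+
  also have "\<dots> \<ge> ln (real (lead_denom x))"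
  proof (rule ln_mono)
    show "real (lead_denom x) \<le> (\<Prod>P\<in>T. real (residue_card E P) ^ nat (- ord_at E P x))"
      using lead_denom_le_norm[OF x] unfolding T_def E_def .
    show "0 < real (lead_denom x)" using lead_denom(1)[OF x(1)] by simp
  qed
  finally have fin: "ln (real (lead_denom x)) \<le>
    (\<Sum>P\<in>{P \<in> finite_places E. place_abs E P x > 1}. ln (max 1 (place_abs E P x)))" .
  have emb: "(\<Sum>\<sigma>\<in>field_embeddings E. ln (max 1 (cmod (\<sigma> x)))) = (\<Sum>y\<in>conjugates x. ln (max 1 (cmod y)))"
    unfolding E_def by (rule sum_field_embeddings[OF x(1)])
  have "real (card (conjugates x)) * weil_height x =
    (\<Sum>\<sigma>\<in>field_embeddings E. ln (max 1 (cmod (\<sigma> x)))) +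
      (\<Sum>P\<in>{P \<in> finite_places E. place_abs E P x > 1}. ln (max 1 (place_abs E P x)))"
    unfolding weil_height_def height_in_def E_def[symmetric]
    using degree_adjoin_Rats[OF x(1)] card_conjugates_pos[OF x(1)] by (simp add: E_def)
  thus ?thesis using fin emb by linarith
qed

section \<open>Lower bounds for heights\<close>

context
  fixes A and l :: nat
  assumes A: "nonarch_abs Qbar A" and l: "Factorial_Ring.prime l" and Al: "A (of_nat l) = 1 / real l"
begin

lemmas Qf = is_subfield_Qbar
lemmas Qc = subfield_closed[OF is_subfield_Qbar]

lemma l_gt_1: "l > 1" using l prime_gt_1_nat by blast

lemma nonarch_of_int_le: "A (of_int b) \<le> 1"
  using nonarch_integer[OF Qf A integers_of_int[OF Qf]] .

lemma nonarch_of_int_coprime: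
  assumes "\<not> int l dvd b" shows "A (of_int b) = 1"
proof (rule antisym[OF nonarch_of_int_le])
  have "Rings.coprime b (int l)"
    using assms l prime_imp_coprime[of "int l" b] by (simp add: coprime_commute)
  then obtain u v where uv: "u * b + v * int l = 1" by (metis coprime_iff_gcd_eq_1 bezout_int)
  have "(1::complex) = of_int (u * b + v * int l)" by (simp add: uv)
  hence "A 1 = A (of_int u * of_int b + of_int v * of_nat l)" by simp
  hence "1 \<le> max (A (of_int u * of_int b)) (A (of_int v * of_nat l))"
    using nonarch_add[OF Qf A, of "of_int u * of_int b" "of_int v * of_nat l"] nonarch_one[OF Qf A] Qc by simp
  moreover have "A (of_int v * of_nat l) \<le> 1 * (1 / real l)"
    unfolding nonarch_mult[OF Qf A Qc(11,10)] Al using nonarch_of_int_le by (intro mult_right_mono) auto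
  moreover have "1 / real l < 1" using l_gt_1 by simp
  ultimately have "1 \<le> max (A (of_int u * of_int b)) (A (of_int v * of_nat l))" "A (of_int v * of_nat l) < 1"
    by linarith+
  moreover have "A (of_int u * of_int b) \<le> 1 * A (of_int b)"
    unfolding nonarch_mult[OF Qf A Qc(11,11)] using nonarch_of_int_le nonarch_nonneg[OF Qf A Qc(11)]
    by (intro mult_right_mono) auto
  ultimately show "1 \<le> A (of_int b)" by auto
qed

text \<open>The product is the absolute value of the part of \<open>b\<close> prime to
  \<open>l\<close>: the product formula with the places other than \<open>l\<close> and infinity
  left out.\<close>

lemma nonarch_of_int_ge:
  assumes "b \<noteq> 0" shows "A (of_int b) * real_of_int \<bar>b\<bar> \<ge> 1"
proof -
  have "\<not> is_unit (int l)" using l_gt_1 by simp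
  then obtain c where c: "b = int l ^ multiplicity (int l) b * c" "\<not> int l dvd c"
    using multiplicity_decompose'[OF assms] by metis
  define s where "s = multiplicity (int l) b"
  have b: "b = int l ^ s * c" using c(1) by (simp add: s_def)
  have "A (of_int b) = A (of_nat l ^ s * of_int c)" by (simp add: b)
  also have "\<dots> = (1 / real l) ^ s"
    using nonarch_mult[OF Qf A, of "of_nat l ^ s" "of_int c"] nonarch_power[OF Qf A Qc(10), of l s] Qc
      nonarch_of_int_coprime[OF c(2)] Al by simp
  finally have "A (of_int b) * real_of_int \<bar>b\<bar> = real_of_int \<bar>c\<bar>"
    using l_gt_1 by (simp add: b abs_mult power_divide)
  moreover have "c \<noteq> 0" using c(2) by auto
  ultimately show ?thesis by linarith
qed

end

text \<open>A prime \<open>q\<close> dividing the reduced denominator has an absolute value above it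
  at which \<open>b\<close> is larger than 1.\<close>

lemma rational_integer_of_abs:
  assumes "b \<in> \<rat>" "\<And>A. nonarch_abs Qbar A \<Longrightarrow> A b \<le> 1"
  shows "b \<in> \<int>"
proof -
  obtain m n :: int where mn: "n > 0" "Rings.coprime m n" "b = of_int m / of_int n"
    using assms(1) by (auto elim: Rats_cases')
  have "n = 1"
  proof (rule ccontr)
    assume "n \<noteq> 1"
    hence "nat n \<noteq> 1" using mn(1) by auto
    then obtain q where q: "Factorial_Ring.prime q" "q dvd nat n" using prime_factor_nat by blast
    obtain A where A: "nonarch_abs Qbar A" "A (of_nat q) = 1 / real q" using nonarch_abs_prime[OF q(1)] by blast
    note Qf = is_subfield_Qbar
    note Qc = subfield_closed[OF is_subfield_Qbar]
    have qn: "int q dvd n" using q(2) mn(1) by (metis int_dvd_int_iff int_nat_eq less_imp_le)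
    have "\<not> int q dvd m"
    proof
      assume "int q dvd m"
      hence "is_unit (int q)" using qn mn(2) coprime_common_divisor by blast
      thus False using q(1) by simp
    qed
    hence Am: "A (of_int m) = 1" by (rule nonarch_of_int_coprime[OF A(1) q(1) A(2)])
    obtain k where k: "n = int q * k" using qn by blast
    have "A (of_int n) = A (of_nat q * of_int k)" by (simp add: k)
    also have "\<dots> = 1 / real q * A (of_int k)"
      using nonarch_mult[OF Qf A(1), of "of_nat q" "of_int k"] Qc A(2) by simp
    also have "\<dots> \<le> 1 / real q * 1" using nonarch_of_int_le[OF A(1) q(1) A(2)] by (intro mult_left_mono) auto
    also have "\<dots> < 1" using prime_gt_1_nat[OF q(1)] by simp
    finally have "A (of_int n) < 1" .
    moreover have "A (of_int n) > 0" using nonarch_pos[OF Qf A(1), of "of_int n"] mn(1) Qc by simp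
    moreover have "A b = 1 / A (of_int n)"
      unfolding mn(3) using nonarch_divide[OF Qf A(1), of "of_int m" "of_int n"] Qc Am by simp
    ultimately have "A b * A (of_int n) = 1" "A (of_int n) < 1" "A (of_int n) > 0" by simp_all
    moreover have "A b * A (of_int n) \<le> 1 * A (of_int n)"
      using assms(2)[OF A(1)] calculation(3) by (intro mult_right_mono) auto
    ultimately show False by simp
  qed
  thus ?thesis using mn by simp
qed

text \<open>The leading coefficient times the conjugates of value above 1 is an algebraic integer,
  so its value is at most 1; the other conjugates contribute a factor 1.\<close>

lemma lead_denom_abs_le:
  assumes x: "x \<in> Qbar" and A: "nonarch_abs Qbar A"
  shows "A (of_nat (lead_denom x)) * (\<Prod>y\<in>conjugates x. max 1 (A y)) \<le> 1"
proof -
  obtain p where p: "p \<noteq> 0" "\<forall>i. coeff p i \<in> \<int>" "poly p x = 0" "lead_coeff p = of_nat (lead_denom x)"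
    using lead_denom(2)[OF x] by blast
  define S where "S = {y\<in>conjugates x. A y > 1}"
  have S: "finite S" "S \<subseteq> conjugates x" "S \<subseteq> Qbar"
    using conjugates_finite[OF x] conjugates_Qbar[OF x] by (auto simp: S_def)
  have "poly p s = 0" if "s \<in> S" for s
    using rational_poly_conjugate_root[OF x, of p s] p(2,3) S(2) that Ints_subset_Rats by blast
  hence "algebraic_int (lead_coeff p * prod (\<lambda>s. s) S)"
    using p(2) int_imp_algebraic_int by (intro algebraic_int_lead_coeff_mult_roots[OF _ p(1) S(1)]) auto
  hence "of_nat (lead_denom x) * prod (\<lambda>s. s) S \<in> integers_of Qbar"
    by (auto simp: p(4) integers_of_def Qbar_def)
  hence "A (of_nat (lead_denom x) * prod (\<lambda>s. s) S) \<le> 1" by (rule nonarch_integer[OF is_subfield_Qbar A])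
  moreover have "prod (\<lambda>s. s) S \<in> Qbar" using S(3) by (intro subfield_prod[OF is_subfield_Qbar]) auto
  moreover have "A (prod (\<lambda>s. s) S) = (\<Prod>y\<in>S. A y)" using S(3) by (intro nonarch_prod[OF is_subfield_Qbar A]) auto
  moreover have "(\<Prod>y\<in>conjugates x. max 1 (A y)) = (\<Prod>y\<in>S. A y)"
    using conjugates_finite[OF x] by (intro prod.mono_neutral_cong_right) (auto simp: S_def)
  ultimately show ?thesis
    using nonarch_mult[OF is_subfield_Qbar A] subfield_of_nat[OF is_subfield_Qbar] by simp
qed

lemma conjugates_prod_rational:
  assumes x: "x \<in> Qbar" shows "(\<Prod>y\<in>conjugates x. y) \<in> \<rat>"
proof (rule aut_fixed_rational)
  show "(\<Prod>y\<in>conjugates x. y) \<in> Qbar"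
    using conjugates_Qbar[OF x] by (intro subfield_prod[OF is_subfield_Qbar]) auto
  fix t assume t: "is_aut t"
  have "t (\<Prod>y\<in>conjugates x. y) = (\<Prod>y\<in>conjugates x. t y)"
    using conjugates_Qbar[OF x] by (intro aut_prod[OF t]) auto
  also have "\<dots> = (\<Prod>y\<in>conjugates x. y)" by (rule prod.reindex_bij_betw[OF conjugates_bij[OF x t]])
  finally show "t (\<Prod>y\<in>conjugates x. y) = (\<Prod>y\<in>conjugates x. y)" .
qed

text \<open>The logarithmic Mahler measure of the primitive minimal polynomial of
  \<open>x\<close>.\<close>

definition log_mahler :: "complex \<Rightarrow> real" where
  "log_mahler x = ln (real (lead_denom x)) + (\<Sum>y\<in>conjugates x. ln (max 1 (cmod y)))"

lemma exp_log_mahler: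
  assumes "x \<in> Qbar"
  shows "exp (log_mahler x) = real (lead_denom x) * (\<Prod>y\<in>conjugates x. max 1 (cmod y))"
proof -
  have "exp (\<Sum>y\<in>conjugates x. ln (max 1 (cmod y))) = (\<Prod>y\<in>conjugates x. max 1 (cmod y))"
    using conjugates_finite[OF assms] by (subst exp_sum) (auto intro!: prod.cong)
  thus ?thesis using lead_denom(1)[OF assms] by (simp add: log_mahler_def exp_add)
qed

text \<open>The rational integer \<open>a\<^sup>2\<close> times the norm of \<open>x\<close>, bounded at the infinite place by the square of
  the Mahler measure and at \<open>A\<close> by the valuations of the conjugates.\<close>

lemma height_ge_valuations:
  assumes l: "Factorial_Ring.prime l" and A: "nonarch_abs Qbar A" "A (of_nat l) = 1 / real l"
    and x: "x \<in> Qbar" "x \<noteq> 0" and U: "U \<subseteq> conjugates x" "\<And>y. y \<in> U \<Longrightarrow> \<bar>ln (A y)\<bar> \<ge> \<delta>"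
  shows "\<delta> * real (card U) \<le> 2 * log_mahler x"
proof -
  define C where "C = conjugates x"
  have C: "finite C" "C \<subseteq> Qbar" using conjugates_finite[OF x(1)] conjugates_Qbar[OF x(1)] by (auto simp: C_def)
  have nz: "y \<noteq> 0" if yC: "y \<in> C" for y
  proof -
    obtain t where t: "is_aut t" "y = t x" using yC by (auto simp: C_def conjugates_def)
    show ?thesis
      using aut_eq_iff[OF t(1) x(1) subfield_zero[OF is_subfield_Qbar]] aut_zero[OF t(1)] t(2) x(2) by simp
  qed
  have Apos: "A y > 0" if "y \<in> C" for y using nonarch_pos[OF is_subfield_Qbar A(1)] C(2) nz that by blast
  define a :: complex where "a = of_nat (lead_denom x)"
  define n where "n = (\<Prod>y\<in>C. y)"
  have a0: "a \<noteq> 0" "a \<in> Qbar" using lead_denom(1)[OF x(1)] subfield_of_nat[OF is_subfield_Qbar] by (auto simp: a_def)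
  have nQ: "n \<in> Qbar" "n \<noteq> 0" unfolding n_def
    using C nz by (auto intro: subfield_prod[OF is_subfield_Qbar])
  have An: "B n = (\<Prod>y\<in>C. B y)" if "nonarch_abs Qbar B" for B
    unfolding n_def using C(2) by (intro nonarch_prod[OF is_subfield_Qbar that]) auto
  have min_le: "B (a * n) \<le> (\<Prod>y\<in>C. B y) / (\<Prod>y\<in>C. max 1 (B y))" if B: "nonarch_abs Qbar B" for B
  proof -
    have pos: "(\<Prod>y\<in>C. max 1 (B y)) > 0" by (intro prod_pos) auto
    have "B a \<le> 1 / (\<Prod>y\<in>C. max 1 (B y))"
      using lead_denom_abs_le[OF x(1) B] pos by (simp add: a_def C_def field_simps)
    moreover have "(\<Prod>y\<in>C. B y) \<ge> 0" using C(2) nonarch_nonneg[OF is_subfield_Qbar B] by (intro prod_nonneg) auto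
    ultimately have "B a * (\<Prod>y\<in>C. B y) \<le> 1 / (\<Prod>y\<in>C. max 1 (B y)) * (\<Prod>y\<in>C. B y)"
      by (intro mult_right_mono) auto
    thus ?thesis using nonarch_mult[OF is_subfield_Qbar B a0(2) nQ(1)] An[OF B] by simp
  qed
  have le1: "B (a * n) \<le> 1" if B: "nonarch_abs Qbar B" for B
  proof -
    have "(\<Prod>y\<in>C. B y) \<le> (\<Prod>y\<in>C. max 1 (B y))"
      using C(2) nonarch_nonneg[OF is_subfield_Qbar B] by (intro prod_mono) auto
    moreover have "(\<Prod>y\<in>C. max 1 (B y)) > 0" by (intro prod_pos) auto
    ultimately have "(\<Prod>y\<in>C. B y) / (\<Prod>y\<in>C. max 1 (B y)) \<le> 1" by simp
    thus ?thesis using min_le[OF B] by linarith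
  qed
  have "a * n \<in> \<rat>" using conjugates_prod_rational[OF x(1)] by (simp add: a_def n_def C_def)
  hence "a * n \<in> \<int>" using le1 by (rule rational_integer_of_abs)
  then obtain k where k: "a * n = of_int k" by (auto elim: Ints_cases)
  have k0: "k \<noteq> 0" using k a0(1) nQ(2) by auto
  \<comment> \<open>\<open>a * n\<close> is already an integer. The second factor \<open>a\<close>
    makes the bound at \<open>A\<close> symmetric: each conjugate contributes the minimum of its
    value and the inverse value, which is \<open>exp (- \<bar>ln (A y)\<bar>)\<close>.\<close>
  define b where "b = int (lead_denom x) * k"
  have b: "of_int b = a * (a * n)" unfolding k by (simp add: b_def a_def)
  have b0: "b \<noteq> 0" using k0 lead_denom(1)[OF x(1)] by (simp add: b_def)
  have "A (of_int b) = A a * A (a * n)"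
    unfolding b using a0 nQ subfield_mult[OF is_subfield_Qbar] by (intro nonarch_mult[OF is_subfield_Qbar A(1)]) auto
  also have "\<dots> \<le> 1 / (\<Prod>y\<in>C. max 1 (A y)) * ((\<Prod>y\<in>C. A y) / (\<Prod>y\<in>C. max 1 (A y)))"
  proof (rule mult_mono)
    have pos: "(\<Prod>y\<in>C. max 1 (A y)) > 0" by (intro prod_pos) auto
    show "A a \<le> 1 / (\<Prod>y\<in>C. max 1 (A y))"
      using lead_denom_abs_le[OF x(1) A(1)] pos by (simp add: a_def C_def field_simps)
    show "0 \<le> 1 / (\<Prod>y\<in>C. max 1 (A y))" using pos by simp
    show "0 \<le> A (a * n)" using nonarch_nonneg[OF is_subfield_Qbar A(1)] a0 nQ subfield_mult[OF is_subfield_Qbar] by blast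
  qed (rule min_le[OF A(1)])
  also have "\<dots> = (\<Prod>y\<in>C. A y / (max 1 (A y))\<^sup>2)"
    by (simp add: prod_dividef power2_eq_square prod.distrib)
  also have "\<dots> = (\<Prod>y\<in>C. exp (- \<bar>ln (A y)\<bar>))"
  proof (intro prod.cong refl)
    fix y assume "y \<in> C"
    hence p: "A y > 0" by (rule Apos)
    show "A y / (max 1 (A y))\<^sup>2 = exp (- \<bar>ln (A y)\<bar>)"
    proof (cases "A y \<ge> 1")
      case True
      hence "\<bar>ln (A y)\<bar> = ln (A y)" by simp
      thus ?thesis using True p by (simp add: exp_minus max_def power2_eq_square field_simps)
    next
      case False
      hence "\<bar>ln (A y)\<bar> = - ln (A y)" using p by simp
      thus ?thesis using False p by (simp add: max_def)
    qed
  qed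
  also have "\<dots> = exp (- (\<Sum>y\<in>C. \<bar>ln (A y)\<bar>))" using C(1) unfolding sum_negf[symmetric] by (rule exp_sum[symmetric])
  finally have Ab: "A (of_int b) \<le> exp (- (\<Sum>y\<in>C. \<bar>ln (A y)\<bar>))" .
  have "real_of_int \<bar>b\<bar> = cmod (of_int b)" by simp
  also have "\<dots> = real (lead_denom x) * (real (lead_denom x) * (\<Prod>y\<in>C. cmod y))"
    unfolding b by (simp add: norm_mult a_def n_def prod_norm)
  also have "\<dots> \<le> (real (lead_denom x) * (\<Prod>y\<in>C. max 1 (cmod y))) * (real (lead_denom x) * (\<Prod>y\<in>C. max 1 (cmod y)))"
  proof (rule mult_mono)
    have "(\<Prod>y\<in>C. max 1 (cmod y)) \<ge> 1" by (intro prod_ge_1) auto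
    thus "real (lead_denom x) \<le> real (lead_denom x) * (\<Prod>y\<in>C. max 1 (cmod y))"
      by (simp add: mult_le_cancel_left1)
    have "(\<Prod>y\<in>C. cmod y) \<le> (\<Prod>y\<in>C. max 1 (cmod y))" by (intro prod_mono) auto
    thus "real (lead_denom x) * (\<Prod>y\<in>C. cmod y) \<le> real (lead_denom x) * (\<Prod>y\<in>C. max 1 (cmod y))"
      by (intro mult_left_mono) auto
  qed (auto intro!: mult_nonneg_nonneg prod_nonneg)
  also have "\<dots> = exp (2 * log_mahler x)"
    unfolding exp_log_mahler[OF x(1), symmetric, folded C_def] by (simp flip: exp_add)
  finally have bb: "real_of_int \<bar>b\<bar> \<le> exp (2 * log_mahler x)" .
  have "1 \<le> A (of_int b) * real_of_int \<bar>b\<bar>" by (rule nonarch_of_int_ge[OF A(1) l A(2) b0])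
  also have "\<dots> \<le> exp (- (\<Sum>y\<in>C. \<bar>ln (A y)\<bar>)) * exp (2 * log_mahler x)"
    using Ab bb by (intro mult_mono) auto
  also have "\<dots> = exp (2 * log_mahler x - (\<Sum>y\<in>C. \<bar>ln (A y)\<bar>))" by (simp flip: exp_add)
  finally have "(\<Sum>y\<in>C. \<bar>ln (A y)\<bar>) \<le> 2 * log_mahler x" by simp
  moreover have "(\<Sum>y\<in>U. \<delta>) \<le> (\<Sum>y\<in>U. \<bar>ln (A y)\<bar>)" using U(2) by (rule sum_mono)
  moreover have "(\<Sum>y\<in>U. \<bar>ln (A y)\<bar>) \<le> (\<Sum>y\<in>C. \<bar>ln (A y)\<bar>)"
    using U(1) C(1) by (intro sum_mono2) (auto simp: C_def)
  ultimately show ?thesis by (simp add: mult.commute)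
qed

section \<open>Products over orbits and congruences\<close>

text \<open>Along the orbit, the entry at position \<open>i\<close> takes each conjugate of
  \<open>xs ! i\<close> as value equally often, namely \<open>m\<close> times.\<close>

lemma orbit_prod:
  fixes g :: "complex \<Rightarrow> real"
  assumes xs: "set xs \<subseteq> Qbar" and i: "i < length xs"
    and m: "m * card (conjugates (xs ! i)) = card (orbit xs)"
  shows "(\<Prod>ys\<in>orbit xs. g (ys ! i)) = (\<Prod>y\<in>conjugates (xs ! i). g y) ^ m"
proof -
  let ?C = "conjugates (xs ! i)"
  have inj: "inj_on (\<lambda>y. [y]) B" for B :: "complex set" by (simp add: inj_on_def)
  have xi: "xs ! i \<in> Qbar" using xs i nth_mem by blast
  define F where "F y = {ys\<in>orbit xs. ys ! i = y}" for y
  have cF: "card (F y) = m" if "y \<in> ?C" for y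
  proof -
    have "card {ys\<in>orbit xs. select [i] ys = [y]} * card (orbit (select [i] xs)) = card (orbit xs)"
      using i that by (intro orbit_fibre_card[OF xs]) (auto simp: select_def orbit_singleton)
    hence "card (F y) * card ?C = m * card ?C"
      using inj by (simp add: select_def orbit_singleton card_image F_def m)
    thus ?thesis using card_conjugates_pos[OF xi] by simp
  qed
  have "ys ! i \<in> ?C" if "ys \<in> orbit xs" for ys using that i by (auto simp: orbit_def conjugates_def)
  hence "(\<Prod>ys\<in>orbit xs. g (ys ! i)) = (\<Prod>y\<in>?C. \<Prod>ys\<in>F y. g (ys ! i))"
    unfolding F_def
    by (intro prod.group[symmetric] orbit_finite[OF xs] conjugates_finite[OF xi]) auto
  also have "\<dots> = (\<Prod>y\<in>?C. g y ^ card (F y))"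
    by (intro prod.cong refl) (simp add: F_def)
  also have "\<dots> = (\<Prod>y\<in>?C. g y ^ m)" by (intro prod.cong) (simp_all add: cF)
  finally show ?thesis by (simp add: prod_power_distrib)
qed

lemma orbit_fibre_number:
  assumes xs: "set xs \<subseteq> Qbar" and i: "i < length xs"
  shows "\<exists>m. m * card (conjugates (xs ! i)) = card (orbit xs)"
proof -
  have "card {ys\<in>orbit xs. select [i] ys = [xs ! i]} * card (orbit (select [i] xs)) = card (orbit xs)"
    using i conjugates_self by (intro orbit_fibre_card[OF xs]) (auto simp: select_def orbit_singleton)
  thus ?thesis by (simp add: select_def orbit_singleton card_image inj_on_def) metis
qed

text \<open>The norm of \<open>x^N - z^N\<close> for a conjugate \<open>z\<close> of \<open>x\<close>, cleared of denominators by a power of the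
  leading coefficient, is a nonzero rational integer divisible by a high power of \<open>l\<close>.\<close>

lemma height_ge_congruence:
  assumes l: "Factorial_Ring.prime l" and A: "nonarch_abs Qbar A" "A (of_nat l) = 1 / real l"
    and xs: "set xs \<subseteq> Qbar" and ij: "i < length xs" "j < length xs" and conj: "xs ! j \<in> conjugates (xs ! i)"
    and ne: "(xs ! i) ^ N \<noteq> (xs ! j) ^ N"
    and O1: "O1 \<subseteq> orbit xs" and r: "0 < r" "r \<le> 1"
    and small: "\<And>ys. ys \<in> O1 \<Longrightarrow>
      A ((ys ! i) ^ N - (ys ! j) ^ N) \<le> r * (max 1 (A (ys ! i)) ^ N * max 1 (A (ys ! j)) ^ N)"
  shows "real (card O1) * (- ln r) \<le>
    real (card (orbit xs)) * (ln 2 + 2 * real N * (log_mahler (xs ! i) / real (card (conjugates (xs ! i)))))"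
proof -
  define x where "x = xs ! i"
  define C where "C = conjugates x"
  have xQ: "x \<in> Qbar" "xs ! j \<in> Qbar" using xs ij nth_mem unfolding x_def by blast+
  have C: "finite C" "C \<subseteq> Qbar" using conjugates_finite[OF xQ(1)] conjugates_Qbar[OF xQ(1)] by (auto simp: C_def)
  have Cj: "conjugates (xs ! j) = C"
  proof -
    obtain t where t: "is_aut t" "xs ! j = t x" using conj unfolding conjugates_def x_def by blast
    have "conjugates (t x) \<subseteq> conjugates x"
    proof
      fix y assume "y \<in> conjugates (t x)"
      then obtain s where s: "is_aut s" "y = (s \<circ> t) x" by (auto simp: conjugates_def)
      thus "y \<in> conjugates x" unfolding conjugates_def using aut_comp[OF s(1) t(1)] by blast
    qed
    moreover have "conjugates x \<subseteq> conjugates (t x)"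
    proof
      fix y assume "y \<in> conjugates x"
      then obtain s where s: "is_aut s" "y = s x" by (auto simp: conjugates_def)
      have "y = (s \<circ> inv_into Qbar t) (t x)" using s aut_inv_left[OF t(1) xQ(1)] by simp
      thus "y \<in> conjugates (t x)" unfolding conjugates_def using aut_comp[OF s(1) aut_inv[OF t(1)]] by blast
    qed
    ultimately show ?thesis using t(2) by (simp add: C_def)
  qed
  define Ob where "Ob = orbit xs"
  have Of: "finite Ob" using orbit_finite[OF xs] by (simp add: Ob_def)
  obtain m where m: "m * card C = card Ob" using orbit_fibre_number[OF xs ij(1)] by (auto simp: C_def x_def Ob_def)
  have pi: "(\<Prod>ys\<in>Ob. g (ys ! i)) = (\<Prod>y\<in>C. g y) ^ m" and pj: "(\<Prod>ys\<in>Ob. g (ys ! j)) = (\<Prod>y\<in>C. g y) ^ m"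
    for g :: "complex \<Rightarrow> real"
    using orbit_prod[OF xs ij(1), of m g] orbit_prod[OF xs ij(2), of m g] m Cj
    by (auto simp: C_def x_def Ob_def)
  have yQ: "ys ! i \<in> Qbar" "ys ! j \<in> Qbar" if "ys \<in> Ob" for ys
    using that xQ ij by (auto simp: Ob_def orbit_def x_def aut_Qbar)
  define f where "f ys = (ys ! i) ^ N - (ys ! j) ^ N" for ys :: "complex list"
  have fQ: "f ys \<in> Qbar" if "ys \<in> Ob" for ys
    unfolding f_def using yQ[OF that] subfield_closed[OF is_subfield_Qbar] by auto
  have tf: "t (f ys) = f (map t ys)" if "is_aut t" "ys \<in> Ob" for t ys
  proof -
    have len: "length ys = length xs" using that orbit_length by (simp add: Ob_def)
    show ?thesis unfolding f_def using yQ[OF that(2)] subfield_power[OF is_subfield_Qbar] len ij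
      by (simp add: aut_diff[OF that(1)] aut_power[OF that(1)])
  qed
  have f0: "f ys \<noteq> 0" if ys: "ys \<in> Ob" for ys
  proof
    assume z: "f ys = 0"
    obtain t where t: "is_aut t" "ys = map t xs" using ys by (auto simp: Ob_def orbit_def)
    have xO: "xs \<in> Ob" using orbit_self by (simp add: Ob_def)
    have "t (f xs) = t 0" using tf[OF t(1) xO] t z aut_zero[OF t(1)] by simp
    hence "f xs = 0" using aut_eq_iff[OF t(1) fQ[OF xO] subfield_zero[OF is_subfield_Qbar]] by simp
    thus False using ne by (simp add: f_def)
  qed
  define a :: complex where "a = of_nat (lead_denom x)"
  \<comment> \<open>The factor \<open>f ys\<close> has degree \<open>N\<close> in each of two
    conjugates, and each position runs \<open>m\<close> times through the conjugates; so the power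
    \<open>2 * m * N\<close> of \<open>a\<close> clears all denominators.\<close>
  define B where "B = a ^ (2 * m * N) * (\<Prod>ys\<in>Ob. f ys)"
  have aQ: "a \<in> Qbar" "a \<noteq> 0" using lead_denom(1)[OF xQ(1)] subfield_of_nat[OF is_subfield_Qbar] by (auto simp: a_def)
  have PQ: "(\<Prod>ys\<in>Ob. f ys) \<in> Qbar" using fQ by (intro subfield_prod[OF is_subfield_Qbar])
  \<comment> \<open>Used twice: with \<open>P\<close> empty it shows that \<open>B\<close> is
    integral at every absolute value; with \<open>P = O1\<close> and \<open>q = r\<close> it gives
    the divisibility at \<open>A\<close>.\<close>
  have Bbound: "D B \<le> q ^ card P" if D: "nonarch_abs Qbar D" and P: "P \<subseteq> Ob" and q: "0 < q" "q \<le> 1"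
    and sm: "\<And>ys. ys \<in> P \<Longrightarrow> D (f ys) \<le> q * (max 1 (D (ys ! i)) ^ N * max 1 (D (ys ! j)) ^ N)" for D P q
  proof -
    define M where "M = (\<Prod>y\<in>C. max 1 (D y))"
    have gen: "D (f ys) \<le> max 1 (D (ys ! i)) ^ N * max 1 (D (ys ! j)) ^ N" if "ys \<in> Ob" for ys
    proof -
      define u v where "u = max 1 (D (ys ! i)) ^ N" and "v = max 1 (D (ys ! j)) ^ N"
      have uv1: "u \<ge> 1" "v \<ge> 1" by (auto simp: u_def v_def intro: one_le_power)
      have "D (f ys) \<le> max (D (ys ! i) ^ N) (D (ys ! j) ^ N)"
        unfolding f_def using nonarch_diff[OF is_subfield_Qbar D, of "(ys ! i) ^ N" "(ys ! j) ^ N"]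
          yQ[OF that] subfield_power[OF is_subfield_Qbar] nonarch_power[OF is_subfield_Qbar D] by simp
      moreover have "D (ys ! i) ^ N \<le> u" "D (ys ! j) ^ N \<le> v"
        unfolding u_def v_def using nonarch_nonneg[OF is_subfield_Qbar D] yQ[OF that] by (auto intro!: power_mono)
      moreover have "u * 1 \<le> u * v" "1 * v \<le> u * v" using uv1 by (auto intro!: mult_mono)
      ultimately show ?thesis unfolding u_def[symmetric] v_def[symmetric] by auto
    qed
    have "D (\<Prod>ys\<in>Ob. f ys) = (\<Prod>ys\<in>Ob. D (f ys))" using fQ by (intro nonarch_prod[OF is_subfield_Qbar D])
    also have "\<dots> \<le> (\<Prod>ys\<in>Ob. (if ys \<in> P then q else 1) * (max 1 (D (ys ! i)) ^ N * max 1 (D (ys ! j)) ^ N))"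
      using sm gen fQ nonarch_nonneg[OF is_subfield_Qbar D] by (intro prod_mono) auto
    also have "\<dots> = (\<Prod>ys\<in>Ob. if ys \<in> P then q else 1) *
        ((\<Prod>ys\<in>Ob. max 1 (D (ys ! i))) ^ N * (\<Prod>ys\<in>Ob. max 1 (D (ys ! j))) ^ N)"
      by (simp add: prod.distrib prod_power_distrib)
    also have "(\<Prod>ys\<in>Ob. if ys \<in> P then q else 1) = q ^ card P"
      using Of P by (simp add: prod.If_cases Int_absorb1 Int_commute)
    also have "(\<Prod>ys\<in>Ob. max 1 (D (ys ! i))) ^ N * (\<Prod>ys\<in>Ob. max 1 (D (ys ! j))) ^ N = M ^ (m * N + m * N)"
      unfolding pi[of "\<lambda>y. max 1 (D y)"] pj[of "\<lambda>y. max 1 (D y)"] M_def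
      by (simp only: power_mult power_add)
    also have "m * N + m * N = 2 * m * N" by simp
    finally have 1: "D (\<Prod>ys\<in>Ob. f ys) \<le> q ^ card P * M ^ (2 * m * N)" .
    have "D B = D a ^ (2 * m * N) * D (\<Prod>ys\<in>Ob. f ys)"
      unfolding B_def using aQ PQ subfield_power[OF is_subfield_Qbar]
      by (simp add: nonarch_mult[OF is_subfield_Qbar D] nonarch_power[OF is_subfield_Qbar D])
    also have "\<dots> \<le> D a ^ (2 * m * N) * (q ^ card P * M ^ (2 * m * N))"
      using 1 nonarch_nonneg[OF is_subfield_Qbar D aQ(1)] by (intro mult_left_mono) auto
    also have "\<dots> = q ^ card P * (D a * M) ^ (2 * m * N)" by (simp add: power_mult_distrib mult_ac)
    also have "\<dots> \<le> q ^ card P * 1"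
    proof (intro mult_left_mono power_le_one)
      show "D a * M \<le> 1" using lead_denom_abs_le[OF xQ(1) D] by (simp add: a_def M_def C_def)
      show "0 \<le> D a * M" using nonarch_nonneg[OF is_subfield_Qbar D aQ(1)] unfolding M_def
        by (intro mult_nonneg_nonneg prod_nonneg) auto
    qed (use q in auto)
    finally show ?thesis by simp
  qed
  have "B \<in> \<rat>"
  proof -
    have "(\<Prod>ys\<in>Ob. f ys) \<in> \<rat>"
    proof (rule aut_fixed_rational[OF PQ])
      fix t assume t: "is_aut t"
      have "t (\<Prod>ys\<in>Ob. f ys) = (\<Prod>ys\<in>Ob. t (f ys))" using fQ by (intro aut_prod[OF t])
      also have "\<dots> = (\<Prod>ys\<in>Ob. f (map t ys))" using tf[OF t] by (intro prod.cong) auto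
      also have "\<dots> = (\<Prod>ys\<in>Ob. f ys)" unfolding Ob_def by (rule prod.reindex_bij_betw[OF orbit_map[OF xs t]])
      finally show "t (\<Prod>ys\<in>Ob. f ys) = (\<Prod>ys\<in>Ob. f ys)" .
    qed
    thus ?thesis unfolding B_def a_def by simp
  qed
  hence "B \<in> \<int>"
    using Bbound[of _ "{}" 1] by (intro rational_integer_of_abs) auto
  then obtain b where b: "B = of_int b" by (auto elim: Ints_cases)
  have b0: "b \<noteq> 0" using b aQ(2) f0 Of unfolding B_def by auto
  have Ab: "A (of_int b) \<le> r ^ card O1"
    unfolding b[symmetric] using O1 r small by (intro Bbound[OF A(1)]) (auto simp: Ob_def f_def)
  have e: "2 * m * N = m * N + m * N" by simp
  define d where "d = real (card C)"
  have d0: "d > 0" using card_conjugates_pos[OF xQ(1)] by (simp add: d_def C_def)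
  have "real_of_int \<bar>b\<bar> = cmod B" by (simp add: b)
  also have "\<dots> = real (lead_denom x) ^ (2 * m * N) * (\<Prod>ys\<in>Ob. cmod (f ys))"
    by (simp add: B_def norm_mult norm_power prod_norm a_def)
  also have "\<dots> \<le> real (lead_denom x) ^ (2 * m * N) *
      (\<Prod>ys\<in>Ob. 2 * (max 1 (cmod (ys ! i)) ^ N * max 1 (cmod (ys ! j)) ^ N))"
  proof (intro mult_left_mono prod_mono conjI)
    fix ys
    define u v where "u = max 1 (cmod (ys ! i)) ^ N" and "v = max 1 (cmod (ys ! j)) ^ N"
    have uv1: "u \<ge> 1" "v \<ge> 1" by (auto simp: u_def v_def intro: one_le_power)
    have "cmod (f ys) \<le> cmod (ys ! i) ^ N + cmod (ys ! j) ^ N"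
      unfolding f_def using norm_triangle_ineq4[of "(ys ! i) ^ N" "(ys ! j) ^ N"] by (simp add: norm_power)
    moreover have "cmod (ys ! i) ^ N \<le> u" "cmod (ys ! j) ^ N \<le> v"
      unfolding u_def v_def by (auto intro!: power_mono)
    moreover have "u * 1 \<le> u * v" "1 * v \<le> u * v" using uv1 by (auto intro!: mult_mono)
    ultimately show "cmod (f ys) \<le> 2 * (max 1 (cmod (ys ! i)) ^ N * max 1 (cmod (ys ! j)) ^ N)"
      unfolding u_def[symmetric] v_def[symmetric] by linarith
  qed auto
  also have "(\<Prod>ys\<in>Ob. 2 * (max 1 (cmod (ys ! i)) ^ N * max 1 (cmod (ys ! j)) ^ N))
      = 2 ^ card Ob * ((\<Prod>ys\<in>Ob. max 1 (cmod (ys ! i))) ^ N * (\<Prod>ys\<in>Ob. max 1 (cmod (ys ! j))) ^ N)"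
    by (simp add: prod.distrib prod_power_distrib)
  also have "real (lead_denom x) ^ (2 * m * N) * \<dots> = 2 ^ card Ob *
      (real (lead_denom x) * (\<Prod>y\<in>C. max 1 (cmod y))) ^ (2 * m * N)"
    unfolding pi[of "\<lambda>y. max 1 (cmod y)"] pj[of "\<lambda>y. max 1 (cmod y)"]
      e by (simp only: power_mult_distrib power_add power_mult[symmetric] mult_ac)
  also have "\<dots> = 2 ^ card Ob * exp (log_mahler x) ^ (2 * m * N)"
    using exp_log_mahler[OF xQ(1)] by (simp add: C_def)
  finally have bb: "real_of_int \<bar>b\<bar> \<le> 2 ^ card Ob * exp (log_mahler x) ^ (2 * m * N)" .
  have "1 \<le> A (of_int b) * real_of_int \<bar>b\<bar>" by (rule nonarch_of_int_ge[OF A(1) l A(2) b0])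
  also have "\<dots> \<le> r ^ card O1 * (2 ^ card Ob * exp (log_mahler x) ^ (2 * m * N))"
    using Ab bb r by (intro mult_mono) auto
  finally have "ln 1 \<le> ln (r ^ card O1 * (2 ^ card Ob * exp (log_mahler x) ^ (2 * m * N)))"
    by (intro ln_mono) auto
  also have "\<dots> = real (card O1) * ln r + (real (card Ob) * ln 2 + real (2 * m * N) * log_mahler x)"
    using r by (simp add: ln_mult ln_realpow)
  finally have "real (card O1) * (- ln r) \<le> real (card Ob) * ln 2 + real (2 * m * N) * log_mahler x" by simp
  moreover have "real m = real (card Ob) / d" using m d0 by (simp add: d_def field_simps flip: of_nat_mult)
  hence "real (2 * m * N) * log_mahler x = real (card Ob) * (2 * real N * (log_mahler x / d))" by simp
  ultimately show ?thesis by (simp add: distrib_left x_def Ob_def d_def C_def)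
qed

section \<open>Kummer extensions at an unramified prime\<close>

lemma power_int_inj:
  fixes w :: real
  assumes "0 < w" "w < 1" "w powi m = w powi n"
  shows "m = n"
  using assms powr_inj[of w "real_of_int m" "real_of_int n"] by (auto simp: powr_real_of_int')

context
  fixes A and l :: nat
  assumes A: "nonarch_abs Qbar A" and l: "Factorial_Ring.prime l" and Al: "A (of_nat l) = 1 / real l"
begin

lemmas A_simps = nonarch_mult[OF is_subfield_Qbar A] nonarch_power[OF is_subfield_Qbar A] nonarch_one[OF is_subfield_Qbar A]
  nonarch_zero[OF is_subfield_Qbar A] nonarch_divide[OF is_subfield_Qbar A]
lemmas Q_closed = subfield_closed[OF is_subfield_Qbar]

lemma prime_number_bounds: "l > 1" "1 / real l < 1" "l - 1 \<noteq> 0" "Suc (l - 1) = l" "real l > 0"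
  using prime_gt_1_nat[OF l] by auto

section \<open>Raising to the power l near 1\<close>

lemma nonarch_choose:
  assumes "0 < k" "k < l" shows "A (of_nat (l choose k)) \<le> 1 / real l"
proof -
  have "l dvd (l choose k)" using assms l by (intro dvd_choose_prime) auto
  then obtain m where m: "l choose k = l * m" by auto
  have "A (of_nat (l choose k)) = 1 / real l * A (of_nat m)"
    unfolding m of_nat_mult by (simp add: A_simps Q_closed Al)
  also have "\<dots> \<le> 1 / real l * 1"
    using nonarch_of_int_le[OF A l Al, of "int m"] by (intro mult_left_mono) auto
  finally show ?thesis by simp
qed

lemma nonarch_binomial_term:
  assumes x: "x \<in> Qbar" and k: "0 < k" "k < l"
  shows "A (of_nat (l choose k) * x ^ k) \<le> A x ^ k / real l"
proof -
  have "A (of_nat (l choose k) * x ^ k) = A (of_nat (l choose k)) * A x ^ k"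
    by (simp add: A_simps Q_closed x)
  also have "\<dots> \<le> 1 / real l * A x ^ k"
    by (intro mult_right_mono nonarch_choose k zero_le_power nonarch_nonneg[OF is_subfield_Qbar A x])
  finally show ?thesis by simp
qed

lemma binomial_split: "(1 + x) ^ l - 1 = (\<Sum>k=1..l. of_nat (l choose k) * (x::complex) ^ k)"
proof -
  have "(1 + x) ^ l = (\<Sum>k\<le>l. of_nat (l choose k) * x ^ k)"
    using binomial_ring[of x 1 l] by (simp add: add.commute)
  also have "{..l} = insert 0 {1..l}" by auto
  finally show ?thesis by (simp add: sum.insert)
qed

lemma binomial_split_last:
  "(1 + x) ^ l - 1 = (\<Sum>k\<in>{1..<l}. of_nat (l choose k) * (x::complex) ^ k) + x ^ l"
proof -
  have "{1..l} = insert l {1..<l}" using prime_number_bounds by auto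
  thus ?thesis unfolding binomial_split by (simp add: sum.insert)
qed

lemma nonarch_binomial_middle:
  assumes x: "x \<in> Qbar" "A x \<le> 1"
  shows "A (\<Sum>k\<in>{1..<l}. of_nat (l choose k) * x ^ k) \<le> A x / real l"
proof (rule nonarch_sum_le[OF is_subfield_Qbar A])
  show "of_nat (l choose k) * x ^ k \<in> Qbar" for k by (intro Q_closed x)
  note nn = nonarch_nonneg[OF is_subfield_Qbar A x(1)]
  show "A x / real l \<ge> 0" using nn by simp
  fix k assume k: "k \<in> {1..<l}"
  have "A x ^ k \<le> A x ^ 1" using k x(2) nn by (intro power_decreasing) auto
  hence "A x ^ k / real l \<le> A x / real l" using prime_number_bounds by (intro divide_right_mono) auto
  thus "A (of_nat (l choose k) * x ^ k) \<le> A x / real l"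
    using nonarch_binomial_term[OF x(1), of k] k by simp
qed

lemma nonarch_le_1_of_power:
  assumes x: "x \<in> Qbar" "A x ^ (l - 1) \<le> 1 / real l"
  shows "A x < 1"
proof (rule ccontr)
  assume "\<not> A x < 1"
  hence "A x ^ (l - 1) \<ge> 1" by (intro one_le_power) simp
  thus False using x(2) prime_number_bounds by simp
qed

lemma nonarch_power_l: "x \<in> Qbar \<Longrightarrow> A (x ^ l) = A x * A x ^ (l - 1)"
  using prime_number_bounds by (metis A_simps(2) power_Suc)

text \<open>On the closed disc every term of the binomial expansion has value at most
  \<open>A x / real l\<close>: the middle ones since \<open>l\<close> divides the binomial
  coefficient, the last one by the assumption on \<open>x\<close>.\<close>

lemma nonarch_prime_power_le:
  assumes x: "x \<in> Qbar" "A x ^ (l - 1) \<le> 1 / real l"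
  shows "A ((1 + x) ^ l - 1) \<le> A x / real l"
proof -
  note nn = nonarch_nonneg[OF is_subfield_Qbar A x(1)]
  have "A (x ^ l) \<le> A x * (1 / real l)"
    unfolding nonarch_power_l[OF x(1)] using x(2) nn by (intro mult_left_mono)
  moreover have "A (\<Sum>k\<in>{1..<l}. of_nat (l choose k) * x ^ k) \<le> A x / real l"
    using nonarch_binomial_middle x nonarch_le_1_of_power[OF x] by simp
  moreover have "A ((1 + x) ^ l - 1) \<le> max (A (\<Sum>k\<in>{1..<l}. of_nat (l choose k) * x ^ k)) (A (x ^ l))"
    unfolding binomial_split_last by (intro nonarch_add[OF is_subfield_Qbar A] Q_closed x subfield_sum[OF is_subfield_Qbar])
  ultimately show ?thesis by simp
qed

text \<open>On the open disc the linear term \<open>l * x\<close> strictly dominates all others,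
  including \<open>x ^ l\<close>.\<close>

lemma nonarch_prime_power_eq:
  assumes x: "x \<in> Qbar" "A x ^ (l - 1) < 1 / real l" "x \<noteq> 0"
  shows "A ((1 + x) ^ l - 1) = A x / real l"
proof -
  let ?f = "\<lambda>k. of_nat (l choose k) * x ^ k"
  have pos: "A x > 0" using nonarch_pos[OF is_subfield_Qbar A] x by simp
  have lt: "A x < 1" using nonarch_le_1_of_power x by simp
  have f1: "A (?f 1) = A x / real l" by (simp add: A_simps Q_closed x Al)
  have "A (sum ?f {1..l}) = A (?f 1)"
  proof (rule nonarch_sum_dominant[OF is_subfield_Qbar A])
    show "?f k \<in> Qbar" for k by (intro Q_closed x)
    show "1 \<in> {1..l}" using prime_number_bounds by simp
    fix k assume k: "k \<in> {1..l}" "k \<noteq> 1"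
    show "A (?f k) < A (?f 1)"
    proof (cases "k = l")
      case True
      have "A x * A x ^ (l - 1) < A x * (1 / real l)"
        using x(2) pos by (intro mult_strict_left_mono)
      thus ?thesis unfolding f1 True using nonarch_power_l[OF x(1)] by simp
    next
      case False
      have "A x ^ k < A x ^ 1" using k pos lt by (intro power_strict_decreasing) auto
      hence "A x ^ k / real l < A x / real l" using prime_number_bounds by (intro divide_strict_right_mono) auto
      thus ?thesis unfolding f1 using nonarch_binomial_term[OF x(1), of k] k False by simp
    qed
  qed simp
  thus ?thesis unfolding binomial_split f1 .
qed

lemma nonarch_prime_power_iter_le:
  assumes x: "x \<in> Qbar" "A x ^ (l - 1) \<le> 1 / real l"
  shows "A ((1 + x) ^ (l ^ k) - 1) \<le> A x / real l ^ k"
proof (induction k)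
  case (Suc k)
  define y where "y = (1 + x) ^ (l ^ k) - 1"
  note nn = nonarch_nonneg[OF is_subfield_Qbar A]
  have y: "y \<in> Qbar" unfolding y_def by (intro Q_closed x)
  have "A x / real l ^ k \<le> A x / 1"
    using nn[OF x(1)] prime_number_bounds by (intro divide_left_mono) (auto simp: one_le_power)
  hence "A y \<le> A x" using Suc unfolding y_def by simp
  hence "A y ^ (l - 1) \<le> A x ^ (l - 1)" using nn[OF y] by (intro power_mono)
  hence "A ((1 + y) ^ l - 1) \<le> A y / real l" using x by (intro nonarch_prime_power_le y) simp
  also have "\<dots> \<le> A x / real l ^ k / real l" using Suc unfolding y_def by (intro divide_right_mono) auto
  also have "(1 + y) ^ l = (1 + x) ^ (l ^ Suc k)" unfolding y_def by (simp add: power_mult[symmetric] mult.commute)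
  finally show ?case by (simp add: mult.commute)
qed simp

text \<open>The exact contraction iterates because the powers stay in the open disc, and the
  resulting value \<open>A x / real l ^ k\<close> is nonzero. So 1 is the only root of unity of
  \<open>l\<close>-power order in that disc.\<close>

lemma prime_power_ne_1:
  assumes x: "x \<in> Qbar" "A x ^ (l - 1) < 1 / real l" "x \<noteq> 0"
  shows "(1 + x) ^ (l ^ k) \<noteq> 1"
proof -
  have "A ((1 + x) ^ (l ^ k) - 1) = A x / real l ^ k"
  proof (induction k)
    case (Suc k)
    define y where "y = (1 + x) ^ (l ^ k) - 1"
    note nn = nonarch_nonneg[OF is_subfield_Qbar A]
    have y: "y \<in> Qbar" unfolding y_def by (intro Q_closed x)
    have pos: "A x > 0" using nonarch_pos[OF is_subfield_Qbar A] x by simp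
    have "A x / real l ^ k \<le> A x / 1"
      using pos prime_number_bounds by (intro divide_left_mono) (auto simp: one_le_power)
    hence le: "A y \<le> A x" using Suc unfolding y_def by simp
    have "A y > 0" using Suc pos prime_number_bounds unfolding y_def by simp
    hence y0: "y \<noteq> 0" using A_simps(4) by auto
    have "A y ^ (l - 1) \<le> A x ^ (l - 1)" using nn[OF y] le by (intro power_mono)
    hence "A ((1 + y) ^ l - 1) = A y / real l" using x y0 by (intro nonarch_prime_power_eq y) auto
    also have "\<dots> = A x / real l ^ k / real l" using Suc unfolding y_def by simp
    also have "(1 + y) ^ l = (1 + x) ^ (l ^ Suc k)" unfolding y_def by (simp add: power_mult[symmetric] mult.commute)
    finally show ?case by (simp add: mult.commute)
  qed simp
  moreover have "A x / real l ^ k > 0" using nonarch_pos[OF is_subfield_Qbar A x(1,3)] prime_number_bounds(5)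
    by (intro divide_pos_pos zero_less_power)
  ultimately have "A ((1 + x) ^ (l ^ k) - 1) > 0" by (simp only:)
  moreover have "A ((1 + x) ^ (l ^ k) - 1) = 0" if "(1 + x) ^ (l ^ k) = 1" unfolding that by (simp add: A_simps(4))
  ultimately show ?thesis by auto
qed

section \<open>Distances between roots of unity\<close>

lemma unity_root_Qbar: "z ^ l = 1 \<Longrightarrow> z \<in> Qbar"
  unfolding Qbar_def algebraic_def using prime_number_bounds
  by (auto intro!: exI[of _ "monom 1 l - 1"] simp: poly_monom coeff_diff dest!: arg_cong[of _ _ "\<lambda>p. coeff p l"])

lemma unity_root_abs: "z ^ l = 1 \<Longrightarrow> A z = 1"
proof -
  assume z: "z ^ l = 1"
  hence "A z ^ l = 1" using A_simps(2,3) unity_root_Qbar by metis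
  thus "A z = 1" using power_eq_iff_eq_base[of l "A z" 1] nonarch_nonneg[OF is_subfield_Qbar A unity_root_Qbar[OF z]] prime_number_bounds by simp
qed

text \<open>The radius l^(-1/(l-1)), at which the terms \<open>l * x\<close> and
  \<open>x ^ l\<close> of the expansion of \<open>(1 + x) ^ l\<close> have the same value.\<close>

definition unity_radius :: real where "unity_radius = root (l - 1) (1 / real l)"

lemma unity_radius_props: "unity_radius ^ (l - 1) = 1 / real l" "unity_radius > 0"
  using prime_number_bounds real_root_pow_pos2[of "l - 1" "1 / real l"] unfolding unity_radius_def by auto

lemma nonarch_le_rho_iff: "x \<in> Qbar \<Longrightarrow> A x \<le> unity_radius \<longleftrightarrow> A x ^ (l - 1) \<le> 1 / real l"
  and nonarch_less_rho_iff: "x \<in> Qbar \<Longrightarrow> A x < unity_radius \<longleftrightarrow> A x ^ (l - 1) < 1 / real l"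
  unfolding not_le[symmetric] unity_radius_props(1)[symmetric]
  using power_mono_iff[of "A x" unity_radius "l - 1"] power_mono_iff[of unity_radius "A x" "l - 1"]
    unity_radius_props(2) prime_number_bounds(3) nonarch_nonneg[OF is_subfield_Qbar A, of x] by simp_all

text \<open>With \<open>x = z - 1\<close>, the term \<open>x ^ l\<close> equals minus the middle
  terms, whose value is at most \<open>A x / real l\<close>; now cancel \<open>A x\<close>.\<close>

lemma unity_root_diff:
  assumes z: "z ^ l = 1" shows "A (z - 1) \<le> unity_radius"
proof (cases "z = 1")
  case False
  define x where "x = z - 1"
  have x: "x \<in> Qbar" "x \<noteq> 0" unfolding x_def using False unity_root_Qbar[OF z] by (auto intro!: Q_closed)
  have x1: "A x \<le> 1" unfolding x_def
    using nonarch_diff[OF is_subfield_Qbar A unity_root_Qbar[OF z] Q_closed(1)] unity_root_abs[OF z] A_simps(3) by simp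
  have pos: "A x > 0" using nonarch_pos[OF is_subfield_Qbar A] x by simp
  have "(\<Sum>k\<in>{1..<l}. of_nat (l choose k) * x ^ k) + x ^ l = 0"
    using binomial_split_last[of x] z unfolding x_def by simp
  hence "x ^ l = - (\<Sum>k\<in>{1..<l}. of_nat (l choose k) * x ^ k)" by (simp add: eq_neg_iff_add_eq_0 add.commute)
  hence "A (x ^ l) = A (\<Sum>k\<in>{1..<l}. of_nat (l choose k) * x ^ k)"
    using nonarch_uminus[OF is_subfield_Qbar A, of "\<Sum>k\<in>{1..<l}. of_nat (l choose k) * x ^ k"]
    by (simp add: Q_closed x subfield_sum[OF is_subfield_Qbar])
  hence "A x * A x ^ (l - 1) \<le> A x * (1 / real l)"
    using nonarch_binomial_middle[OF x(1) x1] nonarch_power_l[OF x(1)] by simp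
  hence "A x ^ (l - 1) \<le> 1 / real l" using pos mult_le_cancel_left_pos[OF pos] by blast
  thus ?thesis using nonarch_le_rho_iff[OF x(1)] unfolding x_def by simp
qed (use unity_radius_props A_simps(4) in simp)

lemma nonarch_sum_less:
  assumes "finite I" "\<And>i. i \<in> I \<Longrightarrow> f i \<in> Qbar" "\<And>i. i \<in> I \<Longrightarrow> A (f i) < c" "c > 0"
  shows "A (sum f I) < c"
  using assms(1-3)
proof (induction I rule: finite_induct)
  case (insert i I)
  have "A (f i + sum f I) \<le> max (A (f i)) (A (sum f I))"
    using insert by (intro nonarch_add[OF is_subfield_Qbar A] subfield_sum[OF is_subfield_Qbar]) auto
  moreover have "A (f i) < c" "A (sum f I) < c" using insert by auto
  ultimately have "A (f i + sum f I) < c" by simp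
  thus ?case using insert by simp
qed (use assms(4) A_simps(4) in simp)

section \<open>Elements of a Kummer extension and their conjugates\<close>

context
  fixes E w b \<beta> \<gamma>
  assumes E: "is_subfield E" "E \<subseteq> Qbar" and w: "0 < w" "w < 1"
    and vals: "\<forall>x\<in>E - {0}. \<exists>k::int. A x = w powi k"
    and beta: "\<beta> \<in> Qbar" "A \<beta> ^ l = w" "\<beta> ^ l \<in> E"
    and b: "\<forall>i. b i \<in> E" and gamma: "\<gamma> = (\<Sum>i<l. b i * \<beta> ^ i)" "\<gamma> \<noteq> 0"
begin

lemma b_Qbar: "b i \<in> Qbar" using b E by blast
lemma term_Qbar: "b i * \<beta> ^ i \<in> Qbar" by (intro Q_closed b_Qbar beta)
lemma gamma_Qbar: "\<gamma> \<in> Qbar" unfolding gamma(1) by (intro subfield_sum[OF is_subfield_Qbar] term_Qbar)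
lemma beta_nz: "\<beta> \<noteq> 0" using beta w A_simps(4) prime_number_bounds by (auto simp: power_0_left)
lemma gamma_pos: "A \<gamma> > 0" using nonarch_pos[OF is_subfield_Qbar A gamma_Qbar gamma(2)] .

text \<open>The \<open>l\<close>-th power of the value of \<open>b n * \<beta> ^ n\<close> is
  \<open>w\<close> to an exponent congruent to \<open>n\<close> modulo \<open>l\<close>, so the
  value determines \<open>n\<close>.\<close>

lemma kummer_abs_distinct:
  assumes ij: "i < l" "j < l" "b i \<noteq> 0" "b j \<noteq> 0" and eq: "A (b i * \<beta> ^ i) = A (b j * \<beta> ^ j)"
  shows "i = j"
proof -
  have pw: "\<exists>k. A (b n * \<beta> ^ n) ^ l = w powi (k * int l + int n)" if n: "b n \<noteq> 0" for n
  proof -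
    obtain k where k: "A (b n) = w powi k" using vals b n by blast
    have "A (b n * \<beta> ^ n) ^ l = (w powi k * A \<beta> ^ n) ^ l"
      by (simp add: A_simps(1,2) Q_closed b_Qbar beta(1) k)
    also have "\<dots> = (w powi k) ^ l * (A \<beta> ^ l) ^ n"
      by (simp only: power_mult_distrib power_mult[symmetric] mult.commute)
    also have "\<dots> = w powi (k * int l + int n)"
      using w by (simp add: beta(2) power_int_add power_int_mult)
    finally show ?thesis by blast
  qed
  obtain k m where km: "A (b i * \<beta> ^ i) ^ l = w powi (k * int l + int i)" "A (b j * \<beta> ^ j) ^ l = w powi (m * int l + int j)"
    using pw ij by metis
  hence "k * int l + int i = m * int l + int j" using power_int_inj w eq by metis
  hence "(k * int l + int i) mod int l = (m * int l + int j) mod int l" by simp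
  thus ?thesis using ij by simp
qed

lemma kummer_dominant:
  "\<exists>i<l. A \<gamma> = A (b i * \<beta> ^ i) \<and> b i \<noteq> 0 \<and> (\<forall>j<l. j \<noteq> i \<longrightarrow> A (b j * \<beta> ^ j) < A \<gamma>)"
proof -
  define f where "f i = b i * \<beta> ^ i" for i
  define I where "I = {i. i < l \<and> b i \<noteq> 0}"
  have fin: "finite I" unfolding I_def by simp
  have "I \<noteq> {}"
  proof
    assume "I = {}"
    hence "\<gamma> = 0" unfolding gamma(1) I_def by (intro sum.neutral) auto
    thus False using gamma by simp
  qed
  then obtain i where i: "i \<in> I" "\<forall>j\<in>I. A (f j) \<le> A (f i)"
    using fin Max_in[of "(\<lambda>i. A (f i)) ` I"] Max_ge[of "(\<lambda>i. A (f i)) ` I"] by fastforce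
  have pos: "A (f i) > 0" using i nonarch_pos[OF is_subfield_Qbar A term_Qbar] beta_nz unfolding f_def I_def by simp
  have lt: "A (f j) < A (f i)" if j: "j < l" "j \<noteq> i" for j
  proof (cases "b j = 0")
    case True thus ?thesis using pos A_simps(4) unfolding f_def by simp
  next
    case False
    hence "j \<in> I" using j unfolding I_def by simp
    moreover have "A (f j) \<noteq> A (f i)" using kummer_abs_distinct[of j i] j False i unfolding f_def I_def by auto
    ultimately show ?thesis using i by fastforce
  qed
  have "A (sum f {..<l}) = A (f i)"
    using lt i unfolding I_def by (intro nonarch_sum_dominant[OF is_subfield_Qbar A]) (auto simp: f_def term_Qbar)
  hence "A \<gamma> = A (f i)" unfolding gamma(1) f_def .
  thus ?thesis using i lt unfolding I_def f_def by auto
qed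

lemma kummer_abs_le: "i < l \<Longrightarrow> A (b i * \<beta> ^ i) \<le> A \<gamma>"
  using kummer_dominant by (metis less_imp_le order_refl)

context
  fixes s assumes s: "is_aut s" "\<forall>x\<in>E. s x = x"
begin

definition "kummer_ratio = s \<beta> / \<beta>"

lemma kummer_ratio_props: "kummer_ratio ^ l = 1" "(kummer_ratio ^ i) ^ l = 1" "kummer_ratio \<in> Qbar" "s \<beta> = kummer_ratio * \<beta>" "kummer_ratio \<noteq> 0"
proof -
  have "s \<beta> ^ l = \<beta> ^ l" using aut_power[OF s(1) beta(1)] s(2) beta(3) by metis
  thus 1: "kummer_ratio ^ l = 1" unfolding kummer_ratio_def using beta_nz by (simp add: power_divide)
  thus "(kummer_ratio ^ i) ^ l = 1" by (metis power_mult mult.commute power_one)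
  show "kummer_ratio \<in> Qbar" using unity_root_Qbar[OF 1] .
  show "s \<beta> = kummer_ratio * \<beta>" unfolding kummer_ratio_def using beta_nz by simp
  show "kummer_ratio \<noteq> 0" using 1 prime_number_bounds by (auto simp: power_0_left)
qed

lemma s_gamma: "s \<gamma> = (\<Sum>i<l. kummer_ratio ^ i * (b i * \<beta> ^ i))"
proof -
  have "s \<gamma> = (\<Sum>i<l. s (b i * \<beta> ^ i))" unfolding gamma(1) by (intro aut_sum[OF s(1)] term_Qbar)
  also have "\<dots> = (\<Sum>i<l. kummer_ratio ^ i * (b i * \<beta> ^ i))"
  proof (rule sum.cong[OF refl])
    fix i
    have "s (b i * \<beta> ^ i) = s (b i) * s \<beta> ^ i"
      using aut_mult[OF s(1) b_Qbar] aut_power[OF s(1) beta(1)] Q_closed(9)[OF beta(1)] by simp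
    thus "s (b i * \<beta> ^ i) = kummer_ratio ^ i * (b i * \<beta> ^ i)" using s(2) b by (simp add: kummer_ratio_props(4) power_mult_distrib)
  qed
  finally show ?thesis .
qed

lemma s_gamma_Qbar: "s \<gamma> \<in> Qbar" using aut_Qbar[OF s(1) gamma_Qbar] .

text \<open>\<open>s\<close> multiplies the summands by powers of one \<open>l\<close>-th root of
  unity. Each factor differs from 1 by at most \<open>unity_radius\<close>, and no summand exceeds
  \<gamma> in value since there is no cancellation in the dominant one.\<close>

lemma kummer_close: "A (s \<gamma> / \<gamma> - 1) \<le> unity_radius"
proof -
  have "s \<gamma> - \<gamma> = (\<Sum>i<l. (kummer_ratio ^ i - 1) * (b i * \<beta> ^ i))"
    unfolding s_gamma unfolding gamma(1) by (simp add: sum_subtractf algebra_simps)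
  moreover have "A (\<Sum>i<l. (kummer_ratio ^ i - 1) * (b i * \<beta> ^ i)) \<le> unity_radius * A \<gamma>"
  proof (rule nonarch_sum_le[OF is_subfield_Qbar A])
    show "(kummer_ratio ^ i - 1) * (b i * \<beta> ^ i) \<in> Qbar" for i by (intro Q_closed term_Qbar kummer_ratio_props)
    fix i assume i: "i \<in> {..<l}"
    have "A ((kummer_ratio ^ i - 1) * (b i * \<beta> ^ i)) = A (kummer_ratio ^ i - 1) * A (b i * \<beta> ^ i)"
      by (intro A_simps Q_closed term_Qbar kummer_ratio_props)
    also have "\<dots> \<le> unity_radius * A \<gamma>"
      using i unity_radius_props by (intro mult_mono unity_root_diff kummer_ratio_props kummer_abs_le nonarch_nonneg[OF is_subfield_Qbar A term_Qbar]) auto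
    finally show "A ((kummer_ratio ^ i - 1) * (b i * \<beta> ^ i)) \<le> unity_radius * A \<gamma>" .
  qed (use unity_radius_props gamma_pos in simp)
  ultimately have "A (s \<gamma> - \<gamma>) \<le> unity_radius * A \<gamma>" by simp
  moreover have "s \<gamma> / \<gamma> - 1 = (s \<gamma> - \<gamma>) / \<gamma>" using gamma by (simp add: field_simps)
  ultimately show ?thesis
    using gamma_pos A_simps(5)[OF Q_closed(2)[OF s_gamma_Qbar gamma_Qbar] gamma_Qbar] by (simp add: divide_le_eq)
qed

text \<open>Apply the contraction \<open>k\<close> times to \<open>s \<gamma> / \<gamma>\<close>,
  which lies in the closed disc. The maxima with 1 put the bound into the form required by
  \<open>height_ge_congruence\<close>, where denominators are cleared.\<close>

lemma kummer_congruence: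
  "A (\<gamma> ^ (l ^ k) - s \<gamma> ^ (l ^ k)) \<le> 1 / real l ^ k * (max 1 (A \<gamma>) ^ (l ^ k) * max 1 (A (s \<gamma>)) ^ (l ^ k))"
proof -
  define x where "x = s \<gamma> / \<gamma> - 1"
  define N where "N = l ^ k"
  have x: "x \<in> Qbar" unfolding x_def by (intro Q_closed s_gamma_Qbar gamma_Qbar)
  have xr: "A x ^ (l - 1) \<le> 1 / real l" using kummer_close nonarch_le_rho_iff[OF x] unfolding x_def by simp
  have "A ((1 + x) ^ N - 1) \<le> A x / real l ^ k" unfolding N_def by (rule nonarch_prime_power_iter_le[OF x xr])
  also have "\<dots> \<le> 1 / real l ^ k" using nonarch_le_1_of_power[OF x xr] by (intro divide_right_mono) auto
  finally have 1: "A ((1 + x) ^ N - 1) \<le> 1 / real l ^ k" .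
  have "s \<gamma> ^ N - \<gamma> ^ N = \<gamma> ^ N * ((1 + x) ^ N - 1)"
    unfolding x_def using gamma by (simp add: power_divide right_diff_distrib)
  hence "A (s \<gamma> ^ N - \<gamma> ^ N) = A \<gamma> ^ N * A ((1 + x) ^ N - 1)"
    by (simp add: A_simps Q_closed x gamma_Qbar)
  also have "\<dots> \<le> (max 1 (A \<gamma>) ^ N * max 1 (A (s \<gamma>)) ^ N) * (1 / real l ^ k)"
  proof (intro mult_mono 1)
    have "A \<gamma> ^ N * 1 \<le> max 1 (A \<gamma>) ^ N * max 1 (A (s \<gamma>)) ^ N"
      using gamma_pos by (intro mult_mono power_mono one_le_power) auto
    thus "A \<gamma> ^ N \<le> max 1 (A \<gamma>) ^ N * max 1 (A (s \<gamma>)) ^ N" by simp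
    show "0 \<le> A ((1 + x) ^ N - 1)" by (intro nonarch_nonneg[OF is_subfield_Qbar A] Q_closed x)
  qed auto
  also have "A (s \<gamma> ^ N - \<gamma> ^ N) = A (\<gamma> ^ N - s \<gamma> ^ N)"
    using nonarch_uminus[OF is_subfield_Qbar A, of "s \<gamma> ^ N - \<gamma> ^ N"] by (simp add: Q_closed s_gamma_Qbar gamma_Qbar)
  finally show ?thesis unfolding N_def by (simp add: mult.commute)
qed

text \<open>Comparing \<open>s \<gamma>\<close> with \<open>kummer_ratio ^ i * \<gamma>\<close>
  instead of \<gamma> cancels the dominant summand, so the quotient lies in the open disc. Its
  \<open>l ^ k\<close>-th power is 1, as \<open>k > 0\<close> also removes the root of unity; hence
  the quotient is 1.\<close>

lemma kummer_rigid:
  assumes i: "i < l" "\<forall>j<l. j \<noteq> i \<longrightarrow> A (b j * \<beta> ^ j) < A \<gamma>"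
    and k: "k > 0" and eq: "s \<gamma> ^ (l ^ k) = \<gamma> ^ (l ^ k)"
  shows "s (\<gamma> / \<beta> ^ i) = \<gamma> / \<beta> ^ i"
proof -
  define x where "x = s \<gamma> / (kummer_ratio ^ i * \<gamma>) - 1"
  have x: "x \<in> Qbar" unfolding x_def by (intro Q_closed s_gamma_Qbar gamma_Qbar kummer_ratio_props)
  have Az: "A (kummer_ratio ^ i) = 1" by (intro unity_root_abs kummer_ratio_props)
  have "s \<gamma> - kummer_ratio ^ i * \<gamma> = (\<Sum>j<l. (kummer_ratio ^ j - kummer_ratio ^ i) * (b j * \<beta> ^ j))"
    unfolding s_gamma unfolding gamma(1) by (simp add: sum_subtractf left_diff_distrib sum_distrib_left)
  moreover have "A (\<Sum>j<l. (kummer_ratio ^ j - kummer_ratio ^ i) * (b j * \<beta> ^ j)) < unity_radius * A \<gamma>"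
  proof (rule nonarch_sum_less)
    show "(kummer_ratio ^ j - kummer_ratio ^ i) * (b j * \<beta> ^ j) \<in> Qbar" for j by (intro Q_closed term_Qbar kummer_ratio_props)
    show pos: "unity_radius * A \<gamma> > 0" using unity_radius_props gamma_pos by simp
    fix j assume j: "j \<in> {..<l}"
    show "A ((kummer_ratio ^ j - kummer_ratio ^ i) * (b j * \<beta> ^ j)) < unity_radius * A \<gamma>"
    proof (cases "j = i")
      case True thus ?thesis using pos A_simps(4) by simp
    next
      case False
      have "kummer_ratio ^ j - kummer_ratio ^ i = (kummer_ratio ^ j - 1) - (kummer_ratio ^ i - 1)" by simp
      hence "A (kummer_ratio ^ j - kummer_ratio ^ i) \<le> max (A (kummer_ratio ^ j - 1)) (A (kummer_ratio ^ i - 1))"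
        using nonarch_diff[OF is_subfield_Qbar A, of "kummer_ratio ^ j - 1" "kummer_ratio ^ i - 1"] by (simp add: Q_closed kummer_ratio_props)
      also have "\<dots> \<le> unity_radius" using unity_root_diff kummer_ratio_props(2) by simp
      finally have 1: "A (kummer_ratio ^ j - kummer_ratio ^ i) \<le> unity_radius" .
      have "A ((kummer_ratio ^ j - kummer_ratio ^ i) * (b j * \<beta> ^ j)) = A (kummer_ratio ^ j - kummer_ratio ^ i) * A (b j * \<beta> ^ j)"
        by (intro A_simps Q_closed term_Qbar kummer_ratio_props)
      also have "\<dots> \<le> unity_radius * A (b j * \<beta> ^ j)"
        by (intro mult_right_mono 1 nonarch_nonneg[OF is_subfield_Qbar A term_Qbar])
      also have "\<dots> < unity_radius * A \<gamma>" using i j False unity_radius_props by (intro mult_strict_left_mono) auto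
      finally show ?thesis .
    qed
  qed simp
  ultimately have "A (s \<gamma> - kummer_ratio ^ i * \<gamma>) < unity_radius * A \<gamma>" by simp
  moreover have "x = (s \<gamma> - kummer_ratio ^ i * \<gamma>) / (kummer_ratio ^ i * \<gamma>)" unfolding x_def using gamma kummer_ratio_props by (simp add: field_simps)
  moreover have "A ((s \<gamma> - kummer_ratio ^ i * \<gamma>) / (kummer_ratio ^ i * \<gamma>)) = A (s \<gamma> - kummer_ratio ^ i * \<gamma>) / (A (kummer_ratio ^ i) * A \<gamma>)"
    using A_simps(5)[of "s \<gamma> - kummer_ratio ^ i * \<gamma>" "kummer_ratio ^ i * \<gamma>"] A_simps(1)[of "kummer_ratio ^ i" \<gamma>] by (simp add: Q_closed kummer_ratio_props gamma_Qbar s_gamma_Qbar)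
  ultimately have "A x < unity_radius" using gamma_pos by (simp add: Az divide_less_eq)
  hence xr: "A x ^ (l - 1) < 1 / real l" using nonarch_less_rho_iff[OF x] by simp
  obtain m where m: "l ^ k = l * m" using k by (cases k) auto
  have "(kummer_ratio ^ i) ^ (l ^ k) = 1" unfolding m power_mult[of _ l m] kummer_ratio_props(2) by simp
  hence "(1 + x) ^ (l ^ k) = 1" unfolding x_def using gamma eq by (simp add: power_divide power_mult_distrib)
  hence "x = 0" using prime_power_ne_1[OF x xr] by blast
  hence sg: "s \<gamma> = kummer_ratio ^ i * \<gamma>" unfolding x_def using gamma kummer_ratio_props by simp
  have "s (\<gamma> / \<beta> ^ i) = s \<gamma> / (s \<beta>) ^ i"
    using aut_divide[OF s(1) gamma_Qbar, of "\<beta> ^ i"] aut_power[OF s(1) beta(1)] Q_closed(9)[OF beta(1)] by simp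
  thus ?thesis unfolding sg kummer_ratio_props(4) using kummer_ratio_props(5) by (simp add: power_mult_distrib)
qed

end
end
end

section \<open>Ramification\<close>

lemma degree_monom_minus_const:
  assumes "l > 0" shows "degree (monom 1 l - [:a::complex:]) = l"
proof -
  have "monom 1 l - [:a:] = monom 1 l + [:-a:]" by simp
  moreover have "degree (monom 1 l + [:-a:]) = l"
    using assms degree_add_eq_left[of "[:-a:]" "monom 1 l"] by (simp add: degree_monom_eq)
  ultimately show ?thesis by (simp only:)
qed

context
  fixes E F P p
  assumes E: "number_field E" and F: "number_field F" "F \<subseteq> E" and P: "is_prime E P"
    and P0: "P \<inter> F \<noteq> {0}" and p: "p \<in> P \<inter> F" "p \<noteq> 0" "ord_at F (P \<inter> F) p = 1"
begin

lemma prime_above_nonzero: "P \<noteq> {0}" using P0 p by auto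

lemma prime_below: "is_prime F (P \<inter> F)"
  by (rule is_prime_restrict[OF P number_field_is_subfield[OF F(1)] F(2)])

text \<open>The absolute value attached to \<open>P\<close> restricts to one on \<open>F\<close>
  centred at \<open>P \<inter> F\<close>, hence to a power of the one attached to that prime;
  \<open>p\<close> reveals the exponent.\<close>

lemma ord_at_extension:
  assumes x: "x \<in> F" "x \<noteq> 0"
  shows "ord_at E P x = ord_at E P p * ord_at F (P \<inter> F) x"
proof -
  define A :: "complex \<Rightarrow> real" where
    "A x = (if x = 0 then 0 else (1/2) powr real_of_int (ord_at E P x))" for x
  have A: "nonarch_abs E A" "center E A = P"
    using ord_abs[OF E P prime_above_nonzero, of "1/2"] unfolding A_def by simp_all
  have c: "center F A = P \<inter> F" using center_Int[OF F(2), of A] A(2) by simp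
  have pF: "p \<in> F" using p by simp
  have "A x = A p powi ord_at F (P \<inter> F) x"
    using nonarch_eq_powi_ord[OF F(1) nonarch_abs_mono[OF A(1) F(2)], unfolded c, OF P0 pF p(2,3) x] .
  hence "(1/2) powr real_of_int (ord_at E P x) = ((1/2::real) powr real_of_int (ord_at E P p)) powr real_of_int (ord_at F (P \<inter> F) x)"
    using x p(2) unfolding A_def by (simp add: powr_real_of_int')
  hence "(1/2) powr real_of_int (ord_at E P x) = (1/2::real) powr real_of_int (ord_at E P p * ord_at F (P \<inter> F) x)"
    by (simp add: powr_powr)
  thus ?thesis using powr_inj[of "1/2" "real_of_int (ord_at E P x)"] by (simp del: of_int_mult)
qed

lemma uniformizer_ord_pos: "ord_at E P p > 0"
proof -
  have "p \<in> integers_of E" using p(1) P unfolding is_prime_def is_ideal_def by auto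
  thus ?thesis using ord_at_pos_iff[OF E P prime_above_nonzero _ p(2)] p(1) by simp
qed

text \<open>Nonzero elements of \<open>P \<inter> F\<close> have order at \<open>P\<close> a
  positive multiple of that of \<open>p\<close>, so \<open>p\<close> alone decides the
  inclusion.\<close>

lemma ideal_below_subset_power:
  "genideal (integer_ring E) (P \<inter> F) \<subseteq> ideal_power E P e \<longleftrightarrow> int e \<le> ord_at E P p"
proof -
  have PE: "P \<subseteq> integers_of E" using P unfolding is_prime_def is_ideal_def by auto
  have car: "carrier (integer_ring E) = integers_of E" unfolding integer_ring_def integers_of_def by simp
  have "genideal (integer_ring E) (P \<inter> F) \<subseteq> ideal_power E P e \<longleftrightarrow> P \<inter> F \<subseteq> ideal_power E P e"
  proof
    assume g: "genideal (integer_ring E) (P \<inter> F) \<subseteq> ideal_power E P e"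
    have "P \<inter> F \<subseteq> genideal (integer_ring E) (P \<inter> F)"
      using PE by (intro ring.genideal_self[OF cring.axioms(1)[OF cring_integer_ring]] number_field_is_subfield[OF E]) (auto simp: car)
    thus "P \<inter> F \<subseteq> ideal_power E P e" using g by (rule order_trans)
  next
    assume "P \<inter> F \<subseteq> ideal_power E P e"
    moreover have "ideal (ideal_power E P e) (integer_ring E)"
      using ideal_iff[OF number_field_is_subfield[OF E]] ideal_power_is_ideal[OF E P prime_above_nonzero] by blast
    ultimately show "genideal (integer_ring E) (P \<inter> F) \<subseteq> ideal_power E P e"
      using ring.genideal_minimal[OF cring.axioms(1)[OF cring_integer_ring[OF number_field_is_subfield[OF E]]]] by blast
  qed
  also have "\<dots> \<longleftrightarrow> int e \<le> ord_at E P p"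
  proof
    assume "P \<inter> F \<subseteq> ideal_power E P e"
    thus "int e \<le> ord_at E P p" using p ideal_power_ord[OF E P prime_above_nonzero] by blast
  next
    assume e: "int e \<le> ord_at E P p"
    show "P \<inter> F \<subseteq> ideal_power E P e"
    proof
      fix x assume x: "x \<in> P \<inter> F"
      have "x = 0 \<or> int e \<le> ord_at E P x"
      proof (cases "x = 0")
        case False
        have xF: "x \<in> integers_of F" using x PE unfolding integers_of_def by auto
        have "ord_at F (P \<inter> F) x > 0"
          using ord_at_pos_iff[OF F(1) prime_below P0 xF False] x by simp
        hence "ord_at E P p * 1 \<le> ord_at E P p * ord_at F (P \<inter> F) x"
          using uniformizer_ord_pos by (intro mult_left_mono) auto
        thus ?thesis using ord_at_extension[of x] x False e by simp
      qed simp
      thus "x \<in> ideal_power E P e" using x PE unfolding ideal_power_ord[OF E P prime_above_nonzero] by blast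
    qed
  qed
  finally show ?thesis .
qed

lemma finite_ramification_index_eq: "finite_ramification_index F E P = enat (nat (ord_at E P p))"
  unfolding finite_ramification_index_def ideal_below_subset_power
proof (rule antisym)
  show "(SUP e\<in>{e. int e \<le> ord_at E P p}. enat e) \<le> enat (nat (ord_at E P p))"
    by (rule SUP_least) auto
  show "enat (nat (ord_at E P p)) \<le> (SUP e\<in>{e. int e \<le> ord_at E P p}. enat e)"
    using uniformizer_ord_pos by (intro SUP_upper) auto
qed

end

lemma uniformizer_exists:
  assumes F: "number_field F" and P: "is_prime F P" "P \<noteq> {0}"
  shows "\<exists>p. p \<in> P \<and> p \<noteq> 0 \<and> ord_at F P p = 1"
  using ord_at_uniformizer[OF assms] by blast

lemma of_nat_in_center:
  assumes "is_subfield E" "Factorial_Ring.prime l" "A (of_nat l) = 1 / real l"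
  shows "of_nat l \<in> center E A"
  using assms subfield_of_nat[OF assms(1), of l] prime_gt_1_nat[OF assms(2)]
  unfolding center_def integers_of_def by (auto intro: int_imp_algebraic_int)

lemma prime_nonzero: "of_nat l \<in> P \<Longrightarrow> Factorial_Ring.prime l \<Longrightarrow> P \<noteq> {0::complex}"
  using prime_gt_0_nat by fastforce

text \<open>The index of \<open>K\<close> is a supremum over all intermediate number fields, so the
  index of \<open>E\<close> is at most 1 and \<open>p\<close> remains a uniformizer in
  \<open>E\<close>.\<close>

lemma unramified_values:
  assumes K: "is_subfield K" "K \<subseteq> Qbar" and l: "Factorial_Ring.prime l"
    and F: "number_field F" "F \<subseteq> K" and un: "unramified_above l F K"
    and A: "nonarch_abs Qbar A" "A (of_nat l) = 1 / real l"
    and p: "p \<in> center F A" "p \<noteq> 0" "ord_at F (center F A) p = 1"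
    and E: "number_field E" "F \<subseteq> E" "E \<subseteq> K"
  shows "\<forall>x\<in>E - {0}. \<exists>k::int. A x = A p powi k"
proof
  fix x assume x: "x \<in> E - {0}"
  note sf = number_field_is_subfield
  define P where "P = center K A"
  have Pp: "is_prime K P" unfolding P_def
    by (rule center_prime[OF K(1) nonarch_abs_mono[OF A(1) K(2)]])
  have PE: "P \<inter> E = center E A" and PF: "P \<inter> F = center F A"
    unfolding P_def using center_Int[OF E(3)] center_Int[OF F(2)] by blast+
  have AE: "nonarch_abs E A" using A(1) E K by (blast intro: nonarch_abs_mono)
  have lF: "of_nat l \<in> center F A" by (rule of_nat_in_center[where A = A, OF sf[OF F(1)] l A(2)])
  have cF: "center F A \<noteq> {0}" by (rule prime_nonzero[OF lF l])
  have lE: "of_nat l \<in> center E A" by (rule of_nat_in_center[where A = A, OF sf[OF E(1)] l A(2)])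
  have cE: "center E A \<noteq> {0}" by (rule prime_nonzero[OF lE l])
  have pE: "is_prime E (center E A)" by (rule center_prime[OF sf[OF E(1)] AE])
  have EF: "center E A \<inter> F = center F A" by (rule center_Int[OF E(2)])
  have "primeideal (center F A) (integer_ring F)"
    using primeideal_iff[OF sf[OF F(1)]] is_prime_restrict[OF Pp sf[OF F(1)] F(2)] PF by simp
  hence "center F A \<in> primes_over F l" unfolding primes_over_def using lF by simp
  hence "\<not> ramified_in F K (center F A)" using un unfolding unramified_above_def by blast
  moreover have "primeideal P (integer_ring K)" using primeideal_iff[OF K(1)] Pp by simp
  ultimately have "ramification_index F K P = 1" using PF unfolding ramified_in_def by blast
  moreover have "finite_ramification_index F E (P \<inter> E) \<le> ramification_index F K P"
    unfolding ramification_index_def using E by (intro SUP_upper) auto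
  ultimately have le: "finite_ramification_index F E (center E A) \<le> 1" using PE by simp
  have pp: "p \<in> center E A \<inter> F" "ord_at F (center E A \<inter> F) p = 1" "center E A \<inter> F \<noteq> {0}" using p cF EF by auto
  note loc = E(1) F(1) E(2) pE pp(3,1) p(2) pp(2)
  have "enat (nat (ord_at E (center E A) p)) \<le> enat 1"
    using le unfolding finite_ramification_index_eq[OF loc] one_enat_def .
  hence "nat (ord_at E (center E A) p) \<le> 1" by (simp only: enat_ord_simps)
  moreover have "ord_at E (center E A) p > 0" by (rule uniformizer_ord_pos[OF loc])
  ultimately have ord1: "ord_at E (center E A) p = 1" by linarith
  have pE': "p \<in> E" using pp(1) E(2) by blast
  have "A x = A p powi ord_at E (center E A) x"
    by (rule nonarch_eq_powi_ord[OF E(1) AE cE pE' p(2) ord1]) (use x in blast)+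
  thus "\<exists>k::int. A x = A p powi k" by blast
qed

section \<open>Bogomolov Kummer extensions\<close>

lemma aut_fixes_basis:
  assumes bs: "set bs \<subseteq> Qbar" "\<forall>x\<in>F. \<exists>c. (\<forall>i. c i \<in> \<rat>) \<and> x = (\<Sum>i<length bs. c i * bs ! i)"
    and t: "is_aut t" "map t bs = bs" and x: "x \<in> F"
  shows "t x = x"
proof -
  note Qc = subfield_closed[OF is_subfield_Qbar]
  obtain c where c: "\<forall>i. c i \<in> \<rat>" "x = (\<Sum>i<length bs. c i * bs ! i)" using bs(2) x by blast
  have cQ: "c i \<in> Qbar" for i using c(1) subfield_Rats[OF is_subfield_Qbar] by blast
  have bQ: "bs ! i \<in> Qbar" if "i < length bs" for i using bs(1) that by auto
  have "t x = (\<Sum>i<length bs. t (c i * bs ! i))"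
    unfolding c(2) using cQ bQ by (intro aut_sum[OF t(1)] Qc) auto
  also have "\<dots> = (\<Sum>i<length bs. c i * bs ! i)"
  proof (rule sum.cong[OF refl])
    fix i assume i: "i \<in> {..<length bs}"
    have "t (bs ! i) = bs ! i" using t(2) i by (metis lessThan_iff nth_map)
    thus "t (c i * bs ! i) = c i * bs ! i"
      using aut_mult[OF t(1) cQ bQ] aut_Rats[OF t(1)] c(1) i by simp
  qed
  finally show ?thesis unfolding c(2)[symmetric] .
qed

context
  fixes K F A l p \<beta>
  assumes K: "is_subfield K" "K \<subseteq> Qbar" and l: "Factorial_Ring.prime (l::nat)"
    and F: "number_field F" "F \<subseteq> K" and un: "unramified_above l F K"
    and A: "nonarch_abs Qbar A" "A (of_nat l) = 1 / real l"
    and p: "p \<in> center F A" "p \<noteq> 0" "ord_at F (center F A) p = 1"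
    and beta: "\<beta> ^ l = p"
begin

lemma uniformizer_mem: "p \<in> F" "p \<in> K" "p \<in> Qbar" using p F K unfolding center_def integers_of_def by auto

lemma prime_exponent_gt_1: "l > 1" "real l > 0" using prime_gt_1_nat[OF l] by auto

lemma beta_Qbar: "\<beta> \<in> Qbar"
proof -
  have "algebraic_int p" using p unfolding center_def integers_of_def by auto
  hence "algebraic_int \<beta>"
    using algebraic_int_root[of p "monom 1 l" \<beta>] prime_exponent_gt_1 beta by (auto simp: poly_monom degree_monom_eq)
  thus ?thesis unfolding Qbar_def by (auto intro: algebraic_int_imp_algebraic)
qed

lemma uniformizer_abs: "0 < A p" "A p < 1"
  using nonarch_pos[OF is_subfield_Qbar A(1) uniformizer_mem(3) p(2)] p unfolding center_def by auto

text \<open>\<open>A \<circ> t\<close> lies above the same prime of \<open>F\<close> but possibly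
  above another prime of \<open>K\<close>. As all primes of \<open>K\<close> over it are unramified,
  the local estimates hold for \<open>A \<circ> t\<close> too, that is, at every conjugate over
  \<open>F\<close>.\<close>

lemma automorphism_twist:
  assumes t: "is_aut t" "\<forall>x\<in>F. t x = x"
  shows "nonarch_abs Qbar (A \<circ> t)" "(A \<circ> t) (of_nat l) = 1 / real l" "(A \<circ> t) p = A p" "(A \<circ> t) \<beta> ^ l = A p"
    "number_field E \<Longrightarrow> F \<subseteq> E \<Longrightarrow> E \<subseteq> K \<Longrightarrow> \<forall>x\<in>E - {0}. \<exists>k::int. (A \<circ> t) x = A p powi k"
proof -
  show 1: "nonarch_abs Qbar (A \<circ> t)" by (rule aut_nonarch_abs[OF t(1) A(1)])
  show 2: "(A \<circ> t) (of_nat l) = 1 / real l" using A(2) aut_of_nat[OF t(1)] by simp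
  show 3: "(A \<circ> t) p = A p" using t(2) uniformizer_mem by simp
  show "(A \<circ> t) \<beta> ^ l = A p"
    using 3 nonarch_power[OF is_subfield_Qbar 1 beta_Qbar, of l] unfolding beta by simp
  have c: "center F (A \<circ> t) = center F A" using t(2) unfolding center_def integers_of_def by auto
  show "\<forall>x\<in>E - {0}. \<exists>k::int. (A \<circ> t) x = A p powi k" if E: "number_field E" "F \<subseteq> E" "E \<subseteq> K"
    using unramified_values[OF K l F un 1 2 _ p(2) _ E] p unfolding c 3 by simp
qed

text \<open>In \<open>K\<close> the value of \<beta> would be an integral power of
  \<open>A p\<close>, while its \<open>l\<close>-th power is \<open>A p\<close>.\<close>

lemma beta_notin: "\<beta> \<notin> K"
proof
  assume "\<beta> \<in> K"
  have "\<exists>E. number_field E \<and> F \<subseteq> E \<and> {\<beta>} \<subseteq> E \<and> (\<forall>A. is_subfield A \<longrightarrow> F \<subseteq> A \<longrightarrow> {\<beta>} \<subseteq> A \<longrightarrow> E \<subseteq> A)"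
    using beta_Qbar by (intro number_field_adjoin_finite[OF F(1)]) auto
  then obtain E where E: "number_field E" "F \<subseteq> E" "\<beta> \<in> E" "E \<subseteq> K" using K F \<open>\<beta> \<in> K\<close> by (elim exE conjE) auto
  have "\<beta> \<noteq> 0" using beta p prime_exponent_gt_1 by (auto simp: power_0_left)
  then obtain k where k: "A \<beta> = A p powi k"
    using unramified_values[OF K l F un A p E(1,2,4)] E(3) by blast
  have "A p powi 1 = A \<beta> ^ l" using nonarch_power[OF is_subfield_Qbar A(1) beta_Qbar, of l] unfolding beta by simp
  also have "\<dots> = A p powi (k * int l)" unfolding k by (simp add: power_int_mult)
  finally have "k * int l = 1" using power_int_inj[OF uniformizer_abs] by metis
  hence "int l dvd 1" by (metis dvd_triv_right)
  thus False using prime_exponent_gt_1 by simp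
qed

lemma adjoin_extension: "algebraic_field_extension K (adjoin K \<beta>)"
  unfolding algebraic_field_extension_def subfield_CC_iff
  using K adjoin_is_subfield adjoin_superset adjoin_least[OF is_subfield_Qbar K(2) beta_Qbar] by blast

lemma element_repr:
  assumes g: "\<gamma> \<in> adjoin K \<beta>"
  shows "\<exists>E b. number_field E \<and> F \<subseteq> E \<and> E \<subseteq> K \<and> (\<forall>i. b i \<in> E) \<and> \<gamma> = (\<Sum>i<l. b i * \<beta> ^ i)"
proof -
  let ?m = "monom 1 l - [:p:]"
  have m: "\<forall>i. coeff ?m i \<in> K" "poly ?m \<beta> = 0"
    using uniformizer_mem subfield_closed[OF K(1)] beta by (auto simp: poly_monom coeff_pCons split: nat.splits)
  have dm: "degree ?m = l"
    using prime_exponent_gt_1 degree_monom_minus_const by simp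
  hence m0: "?m \<noteq> 0" using prime_exponent_gt_1 by auto
  obtain c where c: "\<forall>i. c i \<in> K" "\<gamma> = (\<Sum>i<l. c i * \<beta> ^ i)"
    using adjoin_repr[OF K beta_Qbar g m(1) m0 m(2)] unfolding dm by blast
  have "\<exists>E. number_field E \<and> F \<subseteq> E \<and> c ` {..<l} \<subseteq> E \<and> (\<forall>A. is_subfield A \<longrightarrow> F \<subseteq> A \<longrightarrow> c ` {..<l} \<subseteq> A \<longrightarrow> E \<subseteq> A)"
    using c(1) K by (intro number_field_adjoin_finite[OF F(1)]) auto
  then obtain E where E: "number_field E" "F \<subseteq> E" "c ` {..<l} \<subseteq> E" "E \<subseteq> K"
    using K F c(1) by (elim exE conjE) auto
  let ?b = "\<lambda>i. if i < l then c i else 0"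
  have "\<forall>i. ?b i \<in> E" using E subfield_zero[OF number_field_is_subfield[OF E(1)]] by auto
  moreover have "\<gamma> = (\<Sum>i<l. ?b i * \<beta> ^ i)" unfolding c(2) by (intro sum.cong) auto
  ultimately show ?thesis
    by (intro exI[of _ E] exI[of _ ?b] conjI E(1,2,4))
qed

lemma log_mahler_height:
  assumes "\<gamma> \<in> Qbar" "\<gamma> \<noteq> 0"
  shows "log_mahler \<gamma> / real (card (conjugates \<gamma>)) \<le> weil_height \<gamma>"
    "log_mahler \<gamma> \<le> real (card (conjugates \<gamma>)) * weil_height \<gamma>"
  using weil_height_ge[OF assms] card_conjugates_pos[OF assms(1)] unfolding log_mahler_def[symmetric]
  by (simp_all add: divide_le_eq mult.commute)

section \<open>The two lower bounds for the height\<close>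

context
  fixes bs \<gamma> E b and k :: nat
  assumes bs: "set bs \<subseteq> F" "\<forall>x\<in>F. \<exists>c. (\<forall>i. c i \<in> \<rat>) \<and> x = (\<Sum>i<length bs. c i * bs ! i)"
    and E: "number_field E" "F \<subseteq> E" "E \<subseteq> K" and b: "\<forall>i. b i \<in> E"
    and gamma: "\<gamma> = (\<Sum>i<l. b i * \<beta> ^ i)" "\<gamma> \<notin> K"
begin

lemma kummer_element_basics: "set bs \<subseteq> Qbar" "\<gamma> \<in> Qbar" "\<gamma> \<noteq> 0" "is_subfield E" "E \<subseteq> Qbar" "\<beta> ^ l \<in> E"
proof -
  show "set bs \<subseteq> Qbar" using bs F K by blast
  show 1: "is_subfield E" "E \<subseteq> Qbar" "\<beta> ^ l \<in> E"
    using number_field_is_subfield[OF E(1)] E K uniformizer_mem beta by auto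
  show "\<gamma> \<in> Qbar" unfolding gamma(1) using b 1 beta_Qbar
    by (intro subfield_sum[OF is_subfield_Qbar] subfield_closed[OF is_subfield_Qbar]) auto
  show "\<gamma> \<noteq> 0" using gamma subfield_zero[OF K(1)] by blast
qed

text \<open>Carrying the spanning list \<open>bs\<close> of \<open>F\<close> along in the tuple
  marks the automorphisms that fix \<open>F\<close>: they are those that leave the prefix
  unchanged.\<close>

lemma prefix_fixes:
  assumes "ys \<in> orbit (bs @ zs)" "take (length bs) ys = bs"
  shows "\<exists>t. is_aut t \<and> ys = map t (bs @ zs) \<and> map t bs = bs \<and> (\<forall>x\<in>F. t x = x)"
proof -
  obtain t where t: "is_aut t" "ys = map t (bs @ zs)" using assms(1) unfolding orbit_def by blast
  have "map t bs = bs" using assms(2) unfolding t(2) by simp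
  thus ?thesis using t aut_fixes_basis[OF kummer_element_basics(1) bs(2) t(1)] by blast
qed

lemma kummer_twisted:
  assumes t: "is_aut t" "\<forall>x\<in>F. t x = x"
  shows "nonarch_abs Qbar (A \<circ> t)" "Factorial_Ring.prime l" "(A \<circ> t) (of_nat l) = 1 / real l"
    "is_subfield E" "E \<subseteq> Qbar" "0 < A p" "A p < 1" "\<forall>x\<in>E - {0}. \<exists>k::int. (A \<circ> t) x = A p powi k"
    "\<beta> \<in> Qbar" "(A \<circ> t) \<beta> ^ l = A p" "\<beta> ^ l \<in> E" "\<forall>i. b i \<in> E" "\<gamma> = (\<Sum>i<l. b i * \<beta> ^ i)" "\<gamma> \<noteq> 0"
  using automorphism_twist[OF t] automorphism_twist(5)[OF t E] l kummer_element_basics uniformizer_abs beta_Qbar b gamma by auto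

text \<open>\<open>O1\<close> consists of the conjugates over \<open>F\<close> of the pair of
  \<gamma> and \<open>s \<gamma>\<close>. It is the fraction \<open>1 / card (orbit bs)\<close> of
  the orbit whatever \<gamma> is, and each member satisfies the congruence because it does so for
  the twisted absolute value.\<close>

lemma height_congruence_case:
  assumes s: "is_aut s" "\<forall>x\<in>E. s x = x" and ne: "s \<gamma> ^ (l ^ k) \<noteq> \<gamma> ^ (l ^ k)"
  shows "real k * ln (real l) \<le> real (card (orbit bs)) * (ln 2 + 2 * real (l ^ k) * weil_height \<gamma>)"
proof -
  define n where "n = length bs"
  define xs where "xs = bs @ [\<gamma>, s \<gamma>]"
  define O1 where "O1 = {ys \<in> orbit xs. take n ys = take n xs}"
  have xs: "set xs \<subseteq> Qbar" unfolding xs_def using kummer_element_basics aut_Qbar[OF s(1)] by auto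
  have nth: "xs ! n = \<gamma>" "xs ! Suc n = s \<gamma>" "n < length xs" "Suc n < length xs" "take n xs = bs"
    unfolding xs_def n_def by (auto simp: nth_append)
  have cO: "card O1 * card (orbit bs) = card (orbit xs)"
    unfolding O1_def using orbit_prefix_card[OF xs, of n] nth by simp
  have pos: "card (orbit xs) > 0" using orbit_finite[OF xs] orbit_self[of xs] by (auto simp: card_gt_0_iff)
  have O1pos: "card O1 > 0" using cO pos by (cases "card O1") auto
  have small: "A ((ys ! n) ^ (l ^ k) - (ys ! Suc n) ^ (l ^ k))
      \<le> 1 / real l ^ k * (max 1 (A (ys ! n)) ^ (l ^ k) * max 1 (A (ys ! Suc n)) ^ (l ^ k))" if ys: "ys \<in> O1" for ys
  proof -
    have "\<exists>t. is_aut t \<and> ys = map t (bs @ [\<gamma>, s \<gamma>]) \<and> map t bs = bs \<and> (\<forall>x\<in>F. t x = x)"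
      using ys nth unfolding O1_def xs_def n_def by (intro prefix_fixes) auto
    then obtain t where t: "is_aut t" "ys = map t xs" "\<forall>x\<in>F. t x = x" unfolding xs_def by blast
    have sg: "s \<gamma> \<in> Qbar" using aut_Qbar[OF s(1)] kummer_element_basics by blast
    have y: "ys ! n = t \<gamma>" "ys ! Suc n = t (s \<gamma>)" unfolding t(2) using nth by simp_all
    have "t (\<gamma> ^ (l ^ k) - s \<gamma> ^ (l ^ k)) = t \<gamma> ^ (l ^ k) - t (s \<gamma>) ^ (l ^ k)"
      using kummer_element_basics(2) sg subfield_closed[OF is_subfield_Qbar] by (simp add: aut_diff[OF t(1)] aut_power[OF t(1)])
    thus ?thesis unfolding y using kummer_congruence[OF kummer_twisted[OF t(1,3)] s, of k] by simp
  qed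
  have "real (card O1) * (- ln (1 / real l ^ k)) \<le>
    real (card (orbit xs)) * (ln 2 + 2 * real (l ^ k) * (log_mahler (xs ! n) / real (card (conjugates (xs ! n)))))"
  proof (rule height_ge_congruence[OF l A xs nth(3,4)])
    show "xs ! Suc n \<in> conjugates (xs ! n)" unfolding nth conjugates_def using s by blast
    show "(xs ! n) ^ (l ^ k) \<noteq> (xs ! Suc n) ^ (l ^ k)" unfolding nth using ne by metis
    show "O1 \<subseteq> orbit xs" unfolding O1_def by blast
    show "0 < 1 / real l ^ k" "1 / real l ^ k \<le> 1" using prime_exponent_gt_1 by (auto simp: one_le_power)
  qed (use small in blast)
  also have "- ln (1 / real l ^ k) = real k * ln (real l)" using prime_exponent_gt_1 by (simp add: ln_div ln_realpow)
  also have "real (card (orbit xs)) * (ln 2 + 2 * real (l ^ k) * (log_mahler (xs ! n) / real (card (conjugates (xs ! n)))))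
     \<le> real (card (orbit xs)) * (ln 2 + 2 * real (l ^ k) * weil_height \<gamma>)"
    unfolding nth by (intro mult_left_mono add_left_mono log_mahler_height kummer_element_basics) auto
  also have "\<dots> = real (card O1) * (real (card (orbit bs)) * (ln 2 + 2 * real (l ^ k) * weil_height \<gamma>))"
    unfolding cO[symmetric] by simp
  finally show ?thesis using O1pos by simp
qed

lemma height_valuation_case:
  assumes k: "k > 0" and eq: "\<forall>s. is_aut s \<longrightarrow> (\<forall>x\<in>E. s x = x) \<longrightarrow> s \<gamma> ^ (l ^ k) = \<gamma> ^ (l ^ k)"
  shows "- ln (A p) / real l \<le> 2 * real (card (orbit bs)) * weil_height \<gamma>"
proof -
  note Qc = subfield_closed[OF is_subfield_Qbar]
  note tw = kummer_twisted[OF aut_id, simplified comp_id, simplified]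
  have bnz: "\<beta> \<noteq> 0" using beta p prime_exponent_gt_1 by (auto simp: power_0_left)
  obtain i where i: "i < l" "\<forall>j<l. j \<noteq> i \<longrightarrow> A (b j * \<beta> ^ j) < A \<gamma>"
    using kummer_dominant[OF tw] by blast
  define g where "g = \<gamma> / \<beta> ^ i"
  have gQ: "g \<in> Qbar" unfolding g_def by (intro Qc kummer_element_basics beta_Qbar)
  \<comment> \<open>Rigidity holds for every automorphism fixing \<open>E\<close>, so
    \<open>g\<close> is fixed by all of them and lies in \<open>E\<close>.\<close>
  have "s g = g" if "is_aut s" "\<forall>x\<in>E. s x = x" for s
    unfolding g_def using kummer_rigid[OF tw that i k] eq that by blast
  hence gE: "g \<in> E" using aut_moves[OF kummer_element_basics(4,5) gQ] by blast
  have g0: "g \<noteq> 0" and gamma_g: "\<gamma> = g * \<beta> ^ i" unfolding g_def using bnz kummer_element_basics by auto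
  have i0: "i \<noteq> 0" 
  proof
    assume "i = 0"
    hence "\<gamma> = g" unfolding gamma_g by simp
    thus False using gamma(2) gE E(3) by blast
  qed
  define U where "U = {t \<gamma> | t. is_aut t \<and> map t bs = bs}"
  have UC: "U \<subseteq> conjugates \<gamma>" unfolding U_def conjugates_def by blast
  have finU: "finite U" using UC conjugates_finite[OF kummer_element_basics(2)] finite_subset by blast
  have val: "\<bar>ln (A y)\<bar> \<ge> - ln (A p) / real l" if y: "y \<in> U" for y
  proof -
    obtain t where t: "y = t \<gamma>" "is_aut t" "map t bs = bs" using y unfolding U_def by blast
    have tF: "\<forall>x\<in>F. t x = x" using aut_fixes_basis[OF kummer_element_basics(1) bs(2) t(2,3)] by blast
    note tt = kummer_twisted[OF t(2) tF]
    obtain m where m: "(A \<circ> t) g = A p powi m" using tt(8) gE g0 by blast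
    have y0: "A y > 0" unfolding t(1)
      using nonarch_pos[OF is_subfield_Qbar tt(1) kummer_element_basics(2,3)] by simp
    have "A y = (A \<circ> t) g * (A \<circ> t) \<beta> ^ i"
      unfolding t(1) gamma_g using nonarch_mult[OF is_subfield_Qbar tt(1) gQ Qc(9)[OF beta_Qbar]] nonarch_power[OF is_subfield_Qbar tt(1) beta_Qbar] by simp
    hence "A y ^ l = (A p powi m) ^ l * ((A \<circ> t) \<beta> ^ l) ^ i"
      unfolding m by (simp add: power_mult_distrib power_mult[symmetric] mult.commute)
    also have "\<dots> = A p powi (m * int l + int i)"
      using uniformizer_abs by (simp only: tt(10)) (simp add: power_int_add power_int_mult)
    finally have "ln (A y ^ l) = ln (A p powi (m * int l + int i))" by simp
    hence "real l * ln (A y) = real_of_int (m * int l + int i) * ln (A p)"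
      using y0 uniformizer_abs by (simp add: ln_realpow ln_powr powr_real_of_int'[symmetric])
    hence "real l * \<bar>ln (A y)\<bar> = real_of_int \<bar>m * int l + int i\<bar> * (- ln (A p))"
      using uniformizer_abs by (metis abs_mult_pos nonarch_mult abs_of_nat abs_of_neg ln_less_zero of_int_abs Groups.mult_ac(2) abs_mult)
    moreover have "m * int l + int i \<noteq> 0"
    proof
      assume "m * int l + int i = 0"
      hence "(m * int l + int i) mod int l = 0" by simp
      thus False using i i0 by simp
    qed
    hence "1 \<le> \<bar>m * int l + int i\<bar>" by linarith
    hence "1 \<le> real_of_int \<bar>m * int l + int i\<bar>" by (simp only: of_int_1_le_iff)
    hence "1 * (- ln (A p)) \<le> real_of_int \<bar>m * int l + int i\<bar> * (- ln (A p))"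
      using uniformizer_abs by (intro mult_right_mono) auto
    ultimately have "- ln (A p) \<le> \<bar>ln (A y)\<bar> * real l" by (simp only: mult_1 mult.commute)
    thus ?thesis using prime_exponent_gt_1 by (subst pos_divide_le_eq) auto
  qed
  define n where "n = length bs"
  define xs where "xs = bs @ [\<gamma>]"
  define O1 where "O1 = {ys \<in> orbit xs. take n ys = take n xs}"
  have xs: "set xs \<subseteq> Qbar" unfolding xs_def using kummer_element_basics by auto
  have nth: "xs ! n = \<gamma>" "take n xs = bs" "length xs = Suc n" unfolding xs_def n_def by auto
  have cO: "card O1 * card (orbit bs) = card (orbit xs)"
    unfolding O1_def using orbit_prefix_card[OF xs, of n] nth by simp
  have "conjugates \<gamma> \<subseteq> (\<lambda>ys. ys ! n) ` orbit xs"
  proof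
    fix y assume "y \<in> conjugates \<gamma>"
    then obtain t where t: "is_aut t" "y = t \<gamma>" unfolding conjugates_def by blast
    hence "map t xs \<in> orbit xs" "y = map t xs ! n" unfolding orbit_def using nth by auto
    thus "y \<in> (\<lambda>ys. ys ! n) ` orbit xs" by blast
  qed
  hence c1: "card (conjugates \<gamma>) \<le> card (orbit xs)" by (rule surj_card_le[OF orbit_finite[OF xs]])
  have fix1: "\<exists>t. is_aut t \<and> ys = bs @ [t \<gamma>] \<and> map t bs = bs" if ys: "ys \<in> O1" for ys
  proof -
    have "\<exists>t. is_aut t \<and> ys = map t (bs @ [\<gamma>]) \<and> map t bs = bs \<and> (\<forall>x\<in>F. t x = x)"
      using ys nth unfolding O1_def xs_def n_def by (intro prefix_fixes) auto
    thus ?thesis by force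
  qed
  have "inj_on (\<lambda>ys. ys ! n) O1"
  proof (rule inj_onI)
    fix ys zs assume "ys \<in> O1" "zs \<in> O1" and eq: "ys ! n = zs ! n"
    then obtain t u where "ys = bs @ [t \<gamma>]" "zs = bs @ [u \<gamma>]" using fix1 by meson
    thus "ys = zs" using eq unfolding n_def by simp
  qed
  moreover have "(\<lambda>ys. ys ! n) ` O1 \<subseteq> U"
  proof
    fix y assume "y \<in> (\<lambda>ys. ys ! n) ` O1"
    then obtain ys where ys: "ys \<in> O1" "y = ys ! n" by blast
    then obtain t where "is_aut t" "ys = bs @ [t \<gamma>]" "map t bs = bs" using fix1 by meson
    thus "y \<in> U" unfolding U_def ys(2) n_def by auto
  qed
  ultimately have c2: "card O1 \<le> card U" using finU by (intro card_inj_on_le)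
  \<comment> \<open>\<open>O1\<close> is the fraction \<open>1 / card (orbit bs)\<close> of the
    orbit and injects into \<open>U\<close>, while the whole orbit maps onto the conjugates; so the
    conjugates over \<open>F\<close> make up at least that fraction.\<close>
  have h0: "card U * card (orbit bs) \<ge> card (conjugates \<gamma>)"
    using c1 c2 cO by (metis le_trans mult_le_mono1)
  have "\<gamma> \<in> U" unfolding U_def using aut_id by (auto intro!: exI[of _ id])
  hence Upos: "card U > 0" using finU by (auto simp: card_gt_0_iff)
  have cp: "card (conjugates \<gamma>) > 0" using card_conjugates_pos[OF kummer_element_basics(2)] .
  have 1: "- ln (A p) / real l * real (card U) \<le> 2 * log_mahler \<gamma>"
    by (rule height_ge_valuations[OF l A kummer_element_basics(2,3) UC val])
  \<comment> \<open>The height must be positive for the inequality between cardinalities to be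
    multiplied by it; the valuation bound itself provides this.\<close>
  have lp: "- ln (A p) / real l * real (card U) > 0"
    using uniformizer_abs prime_exponent_gt_1 Upos by (intro mult_pos_pos divide_pos_pos) auto
  hence "log_mahler \<gamma> > 0" using 1 by simp
  hence h: "weil_height \<gamma> > 0"
    using log_mahler_height(2)[OF kummer_element_basics(2,3)] cp by (metis less_le_trans mult_le_0_iff not_le of_nat_0_less_iff less_eq_real_def)
  have "- ln (A p) / real l * real (card U) \<le> 2 * (real (card (conjugates \<gamma>)) * weil_height \<gamma>)"
    using 1 log_mahler_height(2)[OF kummer_element_basics(2,3)] by simp
  also have "\<dots> \<le> 2 * (real (card U * card (orbit bs)) * weil_height \<gamma>)"
    using h h0 by (intro mult_left_mono mult_right_mono) (auto simp only: of_nat_le_iff)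
  also have "\<dots> = (2 * real (card (orbit bs)) * weil_height \<gamma>) * real (card U)" by simp
  finally show ?thesis using Upos by (simp only: mult_le_cancel_right)
qed

end

lemma kummer_bogomolov: "bogomolov K (adjoin K \<beta>)" "adjoin K \<beta> \<noteq> K"
proof -
  show "adjoin K \<beta> \<noteq> K" using beta_notin adjoin_mem[of \<beta> K] by metis
  have "\<exists>bs. set bs \<subseteq> F \<and> (\<forall>x\<in>F. \<exists>c. (\<forall>i. c i \<in> \<rat>) \<and> x = (\<Sum>i<length bs. c i * bs ! i))"
    by (rule number_field_basis[OF F(1)]) blast
  then obtain bs where bs: "set bs \<subseteq> F" "\<forall>x\<in>F. \<exists>c. (\<forall>i. c i \<in> \<rat>) \<and> x = (\<Sum>i<length bs. c i * bs ! i)" by blast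
  define m where "m = real (card (orbit bs))"
  have "set bs \<subseteq> Qbar" using bs F K by blast
  hence m: "m > 0" unfolding m_def using orbit_finite[of bs] orbit_self[of bs] by (auto simp: card_gt_0_iff)
  have lnl: "ln (real l) > 0" using prime_exponent_gt_1 by simp
  \<comment> \<open>In the congruence bound \<open>ln 2\<close> is lost to the triangle inequality
    at the infinite place; the summand 1 is what remains for
    \<open>2 * real (l ^ k) * weil_height \<gamma>\<close>.\<close>
  obtain k0 where "m * (ln 2 + 1) / ln (real l) < real k0" using reals_Archimedean2 by blast
  hence "m * (ln 2 + 1) < real k0 * ln (real l)" using lnl by (simp add: divide_less_eq)
  hence k: "m * (ln 2 + 1) \<le> real (Suc k0) * ln (real l)" using lnl by (simp add: distrib_right)
  define k where "k = Suc k0"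
  \<comment> \<open>The two entries are the height bounds of the congruence case and of the
    valuation case.\<close>
  define \<epsilon> where "\<epsilon> = min (1 / (2 * real (l ^ k))) (- ln (A p) / real l / (2 * m))"
  have "- ln (A p) > 0" using uniformizer_abs ln_less_zero by simp
  hence "- ln (A p) / real l / (2 * m) > 0" using prime_exponent_gt_1 m by (intro divide_pos_pos) auto
  hence eps: "\<epsilon> > 0" unfolding \<epsilon>_def using prime_exponent_gt_1 by simp
  have "\<gamma> \<in> K" if g: "\<gamma> \<in> adjoin K \<beta>" "weil_height \<gamma> < \<epsilon>" for \<gamma>
  proof (rule ccontr)
    assume gK: "\<gamma> \<notin> K"
    obtain E b where E: "number_field E" "F \<subseteq> E" "E \<subseteq> K" "\<forall>i. b i \<in> E" "\<gamma> = (\<Sum>i<l. b i * \<beta> ^ i)"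
      using element_repr[OF g(1)] by blast
    show False
    proof (cases "\<forall>s. is_aut s \<longrightarrow> (\<forall>x\<in>E. s x = x) \<longrightarrow> s \<gamma> ^ (l ^ k) = \<gamma> ^ (l ^ k)")
      case True
      have "- ln (A p) / real l \<le> 2 * m * weil_height \<gamma>"
        unfolding m_def by (rule height_valuation_case[OF bs E gK _ True]) (simp add: k_def)
      hence "- ln (A p) / real l \<le> weil_height \<gamma> * (2 * m)" by (simp only: mult.commute)
      hence "- ln (A p) / real l / (2 * m) \<le> weil_height \<gamma>" using m by (subst pos_divide_le_eq) auto
      thus False using g(2) unfolding \<epsilon>_def by simp
    next
      case False
      then obtain s where s: "is_aut s" "\<forall>x\<in>E. s x = x" "s \<gamma> ^ (l ^ k) \<noteq> \<gamma> ^ (l ^ k)" by blast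
      have "m * (ln 2 + 1) \<le> m * (ln 2 + 2 * real (l ^ k) * weil_height \<gamma>)"
        using k height_congruence_case[OF bs E gK s] unfolding m_def k_def by simp
      hence "1 \<le> 2 * real (l ^ k) * weil_height \<gamma>" using m by (simp only: mult_le_cancel_left_pos)
      moreover have "real (l ^ k) > 0" using prime_exponent_gt_1 by simp
      ultimately have "1 / (2 * real (l ^ k)) \<le> weil_height \<gamma>" by (subst pos_divide_le_eq) (auto simp only: mult.commute mult.left_commute)
      thus False using g(2) unfolding \<epsilon>_def by simp
    qed
  qed
  thus "bogomolov K (adjoin K \<beta>)" unfolding bogomolov_def using adjoin_extension eps by blast
qed

end

lemma kummer_bogomolov_exists:
  assumes K: "is_subfield K" "K \<subseteq> Qbar" and l: "Factorial_Ring.prime (l::nat)"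
    and F: "number_field F" "F \<subseteq> K" and un: "unramified_above l F K"
  shows "\<exists>\<alpha>\<in>K. \<forall>\<beta>. \<beta> ^ l = \<alpha> \<longrightarrow> adjoin K \<beta> \<noteq> K \<and> bogomolov K (adjoin K \<beta>)"
proof -
  obtain A where A: "nonarch_abs Qbar A" "A (of_nat l) = 1 / real l" using nonarch_abs_prime[OF l] by blast
  note sF = number_field_is_subfield[OF F(1)]
  have "F \<subseteq> Qbar" using F K by blast
  hence c: "is_prime F (center F A)" by (intro center_prime[OF sF] nonarch_abs_mono[OF A(1)])
  have "center F A \<noteq> {0}" by (rule prime_nonzero[OF of_nat_in_center[where A = A, OF sF l A(2)] l])
  then obtain p where p: "p \<in> center F A" "p \<noteq> 0" "ord_at F (center F A) p = 1"
    using uniformizer_exists[OF F(1) c] by blast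
  have "p \<in> K" using p F unfolding center_def integers_of_def by auto
  thus ?thesis using kummer_bogomolov[OF K l F un A p] by blast
qed

lemma complex_root_exists:
  assumes "l > 0" shows "\<exists>\<beta>::complex. \<beta> ^ l = a"
proof -
  have "degree (monom 1 l - [:a:]) = l"
    using assms degree_monom_minus_const by simp
  hence "\<exists>z. poly (monom 1 l - [:a:]) z = 0"
    using assms fundamental_theorem_of_algebra constant_degree by (metis less_numeral_extra(3))
  thus ?thesis by (auto simp: poly_monom)
qed

section \<open>Galois extensions\<close>

text \<open>The graph of \<open>s\<close> on \<open>K\<close> is a partial embedding and extends to
  \<open>Qbar\<close>. This transfers the Galois hypothesis, which speaks of automorphisms of
  \<open>K\<close>, to automorphisms of \<open>Qbar\<close>.\<close>

lemma field_automorphism_extends: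
  assumes K: "is_subfield K" "K \<subseteq> Qbar" and s: "s \<in> field_automorphisms \<rat> K"
  shows "\<exists>t. is_aut t \<and> (\<forall>x\<in>K. t x = s x)"
proof -
  have hom: "s \<in> Ring.ring_hom (subfield_ring K) (subfield_ring K)" and bij: "bij_betw s K K"
    and Q: "\<forall>q\<in>\<rat>. s q = q"
    using s unfolding field_automorphisms_def ring_iso_def by (auto simp: subfield_ring_simps)
  have add: "s (x + y) = s x + s y" and mult: "s (x * y) = s x * s y" if "x \<in> K" "y \<in> K" for x y
    using hom that unfolding Ring.ring_hom_def by (auto simp: subfield_ring_simps)
  have sK: "s x \<in> K" if "x \<in> K" for x using bij that by (metis bij_betwE)
  have zero: "s x = 0 \<longleftrightarrow> x = 0" if "x \<in> K" for x
    using bij that Q subfield_zero[OF K(1)] by (metis Rats_0 bij_betw_imp_inj_on inj_onD)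
  define r where "r = (\<lambda>a. (a, s a)) ` K"
  have "hom_graph r"
    unfolding hom_graph_def
  proof (intro conjI ballI)
    show "r \<subseteq> Qbar \<times> Qbar" unfolding r_def using sK K by auto
    show "(q, q) \<in> r" if q: "q \<in> \<rat>" for q
    proof -
      have "q \<in> K" using subfield_Rats[OF K(1)] q by blast
      moreover have "s q = q" using Q q by blast
      ultimately show ?thesis unfolding r_def using image_eqI[of "(q, q)" "\<lambda>a. (a, s a)" q K] by simp
    qed
    show "case a of (x, x') \<Rightarrow> \<forall>(y, y')\<in>r. (x + y, x' + y') \<in> r \<and> (x * y, x' * y') \<in> r" if "a \<in> r" for a
      using that add mult subfield_add[OF K(1)] subfield_mult[OF K(1)] unfolding r_def by auto
    show "case a of (x, x') \<Rightarrow> (x = 0) = (x' = 0)" if "a \<in> r" for a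
      using that zero unfolding r_def by auto
  qed
  from hom_graph_aut[OF this] obtain t where t: "is_aut t" "\<forall>(x, y)\<in>r. t x = y" by (elim exE conjE)
  have "t x = s x" if "x \<in> K" for x using t(2) that unfolding r_def by auto
  thus ?thesis using t(1) by blast
qed

text \<open>The values of \<open>\<Prod>\<^sub>y (X - y)\<close>, taken over a Galois orbit, at natural numbers are rational,
  hence fixed by all automorphisms of \<open>Qbar\<close>; as they determine the polynomial, its roots are
  permuted.\<close>

lemma galois_extension_stable:
  assumes gal: "galois_extension \<rat> K" and x: "x \<in> K" and t: "is_aut t"
  shows "t x \<in> K"
proof -
  have K: "is_subfield K" "K \<subseteq> Qbar"
    using gal unfolding galois_extension_def algebraic_field_extension_def subfield_CC_iff by blast+
  define G where "G = field_automorphisms \<rat> K"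
  have fixed: "z \<in> \<rat>" if "z \<in> K" "\<forall>s\<in>G. s z = z" for z
    using gal that unfolding galois_extension_def G_def by blast
  define Ob where "Ob = (\<lambda>s. s x) ` G"
  have ext: "\<exists>t. is_aut t \<and> (\<forall>x\<in>K. t x = s x)" if "s \<in> G" for s
    using field_automorphism_extends[OF K] that unfolding G_def by blast
  have iso: "s \<in> ring_iso (subfield_ring K) (subfield_ring K)" "\<forall>q\<in>\<rat>. s q = q" if "s \<in> G" for s
    using that unfolding G_def field_automorphisms_def by blast+
  have bij: "bij_betw s K K" if "s \<in> G" for s
    using iso(1)[OF that] unfolding ring_iso_def by (auto simp: subfield_ring_simps)
  have OK: "Ob \<subseteq> K" unfolding Ob_def using bij x by (metis bij_betwE image_subsetI)
  have OQ: "y \<in> Qbar" if "y \<in> Ob" for y using OK K that by blast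
  have "Ob \<subseteq> conjugates x"
  proof
    fix y assume "y \<in> Ob"
    then obtain s where s: "s \<in> G" "y = s x" unfolding Ob_def by blast
    then obtain u where u: "is_aut u" "\<forall>x\<in>K. u x = s x" using ext by blast
    thus "y \<in> conjugates x" unfolding conjugates_def s(2) using x by (metis (mono_tags, lifting) mem_Collect_eq)
  qed
  moreover have xQ: "x \<in> Qbar" using x K by blast
  ultimately have fin: "finite Ob" using conjugates_finite finite_subset by blast
  have perm: "bij_betw s Ob Ob" if s: "s \<in> G" for s
  proof -
    have "s ` Ob \<subseteq> Ob"
    proof
      fix y assume "y \<in> s ` Ob"
      then obtain u where u: "u \<in> G" "y = (s \<circ> u) x" unfolding Ob_def by auto
      have "s \<circ> u \<in> ring_iso (subfield_ring K) (subfield_ring K)"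
        using iso(1)[OF u(1)] iso(1)[OF s] by (rule ring_iso_set_trans)
      hence "s \<circ> u \<in> G" using iso(2)[OF s] iso(2)[OF u(1)] unfolding G_def field_automorphisms_def by simp
      thus "y \<in> Ob" unfolding Ob_def u(2) by (rule imageI)
    qed
    moreover have "inj_on s Ob" using bij[OF s] OK by (metis bij_betw_imp_inj_on inj_on_subset)
    ultimately show ?thesis using fin by (metis bij_betw_def card_image card_subset_eq)
  qed
  have aut_f: "u (\<Prod>y\<in>Ob. of_nat c - y) = (\<Prod>y\<in>Ob. of_nat c - u y)" if u: "is_aut u" for u c
  proof -
    have cy: "of_nat c - y \<in> Qbar" if "y \<in> Ob" for y
      by (intro subfield_closed[OF is_subfield_Qbar] OQ that)
    have "u (\<Prod>y\<in>Ob. of_nat c - y) = (\<Prod>y\<in>Ob. u (of_nat c - y))" by (rule aut_prod[OF u cy])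
    also have "\<dots> = (\<Prod>y\<in>Ob. of_nat c - u y)"
    proof (rule prod.cong[OF refl])
      fix y assume "y \<in> Ob"
      thus "u (of_nat c - y) = of_nat c - u y"
        using aut_diff[OF u subfield_of_nat[OF is_subfield_Qbar] OQ] aut_of_nat[OF u] by simp
    qed
    finally show ?thesis .
  qed
  have rat: "(\<Prod>y\<in>Ob. of_nat c - y) \<in> \<rat>" for c
  proof (rule fixed)
    have "of_nat c - y \<in> K" if "y \<in> Ob" for y
      using OK that by (intro subfield_closed[OF K(1)]) blast
    thus inK: "(\<Prod>y\<in>Ob. of_nat c - y) \<in> K" by (intro subfield_prod[OF K(1)])
    show "\<forall>s\<in>G. s (\<Prod>y\<in>Ob. of_nat c - y) = (\<Prod>y\<in>Ob. of_nat c - y)"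
    proof
      fix s assume s: "s \<in> G"
      then obtain u where u: "is_aut u" "\<forall>x\<in>K. u x = s x" using ext by blast
      have "s (\<Prod>y\<in>Ob. of_nat c - y) = (\<Prod>y\<in>Ob. of_nat c - u y)"
        using u(2) inK aut_f[OF u(1)] by metis
      also have "\<dots> = (\<Prod>y\<in>Ob. of_nat c - s y)" using u(2) OK by (intro prod.cong refl) auto
      also have "\<dots> = (\<Prod>y\<in>Ob. of_nat c - y)" by (rule prod.reindex_bij_betw[OF perm[OF s]])
      finally show "s (\<Prod>y\<in>Ob. of_nat c - y) = (\<Prod>y\<in>Ob. of_nat c - y)" .
    qed
  qed
  define p q where "p = (\<Prod>y\<in>Ob. [:- y, 1:])" and "q = (\<Prod>y\<in>Ob. [:- t y, 1:])"
  have "poly (p - q) (of_nat c) = 0" for c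
    using aut_f[OF t, of c] aut_Rats[OF t rat, of c] unfolding p_def q_def by (simp add: poly_prod)
  hence sub: "range of_nat \<subseteq> {z. poly (p - q) z = 0}" by blast
  have "infinite (range (of_nat :: nat \<Rightarrow> complex))"
    by (simp add: range_inj_infinite inj_of_nat)
  hence "p - q = 0" using sub poly_roots_finite[of "p - q"] finite_subset by blast
  hence pq: "p = q" by simp
  have "id \<in> G"
    unfolding G_def field_automorphisms_def using ring_iso_set_refl by auto
  hence "x \<in> Ob" unfolding Ob_def by (metis id_apply image_eqI)
  hence "\<exists>y\<in>Ob. poly [:- t y, 1:] (t x) = 0" by (intro bexI[of _ x]) auto
  hence "poly q (t x) = 0" unfolding q_def poly_prod using fin by (intro prod_zero)
  hence "(\<Prod>y\<in>Ob. t x - y) = 0" unfolding pq[symmetric] p_def by (simp add: poly_prod)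
  hence "t x \<in> Ob" using fin by simp
  thus ?thesis using OK by blast
qed

text \<open>Adjoin all conjugates of a spanning list. For an automorphism \<open>t\<close>, the
  elements mapped into \<open>F\<close> form a field containing these generators, hence all of
  \<open>F\<close>.\<close>

lemma stable_closure:
  assumes K: "is_subfield K" "K \<subseteq> Qbar" "\<forall>t x. is_aut t \<longrightarrow> x \<in> K \<longrightarrow> t x \<in> K"
    and E: "number_field E" "E \<subseteq> K"
  shows "\<exists>F. number_field F \<and> E \<subseteq> F \<and> F \<subseteq> K \<and> (\<forall>t x. is_aut t \<longrightarrow> x \<in> F \<longrightarrow> t x \<in> F)"
proof -
  note Qc = subfield_closed[OF is_subfield_Qbar]
  have "\<exists>bs. set bs \<subseteq> E \<and> (\<forall>x\<in>E. \<exists>c. (\<forall>i. c i \<in> \<rat>) \<and> x = (\<Sum>i<length bs. c i * bs ! i))"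
    by (rule number_field_basis[OF E(1)]) blast
  then obtain bs where bs: "set bs \<subseteq> E" "\<forall>x\<in>E. \<exists>c. (\<forall>i. c i \<in> \<rat>) \<and> x = (\<Sum>i<length bs. c i * bs ! i)" by blast
  define B where "B = (\<Union>b\<in>set bs. conjugates b)"
  have bK: "set bs \<subseteq> K" using bs E by blast
  have BK: "B \<subseteq> K" unfolding B_def conjugates_def using bK K(3) by blast
  have BQ: "B \<subseteq> Qbar" using BK K by blast
  have fB: "finite B" unfolding B_def using conjugates_finite bK K(2) by blast
  obtain F where F: "number_field F" "B \<subseteq> F" and least: "\<forall>A. is_subfield A \<longrightarrow> \<rat> \<subseteq> A \<longrightarrow> B \<subseteq> A \<longrightarrow> F \<subseteq> A"
    using number_field_adjoin_finite[OF number_field_Rats fB BQ] by blast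
  note sF = number_field_is_subfield[OF F(1)]
  have FK: "F \<subseteq> K" using least K(1) subfield_Rats[OF K(1)] BK by blast
  have FQ: "F \<subseteq> Qbar" using FK K by blast
  have EF: "E \<subseteq> F"
  proof
    fix x assume "x \<in> E"
    then obtain c where c: "\<forall>i. c i \<in> \<rat>" "x = (\<Sum>i<length bs. c i * bs ! i)" using bs(2) by blast
    have "bs ! i \<in> F" if "i < length bs" for i
      using that conjugates_self F(2) unfolding B_def by (meson UN_I nth_mem subsetD)
    moreover have "c i \<in> F" for i using c(1) subfield_Rats[OF sF] by blast
    ultimately show "x \<in> F" unfolding c(2) by (intro subfield_sum[OF sF] subfield_mult[OF sF]) auto
  qed
  have "t x \<in> F" if t: "is_aut t" and x: "x \<in> F" for t x
  proof -
    define S where "S = {x \<in> Qbar. t x \<in> F}"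
    have "is_subfield S" unfolding is_subfield_def S_def
      using Qc(1,2,3,4) subfield_closed(1,2,3,4)[OF sF]
      by (auto simp: aut_one[OF t] aut_diff[OF t] aut_mult[OF t] aut_inverse[OF t])
    moreover have "\<rat> \<subseteq> S" unfolding S_def using subfield_Rats[OF is_subfield_Qbar] subfield_Rats[OF sF]
      by (auto simp: aut_Rats[OF t])
    moreover have "B \<subseteq> S"
    proof
      fix y assume y: "y \<in> B"
      then obtain b s where bs': "b \<in> set bs" "is_aut s" "y = s b" unfolding B_def conjugates_def by blast
      have "is_aut (t \<circ> s)" using aut_comp t bs'(2) by blast
      moreover have "t y = (t \<circ> s) b" unfolding bs'(3) by simp
      ultimately have "t y \<in> B" unfolding B_def conjugates_def using bs'(1) by blast
      thus "y \<in> S" unfolding S_def using F(2) BQ y by blast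
    qed
    ultimately have "F \<subseteq> S" using least by blast
    thus ?thesis using x unfolding S_def by blast
  qed
  thus ?thesis using F(1) EF FK by blast
qed

text \<open>If the centre of \<open>D\<close> were not contained in the centre of any \<open>A \<circ> t\<close>, the Chinese remainder
  theorem would give an element \<open>u\<close> of it that is a unit at all of these; the norm of \<open>u\<close> is then an
  integer that is divisible by \<open>l\<close> and is not.\<close>

lemma conjugate_center:
  assumes l: "Factorial_Ring.prime (l::nat)"
    and A: "nonarch_abs Qbar A" "A (of_nat l) = 1 / real l"
    and D: "nonarch_abs Qbar D" "D (of_nat l) = 1 / real l"
    and E: "number_field E" and stable: "\<And>t x. is_aut t \<Longrightarrow> x \<in> E \<Longrightarrow> t x \<in> E"
  shows "\<exists>t. is_aut t \<and> center E D \<subseteq> center E (A \<circ> t)"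
proof (rule ccontr)
  assume "\<not> ?thesis"
  hence no: "\<not> center E D \<subseteq> center E (A \<circ> t)" if "is_aut t" for t using that by blast
  note Qf = is_subfield_Qbar
  note sE = number_field_is_subfield[OF E]
  have EQ: "E \<subseteq> Qbar" by (rule number_field_subset_Qbar[OF E])
  note Oc = nf_integers[OF E]
  have intQ: "x \<in> integers_of E \<Longrightarrow> x \<in> integers_of Qbar" for x using EQ unfolding integers_of_def by blast
  have At: "nonarch_abs Qbar (A \<circ> t)" "nonarch_abs E (A \<circ> t)" if "is_aut t" for t
    using aut_nonarch_abs[OF that A(1)] nonarch_abs_mono[OF _ EQ] by blast+
  have DE: "nonarch_abs E D" by (rule nonarch_abs_mono[OF D(1) EQ])
  have lt: "(A \<circ> t) (of_nat l) = 1 / real l" if "is_aut t" for t using A(2) aut_of_nat[OF that] by simp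
  have ct: "is_prime E (center E (A \<circ> t))" "center E (A \<circ> t) \<noteq> {0}" if t: "is_aut t" for t
    using center_prime[OF sE At(2)[OF t]] prime_nonzero[OF of_nat_in_center[where A = "A \<circ> t", OF sE l lt[OF t]] l] by blast+
  have cD: "is_prime E (center E D)" using center_prime[OF sE DE] .
  \<comment> \<open>As \<open>P\<close> is maximal, an element of the centre of \<open>D\<close>
    outside \<open>P\<close> has a multiple congruent to 1 modulo \<open>P\<close>.\<close>
  have sep: "\<exists>u. u \<in> center E D \<and> 1 - u \<in> P" if "P \<in> {center E (A \<circ> t) | t. is_aut t}" for P
  proof -
    obtain t where t: "is_aut t" "P = center E (A \<circ> t)" using \<open>P \<in> _\<close> by blast
    obtain x where x: "x \<in> center E D" "x \<notin> P" using no[OF t(1)] t(2) by blast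
    have xO: "x \<in> integers_of E" using x unfolding center_def by blast
    have P: "is_prime E P" "P \<noteq> {0}" unfolding t(2) using ct[OF t(1)] by blast+
    obtain c where c: "c \<in> integers_of E" "1 - x * c \<in> P"
      using prime_maximal[OF E P xO x(2)] by blast
    have "c * x \<in> center E D" using cD x(1) c(1) unfolding is_prime_def is_ideal_def by blast
    thus ?thesis using c(2) by (metis mult.commute)
  qed
  define PP where "PP = {center E (A \<circ> t) | t. is_aut t}"
  have "\<forall>P\<in>PP. \<exists>u. u \<in> center E D \<and> 1 - u \<in> P" using sep unfolding PP_def by blast
  then obtain u where u: "\<forall>P\<in>PP. u P \<in> center E D \<and> 1 - u P \<in> P" by metis
  \<comment> \<open>On \<open>E\<close> an automorphism is determined by the images of
    \<open>bs\<close>, so only finitely many centres occur.\<close>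
  have finPP: "finite PP"
  proof -
    have "\<exists>bs. set bs \<subseteq> E \<and> (\<forall>x\<in>E. \<exists>c. (\<forall>i. c i \<in> \<rat>) \<and> x = (\<Sum>i<length bs. c i * bs ! i))"
      by (rule number_field_basis[OF E]) blast
    then obtain bs where bs: "set bs \<subseteq> E" "\<forall>x\<in>E. \<exists>c. (\<forall>i. c i \<in> \<rat>) \<and> x = (\<Sum>i<length bs. c i * bs ! i)" by blast
    have bQ: "set bs \<subseteq> Qbar" using bs EQ by blast
    have eq: "center E (A \<circ> t) = center E (A \<circ> s)" if ts: "is_aut t" "is_aut s" "map t bs = map s bs" for t s
    proof -
      define r where "r = inv_into Qbar s \<circ> t"
      have r: "is_aut r" unfolding r_def using aut_comp aut_inv ts by blast
      have "map r bs = bs"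
      proof (rule map_idI)
        fix b assume b: "b \<in> set bs"
        have "t b = s b" using ts(3) b by simp
        thus "r b = b" unfolding r_def using aut_inv_left[OF ts(2)] b bQ by auto
      qed
      hence rE: "r x = x" if "x \<in> E" for x using aut_fixes_basis[OF bQ bs(2) r _ that] by blast
      have "t x = s x" if x: "x \<in> E" for x
      proof -
        have tx: "t x \<in> Qbar" using aut_Qbar[OF ts(1)] x EQ by blast
        have "s (inv_into Qbar s (t x)) = t x"
          using ts(2) tx unfolding is_aut_def by (metis bij_betw_inv_into_right)
        thus ?thesis using rE[OF x] unfolding r_def by simp
      qed
      thus ?thesis unfolding center_def integers_of_def by auto
    qed
    define f where "f ys = center E (A \<circ> (SOME t. is_aut t \<and> ys = map t bs))" for ys
    have "PP \<subseteq> f ` orbit bs"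
    proof
      fix P assume "P \<in> PP"
      then obtain t where t: "is_aut t" "P = center E (A \<circ> t)" unfolding PP_def by blast
      let ?s = "SOME s. is_aut s \<and> map t bs = map s bs"
      have s: "is_aut ?s \<and> map t bs = map ?s bs" by (rule someI[of _ t]) (use t in simp)
      have "P = f (map t bs)" unfolding f_def t(2) using eq[OF t(1)] s by blast
      moreover have "map t bs \<in> orbit bs" unfolding orbit_def using t(1) by blast
      ultimately show "P \<in> f ` orbit bs" by (rule image_eqI)
    qed
    thus ?thesis using orbit_finite[OF bQ] by (meson finite_imageI finite_subset)
  qed
  \<comment> \<open>\<open>w\<close> lies in all centres of the \<open>A \<circ> t\<close> and is 1
    modulo the centre of \<open>D\<close>, so \<open>1 - w\<close> lies in the latter and is a unit
    at the former.\<close>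
  define w where "w = (\<Prod>P\<in>PP. 1 - u P)"
  have uO: "u P \<in> integers_of E" if "P \<in> PP" for P using u that unfolding center_def by blast
  have w1: "w \<in> integers_of E \<and> 1 - w \<in> center E D" unfolding w_def
    using finPP u
  proof (induction PP rule: finite_induct)
    case empty
    show ?case using Oc(1) cD unfolding is_prime_def is_ideal_def by simp
  next
    case (insert P S)
    let ?w = "\<Prod>P\<in>S. 1 - u P"
    have IH: "?w \<in> integers_of E" "1 - ?w \<in> center E D" using insert by blast+
    have uD: "u P \<in> center E D" using insert by blast
    hence "u P \<in> integers_of E" unfolding center_def by blast
    hence 1: "1 - u P \<in> integers_of E" using integers_diff[OF sE Oc(1)] by blast
    have "1 - (1 - u P) * ?w = (1 - ?w) + ?w * u P" by (simp add: algebra_simps)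
    moreover have "(1 - ?w) + ?w * u P \<in> center E D"
      using cD IH uD unfolding is_prime_def is_ideal_def by blast
    moreover have "(1 - u P) * ?w \<in> integers_of E" by (rule integers_mult[OF sE 1 IH(1)])
    ultimately show ?case unfolding prod.insert[OF insert(1,2)] by (simp only: conj_absorb)
  qed
  define v where "v = 1 - w"
  have vD: "v \<in> center E D" using w1 unfolding v_def by blast
  have vO: "v \<in> integers_of E" using vD unfolding center_def by blast
  have vE: "v \<in> E" "v \<in> Qbar" "algebraic_int v" using vO EQ unfolding integers_of_def by blast+
  have unit: "A (t v) = 1" if t: "is_aut t" for t
  proof -
    let ?P = "center E (A \<circ> t)"
    have PP: "?P \<in> PP" unfolding PP_def using t by blast
    have P: "is_prime E ?P" using ct[OF t] by blast
    have "w = (1 - u ?P) * (\<Prod>Q\<in>PP - {?P}. 1 - u Q)"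
      unfolding w_def using prod.remove[OF finPP PP, of "\<lambda>P. 1 - u P"] by blast
    moreover have "(\<Prod>Q\<in>PP - {?P}. 1 - u Q) \<in> integers_of E"
    proof -
      have "(\<Prod>Q\<in>S. 1 - u Q) \<in> integers_of E" if "finite S" "S \<subseteq> PP" for S
        using that
      proof (induction S rule: finite_induct)
        case (insert Q S)
        have "1 - u Q \<in> integers_of E" using uO insert by (intro integers_diff[OF sE Oc(1)]) blast
        hence "(1 - u Q) * (\<Prod>Q\<in>S. 1 - u Q) \<in> integers_of E" using insert by (intro integers_mult[OF sE]) blast+
        thus ?case using insert by simp
      qed (use Oc(1) in simp)
      thus ?thesis using finPP by blast
    qed
    moreover have "1 - u ?P \<in> ?P" using u PP by blast
    ultimately have "w \<in> ?P" using P unfolding is_prime_def is_ideal_def by (metis mult.commute)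
    hence "(A \<circ> t) w < 1" unfolding center_def by blast
    moreover have "w \<in> Qbar" using w1 EQ unfolding integers_of_def by blast
    ultimately have "(A \<circ> t) (1 + - w) = (A \<circ> t) 1"
      using nonarch_uminus[OF Qf At(1)[OF t], of w] nonarch_one[OF Qf At(1)[OF t]]
      by (intro nonarch_add_dominant[OF Qf At(1)[OF t]] subfield_closed[OF Qf]) auto
    thus ?thesis using nonarch_one[OF Qf At(1)[OF t]] unfolding v_def by simp
  qed
  define n where "n = (\<Prod>y\<in>conjugates v. y)"
  have cQ: "y \<in> Qbar" if "y \<in> conjugates v" for y using conjugates_Qbar[OF vE(2)] that by blast
  have cI: "algebraic_int y" if "y \<in> conjugates v" for y
    using that aut_algebraic_int vE(3) unfolding conjugates_def by blast
  have "n \<in> \<rat>" unfolding n_def by (rule conjugates_prod_rational[OF vE(2)])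
  moreover have "algebraic_int n" unfolding n_def using cI by (intro algebraic_int_prod)
  ultimately have "n \<in> \<int>" by (rule rational_algebraic_int_is_int[rotated])
  then obtain m where m: "n = of_int m" by (rule Ints_cases)
  \<comment> \<open>All conjugates of \<open>v\<close> have value 1 at \<open>A\<close> because
    \<open>v\<close> is a unit at every \<open>A \<circ> t\<close>; at \<open>D\<close>, by
    contrast, the conjugate \<open>v\<close> itself has value below 1.\<close>
  have An: "A n = 1" unfolding n_def
  proof -
    have "A (\<Prod>y\<in>conjugates v. y) = (\<Prod>y\<in>conjugates v. A y)" by (rule nonarch_prod[OF Qf A(1) cQ])
    also have "\<dots> = 1" using unit unfolding conjugates_def by (intro prod.neutral) blast
    finally show "A (\<Prod>y\<in>conjugates v. y) = 1" .
  qed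
  have "D n = (\<Prod>y\<in>conjugates v. D y)" unfolding n_def by (rule nonarch_prod[OF Qf D(1) cQ])
  also have "\<dots> = D v * (\<Prod>y\<in>conjugates v - {v}. D y)"
    by (rule prod.remove[OF conjugates_finite[OF vE(2)] conjugates_self])
  also have "\<dots> \<le> D v * 1"
  proof (intro mult_left_mono prod_le_1)
    show "D v \<ge> 0" by (rule nonarch_nonneg[OF Qf D(1) vE(2)])
    fix y assume "y \<in> conjugates v - {v}"
    hence y: "y \<in> Qbar" "y \<in> integers_of Qbar" using cQ cI unfolding integers_of_def by auto
    show "0 \<le> D y \<and> D y \<le> 1" using nonarch_nonneg[OF Qf D(1) y(1)] nonarch_integer[OF Qf D(1) y(2)] by simp
  qed
  finally have Dn: "D n < 1" using vD unfolding center_def by simp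
  hence "int l dvd m" using nonarch_of_int_coprime[OF D(1) l D(2), of m] unfolding m by linarith
  then obtain k where k: "m = int l * k" by blast
  have "A n = A (of_nat l) * A (of_int k)"
    unfolding m k using nonarch_mult[OF Qf A(1) subfield_of_nat[OF Qf] subfield_of_int[OF Qf], of l k] by simp
  also have "\<dots> \<le> (1 / real l) * 1" unfolding A(2) using nonarch_of_int_le[OF A(1) l A(2), of k] by (intro mult_left_mono) auto
  finally show False using An prime_gt_1_nat[OF l] by simp
qed

text \<open>The inclusion of centres is an equality because nonzero primes are maximal. Two absolute
  values with the same centre are powers of each other, and the common value at \<open>l\<close>
  makes them equal.\<close>

lemma conjugate_abs:
  assumes l: "Factorial_Ring.prime (l::nat)"
    and A: "nonarch_abs Qbar A" "A (of_nat l) = 1 / real l"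
    and D: "nonarch_abs Qbar D" "D (of_nat l) = 1 / real l"
    and E: "number_field E" and stable: "\<And>t x. is_aut t \<Longrightarrow> x \<in> E \<Longrightarrow> t x \<in> E"
  shows "\<exists>t. is_aut t \<and> (\<forall>x\<in>E. D x = A (t x))"
proof -
  obtain t where t: "is_aut t" "center E D \<subseteq> center E (A \<circ> t)"
    using conjugate_center[OF l A D E] stable by blast
  define B where "B = A \<circ> t"
  note sE = number_field_is_subfield[OF E]
  have EQ: "E \<subseteq> Qbar" by (rule number_field_subset_Qbar[OF E])
  have B: "nonarch_abs E B" "B (of_nat l) = 1 / real l"
    unfolding B_def using aut_nonarch_abs[OF t(1) A(1)] nonarch_abs_mono[OF _ EQ] A(2) aut_of_nat[OF t(1)] by auto
  have DE: "nonarch_abs E D" by (rule nonarch_abs_mono[OF D(1) EQ])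
  define P where "P = center E D"
  have lP: "of_nat l \<in> P" unfolding P_def by (rule of_nat_in_center[where A = D, OF sE l D(2)])
  have P: "is_prime E P" "P \<noteq> {0}" unfolding P_def
    using center_prime[OF sE DE] prime_nonzero[OF lP l] unfolding P_def by blast+
  have cB: "is_prime E (center E B)" by (rule center_prime[OF sE B(1)])
  have "center E B \<subseteq> P"
  proof
    fix x assume x: "x \<in> center E B"
    show "x \<in> P"
    proof (rule ccontr)
      assume nx: "x \<notin> P"
      have xO: "x \<in> integers_of E" using x unfolding center_def by blast
      obtain c where c: "c \<in> integers_of E" "1 - x * c \<in> P" using prime_maximal[OF E P xO nx] by blast
      have "1 - x * c \<in> center E B" using t(2) c(2) unfolding P_def B_def by blast
      moreover have "c * x \<in> center E B" using cB x c(1) unfolding is_prime_def is_ideal_def by blast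
      ultimately have "(1 - x * c) + c * x \<in> center E B" using cB unfolding is_prime_def is_ideal_def by blast
      thus False using cB unfolding is_prime_def by (simp add: mult.commute)
    qed
  qed
  hence eqP: "center E B = P" using t(2) unfolding P_def B_def by blast
  obtain p where p: "p \<in> P" "p \<noteq> 0" "ord_at E P p = 1" using uniformizer_exists[OF E P] by blast
  have pE: "p \<in> E" using p unfolding P_def center_def integers_of_def by blast
  have Dv: "D x = D p powi ord_at E P x" if "x \<in> E" "x \<noteq> 0" for x
    using nonarch_eq_powi_ord[OF E DE, folded P_def, OF P(2) pE p(2,3) that] .
  have Bv: "B x = B p powi ord_at E P x" if "x \<in> E" "x \<noteq> 0" for x
    using nonarch_eq_powi_ord[OF E B(1), unfolded eqP, OF P(2) pE p(2,3) that] .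
  have lE: "of_nat l \<in> E" by (rule subfield_of_nat[OF sE])
  have l0: "(of_nat l :: complex) \<noteq> 0" using prime_gt_0_nat[OF l] by simp
  have lO: "of_nat l \<in> integers_of E" using lE unfolding integers_of_def by (simp add: int_imp_algebraic_int)
  have "ord_at E P (of_nat l) > 0" using ord_at_pos_iff[OF E P lO l0] lP by blast
  then obtain n where n: "ord_at E P (of_nat l) = int n" "n > 0" by (metis zero_less_imp_eq_int)
  have "D p ^ n = B p ^ n" using Dv[OF lE l0] Bv[OF lE l0] D(2) B(2) unfolding n(1) by simp
  hence "D p = B p"
    using power_eq_iff_eq_base[OF n(2)] nonarch_nonneg[OF sE DE pE] nonarch_nonneg[OF sE B(1) pE] by blast
  hence "D x = A (t x)" if "x \<in> E" for x
    using Dv[OF that] Bv[OF that] nonarch_zero[OF sE DE] nonarch_zero[OF sE B(1)] unfolding B_def by (cases "x = 0") auto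
  thus ?thesis using t(1) by blast
qed

section \<open>Ramification read off from value groups\<close>

lemma nonarch_abs_of_prime:
  assumes K: "is_subfield K" "K \<subseteq> Qbar" and l: "Factorial_Ring.prime (l::nat)"
    and P: "is_prime K P" "of_nat l \<in> P"
  shows "\<exists>A. nonarch_abs Qbar A \<and> A (of_nat l) = 1 / real l \<and> center K A = P"
proof -
  obtain Q where Q: "is_prime Qbar Q" "Q \<inter> K = P" using is_prime_lift[OF K P(1)] by metis
  have lQ: "of_nat l \<in> Q" using Q(2) P(2) by blast
  obtain A where A: "nonarch_abs Qbar A" "A (of_nat l) = 1 / real l" "center Qbar A = Q"
    using nonarch_abs_exists[OF l Q(1) lQ] by blast
  have "center K A = P" using center_Int[OF K(2), of A] A(3) Q(2) by simp
  thus ?thesis using A by blast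
qed

lemma finite_ramification_index_center:
  assumes l: "Factorial_Ring.prime (l::nat)" and A: "nonarch_abs Qbar A" "A (of_nat l) = 1 / real l"
    and F: "number_field F" "F \<subseteq> E" and E: "number_field E"
    and p: "p \<in> center F A" "p \<noteq> 0" "ord_at F (center F A) p = 1"
  shows "finite_ramification_index F E (center E A) = enat (nat (ord_at E (center E A) p))" (is ?a)
    "ord_at E (center E A) p > 0" (is ?b)
    "\<And>x. x \<in> F \<Longrightarrow> x \<noteq> 0 \<Longrightarrow> ord_at E (center E A) x = ord_at E (center E A) p * ord_at F (center F A) x"
    (is "\<And>x. _ \<Longrightarrow> _ \<Longrightarrow> ?c x")
proof -
  have EF: "center E A \<inter> F = center F A" by (rule center_Int[OF F(2)])
  have AE: "nonarch_abs E A" by (rule nonarch_abs_mono[OF A(1) number_field_subset_Qbar[OF E]])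
  have pE: "is_prime E (center E A)" by (rule center_prime[OF number_field_is_subfield[OF E] AE])
  have lF: "of_nat l \<in> center F A"
    by (rule of_nat_in_center[where A = A, OF number_field_is_subfield[OF F(1)] l A(2)])
  have cF: "center E A \<inter> F \<noteq> {0}" unfolding EF by (rule prime_nonzero[OF lF l])
  note loc = E F(1,2) pE cF p(1)[folded EF] p(2) p(3)[folded EF]
  show ?a by (rule finite_ramification_index_eq[OF loc])
  show ?b by (rule uniformizer_ord_pos[OF loc])
  show "?c x" if "x \<in> F" "x \<noteq> 0" for x using ord_at_extension[OF loc that] unfolding EF .
qed

lemma center_uniformizer:
  assumes l: "Factorial_Ring.prime (l::nat)" and A: "nonarch_abs Qbar A" "A (of_nat l) = 1 / real l"
    and F: "number_field F"
  shows "\<exists>p. p \<in> center F A \<and> p \<noteq> 0 \<and> p \<in> F \<and> ord_at F (center F A) p = 1 \<and> 0 < A p \<and> A p < 1 \<and>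
    (\<forall>x\<in>F - {0}. A x = A p powi ord_at F (center F A) x)"
proof -
  note sF = number_field_is_subfield[OF F]
  have AF: "nonarch_abs F A" by (rule nonarch_abs_mono[OF A(1) number_field_subset_Qbar[OF F]])
  have lF: "of_nat l \<in> center F A" by (rule of_nat_in_center[where A = A, OF sF l A(2)])
  have c0: "center F A \<noteq> {0}" by (rule prime_nonzero[OF lF l])
  obtain p where p: "p \<in> center F A" "p \<noteq> 0" "ord_at F (center F A) p = 1"
    using uniformizer_exists[OF F center_prime[OF sF AF] c0] by blast
  have pF: "p \<in> F" "A p < 1" using p unfolding center_def integers_of_def by blast+
  have "\<forall>x\<in>F - {0}. A x = A p powi ord_at F (center F A) x"
    using nonarch_eq_powi_ord[OF F AF c0 pF(1) p(2,3)] by blast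
  moreover have "0 < A p" by (rule nonarch_pos[OF sF AF pF(1) p(2)])
  ultimately show ?thesis using p pF by blast
qed

text \<open>If every value on \<open>E\<close> is attained on \<open>F\<close>, then a uniformizer
  of \<open>E\<close> has value an integral power of \<open>A p\<close>; together with
  \<open>A p = A w powi e\<close> this forces \<open>e = 1\<close>.\<close>

lemma unramified_of_values:
  assumes l: "Factorial_Ring.prime (l::nat)" and A: "nonarch_abs Qbar A" "A (of_nat l) = 1 / real l"
    and F: "number_field F" "F \<subseteq> E" and E: "number_field E"
    and vals: "\<And>x. x \<in> E \<Longrightarrow> x \<noteq> 0 \<Longrightarrow> \<exists>y\<in>F - {0}. A x = A y"
  shows "finite_ramification_index F E (center E A) = 1"
proof -
  obtain p where p: "p \<in> center F A" "p \<noteq> 0" "p \<in> F" "ord_at F (center F A) p = 1" "0 < A p" "A p < 1"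
    and pv: "\<forall>x\<in>F - {0}. A x = A p powi ord_at F (center F A) x"
    using center_uniformizer[OF l A F(1)] by blast
  obtain w where w: "w \<noteq> 0" "w \<in> E" "0 < A w" "A w < 1" and wv: "\<forall>x\<in>E - {0}. A x = A w powi ord_at E (center E A) x"
    using center_uniformizer[OF l A E] by blast
  note fr = finite_ramification_index_center[OF l A F E p(1,2,4)]
  define e where "e = ord_at E (center E A) p"
  have e: "e > 0" using fr(2) unfolding e_def .
  have "p \<in> E" using p(3) F(2) by blast
  hence pw: "A p = A w powi e" using wv p(2) unfolding e_def by blast
  obtain y where y: "y \<in> F - {0}" "A w = A y" using vals[OF w(2,1)] by blast
  obtain k where k: "A w = A p powi k" using pv y by metis
  have "A w powi 1 = A w powi (e * k)" using k unfolding pw by (simp add: power_int_mult)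
  hence "1 = e * k" by (rule power_int_inj[OF w(3,4)])
  hence "e = 1" using e by (metis zdvd1_eq dvd_triv_left abs_of_pos)
  thus ?thesis using fr(1) unfolding e_def by (simp add: one_enat_def)
qed

text \<open>At the chosen \<open>A\<close>, maximality of the index means that no field between
  \<open>F\<close> and \<open>K\<close> has values beyond those of \<open>F\<close>. At another
  place, the absolute value agrees with some \<open>A \<circ> t\<close> on a stable field, and
  stability of \<open>F\<close> under \<open>t\<close> carries the equality of value groups
  over.\<close>

lemma finite_ramification_unramified_above:
  assumes l: "Factorial_Ring.prime (l::nat)" and gal: "galois_extension \<rat> K" and fin: "has_finite_ramification l K"
  shows "\<exists>F. number_field F \<and> F \<subseteq> K \<and> unramified_above l F K"
proof -
  note sf = number_field_is_subfield
  have K: "is_subfield K" "K \<subseteq> Qbar"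
    using gal unfolding galois_extension_def algebraic_field_extension_def subfield_CC_iff by blast+
  have stK: "\<forall>t x. is_aut t \<longrightarrow> x \<in> K \<longrightarrow> t x \<in> K"
  proof (intro allI impI)
    fix t x assume t: "is_aut t" and x: "x \<in> K"
    show "t x \<in> K" by (rule galois_extension_stable[OF gal x t])
  qed
  obtain A where A: "nonarch_abs Qbar A" "A (of_nat l) = 1 / real l" using nonarch_abs_prime[OF l] by blast
  obtain q where q: "q \<in> center \<rat> A" "q \<noteq> 0" "ord_at \<rat> (center \<rat> A) q = 1"
    using center_uniformizer[OF l A number_field_Rats] by blast
  have qQ: "q \<in> \<rat>" using q unfolding center_def integers_of_def by blast
  define e where "e E = nat (ord_at E (center E A) q)" for E
  have "is_prime K (center K A)" by (rule center_prime[OF K(1) nonarch_abs_mono[OF A(1) K(2)]])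
  hence "center K A \<in> primes_over K l"
    unfolding primes_over_def primeideal_iff[OF K(1)] using of_nat_in_center[where A = A, OF K(1) l A(2)] by blast
  hence "ramification_index \<rat> K (center K A) < \<infinity>" using fin unfolding has_finite_ramification_def by blast
  then obtain n where n: "ramification_index \<rat> K (center K A) = enat n" by (rule less_infinityE)
  have bound: "e E \<le> n" if E: "number_field E" "E \<subseteq> K" for E
  proof -
    have QE: "\<rat> \<subseteq> E" by (rule subfield_Rats[OF sf[OF E(1)]])
    have "finite_ramification_index \<rat> E (center K A \<inter> E) \<le> enat n"
      unfolding n[symmetric] ramification_index_def using E QE by (intro SUP_upper) auto
    thus ?thesis unfolding center_Int[OF E(2)] e_def
      using finite_ramification_index_center(1)[OF l A number_field_Rats QE E(1) q] by (simp only: enat_ord_simps)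
  qed
  have QK: "number_field \<rat> \<and> \<rat> \<subseteq> K" using number_field_Rats subfield_Rats[OF K(1)] by blast
  have "\<exists>E. (number_field E \<and> E \<subseteq> K) \<and> (\<forall>E'. number_field E' \<and> E' \<subseteq> K \<longrightarrow> e E' \<le> e E)"
    using bound by (intro Lattices_Big.ex_has_greatest_nat[where P = "\<lambda>E. number_field E \<and> E \<subseteq> K" and f = e and b = "Suc n", OF QK]) (simp add: less_Suc_eq_le)
  then obtain E0 where E0: "number_field E0" "E0 \<subseteq> K" and max: "\<forall>E'. number_field E' \<and> E' \<subseteq> K \<longrightarrow> e E' \<le> e E0"
    by blast
  obtain F where F: "number_field F" "E0 \<subseteq> F" "F \<subseteq> K" "\<forall>t x. is_aut t \<longrightarrow> x \<in> F \<longrightarrow> t x \<in> F"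
    using stable_closure[OF K stK E0] by (elim exE conjE)
  obtain p where p: "p \<in> center F A" "p \<noteq> 0" "p \<in> F" "ord_at F (center F A) p = 1"
    and pv: "\<forall>x\<in>F - {0}. A x = A p powi ord_at F (center F A) x"
    using center_uniformizer[OF l A F(1)] by blast
  obtain p0 where p0: "p0 \<in> center E0 A" "p0 \<noteq> 0" "ord_at E0 (center E0 A) p0 = 1"
    using center_uniformizer[OF l A E0(1)] by blast
  have qE: "q \<in> E" if "number_field E" for E using qQ subfield_Rats[OF sf[OF that]] by blast
  \<comment> \<open>The index is multiplicative, so enlarging \<open>E0\<close> to the stable field
    \<open>F\<close> does not lower it; by maximality it is attained at \<open>F\<close>
    too.\<close>
  have eF: "e E0 \<le> e F"
  proof -
    note fr = finite_ramification_index_center(2,3)[OF l A E0(1) F(2,1) p0]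
    have "ord_at E0 (center E0 A) q > 0"
      using finite_ramification_index_center(2)[OF l A number_field_Rats subfield_Rats[OF sf[OF E0(1)]] E0(1) q] .
    hence "1 * ord_at E0 (center E0 A) q \<le> ord_at F (center F A) p0 * ord_at E0 (center E0 A) q"
      using fr(1) by (intro mult_right_mono) auto
    thus ?thesis unfolding e_def using fr(2)[OF qE[OF E0(1)] q(2)] by simp
  qed
  have valsA: "\<exists>y\<in>F - {0}. A x = A y" if E: "number_field E" "F \<subseteq> E" "E \<subseteq> K" and x: "x \<in> E" "x \<noteq> 0" for E x
  proof -
    note fr = finite_ramification_index_center(2,3)[OF l A F(1) E(2,1) p(1,2,4)]
    have qF: "ord_at F (center F A) q > 0"
      using finite_ramification_index_center(2)[OF l A number_field_Rats subfield_Rats[OF sf[OF F(1)]] F(1) q] .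
    \<comment> \<open>The index of \<open>E\<close> is that of \<open>F\<close> times the order of
      \<open>p\<close> in \<open>E\<close>; maximality forces this order to be 1.\<close>
    have eq: "ord_at E (center E A) q = ord_at E (center E A) p * ord_at F (center F A) q"
      by (rule fr(2)[OF qE[OF F(1)] q(2)])
    have "e E \<le> e F" using max E eF by (meson le_trans)
    hence "ord_at E (center E A) p * ord_at F (center F A) q \<le> ord_at F (center F A) q"
      unfolding e_def eq using qF by (subst (asm) nat_le_eq_zle) auto
    hence "ord_at E (center E A) p * ord_at F (center F A) q \<le> 1 * ord_at F (center F A) q" by (simp only: mult_1)
    hence "ord_at E (center E A) p \<le> 1" using qF by (simp only: mult_le_cancel_right_pos)
    hence ord1: "ord_at E (center E A) p = 1" using fr(1) by linarith
    have AE: "nonarch_abs E A" by (rule nonarch_abs_mono[OF A(1) number_field_subset_Qbar[OF E(1)]])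
    have lE: "of_nat l \<in> center E A" by (rule of_nat_in_center[where A = A, OF sf[OF E(1)] l A(2)])
    have cE: "center E A \<noteq> {0}" by (rule prime_nonzero[OF lE l])
    have pE: "p \<in> E" using p(3) E(2) by blast
    have "A x = A p powi ord_at E (center E A) x"
      by (rule nonarch_eq_powi_ord[OF E(1) AE cE pE p(2) ord1 x])
    also have "\<dots> = A (p powi ord_at E (center E A) x)"
      by (rule nonarch_powi[OF sf[OF E(1)] AE pE, symmetric])
    finally have Ax: "A x = A (p powi ord_at E (center E A) x)" .
    have "p powi ord_at E (center E A) x \<in> F - {0}"
      using subfield_closed(12)[OF sf[OF F(1)] p(3)] p(2) by simp
    thus ?thesis using Ax by blast
  qed
  have "unramified_above l F K"
    unfolding unramified_above_def ramified_in_def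
  proof (intro ballI notI, elim exE conjE)
    fix pp P assume pp: "pp \<in> primes_over F l" and P: "primeideal P (integer_ring K)" "P \<inter> F = pp"
      and ne: "ramification_index F K P \<noteq> 1"
    have lP: "of_nat l \<in> P" using pp P(2) unfolding primes_over_def by blast
    have PK: "is_prime K P" using P(1) unfolding primeideal_iff[OF K(1)] .
    obtain D where D: "nonarch_abs Qbar D" "D (of_nat l) = 1 / real l" "center K D = P"
      using nonarch_abs_of_prime[OF K l PK lP] by blast
    have one: "finite_ramification_index F E (P \<inter> E) = 1" if E: "number_field E" "F \<subseteq> E" "E \<subseteq> K" for E
    proof -
      have PE: "P \<inter> E = center E D" using center_Int[OF E(3), of D] D(3) by simp
      \<comment> \<open>\<open>E\<close> need not be stable, whereas conjugacy of absolute values is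
        available on stable fields; so it is applied on a larger field still inside
        \<open>K\<close>.\<close>
      obtain E2 where E2: "number_field E2" "E \<subseteq> E2" "E2 \<subseteq> K" "\<forall>t x. is_aut t \<longrightarrow> x \<in> E2 \<longrightarrow> t x \<in> E2"
        using stable_closure[OF K stK E(1,3)] by (elim exE conjE)
      obtain t where t: "is_aut t" "\<forall>x\<in>E2. D x = A (t x)"
        using conjugate_abs[OF l A D(1,2) E2(1)] E2(4) by blast
      have FE2: "F \<subseteq> E2" using E(2) E2(2) by blast
      have E2Q: "E2 \<subseteq> Qbar" using E2(3) K(2) by blast
      have "\<exists>y\<in>F - {0}. D x = D y" if x: "x \<in> E" "x \<noteq> 0" for x
      proof -
        have xE2: "x \<in> E2" using x(1) E2(2) by blast
        have tx: "t x \<in> E2" using E2(4) t(1) xE2 by blast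
        have "t x \<noteq> 0" using x(2) aut_eq_iff[OF t(1) _ subfield_zero[OF is_subfield_Qbar], of x] aut_zero[OF t(1)] xE2 E2Q by auto
        then obtain y where y: "y \<in> F - {0}" "A (t x) = A y" using valsA[OF E2(1) FE2 E2(3) tx] by blast
        \<comment> \<open>The element of \<open>F\<close> found for \<open>A\<close> is pulled back
          along \<open>t\<close> to an element of \<open>F\<close> with the same value at
          \<open>D\<close>.\<close>
        define z where "z = inv_into Qbar t y"
        have it: "is_aut (inv_into Qbar t)" by (rule aut_inv[OF t(1)])
        have zF: "z \<in> F" unfolding z_def using F(4) it y(1) by blast
        have "y \<in> Qbar" using y(1) FE2 E2Q by blast
        hence tz: "t z = y" unfolding z_def using t(1) unfolding is_aut_def by (metis bij_betw_inv_into_right)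
        have "z \<noteq> 0" using tz y(1) aut_zero[OF t(1)] by auto
        moreover have "D x = D z" using t(2) xE2 zF FE2 y(2) tz by (metis subsetD)
        ultimately show ?thesis using zF by blast
      qed
      thus ?thesis unfolding PE by (intro unramified_of_values[OF l D(1,2) F(1) E(2,1)])
    qed
    have "ramification_index F K P = 1"
      unfolding ramification_index_def by (rule SUP_eq_const) (use F one in auto)
    thus False using ne by simp
  qed
  thus ?thesis using F by blast
qed

theorem theorem1p4:
  fixes K :: "complex set"
  assumes "subfield K CC" and "K \<subseteq> Qbar"
  shows
    "(\<forall>(l::nat) F. Factorial_Ring.prime l \<and> number_field F \<and> F \<subseteq> K \<and> unramified_above l F K \<longrightarrow>
        (\<exists>L. L \<noteq> K \<and> bogomolov K L) \<and>
        (\<exists>\<alpha>\<in>K. \<forall>\<beta>. \<beta> ^ l = \<alpha> \<longrightarrow> adjoin K \<beta> \<noteq> K \<and> bogomolov K (adjoin K \<beta>))) \<and>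
     (\<forall>(l::nat). Factorial_Ring.prime l \<and> galois_extension \<rat> K \<and> has_finite_ramification l K \<longrightarrow>
        (\<exists>F. number_field F \<and> F \<subseteq> K \<and> unramified_above l F K))"
proof (intro conjI allI impI; elim conjE)
  fix l :: nat and F
  assume l: "Factorial_Ring.prime l" and F: "number_field F" "F \<subseteq> K" "unramified_above l F K"
  have K: "is_subfield K" using assms(1) by (simp add: subfield_CC_iff)
  obtain \<alpha> where \<alpha>: "\<alpha> \<in> K" "\<forall>\<beta>. \<beta> ^ l = \<alpha> \<longrightarrow> adjoin K \<beta> \<noteq> K \<and> bogomolov K (adjoin K \<beta>)"
    using kummer_bogomolov_exists[OF K assms(2) l F] by blast
  thus "\<exists>\<alpha>\<in>K. \<forall>\<beta>. \<beta> ^ l = \<alpha> \<longrightarrow> adjoin K \<beta> \<noteq> K \<and> bogomolov K (adjoin K \<beta>)" by blast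
  \<comment> \<open>A root of \<alpha> exists among the complex numbers, so the assertion about all
    roots also produces a nontrivial extension.\<close>
  obtain \<beta> where "\<beta> ^ l = \<alpha>" using complex_root_exists[OF prime_gt_0_nat[OF l]] by blast
  thus "\<exists>L. L \<noteq> K \<and> bogomolov K L" using \<alpha>(2) by blast
next
  fix l :: nat
  assume "Factorial_Ring.prime l" "galois_extension \<rat> K" "has_finite_ramification l K"
  thus "\<exists>F. number_field F \<and> F \<subseteq> K \<and> unramified_above l F K"
    by (rule finite_ramification_unramified_above)
qed

end
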